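(* Suppose that $r$ is a non-integral rational number and that $n$ is an integer greater than $1$. Then the following hold. (1) The simple loops $\{\alpha_s \mid s\in I(r;n)\}$ ($s$ rational) represent mutually distinct conjugacy classes in the even Heckoid group $G(r;n)$. (2) There is no rational number $s \in I(r;n)$ for which $\alpha_s$ is peripheral in $G(r;n)$. (3) There is no rational number $s \in I(r;n)$ for which $\alpha_s$ is torsion in $G(r;n)$.
   Context: **Loops.** Let $\hat{\mathbb{Q}}=\mathbb{Q}\cup\{\infty\}$. The Conway sphere $\boldsymbol{S}$ is the 4-times punctured sphere obtained as the quotient of $\mathbb{R}^2-\mathbb{Z}^2$ by the group generated by the $\pi$-rotations around the points of $\mathbb{Z}^2$. For $s\in\hat{\mathbb{Q}}$, $\alpha_s$ is the (unoriented) essential simple loop in $\boldsymbol{S}$ obtained as the projection of a line of slope $s$ in $\mathbb{R}^2-\mathbb{Z}^2$. The rational tangle $(B^3,t(s))$ of slope $s$ is such that $\partial(B^3-t(s))$ is identified with $\boldsymbol{S}$ and $\alpha_s$ bounds a disk in $B^3-t(s)$. The 2-bridge link $K(r)$ is the sum of $(B^3,t(\infty))$ and $(B^3,t(r))$. **Heckoid group.** For $r\in\mathbb{Q}$ and an integer $n\ge 2$, the even Heckoid group is $$G(r;n)=\pi_1(\boldsymbol{S})/\langle\langle\alpha_\infty,\alpha_r^n\rangle\rangle\cong\pi_1(B^3-t(\infty))/\langle\langle\alpha_r^n\rangle\rangle ,$$ which is the orbifold fundamental group of the even Heckoid orbifold (underlying space the exterior of $K(r)$, singular set the lower tunnel of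 $K(r)$, with index $n$). Explicitly, $\pi_1(B^3-t(\infty))$ is the free group $F(a,b)$ on a standard meridian pair $\{a,b\}$, in which $\alpha_\infty$ is trivial, and for rational $s=q/p$ ($p,q$ relatively prime, $p\ge1$) the loop $\alpha_s$ is represented by the word $u_s$ defined as follows. Put $\epsilon_i=(-1)^{\lfloor iq/p\rfloor}$ for $1\le i\le p-1$. - If $p$ is odd, $u_{q/p}=a\,\hat u\, b^{(-1)^q}\,\hat u^{-1}$ with $\hat u=b^{\epsilon_1}a^{\epsilon_2}\cdots b^{\epsilon_{p-2}}a^{\epsilon_{p-1}}$ (empty if $p=1$). - If $p$ is even, $u_{q/p}=a\,\hat u\, a^{-1}\,\hat u^{-1}$ with $\hat u=b^{\epsilon_1}a^{\epsilon_2}\cdots a^{\epsilon_{p-2}}b^{\epsilon_{p-1}}$. Thus $G(r;n)\cong\langle a,b\mid u_r^n\rangle$. **Conjugacy classes.** Since loops are unoriented, the conjugacy class represented by $\alpha_s$ is that of $u_s$ up to inversion: $\alpha_s$ and $\alpha_{s'}$ represent the same conjugacy class in $G(r;n)$ iff $u_s$ is conjugate in $G(r;n)$ to $u_{s'}$ or $u_{s'}^{-1}$. The loop $\alpha_s$ is *peripheral* in $G(r;n)$ if it represents the conjugacy class of a power of a meridian, i.e. $u_s$ is conjugate in $G(r;n)$ to a power of $a$ or of $b$. It is *torsion* in $G(r;n)$ if it represents the conjugacy class of a non-trivial torsion element of $G(r;n)$. **The set $I(r;n)$.** Let $\mathcal{D}$ be the Farey tessellation of the upper half plane $\mathbb{H}^2$,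 with ideal vertex set $\hat{\mathbb{Q}}$. Let $\Gamma_\infty$ be the group generated by the reflections in the edges of $\mathcal{D}$ with endpoint $\infty$, and let $C_r(2n)$ be the infinite cyclic group generated by the parabolic automorphism of $\mathcal{D}$ fixing $r$ that shifts the Farey edges ending at $r$ by $2n$ units in the clockwise direction. Let $\Gamma(r;n)$ be the group generated by $\Gamma_\infty$ and $C_r(2n)$. For non-integral $r$, it is the free product $\Gamma_\infty * C_r(2n)$ and has a fundamental domain $R$ in $\mathbb{H}^2$ bounded by (i) the pair of adjacent Farey edges with endpoint $\infty$ cutting off a region containing $r$, i.e. the edges from $\infty$ to $\lfloor r\rfloor$ and to $\lfloor r\rfloor+1$, and (ii) a pair of Farey edges with endpoint $r$ which cut off a region in $\overline{\mathbb{H}}^2$ containing $\infty$ and such that one is the image of the other by a generator of $C_r(2n)$. Let $r_1,r_2$ be the endpoints other than $r$ of the two edges in (ii), labelled so that $r_2$ is the image of $r_1$ by a generator of $C_r(2n)$. One of them, $e_-$, is less than $r$ and the other, $e_+$, is greater than $r$. $\bar I(r;n)$ is the union of the two closed intervals $[\lfloor r\rfloor,e_-]\cup[e_+,\lfloor r\rfloor+1]$ (the intersection of the closure of $R$ with $\partial\mathbb{H}^2$, apart from the isolated points $\infty,r$). The edges in (ii) are chosen so that both intervals are non-degenerate. Finally $I(r;n):=\bar I(r;n)-\{r_i\}$ with $i=1$ or $2$, so $I(r;n)$ is the disjoint union of a closed interval and a half-open interval. *)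

theory Defs
  imports Complex_Main "HOL-Algebra.Bij" "HOL-Algebra.Generated_Groups"
begin

section \<open>Free groups and one-relator quotients\<close>

text \<open>A letter \<open>(x, True)\<close> stands for the generator \<open>x\<close> and \<open>(x, False)\<close> for its inverse.\<close>

type_synonym 'g word = "('g \<times> bool) list"

definition word_inv :: "'g word \<Rightarrow> 'g word" where
  "word_inv w = rev (map (\<lambda>(x, e). (x, \<not> e)) w)"

inductive freely_eq :: "'g word \<Rightarrow> 'g word \<Rightarrow> bool" where
  refl: "freely_eq u u"
| sym: "freely_eq u v \<Longrightarrow> freely_eq v u"
| trans: "freely_eq u v \<Longrightarrow> freely_eq v w \<Longrightarrow> freely_eq u w"
| cancel: "freely_eq (u @ [(x, e), (x, \<not> e)] @ v) (u @ v)"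

definition free_rel :: "('g word \<times> 'g word) set" where
  "free_rel = {(u, v). freely_eq u v}"

definition word_class :: "'g word \<Rightarrow> 'g word set" where
  "word_class w = free_rel `` {w}"

definition free_group :: "'g word set monoid" where
  "free_group =
     \<lparr>carrier = UNIV // free_rel,
      mult = (\<lambda>X Y. \<Union>u\<in>X. \<Union>v\<in>Y. word_class (u @ v)),
      one = word_class []\<rparr>"

definition normal_closure :: "('a, 'b) monoid_scheme \<Rightarrow> 'a set \<Rightarrow> 'a set" where
  "normal_closure G S = \<Inter> {N. N \<lhd> G \<and> S \<subseteq> N}"

lemma equiv_free_rel: "equiv UNIV free_rel"
  by (rule equivI) (auto simp: free_rel_def refl_on_def sym_def trans_def
        intro: freely_eq.intros)

lemma word_class_eq_iff: "word_class u = word_class v \<longleftrightarrow> freely_eq u v"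
  unfolding word_class_def
  using eq_equiv_class_iff[OF equiv_free_rel, of u v] by (simp add: free_rel_def)

lemma freely_eq_append_left: "freely_eq u v \<Longrightarrow> freely_eq (w @ u) (w @ v)"
proof (induction rule: freely_eq.induct)
  case (cancel u x e v)
  show ?case using freely_eq.cancel[of "w @ u" x e v] by simp
qed (auto intro: freely_eq.intros)

lemma freely_eq_append_right: "freely_eq u v \<Longrightarrow> freely_eq (u @ w) (v @ w)"
proof (induction rule: freely_eq.induct)
  case (cancel u x e v)
  show ?case using freely_eq.cancel[of u x e "v @ w"] by simp
qed (auto intro: freely_eq.intros)

lemma freely_eq_append:
  "freely_eq u u' \<Longrightarrow> freely_eq v v' \<Longrightarrow> freely_eq (u @ v) (u' @ v')"
  by (meson freely_eq.trans freely_eq_append_left freely_eq_append_right)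

lemma mult_word_class:
  "word_class u \<otimes>\<^bsub>free_group\<^esub> word_class v = word_class (u @ v)"
proof -
  have mem: "x \<in> word_class y \<longleftrightarrow> freely_eq y x" for x y :: "'a word"
    by (simp add: word_class_def free_rel_def)
  have "word_class (u' @ v') = word_class (u @ v)"
    if "u' \<in> word_class u" "v' \<in> word_class v" for u' v'
    using that unfolding word_class_eq_iff mem by (blast intro: freely_eq_append freely_eq.sym)
  then have "(\<Union>u'\<in>word_class u. \<Union>v'\<in>word_class v. word_class (u' @ v'))
      = (\<Union>u'\<in>word_class u. \<Union>v'\<in>word_class v. word_class (u @ v))"
    by (intro SUP_cong HOL.refl) simp
  also have "\<dots> = word_class (u @ v)"
  proof -
    have "u \<in> word_class u" "v \<in> word_class v"
      unfolding mem by (rule freely_eq.refl)+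
    then show ?thesis by blast
  qed
  finally show ?thesis by (simp add: free_group_def)
qed

lemma carrier_free_group: "carrier free_group = range word_class"
  by (auto simp: free_group_def quotient_def word_class_def)

lemma one_free_group: "\<one>\<^bsub>free_group\<^esub> = word_class []"
  by (simp add: free_group_def)

lemma freely_eq_word_inv: "freely_eq (word_inv w @ w) []"
proof (induction w)
  case Nil
  show ?case by (simp add: word_inv_def freely_eq.refl)
next
  case (Cons l w)
  obtain x e where l: "l = (x, e)" by (cases l)
  have "freely_eq (word_inv w @ [(x, \<not> e), (x, \<not> \<not> e)] @ w) (word_inv w @ w)"
    by (rule freely_eq.cancel)
  then show ?case
    using Cons.IH by (auto simp: l word_inv_def intro: freely_eq.trans)
qed

lemma group_free_group: "group free_group"
proof (rule groupI)
  fix x :: "'a word set"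
  assume "x \<in> carrier free_group"
  then obtain w where "x = word_class w" by (auto simp: carrier_free_group)
  then have "word_class (word_inv w) \<otimes>\<^bsub>free_group\<^esub> x = \<one>\<^bsub>free_group\<^esub>"
    using freely_eq_word_inv[of w] by (simp add: mult_word_class one_free_group word_class_eq_iff)
  then show "\<exists>y\<in>carrier free_group. y \<otimes>\<^bsub>free_group\<^esub> x = \<one>\<^bsub>free_group\<^esub>"
    by (rule bexI) (simp add: carrier_free_group)
next
  fix x y z :: "'a word set"
  assume "x \<in> carrier free_group" "y \<in> carrier free_group" "z \<in> carrier free_group"
  then obtain u v w where "x = word_class u" "y = word_class v" "z = word_class w"
    unfolding carrier_free_group by blast
  then show "x \<otimes>\<^bsub>free_group\<^esub> y \<otimes>\<^bsub>free_group\<^esub> z = x \<otimes>\<^bsub>free_group\<^esub> (y \<otimes>\<^bsub>free_group\<^esub> z)"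
    by (simp add: mult_word_class)
next
  fix x y :: "'a word set"
  assume "x \<in> carrier free_group" "y \<in> carrier free_group"
  then obtain u v where "x = word_class u" "y = word_class v"
    unfolding carrier_free_group by blast
  then show "x \<otimes>\<^bsub>free_group\<^esub> y \<in> carrier free_group"
    by (simp add: mult_word_class carrier_free_group)
next
  fix x :: "'a word set"
  assume "x \<in> carrier free_group"
  then obtain u where "x = word_class u"
    unfolding carrier_free_group by blast
  then show "\<one>\<^bsub>free_group\<^esub> \<otimes>\<^bsub>free_group\<^esub> x = x"
    by (simp add: mult_word_class one_free_group)
next
  show "\<one>\<^bsub>free_group\<^esub> \<in> carrier (free_group :: 'a word set monoid)"
    by (simp add: one_free_group carrier_free_group)
qed

lemma (in group) normal_normal_closure:
  assumes "S \<subseteq> carrier G"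
  shows "normal_closure G S \<lhd> G"
proof (rule normal_invI)
  have "carrier G \<lhd> G"
    by (rule normal_invI[OF subgroup_self]) simp
  then have ne: "{N. N \<lhd> G \<and> S \<subseteq> N} \<noteq> {}"
    using assms by blast
  show "subgroup (normal_closure G S) G"
    unfolding normal_closure_def
    using ne by (intro subgroups_Inter) (simp_all add: normal_imp_subgroup)
  show "x \<otimes> h \<otimes> inv x \<in> normal_closure G S"
    if "x \<in> carrier G" "h \<in> normal_closure G S" for x h
    unfolding normal_closure_def
  proof (rule InterI)
    fix N assume "N \<in> {N. N \<lhd> G \<and> S \<subseteq> N}"
    then have "N \<lhd> G" "h \<in> N"
      using that(2) unfolding normal_closure_def by simp_all
    then show "x \<otimes> h \<otimes> inv x \<in> N"
      using that(1) by (simp add: normal.inv_op_closed2)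
  qed
qed


section \<open>The even Heckoid group\<close>

text \<open>\<open>Gen_a\<close> and \<open>Gen_b\<close> are the standard meridian pair generating the fundamental group of
  the complement of the trivial tangle of slope infinity.\<close>

datatype meridian = Gen_a | Gen_b

text \<open>For \<open>s = q/p\<close> in lowest terms with \<open>p \<ge> 1\<close>, \<open>\<epsilon>\<^sub>i = (-1)^\<lfloor>i q / p\<rfloor>\<close> is the exponent of the
  \<open>i\<close>-th letter of \<open>uhat s\<close>, for \<open>1 \<le> i \<le> p - 1\<close>; the letters alternate, starting with \<open>b\<close>.\<close>

definition uhat :: "rat \<Rightarrow> meridian word" where
  "uhat s = map (\<lambda>i. (if odd i then Gen_b else Gen_a, even \<lfloor>of_nat i * s\<rfloor>))
              [1..<nat (snd (quotient_of s))]"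

definition uword :: "rat \<Rightarrow> meridian word" where
  "uword s = (let (q, p) = quotient_of s in
     if odd p then [(Gen_a, True)] @ uhat s @ [(Gen_b, even q)] @ word_inv (uhat s)
     else [(Gen_a, True)] @ uhat s @ [(Gen_a, False)] @ word_inv (uhat s))"

definition heckoid_kernel :: "rat \<Rightarrow> nat \<Rightarrow> meridian word set set" where
  "heckoid_kernel r n =
     normal_closure free_group {word_class (uword r) [^]\<^bsub>free_group\<^esub> n}"

definition heckoid_group :: "rat \<Rightarrow> nat \<Rightarrow> meridian word set set monoid" where
  "heckoid_group r n = free_group Mod heckoid_kernel r n"

definition heckoid_elt :: "rat \<Rightarrow> nat \<Rightarrow> meridian word \<Rightarrow> meridian word set set" where
  "heckoid_elt r n w = heckoid_kernel r n #>\<^bsub>free_group\<^esub> word_class w"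

lemma normal_heckoid_kernel: "heckoid_kernel r n \<lhd> free_group"
proof -
  interpret F: group "free_group :: meridian word set monoid" by (rule group_free_group)
  have "word_class (uword r) [^]\<^bsub>free_group\<^esub> n \<in> carrier free_group"
    by (rule F.nat_pow_closed) (simp add: carrier_free_group)
  then show ?thesis
    unfolding heckoid_kernel_def by (intro F.normal_normal_closure) simp
qed

lemma group_heckoid_group: "group (heckoid_group r n)"
  unfolding heckoid_group_def by (rule normal.factorgroup_is_group[OF normal_heckoid_kernel])

lemma heckoid_elt_closed: "heckoid_elt r n w \<in> carrier (heckoid_group r n)"
  by (auto simp: heckoid_elt_def heckoid_group_def FactGroup_def RCOSETS_def carrier_free_group)


section \<open>Conjugacy classes of simple loops\<close>

definition conjugate_in :: "('a, 'b) monoid_scheme \<Rightarrow> 'a \<Rightarrow> 'a \<Rightarrow> bool" where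
  "conjugate_in G x y \<longleftrightarrow> (\<exists>h\<in>carrier G. y = h \<otimes>\<^bsub>G\<^esub> x \<otimes>\<^bsub>G\<^esub> inv\<^bsub>G\<^esub> h)"

abbreviation loop_elt :: "rat \<Rightarrow> nat \<Rightarrow> rat \<Rightarrow> meridian word set set" where
  "loop_elt r n s \<equiv> heckoid_elt r n (uword s)"

text \<open>Loops are unoriented, hence the inverse.\<close>

definition same_loop_class :: "rat \<Rightarrow> nat \<Rightarrow> rat \<Rightarrow> rat \<Rightarrow> bool" where
  "same_loop_class r n s s' \<longleftrightarrow>
     conjugate_in (heckoid_group r n) (loop_elt r n s) (loop_elt r n s') \<or>
     conjugate_in (heckoid_group r n) (loop_elt r n s)
       (inv\<^bsub>heckoid_group r n\<^esub> loop_elt r n s')"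

definition loop_peripheral :: "rat \<Rightarrow> nat \<Rightarrow> rat \<Rightarrow> bool" where
  "loop_peripheral r n s \<longleftrightarrow>
     (\<exists>x. \<exists>k::int. conjugate_in (heckoid_group r n) (loop_elt r n s)
        (heckoid_elt r n [(x, True)] [^]\<^bsub>heckoid_group r n\<^esub> k))"

definition torsion_elt :: "('a, 'b) monoid_scheme \<Rightarrow> 'a \<Rightarrow> bool" where
  "torsion_elt G g \<longleftrightarrow> g \<in> carrier G \<and> (\<exists>k::nat. k > 0 \<and> g [^]\<^bsub>G\<^esub> k = \<one>\<^bsub>G\<^esub>)"

definition loop_torsion :: "rat \<Rightarrow> nat \<Rightarrow> rat \<Rightarrow> bool" where
  "loop_torsion r n s \<longleftrightarrow>
     (\<exists>g. torsion_elt (heckoid_group r n) g \<and> g \<noteq> \<one>\<^bsub>heckoid_group r n\<^esub> \<and>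
        conjugate_in (heckoid_group r n) (loop_elt r n s) g)"


section \<open>The Farey tessellation and the set \<open>I(r;n)\<close>\<close>

datatype qhat = Fin rat | Infty

fun qnum :: "qhat \<Rightarrow> int" where
  "qnum (Fin x) = fst (quotient_of x)"
| "qnum Infty = 1"

fun qden :: "qhat \<Rightarrow> int" where
  "qden (Fin x) = snd (quotient_of x)"
| "qden Infty = 0"

definition qfrac :: "int \<Rightarrow> int \<Rightarrow> qhat" where
  "qfrac a b = (if b = 0 then Infty else Fin (Fract a b))"

definition farey_edge :: "qhat \<Rightarrow> qhat \<Rightarrow> bool" where
  "farey_edge x y \<longleftrightarrow> \<bar>qnum x * qden y - qnum y * qden x\<bar> = 1"

text \<open>The action on \<open>qhat\<close> of the parabolic matrix
  \<open>1 + m p q, - m q\<^sup>2; m p\<^sup>2, 1 - m p q\<close> of determinant 1, where \<open>q/p\<close> is the fixed point. It shifts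
  the Farey edges ending at \<open>q/p\<close> by \<open>m\<close> units in the clockwise direction; for the fixed point
  \<open>Infty = 1/0\<close> it is \<open>x \<mapsto> x - m\<close>. See \<open>farey_edge_shift\<close> and \<open>farey_edge_shift_ex\<close> below.\<close>

definition farey_shift :: "qhat \<Rightarrow> int \<Rightarrow> qhat \<Rightarrow> qhat" where
  "farey_shift c m x =
     (let q = qnum c; p = qden c in
      qfrac ((1 + m * p * q) * qnum x - m * q^2 * qden x)
            (m * p^2 * qnum x + (1 - m * p * q) * qden x))"

lemma coprime_qnum_qden: "coprime (qnum x) (qden x)"
  by (cases x) (auto intro: quotient_of_coprime simp: prod_eq_iff)

lemma qden_nonneg: "qden x \<ge> 0"
  by (cases x) (auto intro: less_imp_le quotient_of_denom_pos')

lemma qfrac_qnum_qden: "qfrac (qnum x) (qden x) = x"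
proof (cases x)
  case (Fin y)
  then show ?thesis using quotient_of_denom_pos'[of y] by (simp add: qfrac_def)
qed (simp add: qfrac_def)

lemma qfrac_uminus: "qfrac (- a) (- b) = qfrac a b"
  by (simp add: qfrac_def)

lemma qnum_qden_qfrac:
  assumes "coprime a b"
  shows "(qnum (qfrac a b) = a \<and> qden (qfrac a b) = b) \<or>
         (qnum (qfrac a b) = - a \<and> qden (qfrac a b) = - b)"
proof (cases "b = 0")
  case True
  then show ?thesis using assms by (auto simp: qfrac_def)
next
  case False
  then show ?thesis using assms
    by (auto simp: qfrac_def quotient_of_Fract normalize_def Let_def coprime_imp_gcd_eq_1)
qed

context
  fixes c :: qhat and q p :: int
  defines "q \<equiv> qnum c" and "p \<equiv> qden c"
begin

private lemma shift_coprime: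
  fixes a b m :: int
  assumes "coprime a b"
  shows "coprime ((1 + m * p * q) * a - m * q^2 * b) (m * p^2 * a + (1 - m * p * q) * b)"
    (is "coprime ?u ?v")
proof (rule coprimeI)
  fix d assume d: "d dvd ?u" "d dvd ?v"
  have "a = (1 - m * p * q) * ?u + m * q^2 * ?v" "b = (1 + m * p * q) * ?v - m * p^2 * ?u"
    by (simp_all add: algebra_simps power2_eq_square)
  then have "d dvd a" "d dvd b"
    using d by (metis dvd_add dvd_mult, metis dvd_diff dvd_mult)
  then show "is_unit d" using assms by (meson coprime_common_divisor)
qed

private lemma shift_num_den:
  obtains e :: int where "e = 1 \<or> e = -1"
    and "qnum (farey_shift c m x) = e * ((1 + m * p * q) * qnum x - m * q^2 * qden x)"
    and "qden (farey_shift c m x) = e * (m * p^2 * qnum x + (1 - m * p * q) * qden x)"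
  using qnum_qden_qfrac[OF shift_coprime[OF coprime_qnum_qden[of x], of m]]
  by (auto simp: farey_shift_def Let_def q_def[symmetric] p_def[symmetric]
        intro: that[of 1] that[of "-1"])

lemma farey_shift_0: "farey_shift c 0 x = x"
  by (simp add: farey_shift_def qfrac_qnum_qden)

lemma farey_shift_add: "farey_shift c k (farey_shift c m x) = farey_shift c (k + m) x"
proof -
  obtain e :: int where e: "e = 1 \<or> e = -1"
    and 1: "qnum (farey_shift c m x) = e * ((1 + m * p * q) * qnum x - m * q^2 * qden x)"
    and 2: "qden (farey_shift c m x) = e * (m * p^2 * qnum x + (1 - m * p * q) * qden x)"
    by (rule shift_num_den)
  have "farey_shift c k (farey_shift c m x) =
    qfrac (e * ((1 + (k + m) * p * q) * qnum x - (k + m) * q^2 * qden x))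
          (e * ((k + m) * p^2 * qnum x + (1 - (k + m) * p * q) * qden x))"
    unfolding farey_shift_def[of c k] Let_def 1 2 q_def[symmetric] p_def[symmetric]
    by (intro arg_cong2[of _ _ _ _ qfrac]) (simp_all add: algebra_simps power2_eq_square)
  also have "\<dots> = farey_shift c (k + m) x"
    unfolding farey_shift_def Let_def q_def[symmetric] p_def[symmetric]
    using e qfrac_uminus[of "(1 + (k + m) * p * q) * qnum x - (k + m) * q^2 * qden x"
        "(k + m) * p^2 * qnum x + (1 - (k + m) * p * q) * qden x"]
    by (elim disjE) (simp_all del: qfrac_uminus)
  finally show ?thesis .
qed

lemma farey_shift_fixes: "farey_shift c m c = c"
proof -
  have "(1 + m * p * q) * q - m * q^2 * p = q" "m * p^2 * q + (1 - m * p * q) * p = p"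
    by (simp_all add: algebra_simps power2_eq_square)
  then show ?thesis
    by (simp add: farey_shift_def Let_def q_def[symmetric] p_def[symmetric])
       (simp add: q_def p_def qfrac_qnum_qden)
qed

lemma farey_shift_automorphism:
  "farey_edge (farey_shift c m x) (farey_shift c m y) \<longleftrightarrow> farey_edge x y"
proof -
  obtain e :: int where e: "e = 1 \<or> e = -1"
    and 1: "qnum (farey_shift c m x) = e * ((1 + m * p * q) * qnum x - m * q^2 * qden x)"
    and 2: "qden (farey_shift c m x) = e * (m * p^2 * qnum x + (1 - m * p * q) * qden x)"
    by (rule shift_num_den)
  obtain f :: int where f: "f = 1 \<or> f = -1"
    and 3: "qnum (farey_shift c m y) = f * ((1 + m * p * q) * qnum y - m * q^2 * qden y)"
    and 4: "qden (farey_shift c m y) = f * (m * p^2 * qnum y + (1 - m * p * q) * qden y)"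
    by (rule shift_num_den)
  have "qnum (farey_shift c m x) * qden (farey_shift c m y)
      - qnum (farey_shift c m y) * qden (farey_shift c m x)
      = e * f * (qnum x * qden y - qnum y * qden x)"
    unfolding 1 2 3 4 by (simp add: algebra_simps power2_eq_square)
  then show ?thesis using e f by (auto simp: farey_edge_def abs_mult)
qed

text \<open>Consecutive Farey edges ending at \<open>c\<close> are sides of a common Farey triangle.\<close>

lemma farey_edge_shift:
  assumes "farey_edge c x"
  shows "farey_edge x (farey_shift c 1 x)"
proof -
  obtain e :: int where e: "e = 1 \<or> e = -1"
    and 1: "qnum (farey_shift c 1 x) = e * ((1 + 1 * p * q) * qnum x - 1 * q^2 * qden x)"
    and 2: "qden (farey_shift c 1 x) = e * (1 * p^2 * qnum x + (1 - 1 * p * q) * qden x)"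
    by (rule shift_num_den)
  have "qnum x * qden (farey_shift c 1 x) - qnum (farey_shift c 1 x) * qden x
      = e * (q * qden x - qnum x * p)^2"
    unfolding 1 2 by (simp add: algebra_simps power2_eq_square)
  moreover have "\<bar>q * qden x - qnum x * p\<bar> = 1"
    using assms by (simp add: farey_edge_def q_def p_def)
  then have "(q * qden x - qnum x * p)^2 = 1"
    by (metis power2_abs one_power2)
  ultimately show ?thesis using e by (auto simp: farey_edge_def)
qed

lemma farey_edge_shift_ex:
  assumes "farey_edge c x" "farey_edge c y"
  shows "\<exists>m. y = farey_shift c m x"
proof -
  define dx where "dx = q * qden x - qnum x * p"
  define dy where "dy = q * qden y - qnum y * p"
  have dx: "dx = 1 \<or> dx = -1" and dy: "dy = 1 \<or> dy = -1"
    using assms by (auto simp: farey_edge_def q_def p_def dx_def dy_def)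
  define m' where "m' = dx * dy * (qnum x * qden y - qnum y * qden x)"
  have sq: "dx * dx = 1" "dy * dy = 1" using dx dy by auto
  have d0: "(1 + m' * p * q) * qnum x - m' * q^2 * qden x = qnum x - m' * q * dx"
    "m' * p^2 * qnum x + (1 - m' * p * q) * qden x = qden x - m' * p * dx"
    by (simp_all add: dx_def algebra_simps power2_eq_square)
  have c1: "q * (qnum x * qden y - qnum y * qden x) = dy * qnum x - dx * qnum y"
    "p * (qnum x * qden y - qnum y * qden x) = dy * qden x - dx * qden y"
    by (simp_all add: dx_def dy_def algebra_simps)
  have "m' * q * dx = (dx * dx) * dy * (q * (qnum x * qden y - qnum y * qden x))"
    "m' * p * dx = (dx * dx) * dy * (p * (qnum x * qden y - qnum y * qden x))"
    by (simp_all add: m'_def algebra_simps)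
  then have "m' * q * dx = dy * (dy * qnum x - dx * qnum y)"
    "m' * p * dx = dy * (dy * qden x - dx * qden y)"
    by (simp_all only: c1 sq mult_1)
  moreover have "dy * (dy * z) = z" for z using dy by auto
  ultimately have "qnum x - m' * q * dx = dx * dy * qnum y" "qden x - m' * p * dx = dx * dy * qden y"
    by (simp_all add: algebra_simps)
  then have "farey_shift c m' x = qfrac (dx * dy * qnum y) (dx * dy * qden y)"
    using d0 by (simp add: farey_shift_def Let_def q_def[symmetric] p_def[symmetric])
  also have "\<dots> = y"
    using dx dy qfrac_uminus[of "qnum y" "qden y"] by (auto simp: qfrac_qnum_qden)
  finally show ?thesis by metis
qed

lemma farey_shift_in_BijGroup: "farey_shift c m \<in> carrier (BijGroup UNIV)"
proof -
  have "bij (farey_shift c m)"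
    by (rule o_bij[of "farey_shift c (- m)"]) (auto simp: fun_eq_iff farey_shift_add farey_shift_0)
  then show ?thesis by (simp add: BijGroup_def Bij_def)
qed

end

definition shift_group :: "rat \<Rightarrow> int \<Rightarrow> (qhat \<Rightarrow> qhat) set" where
  "shift_group r m = generate (BijGroup UNIV) {farey_shift (Fin r) m}"

text \<open>\<open>r1\<close>, \<open>r2\<close> are the endpoints other than \<open>r\<close> of a pair of Farey edges ending at \<open>r\<close> that
  bounds, together with the edges from infinity to \<open>\<lfloor>r\<rfloor>\<close> and \<open>\<lfloor>r\<rfloor> + 1\<close>, a fundamental domain;
  \<open>r\<close> lies strictly between \<open>r1\<close> and \<open>r2\<close> iff the region cut off by both edges contains infinity.
  The last two conditions say that both intervals of \<open>Ibar\<close> are non-degenerate.\<close>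

definition fundamental_pair :: "rat \<Rightarrow> nat \<Rightarrow> rat \<Rightarrow> rat \<Rightarrow> bool" where
  "fundamental_pair r n r1 r2 \<longleftrightarrow>
     farey_edge (Fin r) (Fin r1) \<and> farey_edge (Fin r) (Fin r2) \<and>
     (\<exists>g\<in>shift_group r (2 * int n).
        generate (BijGroup UNIV) {g} = shift_group r (2 * int n) \<and> Fin r2 = g (Fin r1)) \<and>
     min r1 r2 < r \<and> r < max r1 r2 \<and>
     of_int \<lfloor>r\<rfloor> < min r1 r2 \<and> max r1 r2 < of_int (\<lfloor>r\<rfloor> + 1)"

definition Ibar :: "rat \<Rightarrow> rat \<Rightarrow> rat \<Rightarrow> real set" where
  "Ibar r r1 r2 =
     {of_int \<lfloor>r\<rfloor> .. of_rat (min r1 r2)} \<union> {of_rat (max r1 r2) .. of_int (\<lfloor>r\<rfloor> + 1)}"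

end

theory Submission
  imports Defs
begin

text \<open>
  Two loops are told apart by an action of the free group on which \<open>u\<^sub>r\<^sup>n\<close> acts trivially and in which
  one of the two words has a fixed point while the other has none. The \<open>i\<close>-th letter of \<open>u\<^sub>s\<close> has
  exponent \<open>(-1)\<close> to the floor of \<open>i s\<close>, so closed words \<open>u\<^sub>s\<close> are periodic readings of a line of
  slope \<open>s\<close>. Start with the cycle labelled by \<open>u\<^sub>s\<close> and attach, layer by layer, relator cycles
  wherever a relator cannot be read; the limit is an action. If \<open>s\<close> lies in the fundamental domain,
  its line follows a relator for less than a full period and what remains still determines the
  phase of the relator. A line of slope \<open>s'\<close> that closes up in the limit therefore stays on the
  cycle, except for detours along the first relators attached to it. Comparing lattice points
  under the three lines of slopes \<open>s\<close>, \<open>r\<close>, \<open>s'\<close> around such a ring of relators leaves only \<open>s = s'\<close>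
  and the case that \<open>s\<close>, \<open>s'\<close> are the two end points next to \<open>r\<close>. Starting instead with
  a cycle labelled by a power of a meridian excludes peripheral and torsion loops.
\<close>

section \<open>Relator phases\<close>

text \<open>Parities of floors carry the argument. All slopes lie between two consecutive integers,
  so a floor sequence has only two possible steps, of different parity, and the signs of letters
  recover the lattice points below a line. A piece of a relator is rigid once it meets the residues
  0 and -1 modulo \<open>p\<close>, as its line can then be moved neither down nor up. The obstacle
  is folding: attached cycles must not be identified in an uncontrolled way. A relator of which
  fewer than \<open>p\<close> of its \<open>2 n p \<ge> 4 p\<close> letters are present can be
  attached safely, but the starting cycle may contain much longer pieces. Those are unique at their
  ends and are attached beforehand. This may create rich pieces that bridge two of them; it has to
  be shown that no line in question uses such a bridge. In a ring of relators on opposite sides of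
  \<open>r\<close>, each relator takes on average \<open>d / dt N d\<close> letters along one line
  and \<open>d' / (- dt N' d')\<close> along the other. The sum is \<open>2 n p = pm + pp\<close>,
  while \<open>pm\<close> and \<open>pp\<close> bound the summands, so only the two end points
  remain. On one side of \<open>r\<close> the count forces \<open>n = 2\<close> and both slopes to
  be \<open>(2 q - 1) / (2 p)\<close>.\<close>

definition sgn_of :: "int \<Rightarrow> int \<Rightarrow> bool" where
  "sgn_of d x \<longleftrightarrow> even (x div d)"

lemma minus_one_minus_div:
  fixes x d :: int assumes "d > 0" shows "(- 1 - x) div d = - 1 - x div d"
proof -
  have x: "x = d * (x div d) + x mod d" by simp
  have "- 1 - x = d * (- 1 - x div d) + (d - 1 - x mod d)"
    by (subst x) (simp add: algebra_simps)
  moreover have "0 \<le> d - 1 - x mod d" "d - 1 - x mod d < d"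
    using assms pos_mod_bound[of d x] pos_mod_sign[of d x] by linarith+
  ultimately show ?thesis by (rule int_div_pos_eq)
qed

text \<open>Passing to the inverse word negates every sign. Reflecting about -1/2 instead of 0 makes
  this exact at multiples of \<open>d\<close> too.\<close>

lemma sgn_of_reflect: "d > 0 \<Longrightarrow> sgn_of d (- 1 - x) \<longleftrightarrow> \<not> sgn_of d x"
  by (simp add: sgn_of_def minus_one_minus_div)

lemma sgn_of_add_period: "d > 0 \<Longrightarrow> sgn_of d (x + 2 * d * z) \<longleftrightarrow> sgn_of d x"
proof -
  assume "d > 0"
  then have "(x + 2 * d * z) div d = x div d + 2 * z"
    using div_mult_self2[of d x "2 * z"] by (simp add: mult.assoc mult.left_commute)
  then show ?thesis by (simp add: sgn_of_def)
qed

lemma sgn_of_cong: "d > 0 \<Longrightarrow> 2 * d dvd x - y \<Longrightarrow> sgn_of d x \<longleftrightarrow> sgn_of d y"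
proof -
  assume d: "d > 0" and "2 * d dvd x - y"
  then obtain z where "x - y = 2 * d * z" by (elim dvdE)
  then have "x = y + 2 * d * z" by simp
  then show ?thesis using sgn_of_add_period[OF d] by simp
qed

text \<open>The pattern of floors along a line of slope between \<open>f\<close> and
  \<open>f + 1\<close>. The two steps have different parity, so one value and all parities give back
  the sequence.\<close>

definition steps_in :: "int \<Rightarrow> (int \<Rightarrow> int) \<Rightarrow> bool" where
  "steps_in f Y \<longleftrightarrow> (\<forall>t. Y (t + 1) = Y t + f \<or> Y (t + 1) = Y t + f + 1)"

lemma steps_in_div:
  assumes "d > 0" "f * d \<le> N" "N \<le> (f + 1) * d"
  shows "steps_in f (\<lambda>t. (h + t * N) div d)"
  unfolding steps_in_def
proof
  fix t
  let ?x = "h + t * N"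
  have e: "h + (t + 1) * N = ?x + N" by (simp add: algebra_simps)
  have "?x + f * d \<le> ?x + N" "?x + N \<le> ?x + (f + 1) * d" using assms by auto
  then have "(?x + f * d) div d \<le> (?x + N) div d" "(?x + N) div d \<le> (?x + (f + 1) * d) div d"
    using zdiv_mono1[OF _ assms(1)] by blast+
  moreover have "(?x + f * d) div d = ?x div d + f" "(?x + (f + 1) * d) div d = ?x div d + (f + 1)"
    using assms(1) by simp_all
  ultimately show "(h + (t + 1) * N) div d = (h + t * N) div d + f \<or>
      (h + (t + 1) * N) div d = (h + t * N) div d + f + 1"
    unfolding e by linarith
qed

lemma steps_in_parity_eq_up:
  assumes "steps_in f Y" "steps_in f Z" "Y i = Z i"
    and "\<And>t. i \<le> t \<Longrightarrow> t \<le> j \<Longrightarrow> even (Y t) \<longleftrightarrow> even (Z t)"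
    and "i \<le> t" "t \<le> j"
  shows "Y t = Z t"
  using assms(5,6)
proof (induction t rule: int_ge_induct)
  case base
  then show ?case using assms(3) by simp
next
  case (step t)
  then have "Y t = Z t" "even (Y (t + 1)) \<longleftrightarrow> even (Z (t + 1))" using assms(4) by auto
  moreover have "Y (t + 1) = Y t + f \<or> Y (t + 1) = Y t + f + 1"
     "Z (t + 1) = Z t + f \<or> Z (t + 1) = Z t + f + 1"
    using assms(1,2) unfolding steps_in_def by auto
  ultimately show ?case by auto
qed

lemma steps_in_parity_eq_down:
  assumes "steps_in f Y" "steps_in f Z" "Y j = Z j"
    and "\<And>t. i \<le> t \<Longrightarrow> t \<le> j \<Longrightarrow> even (Y t) \<longleftrightarrow> even (Z t)"
    and "i \<le> t" "t \<le> j"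
  shows "Y t = Z t"
  using assms(6,5)
proof (induction t rule: int_le_induct)
  case base
  then show ?case using assms(3) by simp
next
  case (step t)
  then have "Y t = Z t" "even (Y (t - 1)) \<longleftrightarrow> even (Z (t - 1))" using assms(4) by auto
  moreover have "Y t = Y (t - 1) + f \<or> Y t = Y (t - 1) + f + 1"
     "Z t = Z (t - 1) + f \<or> Z t = Z (t - 1) + f + 1"
    using assms(1,2)[unfolded steps_in_def, rule_format, of "t - 1"] by simp_all
  ultimately show ?case by presburger
qed

lemma steps_in_parity_eq:
  assumes "steps_in f Y" "steps_in f Z" "Y k = Z k" "i \<le> k" "k \<le> j"
    and "\<And>t. i \<le> t \<Longrightarrow> t \<le> j \<Longrightarrow> even (Y t) \<longleftrightarrow> even (Z t)"
    and "i \<le> t" "t \<le> j"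
  shows "Y t = Z t"
proof (cases "k \<le> t")
  case True
  then show ?thesis
    using steps_in_parity_eq_up[OF assms(1-3), of j t] assms(4-8) by auto
next
  case False
  then show ?thesis
    using steps_in_parity_eq_down[OF assms(1-3), of i t] assms(4-8) by auto
qed

text \<open>The slope \<open>r\<close> is \<open>q / p\<close> in lowest terms, and
  \<open>2 \<le> p\<close> says that it is not an integer.\<close>

locale heckoid =
  fixes q p :: int and n :: nat
  assumes p_ge: "2 \<le> p" and coprime_qp: "coprime q p" and n_ge: "2 \<le> n"
begin

lemma p_pos: "p > 0" using p_ge by simp

abbreviation sg :: "int \<Rightarrow> bool" where "sg \<equiv> sgn_of p"

text \<open>The number of letters of the relator: the word of slope \<open>q / p\<close> has
  \<open>2 * p\<close> letters and is raised to the power \<open>n\<close>.\<close>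

definition rlen :: nat where "rlen = nat (2 * p * int n)"

lemma int_rlen: "int rlen = 2 * p * int n"
  unfolding rlen_def using p_pos by simp

text \<open>The bound comes from \<open>n_ge\<close>. After removal of fewer than \<open>p\<close>
  letters it leaves at least \<open>2 p - 1\<close>, enough for a fat complement.\<close>

lemma rlen_ge: "int rlen \<ge> 4 * p"
proof -
  have "int rlen = p * (2 * int n)" using int_rlen by simp
  also have "\<dots> \<ge> p * 4" using n_ge p_pos by (intro mult_left_mono) auto
  finally show ?thesis by simp
qed

lemma even_rlen: "even rlen" 
  using int_rlen by (metis even_mult_iff even_numeral even_of_nat_iff)

text \<open>The phase \<open>x\<close>, taken modulo \<open>2 p\<close>, is the place in the relator of slope \<open>q/p\<close> at which reading
  starts: the next letters have exponent signs \<open>sg (x + l q)\<close>.\<close>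

definition rel :: "int \<Rightarrow> nat \<Rightarrow> bool list" where
  "rel x m = map (\<lambda>l. sg (x + int l * q)) [0..<m]"

lemma length_rel [simp]: "length (rel x m) = m" by (simp add: rel_def)

lemma nth_rel [simp]: "l < m \<Longrightarrow> rel x m ! l = sg (x + int l * q)" by (simp add: rel_def)

lemma rel_0 [simp]: "rel x 0 = []" by (simp add: rel_def)

lemma rel_snoc: "rel x (Suc m) = rel x m @ [sg (x + int m * q)]" by (simp add: rel_def)

lemma take_rel: "k \<le> m \<Longrightarrow> take k (rel x m) = rel x k"
  by (simp add: rel_def take_map)

lemma rel_eq_iff: "rel x m = rel y m \<longleftrightarrow> (\<forall>l<m. sg (x + int l * q) = sg (y + int l * q))"
  by (auto simp: rel_def)

text \<open>A rich piece of the relator determines its phase, see \<open>rich_determines\<close>.\<close>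

definition rich :: "int \<Rightarrow> nat \<Rightarrow> bool" where
  "rich x m \<longleftrightarrow> (\<exists>l<m. p dvd x + int l * q) \<and> (\<exists>l<m. p dvd x + int l * q + 1)"

lemma rich_mono: "rich x m \<Longrightarrow> m \<le> k \<Longrightarrow> rich x k"
  unfolding rich_def by (meson order_less_le_trans)

lemma rich_prepend: "rich (x + int k * q) m \<Longrightarrow> rich x (k + m)"
proof -
  assume "rich (x + int k * q) m"
  then obtain l l' where l: "l < m" "p dvd x + int k * q + int l * q"
     "l' < m" "p dvd x + int k * q + int l' * q + 1" unfolding rich_def by auto
  have "p dvd x + int (k + l) * q" "p dvd x + int (k + l') * q + 1"
    using l by (simp_all add: algebra_simps)
  then show ?thesis unfolding rich_def using l(1,3) by (meson add_less_cancel_left)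
qed

lemma rich_cong:
  assumes "2 * p dvd x - y" shows "rich x m \<longleftrightarrow> rich y m"
proof -
  have d: "p dvd x - y" using assms by (meson dvd_mult_right)
  have 1: "p dvd x + z \<longleftrightarrow> p dvd y + z" for z
    using d dvd_add_right_iff[OF d, of "y + z"] by (simp add: algebra_simps)
  show ?thesis
    unfolding rich_def add.assoc 1 ..
qed

lemma ex_mark: "\<exists>l<nat p. p dvd x + int l * q"
proof -
  obtain u v where "u * q + v * p = gcd q p" using bezout_int by blast
  then have uv: "u * q + v * p = 1" using coprime_qp by simp
  define l where "l = nat ((- x * u) mod p)"
  have l: "int l = (- x * u) mod p" using p_pos by (simp add: l_def)
  have "int l = - x * u - p * ((- x * u) div p)" unfolding l by (simp add: minus_mult_div_eq_mod)
  then have "x + int l * q = x + (- x * u - p * ((- x * u) div p)) * q" by (rule arg_cong)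
  then have "x + int l * q = x * (1 - u * q) - p * ((- x * u) div p) * q"
    by (simp only: algebra_simps)
  also have "1 - u * q = v * p" using uv by simp
  also have "x * (v * p) - p * ((- x * u) div p) * q = p * (x * v - ((- x * u) div p) * q)"
    by (simp add: algebra_simps)
  finally have "p dvd x + int l * q" by simp
  moreover have "int l < p" using l p_pos by simp
  moreover from this have "l < nat p" by linarith
  ultimately show ?thesis by blast
qed

text \<open>Since \<open>q\<close> is coprime to \<open>p\<close>, any \<open>p\<close> consecutive
  letters meet every residue, in particular 0 and -1.\<close>

lemma rich_long: "int m \<ge> p \<Longrightarrow> rich x m"
proof -
  assume m: "int m \<ge> p"
  obtain l l' where l: "l < nat p" "p dvd x + int l * q" "l' < nat p" "p dvd x + 1 + int l' * q"
    using ex_mark[of x] ex_mark[of "x + 1"] by blast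
  have "l < m" "l' < m" using l(1,3) m p_pos by linarith+
  moreover have "x + 1 + int l' * q = x + int l' * q + 1" by simp
  ultimately show ?thesis unfolding rich_def using l(2,4) by metis
qed

lemma not_rich_short: "\<not> rich x m \<Longrightarrow> int m \<le> p - 1"
  using rich_long[of m x] by linarith

lemma rich_imp_pos: "rich x m \<Longrightarrow> 0 < m" unfolding rich_def by auto

text \<open>The phase on the left is that of the inverse piece. Reflection exchanges the residues 0
  and -1, so the two halves of richness swap.\<close>

lemma rich_reflect:
  "rich (- 1 - x - (int m - 1) * q) m \<longleftrightarrow> rich x m"
proof -
  have *: "rich (- 1 - x - (int m - 1) * q) m" if asm: "rich x m" for x
  proof -
    obtain l l' where l: "l < m" "p dvd x + int l * q" "l' < m" "p dvd x + int l' * q + 1"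
      using asm unfolding rich_def by auto
    have "(- 1 - x - (int m - 1) * q) + int (m - 1 - l') * q = - (x + int l' * q + 1)"
       "(- 1 - x - (int m - 1) * q) + int (m - 1 - l) * q + 1 = - (x + int l * q)"
      using l by (simp_all add: of_nat_diff algebra_simps)
    then have "p dvd (- 1 - x - (int m - 1) * q) + int (m - 1 - l') * q" 
       "p dvd (- 1 - x - (int m - 1) * q) + int (m - 1 - l) * q + 1"
      using l by (simp_all only: dvd_minus_iff)
    moreover have "m - 1 - l' < m" "m - 1 - l < m" using l by auto
    ultimately show ?thesis unfolding rich_def by blast
  qed
  show ?thesis
  proof
    assume "rich (- 1 - x - (int m - 1) * q) m"
    from *[OF this] show "rich x m" by simp
  qed (rule *)
qed

lemma rel_reflect:
  assumes "l < m"
  shows "sg ((- 1 - x - (int m - 1) * q) + int l * q) \<longleftrightarrow> \<not> sg (x + int (m - 1 - l) * q)"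
proof -
  have "(- 1 - x - (int m - 1) * q) + int l * q = - 1 - (x + int (m - 1 - l) * q)"
    using assms by (simp add: of_nat_diff algebra_simps)
  then show ?thesis using sgn_of_reflect[OF p_pos] by (simp only:)
qed

lemma q_bounds: "(q div p) * p \<le> q" "q \<le> (q div p + 1) * p"
  using div_mult_mod_eq[of q p] pos_mod_sign[OF p_pos, of q] pos_mod_bound[OF p_pos, of q]
  unfolding distrib_right by linarith+

lemma steps_in_rel: "steps_in (q div p) (\<lambda>t. (x + t * q) div p)"
  using steps_in_div[OF p_pos q_bounds] .

text \<open>A letter at residue 0 loses its floor as soon as the line is lowered, a letter at
  residue -1 as soon as it is raised.\<close>

lemma rich_floor_determines:
  assumes "rich x m" "\<And>l. l < m \<Longrightarrow> (x + int l * q) div p = (y + int l * q) div p"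
  shows "x = y"
proof -
  obtain l l' where l: "l < m" "p dvd x + int l * q" "l' < m" "p dvd x + int l' * q + 1"
    using \<open>rich x m\<close> unfolding rich_def by auto
  obtain k where k: "x + int l * q = p * k" using l(2) by (elim dvdE)
  then have "(y + int l * q) div p = k" using assms(2)[OF l(1)] p_pos by simp
  then have 1: "p * k \<le> y + int l * q"
    using mult_div_mod_eq[of p "y + int l * q"] pos_mod_sign[OF p_pos, of "y + int l * q"] by simp
  obtain k' where k': "x + int l' * q + 1 = p * k'" using l(4) by (elim dvdE)
  have "x + int l' * q = p * (k' - 1) + (p - 1)" using k' by (simp add: algebra_simps)
  then have "(x + int l' * q) div p = k' - 1"
    using p_pos by (intro int_div_pos_eq[where r = "p - 1"]) auto
  then have "(y + int l' * q) div p = k' - 1" using assms(2)[OF l(3)] by simp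
  then have "y + int l' * q = p * (k' - 1) + (y + int l' * q) mod p"
    using mult_div_mod_eq[of p "y + int l' * q"] by simp
  then have 2: "y + int l' * q \<le> p * k' - 1"
    using pos_mod_bound[OF p_pos, of "y + int l' * q"] by (simp add: algebra_simps)
  show ?thesis using 1 2 k k' by linarith
qed

text \<open>Equal parities give equal floors up to one even constant; shifting \<open>y\<close> by a
  multiple of \<open>2 p\<close> absorbs it. This is why a phase is known modulo \<open>2 p\<close>
  only.\<close>

lemma rich_determines:
  assumes "rich x m" "\<And>l. l < m \<Longrightarrow> sg (x + int l * q) = sg (y + int l * q)"
  shows "2 * p dvd x - y"
proof -
  have m: "0 < m" using assms(1) by (rule rich_imp_pos)
  have "even (x div p) = even (y div p)" using assms(2)[OF m] by (simp add: sgn_of_def)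
  then have "even (x div p - y div p)" by simp
  then obtain z where z: "x div p - y div p = 2 * z" by (elim dvdE)
  let ?y = "y + 2 * p * z"
  have 0: "x div p = ?y div p"
    using z p_pos div_mult_self2[of p y "2 * z"] by (simp add: mult.assoc mult.left_commute)
  have "(x + t * q) div p = (?y + t * q) div p" if "0 \<le> t" "t \<le> int m - 1" for t
  proof (rule steps_in_parity_eq_up[OF steps_in_rel steps_in_rel _ _ that])
    show "(x + 0 * q) div p = (?y + 0 * q) div p" using 0 by simp
    fix s :: int assume s: "0 \<le> s" "s \<le> int m - 1"
    have e: "?y + s * q = (y + s * q) + 2 * p * z" by simp
    have "sg (?y + s * q) = sg (y + s * q)" unfolding e by (rule sgn_of_add_period[OF p_pos])
    also have "\<dots> = sg (x + s * q)" using assms(2)[of "nat s"] s by simp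
    finally show "even ((x + s * q) div p) = even ((?y + s * q) div p)" by (simp add: sgn_of_def)
  qed
  then have "x = ?y" using rich_floor_determines[OF assms(1), of ?y] by auto
  then show ?thesis by simp
qed

text \<open>Branches of two fat pieces can be cut so that each part still determines its phase,
  see \<open>fat_split\<close> and \<open>fat_imp_splits\<close>.\<close>

definition fat :: "int \<Rightarrow> nat \<Rightarrow> bool" where
  "fat x k \<longleftrightarrow> (\<forall>t\<le>k. rich x t \<or> rich (x + int t * q) (k - t))"

text \<open>Take the shortest rich initial piece, of \<open>Suc t\<close> letters. Its first
  \<open>t\<close> letters are not rich, so fatness makes the part from \<open>t\<close> on rich.
  The letter at \<open>t\<close> belongs to both parts and becomes the joining edge.\<close>

lemma fat_split:
  assumes "fat x k"
  obtains t where "t < k" "rich x (Suc t)" "rich (x + int t * q) (k - t)"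
proof -
  have "rich x k \<or> rich (x + int k * q) (k - k)" using assms unfolding fat_def by blast
  then have k: "rich x k" using rich_imp_pos by auto
  define t where "t = (LEAST t. rich x t)"
  have t: "rich x t" "t \<le> k" using k unfolding t_def by (auto intro: LeastI Least_le)
  have "0 < t" using t(1) by (rule rich_imp_pos)
  then have "\<not> rich x (t - 1)" using not_less_Least[of "t - 1" "rich x"] unfolding t_def by simp
  then have "rich (x + int (t - 1) * q) (k - (t - 1))"
    using assms t(2) unfolding fat_def by (meson diff_le_self le_trans)
  then show ?thesis using that[of "t - 1"] t \<open>0 < t\<close> by simp
qed

text \<open>Of two parts with together \<open>2 * p - 1\<close> letters one has at least
  \<open>p\<close>.\<close>

lemma fat_long: "int k \<ge> 2 * p - 1 \<Longrightarrow> fat x k"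
  unfolding fat_def
proof (intro allI impI)
  fix t assume "int k \<ge> 2 * p - 1" "t \<le> k"
  then have "p \<le> int t \<or> p \<le> int (k - t)" by linarith
  then show "rich x t \<or> rich (x + int t * q) (k - t)" using rich_long by blast
qed

lemma fat_cong: "2 * p dvd x - y \<Longrightarrow> fat x k \<longleftrightarrow> fat y k"
proof -
  assume *: "2 * p dvd x - y"
  then have "2 * p dvd (x + z) - (y + z)" for z by simp
  with * show ?thesis unfolding fat_def using rich_cong by blast
qed

lemma fat_imp_rich: "fat x k \<Longrightarrow> rich x k"
proof -
  assume "fat x k"
  then have "rich x 0 \<or> rich (x + int 0 * q) (k - 0)" unfolding fat_def by blast
  then show ?thesis using rich_imp_pos by auto
qed

text \<open>A cut outside the fat core leaves the whole core on one side, and the core is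
  rich.\<close>

lemma fat_extend:
  assumes "fat (x + int a * q) k" shows "fat x (a + k + b)"
  unfolding fat_def
proof (intro allI impI)
  fix t assume t: "t \<le> a + k + b"
  consider "t < a" | "a \<le> t" "t \<le> a + k" | "a + k < t" by linarith
  then show "rich x t \<or> rich (x + int t * q) (a + k + b - t)"
  proof cases
    case 1
    have "rich (x + int a * q) k" using assms by (rule fat_imp_rich)
    moreover have "x + int a * q = (x + int t * q) + int (a - t) * q"
      using 1 by (simp add: of_nat_diff algebra_simps)
    ultimately have "rich (x + int t * q) (a - t + k)" using rich_prepend by metis
    then have "rich (x + int t * q) (a + k + b - t)" by (rule rich_mono) (use 1 in simp)
    then show ?thesis ..
  next
    case 2
    have e: "x + int a * q + int (t - a) * q = x + int t * q"
      using 2 by (simp add: of_nat_diff algebra_simps)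
    have "t - a \<le> k" using 2 by simp
    then have "rich (x + int a * q) (t - a) \<or> rich (x + int t * q) (k - (t - a))"
      using assms unfolding fat_def e[symmetric] by blast
    then show ?thesis
    proof
      assume "rich (x + int a * q) (t - a)"
      then have "rich x (a + (t - a))" by (rule rich_prepend)
      then show ?thesis using 2 by simp
    next
      assume "rich (x + int t * q) (k - (t - a))"
      then have "rich (x + int t * q) (a + k + b - t)" by (rule rich_mono) (use 2 in simp)
      then show ?thesis ..
    qed
  next
    case 3
    have "rich (x + int a * q) k" using assms by (rule fat_imp_rich)
    then have "rich x (a + k)" by (rule rich_prepend)
    then show ?thesis using 3 rich_mono by simp
  qed
qed

end

section \<open>Graphs and relator walks\<close>

text \<open>An edge \<open>(v, e, b, w)\<close> carries the generator \<open>a\<close> (\<open>e = False\<close>) or \<open>b\<close> (\<open>e = True\<close>) with exponent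
  sign \<open>b\<close>. The node \<open>New v e w\<close> is reached from \<open>v\<close> by a new path whose first letter has type \<open>e\<close> and
  which reads \<open>w\<close>. A flag \<open>(v, e, x)\<close> is a relator at phase \<open>x\<close> whose next letter is read at \<open>v\<close> and
  has type \<open>e\<close>.\<close>

datatype node = Base int | New node bool "bool list"

type_synonym graph = "(node \<times> bool \<times> bool \<times> node) set"
type_synonym flag = "node \<times> bool \<times> int"

text \<open>A folded graph: each letter acts on the vertices as a partial injection and the inverse
  letter as the inverse injection.\<close>

definition graph_on :: "node set \<Rightarrow> graph \<Rightarrow> bool" where
  "graph_on V E \<longleftrightarrow>
     (\<forall>v e b w. (v, e, b, w) \<in> E \<longrightarrow> v \<in> V \<and> (w, e, \<not> b, v) \<in> E) \<and>
     (\<forall>v e b w w'. (v, e, b, w) \<in> E \<longrightarrow> (v, e, b, w') \<in> E \<longrightarrow> w = w')"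

lemma graph_onD:
  assumes "graph_on V E" "(v, e, b, w) \<in> E"
  shows "v \<in> V" "w \<in> V" "(w, e, \<not> b, v) \<in> E"
  using assms unfolding graph_on_def by blast+

lemma graph_on_det: "graph_on V E \<Longrightarrow> (v, e, b, w) \<in> E \<Longrightarrow> (v, e, b, w') \<in> E \<Longrightarrow> w = w'"
  unfolding graph_on_def by blast

lemma graph_on_det_back: 
  "graph_on V E \<Longrightarrow> (v, e, b, w) \<in> E \<Longrightarrow> (v', e, b, w) \<in> E \<Longrightarrow> v = v'"
  using graph_onD(3) graph_on_det by metis

definition fresh_for :: "node set \<Rightarrow> graph \<Rightarrow> bool" where
  "fresh_for V E \<longleftrightarrow> (\<forall>v e w. New v e w \<in> V \<longrightarrow> w \<noteq> [] \<and> v \<in> V \<and> (\<exists>u. (v, e, hd w, u) \<in> E))"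

text \<open>The generators alternate along every relator and every line; \<open>tp e k\<close> is
  the type found \<open>k\<close> letters after one of type \<open>e\<close>.\<close>

definition tp :: "bool \<Rightarrow> nat \<Rightarrow> bool" where "tp e k \<longleftrightarrow> (e \<longleftrightarrow> even k)"

lemma tp_0 [simp]: "tp e 0 = e" by (simp add: tp_def)
lemma tp_Suc [simp]: "tp e (Suc k) = (\<not> tp e k)" by (auto simp: tp_def)
lemma tp_add: "tp e (k + l) = tp (tp e k) l" by (auto simp: tp_def)
lemma tp_not: "tp (\<not> e) k = (\<not> tp e k)" by (auto simp: tp_def)
lemma tp_tp [simp]: "tp (tp e k) k = e" by (auto simp: tp_def)

definition nd :: "node \<Rightarrow> bool \<Rightarrow> bool list \<Rightarrow> node" where
  "nd v e w = (if w = [] then v else New v e w)"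

lemma nd_Nil [simp]: "nd v e [] = v" by (simp add: nd_def)

section \<open>Relator walks, their rotation and reversal\<close>

context heckoid begin

definition rwalk :: "graph \<Rightarrow> bool \<Rightarrow> int \<Rightarrow> nat \<Rightarrow> (nat \<Rightarrow> node) \<Rightarrow> bool" where
  "rwalk E e x m P \<longleftrightarrow> (\<forall>i<m. (P i, tp e i, sg (x + int i * q), P (Suc i)) \<in> E)"

lemma rwalkD: "rwalk E e x m P \<Longrightarrow> i < m \<Longrightarrow> (P i, tp e i, sg (x + int i * q), P (Suc i)) \<in> E"
  unfolding rwalk_def by blast

lemma rwalk_det:
  assumes "graph_on V E" "rwalk E e x m P" "rwalk E e x k P'" "P 0 = P' 0" "i \<le> m" "i \<le> k"
  shows "P i = P' i"
  using assms(5,6)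
proof (induction i)
  case (Suc i)
  then have "P i = P' i" "i < m" "i < k" by simp_all
  then have "(P i, tp e i, sg (x + int i * q), P (Suc i)) \<in> E"
    "(P i, tp e i, sg (x + int i * q), P' (Suc i)) \<in> E"
    using rwalkD[OF assms(2), of i] rwalkD[OF assms(3), of i] by simp_all
  then show ?case using graph_on_det[OF assms(1)] by blast
qed (use assms(4) in simp)

lemma rwalk_mono: "rwalk E e x m P \<Longrightarrow> E \<subseteq> E' \<Longrightarrow> k \<le> m \<Longrightarrow> rwalk E' e x k P"
  unfolding rwalk_def by auto

lemma rwalk_drop:
  "rwalk E e x (k + m) P \<Longrightarrow> rwalk E (tp e k) (x + int k * q) m (\<lambda>i. P (k + i))"
proof -
  assume *: "rwalk E e x (k + m) P"
  show ?thesis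
    unfolding rwalk_def
  proof (intro allI impI)
    fix i assume "i < m"
    then have "(P (k + i), tp e (k + i), sg (x + int (k + i) * q), P (Suc (k + i))) \<in> E"
      using rwalkD[OF *, of "k + i"] by simp
    then show "(P (k + i), tp (tp e k) i, sg (x + int k * q + int i * q), P (k + Suc i)) \<in> E"
      unfolding tp_add by (simp add: algebra_simps)
  qed
qed

lemma rwalk_append:
  assumes "rwalk E e x k P" "rwalk E (tp e k) (x + int k * q) m P'" "P k = P' 0"
  shows "rwalk E e x (k + m) (\<lambda>i. if i \<le> k then P i else P' (i - k))"
  unfolding rwalk_def
proof (intro allI impI)
  fix i assume i: "i < k + m"
  show "(if i \<le> k then P i else P' (i - k), tp e i, sg (x + int i * q),
          if Suc i \<le> k then P (Suc i) else P' (Suc i - k)) \<in> E"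
  proof (cases "i < k")
    case True
    then show ?thesis using assms(1) unfolding rwalk_def by simp
  next
    case False
    then obtain j where j: "i = k + j" using le_Suc_ex not_less by blast
    then have "(P' j, tp (tp e k) j, sg (x + int k * q + int j * q), P' (Suc j)) \<in> E"
      using rwalkD[OF assms(2), of j] i by simp
    moreover have "tp (tp e k) j = tp e i" using j tp_add by simp
    moreover have "x + int k * q + int j * q = x + int i * q" using j by (simp add: algebra_simps)
    ultimately have "(P' j, tp e i, sg (x + int i * q), P' (Suc j)) \<in> E" by simp
    then show ?thesis using j assms(3) by (cases j) auto
  qed
qed

lemma rwalk_reverse:
  assumes "graph_on V E" "rwalk E e x m P"
  shows "rwalk E (\<not> tp e m) (- 1 - x - (int m - 1) * q) m (\<lambda>i. P (m - i))"
  unfolding rwalk_def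
proof (intro allI impI)
  fix i assume i: "i < m"
  then have "(P (m - 1 - i), tp e (m - 1 - i), sg (x + int (m - 1 - i) * q), P (Suc (m - 1 - i))) \<in> E"
    using rwalkD[OF assms(2), of "m - 1 - i"] by simp
  then have "(P (Suc (m - 1 - i)), tp e (m - 1 - i), \<not> sg (x + int (m - 1 - i) * q), P (m - 1 - i)) \<in> E"
    using graph_onD(3)[OF assms(1)] by blast
  moreover have "Suc (m - 1 - i) = m - i" "m - 1 - i = m - Suc i" using i by auto
  moreover have "tp e (m - Suc i) = tp (\<not> tp e m) i"
    using i by (auto simp: tp_def)
  ultimately show "(P (m - i), tp (\<not> tp e m) i, sg (- 1 - x - (int m - 1) * q + int i * q), P (m - Suc i)) \<in> E"
    using rel_reflect[OF i, of x] by simp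
qed

lemma rwalk_cong_phase:
  assumes "2 * p dvd x - y" shows "rwalk E e x m P \<longleftrightarrow> rwalk E e y m P"
proof -
  have "sg (x + z) = sg (y + z)" for z
    using assms by (intro sgn_of_cong p_pos) simp
  then show ?thesis unfolding rwalk_def by simp
qed

text \<open>The pairs of a type and a phase modulo \<open>2 * p\<close> are exactly the starting
  places of the relator and of its inverse, so all cyclic shifts of both are covered when
  \<open>e\<close> and \<open>x\<close> vary.\<close>

definition closed_at :: "graph \<Rightarrow> node \<Rightarrow> bool \<Rightarrow> int \<Rightarrow> bool" where
  "closed_at E v e x \<longleftrightarrow> (\<exists>P. rwalk E e x rlen P \<and> P 0 = v \<and> P rlen = v)"

lemma closed_at_mono: "closed_at E v e x \<Longrightarrow> E \<subseteq> E' \<Longrightarrow> closed_at E' v e x"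
  unfolding closed_at_def using rwalk_mono by blast

lemma closed_at_cong: "2 * p dvd x - y \<Longrightarrow> closed_at E v e x \<longleftrightarrow> closed_at E v e y"
  unfolding closed_at_def using rwalk_cong_phase by blast

lemma rlen_period: "2 * p dvd x + int rlen * q - x"
  using int_rlen by (simp add: mult.assoc)

lemma tp_rlen [simp]: "tp e rlen = e" using even_rlen by (simp add: tp_def)

text \<open>Rotation by one letter. The first edge can be appended at the end because a whole
  relator preserves the type and changes the phase by a multiple of \<open>2 * p\<close>.\<close>

lemma closed_at_Suc:
  assumes "graph_on V E" "closed_at E v e x" 
  obtains u where "(v, e, sg x, u) \<in> E" "closed_at E u (\<not> e) (x + q)"
proof -
  obtain P where P: "rwalk E e x rlen P" "P 0 = v" "P rlen = v"
    using assms(2) unfolding closed_at_def by blast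
  have pos: "0 < rlen" using rlen_ge p_pos by linarith
  then have e: "(v, e, sg x, P 1) \<in> E" using rwalkD[OF P(1), of 0] P(2) by simp
  define m where "m = rlen - 1"
  have m: "rlen = 1 + m" using pos by (simp add: m_def)
  have 1: "rwalk E (\<not> e) (x + q) m (\<lambda>i. P (1 + i))"
    using rwalk_drop[of E e x 1 m P] P(1) m by simp
  have ph: "sg (x + q + int m * q) = sg x"
  proof -
    have "x + q + int m * q - x = int rlen * q" using m by (simp add: algebra_simps)
    then show ?thesis using rlen_period[of x] by (intro sgn_of_cong[OF p_pos]) simp
  qed
  have "tp (\<not> e) m = e" using tp_rlen[of e] m by (simp add: tp_not)
  then have 2: "rwalk E (tp (\<not> e) m) (x + q + int m * q) 1 (\<lambda>i. if i = 0 then v else P 1)"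
    unfolding rwalk_def using e ph by simp
  define P' where "P' = (\<lambda>i. if i \<le> m then P (1 + i) else (\<lambda>i. if i = 0 then v else P 1) (i - m))"
  have "rwalk E (\<not> e) (x + q) (m + 1) P'"
    unfolding P'_def by (rule rwalk_append[OF 1 2]) (use m P(3) in simp)
  then have "closed_at E (P 1) (\<not> e) (x + q)"
    unfolding closed_at_def using m by (intro exI[of _ P']) (simp add: P'_def)
  then show ?thesis using that e by blast
qed

text \<open>\<open>q - 1 - x\<close> is the phase of the inverse relator at the same vertex, and the
  type flips because the last letter is now read first.\<close>

lemma closed_at_reverse:
  assumes "graph_on V E" "closed_at E v e x"
  shows "closed_at E v (\<not> e) (q - 1 - x)"
proof -
  obtain P where P: "rwalk E e x rlen P" "P 0 = v" "P rlen = v"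
    using assms(2) unfolding closed_at_def by blast
  have "closed_at E v (\<not> e) (- 1 - x - (int rlen - 1) * q)"
    unfolding closed_at_def
    using rwalk_reverse[OF assms(1) P(1)] P(2,3) by (intro exI[of _ "\<lambda>i. P (rlen - i)"]) simp
  moreover have "2 * p dvd (- 1 - x - (int rlen - 1) * q) - (q - 1 - x)"
  proof -
    have "(- 1 - x - (int rlen - 1) * q) - (q - 1 - x) = - (x + int rlen * q - x)" by (simp add: algebra_simps)
    then show ?thesis using rlen_period by (metis dvd_minus_iff)
  qed
  ultimately show ?thesis using closed_at_cong by blast
qed

lemma closed_at_forward:
  assumes "graph_on V E" "closed_at E v e x" "rwalk E e x m P" "P 0 = v"
  shows "closed_at E (P m) (tp e m) (x + int m * q)"
  using assms(3)
proof (induction m)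
  case 0
  then show ?case using assms(2,4) by simp
next
  case (Suc m)
  then have "closed_at E (P m) (tp e m) (x + int m * q)"
    using rwalk_mono[OF Suc.prems, of E m] by simp
  then obtain u where u: "(P m, tp e m, sg (x + int m * q), u) \<in> E"
     "closed_at E u (\<not> tp e m) (x + int m * q + q)"
    by (rule closed_at_Suc[OF assms(1)])
  have "(P m, tp e m, sg (x + int m * q), P (Suc m)) \<in> E" using Suc.prems unfolding rwalk_def by simp
  then have "u = P (Suc m)" using u(1) graph_on_det[OF assms(1)] by blast
  then show ?case using u(2) by (simp add: algebra_simps)
qed

lemma closed_at_backward:
  assumes "graph_on V E" "rwalk E e x m P" "closed_at E (P m) (tp e m) (x + int m * q)"
  shows "closed_at E (P 0) e x"
proof -
  let ?y = "q - 1 - (x + int m * q)"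
  have c: "closed_at E (P m) (\<not> tp e m) ?y" by (rule closed_at_reverse[OF assms(1,3)])
  have "?y = - 1 - x - (int m - 1) * q" by (simp add: algebra_simps)
  then have r: "rwalk E (\<not> tp e m) ?y m (\<lambda>i. P (m - i))"
    using rwalk_reverse[OF assms(1,2)] by (simp only:)
  have "closed_at E (P (m - m)) (tp (\<not> tp e m) m) (?y + int m * q)"
    using closed_at_forward[OF assms(1) c r] by simp
  then have "closed_at E (P 0) (\<not> e) (q - 1 - x)" by (simp add: tp_not algebra_simps)
  then have "closed_at E (P 0) (\<not> \<not> e) (q - 1 - (q - 1 - x))" by (rule closed_at_reverse[OF assms(1)])
  then show ?thesis by simp
qed

end

section \<open>Attaching relator cycles\<close>

text \<open>At each flag of \<open>T\<close> the next edge is missing. The missing part of the relator cycle consists of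
  two branches, starting at the flag and at \<open>par\<close> of it, which is the other end of the existing part
  read backwards; they are joined by an edge after \<open>t\<close> letters. By \<open>ident\<close>, branches of different flags
  separate before that edge.\<close>

locale layer = heckoid +
  fixes V :: "node set" and E :: graph and T :: "flag set"
    and par :: "flag \<Rightarrow> flag" and t :: "flag \<Rightarrow> nat"
  assumes gr: "graph_on V E" and fresh: "fresh_for V E"
    and T_V: "(v, e, x) \<in> T \<Longrightarrow> v \<in> V"
    and T_missing: "(v, e, x) \<in> T \<Longrightarrow> (v, e, sg x, u) \<notin> E"
    and par_T: "f \<in> T \<Longrightarrow> par f \<in> T" and par_par: "f \<in> T \<Longrightarrow> par (par f) = f"
    and par_type: "(v, e, x) \<in> T \<Longrightarrow> par (v, e, x) = (v', e', x') \<Longrightarrow>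
        e' = tp (tp e (t (v, e, x))) (t (par (v, e, x)))"
    and par_phase: "(v, e, x) \<in> T \<Longrightarrow> par (v, e, x) = (v', e', x') \<Longrightarrow>
        2 * p dvd x' + 1 + x + (int (t (v, e, x)) + int (t (par (v, e, x)))) * q"
    and ident: "(v, e, x) \<in> T \<Longrightarrow> (v, e, y) \<in> T \<Longrightarrow>
        rel x (Suc (t (v, e, x))) = rel y (Suc (t (v, e, x))) \<Longrightarrow> x = y"
    and t_bound: "f \<in> T \<Longrightarrow> t f < rlen"
begin

definition len :: "flag \<Rightarrow> nat" where "len f = t f + t (par f) + 1"

text \<open>Nodes are named by the letters read since \<open>v\<close>, not by the flag. Branches
  with a common prefix thus share nodes, and folding at the root takes place in the naming.\<close>

definition branch :: "flag \<Rightarrow> nat \<Rightarrow> node" where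
  "branch f l = (case f of (v, e, x) \<Rightarrow> nd v e (rel x l))"

definition pos :: "flag \<Rightarrow> nat \<Rightarrow> node" where
  "pos f l = (if l \<le> t f then branch f l else branch (par f) (len f - l))"

text \<open>Edges away from the root, with the joining edge at \<open>l = t f\<close>. The reverse
  of a joining edge is the joining edge of the partner and lies in \<open>up\<close> as well;
  \<open>down\<close> collects the other reverses.\<close>

definition up :: graph where
  "up = {(branch (v, e, x) l, tp e l, sg (x + int l * q), pos (v, e, x) (Suc l)) | v e x l.
           (v, e, x) \<in> T \<and> l \<le> t (v, e, x)}"

definition down :: graph where
  "down = {(branch (v, e, x) (Suc l), tp e l, \<not> sg (x + int l * q), branch (v, e, x) l) | v e x l.
           (v, e, x) \<in> T \<and> l < t (v, e, x)}"

definition E1 :: graph where "E1 = E \<union> up \<union> down"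

definition V1 :: "node set" where "V1 = V \<union> {branch f l | f l. f \<in> T \<and> l \<le> t f}"

lemma branch_simp: "branch (v, e, x) l = nd v e (rel x l)" by (simp add: branch_def)

lemma branch_0 [simp]: "branch (v, e, x) 0 = v" by (simp add: branch_def)

lemma len_par: "f \<in> T \<Longrightarrow> len (par f) = len f" by (simp add: len_def par_par)

lemma branch_new:
  assumes "(v, e, x) \<in> T" "0 < l" shows "branch (v, e, x) l = New v e (rel x l)" "branch (v, e, x) l \<notin> V"
proof -
  have ne: "rel x l \<noteq> []" using assms(2) length_rel[of x l] by fastforce
  then show 1: "branch (v, e, x) l = New v e (rel x l)" by (simp add: branch_simp nd_def)
  have "hd (rel x l) = sg x" using assms(2) ne by (simp add: hd_conv_nth)
  show "branch (v, e, x) l \<notin> V"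
  proof
    assume "branch (v, e, x) l \<in> V"
    then obtain u where "(v, e, hd (rel x l), u) \<in> E"
      using fresh unfolding 1 fresh_for_def by blast
    then show False using T_missing[OF assms(1)] \<open>hd (rel x l) = sg x\<close> by simp
  qed
qed

lemma branch_eq:
  assumes "branch (v, e, x) l = branch (v', e', x') l'" "(v, e, x) \<in> T" "(v', e', x') \<in> T"
  shows "v = v'" "l = l'" "0 < l \<Longrightarrow> e = e'" "rel x l = rel x' l"
proof -
  have z: "l = 0 \<longleftrightarrow> l' = 0"
  proof
    assume "l = 0"
    then have "branch (v', e', x') l' \<in> V" using assms T_V[OF assms(2)] by simp
    then show "l' = 0" using branch_new(2)[OF assms(3)] by blast
  next
    assume "l' = 0"
    then have "branch (v, e, x) l \<in> V" using assms T_V[OF assms(3)] by simp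
    then show "l = 0" using branch_new(2)[OF assms(2)] by blast
  qed
  have "v = v' \<and> l = l' \<and> (0 < l \<longrightarrow> e = e') \<and> rel x l = rel x' l"
  proof (cases "l = 0")
    case True
    then show "v = v' \<and> l = l' \<and> (0 < l \<longrightarrow> e = e') \<and> rel x l = rel x' l" using z assms(1) by simp
  next
    case False
    then have "New v e (rel x l) = New v' e' (rel x' l')"
      using assms z branch_new(1) by (metis not_gr_zero)
    then show "v = v' \<and> l = l' \<and> (0 < l \<longrightarrow> e = e') \<and> rel x l = rel x' l"
      by (metis length_rel node.inject(2))
  qed
  then show "v = v'" "l = l'" "0 < l \<Longrightarrow> e = e'" "rel x l = rel x' l" by blast+
qed

lemma tp_inject: "tp e k = tp e' k \<Longrightarrow> e = e'" by (auto simp: tp_def)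

lemma rel_take_eq: "rel x k = rel y k \<Longrightarrow> l \<le> k \<Longrightarrow> rel x l = rel y l"
  by (metis take_rel)

lemma up_cases:
  assumes "(z, s, b, u) \<in> up"
  obtains v e x l where "(v, e, x) \<in> T" "l \<le> t (v, e, x)" "z = branch (v, e, x) l" "s = tp e l"
    "b = sg (x + int l * q)" "u = pos (v, e, x) (Suc l)"
  using assms unfolding up_def by blast

lemma down_cases:
  assumes "(z, s, b, u) \<in> down"
  obtains v e x l where "(v, e, x) \<in> T" "l < t (v, e, x)" "z = branch (v, e, x) (Suc l)" "s = tp e l"
    "b = (\<not> sg (x + int l * q))" "u = branch (v, e, x) l"
  using assms unfolding down_def by blast

lemma up_edge: "(v, e, x) \<in> T \<Longrightarrow> l \<le> t (v, e, x) \<Longrightarrow>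
    (branch (v, e, x) l, tp e l, sg (x + int l * q), pos (v, e, x) (Suc l)) \<in> up"
  unfolding up_def by blast

lemma down_edge: "(v, e, x) \<in> T \<Longrightarrow> l < t (v, e, x) \<Longrightarrow>
    (branch (v, e, x) (Suc l), tp e l, \<not> sg (x + int l * q), branch (v, e, x) l) \<in> down"
  unfolding down_def by blast

lemma pos_low: "l \<le> t f \<Longrightarrow> pos f l = branch f l" by (simp add: pos_def)

text \<open>Equal sources and letters mean a common prefix one letter longer. Inside both branches
  the targets then have the same name, and at a joining edge \<open>ident\<close> makes the flags
  equal.\<close>

lemma up_up_det:
  assumes "(z, s, b, u) \<in> up" "(z, s, b, u') \<in> up" shows "u = u'"
proof -
  obtain v e x l where 1: "(v, e, x) \<in> T" "l \<le> t (v, e, x)" "z = branch (v, e, x) l" "s = tp e l"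
    "b = sg (x + int l * q)" "u = pos (v, e, x) (Suc l)" using assms(1) by (rule up_cases)
  obtain v' e' x' l' where 2: "(v', e', x') \<in> T" "l' \<le> t (v', e', x')" "z = branch (v', e', x') l'" "s = tp e' l'"
    "b = sg (x' + int l' * q)" "u' = pos (v', e', x') (Suc l')" using assms(2) by (rule up_cases)
  have eq: "v = v'" "l = l'" "rel x l = rel x' l" using branch_eq[of v e x l v' e' x' l'] 1 2 by auto
  have e: "e = e'" using 1(4) 2(4) eq(2) tp_inject[of e l e'] by simp
  have r: "rel x (Suc l) = rel x' (Suc l)" using eq 1(5) 2(5) by (simp add: rel_snoc)
  consider "l < t (v, e, x)" "l < t (v', e', x')" | "l = t (v, e, x)" | "l = t (v', e', x')"
    using 1(2) 2(2) eq(2) by linarith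
  then show ?thesis
  proof cases
    case 1
    then show ?thesis using \<open>u = _\<close> \<open>u' = _\<close> eq e r by (simp add: pos_low branch_simp)
  next
    case 2
    then have "x = x'" using ident[of v e x x'] \<open>(v, e, x) \<in> T\<close> \<open>(v', e', x') \<in> T\<close> r eq e by simp
    then show ?thesis using \<open>u = _\<close> \<open>u' = _\<close> eq e by simp
  next
    case 3
    then have "x' = x" using ident[of v e x' x] \<open>(v, e, x) \<in> T\<close> \<open>(v', e', x') \<in> T\<close> r eq e by simp
    then show ?thesis using \<open>u = _\<close> \<open>u' = _\<close> eq e by simp
  qed
qed

text \<open>As types alternate, the edge back to the root has another type than all edges leading
  away from it.\<close>

lemma up_down_disjoint:
  assumes "(z, s, b, u) \<in> up" "(z, s, b', u') \<in> down" shows False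
proof -
  obtain v e x l where 1: "(v, e, x) \<in> T" "l \<le> t (v, e, x)" "z = branch (v, e, x) l" "s = tp e l"
    "b = sg (x + int l * q)" "u = pos (v, e, x) (Suc l)" using assms(1) by (rule up_cases)
  obtain v' e' x' l' where 2: "(v', e', x') \<in> T" "l' < t (v', e', x')" "z = branch (v', e', x') (Suc l')" "s = tp e' l'"
    "u' = branch (v', e', x') l'" using assms(2) by (rule down_cases)
  have "l = Suc l'" "e = e'" using branch_eq[of v e x l v' e' x' "Suc l'"] 1 2 by auto
  then show False using 1(4) 2(4) by simp
qed

lemma down_det:
  assumes "(z, s, b, u) \<in> down" "(z, s', b', u') \<in> down" shows "u = u'" "s = s'" "b = b'"
proof -
  obtain v e x l where 1: "(v, e, x) \<in> T" "l < t (v, e, x)" "z = branch (v, e, x) (Suc l)" "s = tp e l"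
    "b = (\<not> sg (x + int l * q))" "u = branch (v, e, x) l" using assms(1) by (rule down_cases)
  obtain v' e' x' l' where 2: "(v', e', x') \<in> T" "l' < t (v', e', x')" "z = branch (v', e', x') (Suc l')" "s' = tp e' l'"
    "b' = (\<not> sg (x' + int l' * q))" "u' = branch (v', e', x') l'" using assms(2) by (rule down_cases)
  have eq: "v = v'" "l = l'" "e = e'" "rel x (Suc l) = rel x' (Suc l)"
    using branch_eq[of v e x "Suc l" v' e' x' "Suc l'"] 1 2 by auto
  then have "rel x l = rel x' l" "sg (x + int l * q) = sg (x' + int l * q)" by (auto simp: rel_snoc)
  then show "u = u'" "s = s'" "b = b'" using 1 2 eq by (simp_all add: branch_simp)
qed

lemma new_edge_at_old:
  assumes "(z, s, b, u) \<in> up \<union> down" "z \<in> V"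
  obtains x where "(z, s, x) \<in> T" "b = sg x" "u = pos (z, s, x) 1"
proof (cases "(z, s, b, u) \<in> up")
  case True
  then obtain v e x l where 1: "(v, e, x) \<in> T" "l \<le> t (v, e, x)" "z = branch (v, e, x) l" "s = tp e l"
    "b = sg (x + int l * q)" "u = pos (v, e, x) (Suc l)" by (rule up_cases)
  have "l = 0" using 1 assms(2) branch_new(2)[of v e x l] by blast
  then show ?thesis using 1 that[of x] by simp
next
  case False
  then have "(z, s, b, u) \<in> down" using assms(1) by blast
  then obtain v e x l where "(v, e, x) \<in> T" "z = branch (v, e, x) (Suc l)" by (rule down_cases)
  then show ?thesis using assms(2) branch_new(2)[of v e x "Suc l"] by simp
qed

lemma E_new_edge_disjoint:
  assumes "(z, s, b, u) \<in> E" "(z, s, b, u') \<in> up \<union> down" shows False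
proof -
  have "z \<in> V" using graph_onD(1)[OF gr assms(1)] .
  then obtain x where "(z, s, x) \<in> T" "b = sg x" using new_edge_at_old[OF assms(2)] by metis
  then show False using T_missing assms(1) by blast
qed

lemma par_edge_type:
  assumes "(v, e, x) \<in> T" "par (v, e, x) = (v', e', x')" "l < len (v, e, x)"
  shows "tp e' (len (v, e, x) - Suc l) = tp e l"
    and "sg (x' + int (len (v, e, x) - Suc l) * q) \<longleftrightarrow> \<not> sg (x + int l * q)"
proof -
  let ?k = "len (v, e, x) - Suc l"
  have len: "len (v, e, x) = t (v, e, x) + t (par (v, e, x)) + 1" by (simp add: len_def)
  have "even (t (v, e, x) + t (par (v, e, x))) \<longleftrightarrow> (even l \<longleftrightarrow> even ?k)"
  proof -
    have "t (v, e, x) + t (par (v, e, x)) = l + ?k" using len assms(3) by simp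
    then show ?thesis by simp
  qed
  then have "(even (t (v, e, x)) \<longleftrightarrow> even (t (par (v, e, x)))) \<longleftrightarrow> (even l \<longleftrightarrow> even ?k)" by simp
  then show "tp e' ?k = tp e l" unfolding par_type[OF assms(1,2)] tp_def by blast
  have "2 * p dvd (x' + int ?k * q) - (- 1 - (x + int l * q))"
  proof -
    have *: "int l + int ?k = int (t (v, e, x)) + int (t (par (v, e, x)))"
      using len assms(3) by linarith
    have "(x' + int ?k * q) - (- 1 - (x + int l * q)) = x' + 1 + x + (int l + int ?k) * q"
      by (simp add: algebra_simps)
    then have "(x' + int ?k * q) - (- 1 - (x + int l * q))
       = x' + 1 + x + (int (t (v, e, x)) + int (t (par (v, e, x)))) * q"
      unfolding * .
    then show ?thesis using par_phase[OF assms(1,2)] by (simp only:)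
  qed
  then have "sg (x' + int ?k * q) = sg (- 1 - (x + int l * q))" by (rule sgn_of_cong[OF p_pos])
  then show "sg (x' + int ?k * q) \<longleftrightarrow> \<not> sg (x + int l * q)" using sgn_of_reflect[OF p_pos] by simp
qed

lemma pos_edge:
  assumes "(v, e, x) \<in> T" "l < len (v, e, x)"
  shows "(pos (v, e, x) l, tp e l, sg (x + int l * q), pos (v, e, x) (Suc l)) \<in> up \<union> down"
proof (cases "l \<le> t (v, e, x)")
  case True
  then show ?thesis using up_edge[OF assms(1) True] by (simp add: pos_low)
next
  case False
  obtain v' e' x' where par: "par (v, e, x) = (v', e', x')" by (metis prod_cases3)
  let ?k = "len (v, e, x) - Suc l"
  have k: "?k < t (v', e', x')" using False assms(2) par by (simp add: len_def)
  have T': "(v', e', x') \<in> T" using par_T[OF assms(1)] par by simp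
  have "(branch (v', e', x') (Suc ?k), tp e' ?k, \<not> sg (x' + int ?k * q), branch (v', e', x') ?k) \<in> down"
    by (rule down_edge[OF T' k])
  moreover have "Suc ?k = len (v, e, x) - l" using assms(2) by simp
  moreover have "pos (v, e, x) l = branch (v', e', x') (len (v, e, x) - l)"
     "pos (v, e, x) (Suc l) = branch (v', e', x') ?k" using False par by (simp_all add: pos_def)
  ultimately show ?thesis using par_edge_type[OF assms(1) par assms(2)] by simp
qed

lemma pos_par:
  assumes "f \<in> T" "l \<le> len f" shows "pos (par f) l = pos f (len f - l)"
  using assms unfolding pos_def by (auto simp: len_def par_par add.commute)

lemma up_reverse:
  assumes "(z, s, b, u) \<in> up" shows "(u, s, \<not> b, z) \<in> up \<union> down"
proof -
  obtain v e x l where 1: "(v, e, x) \<in> T" "l \<le> t (v, e, x)" "z = branch (v, e, x) l" "s = tp e l"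
    "b = sg (x + int l * q)" "u = pos (v, e, x) (Suc l)" using assms(1) by (rule up_cases)
  obtain v' e' x' where par: "par (v, e, x) = (v', e', x')" by (metis prod_cases3)
  have T': "(v', e', x') \<in> T" using par_T[OF 1(1)] par by simp
  have l: "l < len (v, e, x)" using 1(2) by (simp add: len_def)
  let ?k = "len (v, e, x) - Suc l"
  have "?k < len (v', e', x')" using len_par[OF 1(1)] par l by simp
  from pos_edge[OF T' this]
  have "(pos (v', e', x') ?k, s, \<not> b, pos (v', e', x') (Suc ?k)) \<in> up \<union> down"
    using par_edge_type[OF 1(1) par l] 1(4,5) by simp
  moreover have "pos (v', e', x') ?k = u" "pos (v', e', x') (Suc ?k) = z"
    using pos_par[OF 1(1), of ?k] pos_par[OF 1(1), of "Suc ?k"] par l 1 by (simp_all add: pos_low Suc_diff_Suc)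
  ultimately show ?thesis by simp
qed

lemma down_reverse:
  assumes "(z, s, b, u) \<in> down" shows "(u, s, \<not> b, z) \<in> up"
proof -
  obtain v e x l where 1: "(v, e, x) \<in> T" "l < t (v, e, x)" "z = branch (v, e, x) (Suc l)" "s = tp e l"
    "b = (\<not> sg (x + int l * q))" "u = branch (v, e, x) l" using assms(1) by (rule down_cases)
  then show ?thesis using up_edge[of v e x l] by (simp add: pos_low)
qed

lemma branch_V1: "f \<in> T \<Longrightarrow> l \<le> t f \<Longrightarrow> branch f l \<in> V1" unfolding V1_def by blast

lemma graph_on_E1: "graph_on V1 E1"
  unfolding graph_on_def
proof (intro conjI allI impI)
  fix z s b u assume "(z, s, b, u) \<in> E1"
  then consider "(z, s, b, u) \<in> E" | "(z, s, b, u) \<in> up" | "(z, s, b, u) \<in> down" unfolding E1_def by blast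
  note c = this
  show "z \<in> V1"
    using c
  proof cases
    case 1
    then show ?thesis using graph_onD(1)[OF gr] unfolding V1_def by blast
  next
    case 2
    then show ?thesis by (elim up_cases) (auto intro: branch_V1)
  next
    case 3
    then show ?thesis by (elim down_cases) (auto intro: branch_V1)
  qed
  show "(u, s, \<not> b, z) \<in> E1"
    using c
  proof cases
    case 1
    then show ?thesis using graph_onD(3)[OF gr] unfolding E1_def by blast
  next
    case 2
    then show ?thesis using up_reverse unfolding E1_def by blast
  next
    case 3
    then show ?thesis using down_reverse unfolding E1_def by blast
  qed
next
  fix z s b u u' assume u: "(z, s, b, u) \<in> E1" and u': "(z, s, b, u') \<in> E1"
  consider "(z, s, b, u) \<in> E" | "(z, s, b, u) \<in> up" | "(z, s, b, u) \<in> down"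
    using u unfolding E1_def by blast
  then show "u = u'"
  proof cases
    case 1
    then have "(z, s, b, u') \<in> E" using u' E_new_edge_disjoint unfolding E1_def by blast
    then show ?thesis using 1 graph_on_det[OF gr] by blast
  next
    case 2
    then have "(z, s, b, u') \<in> up" using u' E_new_edge_disjoint up_down_disjoint unfolding E1_def by blast
    then show ?thesis using 2 up_up_det by blast
  next
    case 3
    then have "(z, s, b, u') \<in> down" using u' E_new_edge_disjoint up_down_disjoint unfolding E1_def by blast
    then show ?thesis using 3 down_det(1) by blast
  qed
qed

lemma fresh_for_E1: "fresh_for V1 E1"
  unfolding fresh_for_def
proof (intro allI impI)
  fix v e w assume new: "New v e w \<in> V1"
  show "w \<noteq> [] \<and> v \<in> V1 \<and> (\<exists>u. (v, e, hd w, u) \<in> E1)"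
  proof (cases "New v e w \<in> V")
    case True
    then show ?thesis using fresh unfolding fresh_for_def V1_def E1_def by blast
  next
    case False
    then obtain f l where "f \<in> T" "l \<le> t f" "New v e w = branch f l"
      using new unfolding V1_def by blast
    then obtain v' e' x where f: "(v', e', x) \<in> T" "l \<le> t (v', e', x)" "New v e w = branch (v', e', x) l"
      by (cases f) auto
    have "0 < l" using False f T_V[OF f(1)] by (cases l) auto
    then have eq: "v = v'" "e = e'" "w = rel x l" using f(3) branch_new(1)[OF f(1)] by auto
    have ne: "w \<noteq> []" using \<open>0 < l\<close> eq(3) length_rel[of x l] by fastforce
    have "hd w = sg x" using eq(3) ne \<open>0 < l\<close> by (simp add: hd_conv_nth)
    then have "(v, e, hd w, pos (v, e, x) 1) \<in> E1"
      using up_edge[OF f(1), of 0] eq unfolding E1_def by simp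
    then show ?thesis using ne T_V[OF f(1)] eq unfolding V1_def by blast
  qed
qed

lemma pos_0: "(v, e, x) \<in> T \<Longrightarrow> pos (v, e, x) 0 = v" by (simp add: pos_low)

lemma pos_len: "f \<in> T \<Longrightarrow> pos f (len f) = fst (par f)"
  using pos_par[of f 0] par_T[of f] by (cases "par f") (simp add: pos_0)

lemma pos_in_V1: "f \<in> T \<Longrightarrow> l \<le> len f \<Longrightarrow> pos f l \<in> V1"
  unfolding pos_def using par_T[of f] by (auto intro!: branch_V1 simp: len_def)

lemma pos_inner:
  assumes "f \<in> T" "0 < l" "l < len f" shows "pos f l \<notin> V"
  using assms branch_new(2) par_T unfolding pos_def by (cases f; cases "par f") (metis zero_less_diff)

text \<open>Once outside \<open>V\<close> a walk stays on the missing path of a single flag. On a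
  shared prefix that flag is still undecided, so the induction must be free to exchange it for one
  with the same letters so far.\<close>

lemma excursion:
  assumes v: "v \<in> V" "P 0 = v" and k: "0 < k"
    and edges: "\<And>i. i < k \<Longrightarrow> (P i, tp e i, s i, P (Suc i)) \<in> E1"
    and first: "(P 0, e, s 0, P 1) \<notin> E"
    and inner: "\<And>i. 0 < i \<Longrightarrow> i < k \<Longrightarrow> P i \<notin> V"
  shows "\<exists>x. (v, e, x) \<in> T \<and> k \<le> len (v, e, x) \<and> (\<forall>i<k. s i = sg (x + int i * q)) \<and>
     (\<forall>i\<le>k. P i = pos (v, e, x) i)"
  using k edges inner
proof (induction k)
  case (Suc k)
  show ?case
  proof (cases "k = 0")
    case True
    have "(v, e, s 0, P 1) \<in> up \<union> down"
      using Suc.prems(2)[of 0] first v(2) unfolding E1_def by auto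
    then obtain x where "(v, e, x) \<in> T" "s 0 = sg x" "P 1 = pos (v, e, x) 1"
      by (rule new_edge_at_old[OF _ v(1)])
    then show ?thesis using True v(2) by (auto simp: len_def pos_0 le_Suc_eq intro!: exI[of _ x])
  next
    case False
    then have k: "0 < k" by simp
    obtain x where x: "(v, e, x) \<in> T" "k \<le> len (v, e, x)" "\<forall>i<k. s i = sg (x + int i * q)"
      "\<forall>i\<le>k. P i = pos (v, e, x) i" using Suc.IH[OF k] Suc.prems by auto
    have Pk: "P k \<notin> V" using Suc.prems(3)[of k] k by simp
    have klen: "k < len (v, e, x)"
    proof (rule ccontr)
      assume "\<not> k < len (v, e, x)"
      then have "P k = fst (par (v, e, x))" using x pos_len[OF x(1)] by simp
      moreover have "fst (par (v, e, x)) \<in> V" using par_T[OF x(1)] T_V by (cases "par (v, e, x)") auto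
      ultimately show False using Pk by simp
    qed
    have edge: "(P k, tp e k, s k, P (Suc k)) \<in> up \<union> down"
      using Suc.prems(2)[of k] Pk graph_onD(1)[OF gr] unfolding E1_def by auto
    have pe: "(P k, tp e k, sg (x + int k * q), pos (v, e, x) (Suc k)) \<in> up \<union> down"
      using pos_edge[OF x(1) klen] x(4) by simp
    show ?thesis
    proof (cases "k \<le> t (v, e, x)")
      case False
      have "(P k, tp e k, sg (x + int k * q), pos (v, e, x) (Suc k)) \<in> down"
      proof -
        obtain v' e' x' where par: "par (v, e, x) = (v', e', x')" by (metis prod_cases3)
        let ?k = "len (v, e, x) - Suc k"
        have k': "?k < t (v', e', x')" using False klen par by (simp add: len_def)
        have "(branch (v', e', x') (Suc ?k), tp e' ?k, \<not> sg (x' + int ?k * q), branch (v', e', x') ?k) \<in> down"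
          using down_edge[OF _ k'] par_T[OF x(1)] par by simp
        moreover have "Suc ?k = len (v, e, x) - k" using klen by simp
        ultimately show ?thesis
          using par_edge_type[OF x(1) par klen] x(4) False par by (simp add: pos_def)
      qed
      moreover from this have "(P k, tp e k, s k, P (Suc k)) \<in> down"
        using edge up_down_disjoint by blast
      ultimately have "s k = sg (x + int k * q)" "P (Suc k) = pos (v, e, x) (Suc k)"
        using down_det(1,3) by blast+
      then show ?thesis using x klen by (auto simp: less_Suc_eq le_Suc_eq intro!: exI[of _ x])
    next
      case True
      then have "(P k, tp e k, sg (x + int k * q), pos (v, e, x) (Suc k)) \<in> up"
        using up_edge[OF x(1) True] x(4) by (simp add: pos_low)
      then have "(P k, tp e k, s k, P (Suc k)) \<in> up" using edge up_down_disjoint by blast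
      \<comment> \<open>The edge may belong to another flag. Its branch has the same nodes up to
        \<open>k\<close>, so the walk is reassigned to that flag.\<close>
      then obtain v' e' y l where y: "(v', e', y) \<in> T" "l \<le> t (v', e', y)" "P k = branch (v', e', y) l"
        "tp e k = tp e' l" "s k = sg (y + int l * q)" "P (Suc k) = pos (v', e', y) (Suc l)" by (rule up_cases)
      have "branch (v, e, x) k = branch (v', e', y) l" using x(4) y(3) True by (simp add: pos_low)
      then have eq: "v = v'" "k = l" "e = e'" "rel x k = rel y k"
        using branch_eq[OF _ x(1) y(1)] k by auto
      have "\<forall>i<k. s i = sg (y + int i * q)" using x(3) eq(4) by (auto simp: rel_eq_iff)
      moreover have "\<forall>i\<le>k. P i = pos (v, e, y) i"
        using x(4) True y(2) eq rel_take_eq[OF eq(4)] by (auto simp: pos_low branch_simp)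
      ultimately show ?thesis using y eq
        by (intro exI[of _ y]) (auto simp: less_Suc_eq le_Suc_eq len_def)
    qed
  qed
qed simp

lemma E_E1: "E \<subseteq> E1" unfolding E1_def by blast

lemma V_V1: "V \<subseteq> V1" unfolding V1_def by blast

lemma pos_edge_E1:
  "(v, e, x) \<in> T \<Longrightarrow> l < len (v, e, x) \<Longrightarrow>
     (pos (v, e, x) l, tp e l, sg (x + int l * q), pos (v, e, x) (Suc l)) \<in> E1"
  using pos_edge unfolding E1_def by blast

lemma rwalk_pos: "(v, e, x) \<in> T \<Longrightarrow> rwalk E1 e x (len (v, e, x)) (pos (v, e, x))"
  unfolding rwalk_def using pos_edge_E1 by blast

lemma backward_edge:
  assumes "(z, tp e l, b, u) \<in> E1" "z = branch (v, e, x) (Suc l)" "(v, e, x) \<in> T" "Suc l \<le> t (v, e, x)"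
  shows "u = branch (v, e, x) l" "b = (\<not> sg (x + int l * q))"
proof -
  have d: "(z, tp e l, \<not> sg (x + int l * q), branch (v, e, x) l) \<in> down"
    using down_edge[of v e x l] assms by simp
  have "z \<notin> V" using branch_new(2)[OF assms(3)] assms(2) by simp
  then have "(z, tp e l, b, u) \<in> up \<union> down"
    using assms(1) graph_onD(1)[OF gr] unfolding E1_def by auto
  moreover have "(z, tp e l, b, u) \<notin> up"
  proof
    assume "(z, tp e l, b, u) \<in> up"
    then obtain v2 e2 x2 l2 where 2: "(v2, e2, x2) \<in> T" "z = branch (v2, e2, x2) l2" "tp e l = tp e2 l2"
      by (rule up_cases)
    then have "l2 = Suc l" "e2 = e"
      using branch_eq[of v e x "Suc l" v2 e2 x2 l2] assms(2,3) by auto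
    then show False using 2(3) by simp
  qed
  ultimately have "(z, tp e l, b, u) \<in> down" by blast
  from down_det(1)[OF d this] down_det(3)[OF d this]
  show "u = branch (v, e, x) l" "b = (\<not> sg (x + int l * q))" by auto
qed

section \<open>Bi-infinite lines passing through a layer of new edges\<close>

lemma descend:
  assumes W: "\<And>i::int. W i \<in> V1 - V \<Longrightarrow> (W (i - 1), odd (i - 1), s (i - 1), W i) \<in> E1"
    and f: "(v, e, x) \<in> T" and "l \<le> t (v, e, x)" "W k = branch (v, e, x) l" "odd k = tp e l"
  shows "W (k - int l) = v \<and> odd (k - int l) = e \<and> (\<forall>i\<le>l. W (k - int l + int i) = branch (v, e, x) i)"
  using assms(3-)
proof (induction l arbitrary: k)
  case 0
  then show ?case by simp
next
  case (Suc l)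
  have "W k \<in> V1 - V" using branch_new(2)[OF f] branch_V1[OF f Suc.prems(1)] Suc.prems(2) by simp
  then have "(W (k - 1), odd (k - 1), s (k - 1), W k) \<in> E1" by (rule W)
  then have "(W k, odd (k - 1), \<not> s (k - 1), W (k - 1)) \<in> E1" using graph_onD(3)[OF graph_on_E1] by blast
  moreover have tpk: "odd (k - 1) = tp e l" using Suc.prems(3) by auto
  ultimately have eq: "W (k - 1) = branch (v, e, x) l"
    using backward_edge(1)[OF _ Suc.prems(2) f Suc.prems(1)] by simp
  have "W (k - 1 - int l) = v \<and> odd (k - 1 - int l) = e \<and>
      (\<forall>i\<le>l. W (k - 1 - int l + int i) = branch (v, e, x) i)"
    by (rule Suc.IH) (use Suc.prems eq tpk in auto)
  moreover have "k - 1 - int l = k - int (Suc l)" by simp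
  ultimately show ?case using Suc.prems(2) by (simp add: le_Suc_eq)
qed

definition follows :: "(int \<Rightarrow> node) \<Rightarrow> (int \<Rightarrow> bool) \<Rightarrow> int \<Rightarrow> flag \<Rightarrow> bool" where
  "follows W s k f \<longleftrightarrow> f \<in> T \<and> fst f = W k \<and> fst (snd f) = odd k \<and>
     (\<forall>i<len f. s (k + int i) = sg (snd (snd f) + int i * q)) \<and> (\<forall>i\<le>len f. W (k + int i) = pos f i)"

text \<open>Backwards in time the line retraces a branch to its root, because at a branch node the
  preceding type leads only there. From the root on it is an excursion, which ends as missing paths
  have bounded length.\<close>

lemma follows_up:
  assumes W: "\<And>i::int. W i \<in> V1 - V \<Longrightarrow>
      (W (i - 1), odd (i - 1), s (i - 1), W i) \<in> E1 \<and> (W i, odd i, s i, W (i + 1)) \<in> E1"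
    and up: "(W k, odd k, s k, W (k + 1)) \<in> up"
  shows "\<exists>k0 f. follows W s k0 f \<and> k0 \<le> k \<and> k < k0 + int (len f)"
proof -
  obtain v e x l where f: "(v, e, x) \<in> T" "l \<le> t (v, e, x)" "W k = branch (v, e, x) l" "odd k = tp e l"
    "s k = sg (x + int l * q)" "W (k + 1) = pos (v, e, x) (Suc l)" using up by (rule up_cases)
  define k0 where "k0 = k - int l"
  have D: "W k0 = v" "odd k0 = e" "\<And>i. i \<le> l \<Longrightarrow> W (k0 + int i) = branch (v, e, x) i"
    using descend[of W s, OF conjunct1[OF W] f(1-4)] unfolding k0_def by blast+
  have v: "v \<in> V" using T_V[OF f(1)] .
  have new: "W (k0 + int i) \<notin> V" if "0 < i" "i \<le> l" for i
    using D(3)[OF that(2)] branch_new(2)[OF f(1) that(1)] by simp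
  have e0: "(W k0, e, s k0, W (k0 + 1)) \<in> E1 - E"
  proof (cases "l = 0")
    case True
    then have "(W k0, e, s k0, W (k0 + 1)) \<in> up" using up D(2) unfolding k0_def by simp
    then show ?thesis using E_new_edge_disjoint unfolding E1_def by blast
  next
    case False
    then have w: "W (k0 + 1) = branch (v, e, x) 1" "W (k0 + 1) \<notin> V" using D(3)[of 1] new[of 1] by auto
    then have "W (k0 + 1) \<in> V1 - V" using branch_V1[OF f(1), of 1] False f(2) by simp
    then have "(W k0, e, s k0, W (k0 + 1)) \<in> E1" using W[of "k0 + 1"] D(2) by simp
    then show ?thesis using w(2) graph_onD(2)[OF gr] by blast
  qed
  have tpk: "odd (k0 + int i) = tp e i" for i using D(2) by (auto simp: tp_def)
  have exc: "\<exists>y. (v, e, y) \<in> T \<and> m \<le> len (v, e, y) \<and> (\<forall>i<m. s (k0 + int i) = sg (y + int i * q)) \<and>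
     (\<forall>i\<le>m. W (k0 + int i) = pos (v, e, y) i)"
    if "0 < m" "\<And>i. 0 < i \<Longrightarrow> i < m \<Longrightarrow> W (k0 + int i) \<notin> V" for m
    using that
  proof (induction m rule: less_induct)
    case (less m)
    show ?case
    proof (rule excursion[where P = "\<lambda>i. W (k0 + int i)" and s = "\<lambda>i. s (k0 + int i)", OF v])
      show "(W (k0 + int 0), e, s (k0 + int 0), W (k0 + int 1)) \<notin> E" using e0 by simp
      fix i assume i: "i < m"
      show "(W (k0 + int i), tp e i, s (k0 + int i), W (k0 + int (Suc i))) \<in> E1"
      proof (cases "i = 0")
        case True
        then show ?thesis using e0 by simp
      next
        case False
        then obtain y where y: "(v, e, y) \<in> T" "i \<le> len (v, e, y)" "W (k0 + int i) = pos (v, e, y) i"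
          using less.IH[OF i] less.prems i by (meson less_trans not_gr_zero order_refl)
        then have "W (k0 + int i) \<in> V1 - V"
          using pos_in_V1[OF y(1,2)] less.prems(2)[of i] False i by simp
        then show ?thesis using W[of "k0 + int i"] tpk[of i] by (simp add: algebra_simps)
      qed
    qed (use less.prems D in auto)
  qed
  \<comment> \<open>A missing path has fewer than \<open>2 * rlen\<close> letters, so the line
    cannot stay outside for \<open>2 * rlen + 2\<close> steps.\<close>
  have ex: "\<exists>m. 0 < m \<and> W (k0 + int m) \<in> V"
  proof (rule ccontr)
    assume none: "\<nexists>m. 0 < m \<and> W (k0 + int m) \<in> V"
    then have "\<And>i. 0 < i \<Longrightarrow> i < 2 * rlen + 2 \<Longrightarrow> W (k0 + int i) \<notin> V" by blast
    moreover have "0 < 2 * rlen + 2" by simp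
    ultimately have "\<exists>y. (v, e, y) \<in> T \<and> 2 * rlen + 2 \<le> len (v, e, y)"
      using exc[of "2 * rlen + 2"] by metis
    then obtain y where "(v, e, y) \<in> T" "2 * rlen + 2 \<le> len (v, e, y)" by blast
    then show False using t_bound[of "(v, e, y)"] t_bound[OF par_T, of "(v, e, y)"] by (simp add: len_def)
  qed
  define m where "m = (LEAST m. 0 < m \<and> W (k0 + int m) \<in> V)"
  have m: "0 < m" "W (k0 + int m) \<in> V" using LeastI_ex[OF ex] unfolding m_def by auto
  have least: "W (k0 + int i) \<notin> V" if "0 < i" "i < m" for i
    using not_less_Least[of i] that unfolding m_def by blast
  obtain y where y: "(v, e, y) \<in> T" "m \<le> len (v, e, y)" "\<forall>i<m. s (k0 + int i) = sg (y + int i * q)"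
     "\<forall>i\<le>m. W (k0 + int i) = pos (v, e, y) i" using exc[OF m(1) least] by blast
  have "m = len (v, e, y)" using pos_inner[OF y(1) m(1)] y m(2) by force
  then have "follows W s k0 (v, e, y)" using y D(1,2) unfolding follows_def by simp
  moreover have "l < m" using new[of m] m by force
  ultimately show ?thesis using \<open>m = len (v, e, y)\<close> unfolding k0_def by (intro exI[of _ k0]) (auto simp: k0_def)
qed

lemma follows_new_edge:
  assumes W: "\<And>i::int. W i \<in> V1 - V \<Longrightarrow>
      (W (i - 1), odd (i - 1), s (i - 1), W i) \<in> E1 \<and> (W i, odd i, s i, W (i + 1)) \<in> E1"
    and new: "(W k, odd k, s k, W (k + 1)) \<in> E1 - E"
  shows "\<exists>k0 f. follows W s k0 f \<and> k0 \<le> k \<and> k < k0 + int (len f)"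
proof (cases "(W k, odd k, s k, W (k + 1)) \<in> up")
  case True
  then show ?thesis using follows_up[OF W] by blast
next
  case False
  then have d: "(W k, odd k, s k, W (k + 1)) \<in> down" using new unfolding E1_def by blast
  \<comment> \<open>Time reversal. Shifting the vertices by 1 turns letter \<open>- i\<close> into
    letter \<open>i\<close>, so types are kept, and edges of \<open>down\<close> become edges of
    \<open>up\<close>.\<close>
  define W' where "W' = (\<lambda>i. W (1 - i))"
  define s' where "s' = (\<lambda>i. \<not> s (- i))"
  have "(W' (- k), odd (- k), s' (- k), W' (- k + 1)) \<in> up"
    using down_reverse[OF d] unfolding W'_def s'_def by (simp add: add.commute)
  moreover have "(W' (i - 1), odd (i - 1), s' (i - 1), W' i) \<in> E1 \<and> (W' i, odd i, s' i, W' (i + 1)) \<in> E1"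
    if i: "W' i \<in> V1 - V" for i
  proof -
    have "(W (- i), odd (- i), s (- i), W (1 - i)) \<in> E1" "(W (1 - i), odd (1 - i), s (1 - i), W (2 - i)) \<in> E1"
      using W[of "1 - i"] i unfolding W'_def by (auto simp: algebra_simps)
    then have "(W (1 - i), odd (- i), \<not> s (- i), W (- i)) \<in> E1"
       "(W (2 - i), odd (1 - i), \<not> s (1 - i), W (1 - i)) \<in> E1"
      using graph_onD(3)[OF graph_on_E1] by blast+
    moreover have "odd (- i) = odd i" "odd (1 - i) = odd (i - 1)" by auto
    ultimately show ?thesis unfolding W'_def s'_def by (simp add: algebra_simps)
  qed
  ultimately obtain k0 f where f: "follows W' s' k0 f" "k0 \<le> - k" "- k < k0 + int (len f)"
    using follows_up[of W' s' "- k"] by blast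
  obtain v e x where vex: "f = (v, e, x)" by (metis prod_cases3)
  obtain v' e' x' where par: "par (v, e, x) = (v', e', x')" by (metis prod_cases3)
  have fT: "(v, e, x) \<in> T" using f(1) unfolding follows_def vex by blast
  let ?L = "len (v, e, x)"
  have pT: "(v', e', x') \<in> T" and pL: "len (v', e', x') = ?L" using par_T[OF fT] len_par[OF fT] par by auto
  have W': "W' (k0 + int i) = pos (v, e, x) i" if "i \<le> ?L" for i
    using f(1) that vex unfolding follows_def by simp
  have s': "s' (k0 + int i) = sg (x + int i * q)" if "i < ?L" for i
    using f(1) that vex unfolding follows_def by simp
  define k1 where "k1 = 1 - (k0 + int ?L)"
  have "follows W s k1 (v', e', x')"
    unfolding follows_def
  proof (intro conjI allI impI)
    show "(v', e', x') \<in> T" by (rule pT)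
    have Wk: "W (k1 + int i) = pos (v', e', x') i" if "i \<le> ?L" for i
    proof -
      have "W (k1 + int i) = W' (k0 + int (?L - i))" using that unfolding k1_def W'_def by (simp add: of_nat_diff algebra_simps)
      also have "\<dots> = pos (v, e, x) (?L - i)" by (rule W') simp
      also have "\<dots> = pos (v', e', x') i" using pos_par[OF fT that] par by simp
      finally show ?thesis .
    qed
    then show "\<And>i. i \<le> len (v', e', x') \<Longrightarrow> W (k1 + int i) = pos (v', e', x') i" using pL by simp
    show "fst (v', e', x') = W k1" using Wk[of 0] pos_0[OF pT] by simp
    have "odd k0 = e" using f(1) vex unfolding follows_def by simp
    moreover have "e' = tp (tp e (t (v, e, x))) (t (par (v, e, x)))" by (rule par_type[OF fT par])
    ultimately show "fst (snd (v', e', x')) = odd k1" unfolding k1_def len_def by (auto simp: tp_def)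
    fix i assume "i < len (v', e', x')"
    then have i: "i < ?L" using pL by simp
    have "s (k1 + int i) = (\<not> s' (k0 + int (?L - Suc i)))"
      using i unfolding k1_def s'_def by (simp add: of_nat_diff algebra_simps)
    also have "\<dots> = (\<not> sg (x + int (?L - Suc i) * q))" using s'[of "?L - Suc i"] i by simp
    also have "\<dots> = sg (x' + int i * q)"
      using par_edge_type(2)[OF fT par, of "?L - Suc i"] i by simp
    finally show "s (k1 + int i) = sg (snd (snd (v', e', x')) + int i * q)" by simp
  qed
  moreover have "k1 \<le> k" "k < k1 + int (len (v', e', x'))" using f(2,3) vex pL unfolding k1_def by auto
  ultimately show ?thesis by blast
qed

text \<open>Prolonged back to the root, the walk is an excursion along one flag. If it were rich,
  its phase would be the phase of that flag, whose cycle is closed.\<close>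

lemma new_walk_not_rich_forward:
  assumes closed: "\<And>v e x. (v, e, x) \<in> T \<Longrightarrow> closed_at E1 v e x"
    and P: "rwalk E1 e x m P" "\<And>i. i \<le> m \<Longrightarrow> P i \<notin> V" and nc: "\<not> closed_at E1 (P 0) e x"
    and f: "(v, e', x') \<in> T" "l \<le> t (v, e', x')" "P 0 = branch (v, e', x') l" "e = tp e' l"
  shows "\<not> rich x m"
proof
  assume rich: "rich x m"
  then have m: "0 < m" by (rule rich_imp_pos)
  have l: "0 < l" using P(2)[of 0] f T_V[OF f(1)] by (cases l) auto
  define P' where "P' = (\<lambda>i. if i < l then branch (v, e', x') i else P (i - l))"
  define s' where "s' = (\<lambda>i. if i < l then sg (x' + int i * q) else sg (x + int (i - l) * q))"
  have "\<exists>y. (v, e', y) \<in> T \<and> l + m \<le> len (v, e', y) \<and> (\<forall>i<l + m. s' i = sg (y + int i * q)) \<and>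
     (\<forall>i\<le>l + m. P' i = pos (v, e', y) i)"
  proof (rule excursion[OF T_V[OF f(1)]])
    show "P' 0 = v" using l by (simp add: P'_def)
    show "0 < l + m" using m by simp
    have new: "P' i \<notin> V" if "0 < i" "i \<le> l + m" for i
      using that branch_new(2)[OF f(1)] P(2) unfolding P'_def by auto
    then show "\<And>i. 0 < i \<Longrightarrow> i < l + m \<Longrightarrow> P' i \<notin> V" by simp
    show "(P' 0, e', s' 0, P' 1) \<notin> E" using new[of 1] m graph_onD(2)[OF gr] by auto
    fix i assume i: "i < l + m"
    show "(P' i, tp e' i, s' i, P' (Suc i)) \<in> E1"
    proof (cases "i < l")
      case True
      have "P' (Suc i) = branch (v, e', x') (Suc i)"
        using True f(3) unfolding P'_def by (cases "Suc i = l") auto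
      then show ?thesis
        using up_edge[OF f(1), of i] True f(2) unfolding E1_def P'_def s'_def by (simp add: pos_low)
    next
      case False
      then obtain j where j: "i = l + j" using le_Suc_ex not_less by blast
      then have "(P j, tp e j, sg (x + int j * q), P (Suc j)) \<in> E1" using rwalkD[OF P(1)] i by simp
      then show ?thesis using j f(4) tp_add[of e' l j] unfolding P'_def s'_def by simp
    qed
  qed
  then obtain y where y: "(v, e', y) \<in> T" "l + m \<le> len (v, e', y)" "\<forall>i<l + m. s' i = sg (y + int i * q)"
     "\<forall>i\<le>l + m. P' i = pos (v, e', y) i" by blast
  have "2 * p dvd x - (y + int l * q)"
  proof (rule rich_determines[OF rich])
    fix j assume "j < m"
    then show "sg (x + int j * q) = sg (y + int l * q + int j * q)"
      using y(3)[rule_format, of "l + j"] unfolding s'_def by (simp add: algebra_simps)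
  qed
  moreover have "closed_at E1 (pos (v, e', y) l) (tp e' l) (y + int l * q)"
    using closed_at_forward[OF graph_on_E1 closed[OF y(1)] rwalk_mono[OF rwalk_pos[OF y(1)] order_refl, of l]]
      pos_0[OF y(1)] y(2) by simp
  moreover have "pos (v, e', y) l = P 0" using y(4)[rule_format, of l] unfolding P'_def by simp
  ultimately have "closed_at E1 (P 0) e (y + int l * q)" "2 * p dvd x - (y + int l * q)"
    using f(4) by simp_all
  then show False using nc closed_at_cong by blast
qed

text \<open>The walk either leads away from the root of the branch it starts on or retraces that
  branch. The second case is reversed first; richness and openness survive reversal.\<close>

lemma new_walk_not_rich:
  assumes closed: "\<And>v e x. (v, e, x) \<in> T \<Longrightarrow> closed_at E1 v e x"
    and P: "rwalk E1 e x m P" "\<And>i. i \<le> m \<Longrightarrow> P i \<notin> V" and nc: "\<not> closed_at E1 (P 0) e x"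
    and P0: "P 0 \<in> V1"
  shows "\<not> rich x m"
proof -
  obtain f l where "f \<in> T" "l \<le> t f" "P 0 = branch f l"
    using P0 P(2)[of 0] unfolding V1_def by auto
  then obtain v e' x' where f: "(v, e', x') \<in> T" "l \<le> t (v, e', x')" "P 0 = branch (v, e', x') l"
    by (cases f) auto
  show ?thesis
  proof (cases "e = tp e' l")
    case True
    then show ?thesis using new_walk_not_rich_forward[OF closed P nc f] by blast
  next
    case False
    have Pi: "i \<le> l \<and> P i = branch (v, e', x') (l - i)" if "i \<le> m" for i
      using that
    proof (induction i)
      case (Suc i)
      then have IH: "i \<le> l" "P i = branch (v, e', x') (l - i)" by auto
      have "P i \<notin> V" using P(2)[of i] Suc.prems by simp
      then have "i < l" using IH T_V[OF f(1)] by (cases "i = l") auto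
      then obtain j where j: "l - i = Suc j" by (metis Suc_diff_Suc)
      then have lj: "l = i + Suc j" by simp
      have "(P i, tp e i, sg (x + int i * q), P (Suc i)) \<in> E1" using rwalkD[OF P(1)] Suc.prems by simp
      moreover have "tp e i = tp e' j" using False unfolding lj by (auto simp: tp_def)
      ultimately have "P (Suc i) = branch (v, e', x') j"
        using backward_edge(1)[of "P i" e' j _ _ v x'] IH(2) j f(1,2) by simp
      moreover have "l - Suc i = j" using j by simp
      ultimately show ?case using \<open>i < l\<close> by simp
    qed (use f in simp)
    let ?x = "- 1 - x - (int m - 1) * q"
    have r: "rwalk E1 (\<not> tp e m) ?x m (\<lambda>i. P (m - i))" by (rule rwalk_reverse[OF graph_on_E1 P(1)])
    have "\<not> rich ?x m"
    proof (rule new_walk_not_rich_forward[OF closed r _ _ f(1)])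
      show "P (m - 0) = branch (v, e', x') (l - m)" "l - m \<le> t (v, e', x')" using Pi[of m] f(2) by auto
      show "(\<not> tp e m) = tp e' (l - m)" using False Pi[of m] by (auto simp: tp_def)
      show "\<not> closed_at E1 (P (m - 0)) (\<not> tp e m) ?x"
      proof
        assume "closed_at E1 (P (m - 0)) (\<not> tp e m) ?x"
        then have "closed_at E1 (P m) (\<not> \<not> tp e m) (q - 1 - ?x)"
          using closed_at_reverse[OF graph_on_E1, of "P m" "\<not> tp e m" ?x] by (simp only: diff_zero)
        moreover have "q - 1 - ?x = x + int m * q" by (simp add: algebra_simps)
        ultimately have "closed_at E1 (P m) (tp e m) (x + int m * q)" by (simp only: not_not)
        then have "closed_at E1 (P 0) e x" by (rule closed_at_backward[OF graph_on_E1 P(1)])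
        then show False using nc by blast
      qed
    qed (use P(2) in auto)
    then show ?thesis using rich_reflect by blast
  qed
qed

end

section \<open>Missing relator pieces and their two ends\<close>

context heckoid begin

text \<open>Phases are normalised to representatives modulo \<open>2 * p\<close>, so that congruent
  phases give the same flag.\<close>

definition exits :: "node set \<Rightarrow> graph \<Rightarrow> flag set" where
  "exits V E = {(v, e, x). v \<in> V \<and> 0 \<le> x \<and> x < 2 * p \<and> \<not> (\<exists>u. (v, e, sg x, u) \<in> E)}"

definition back_walk :: "graph \<Rightarrow> flag \<Rightarrow> nat \<Rightarrow> (nat \<Rightarrow> node) \<Rightarrow> bool" where
  "back_walk E f m P \<longleftrightarrow> (case f of (v, e, x) \<Rightarrow> rwalk E (tp e m) (x - int m * q) m P \<and> P m = v)"

definition bounded_back :: "graph \<Rightarrow> flag \<Rightarrow> bool" where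
  "bounded_back E f \<longleftrightarrow> (\<forall>m P. back_walk E f m P \<longrightarrow> m < rlen)"

definition blen :: "graph \<Rightarrow> flag \<Rightarrow> nat" where
  "blen E f = (GREATEST m. \<exists>P. back_walk E f m P)"

definition bwalk :: "graph \<Rightarrow> flag \<Rightarrow> nat \<Rightarrow> node" where
  "bwalk E f = (SOME P. back_walk E f (blen E f) P)"

text \<open>The other end of the present part of the relator. Reading that part of
  \<open>blen\<close> letters in reverse flips the type and turns the phase \<open>y\<close> of its
  first letter into \<open>q - 1 - y\<close>.\<close>

definition par_of :: "graph \<Rightarrow> flag \<Rightarrow> flag" where
  "par_of E f = (bwalk E f 0, \<not> tp (fst (snd f)) (blen E f),
      (q - 1 - (snd (snd f) - int (blen E f) * q)) mod (2 * p))"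

lemma back_walk_0: "back_walk E (v, e, x) 0 (\<lambda>_. v)"
  by (simp add: back_walk_def rwalk_def)

lemma blen_walk:
  assumes "bounded_back E f" shows "back_walk E f (blen E f) (bwalk E f)" "blen E f < rlen"
proof -
  obtain v e x where f: "f = (v, e, x)" by (metis prod_cases3)
  have "\<exists>P. back_walk E f (blen E f) P"
    unfolding blen_def
  proof (rule GreatestI_nat[where b = rlen])
    show "\<exists>P. back_walk E f 0 P" using back_walk_0 f by blast
    show "\<And>m. \<exists>P. back_walk E f m P \<Longrightarrow> m \<le> rlen"
      using assms unfolding bounded_back_def by (meson less_imp_le)
  qed
  then show "back_walk E f (blen E f) (bwalk E f)" unfolding bwalk_def by (rule someI_ex)
  then show "blen E f < rlen" using assms unfolding bounded_back_def by blast
qed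

lemma blen_max: "bounded_back E f \<Longrightarrow> back_walk E f m P \<Longrightarrow> m \<le> blen E f"
  unfolding blen_def
  by (rule Greatest_le_nat[where b = rlen]) (auto simp: bounded_back_def intro: less_imp_le)

lemma back_walk_extend:
  assumes "back_walk E (v, e, x) m P" "(u, \<not> tp e m, sg (x - int m * q - q), P 0) \<in> E"
  shows "back_walk E (v, e, x) (Suc m) (\<lambda>i. case i of 0 \<Rightarrow> u | Suc j \<Rightarrow> P j)"
  unfolding back_walk_def prod.case
proof
  show "(case Suc m of 0 \<Rightarrow> u | Suc j \<Rightarrow> P j) = v" using assms(1) unfolding back_walk_def by simp
  show "rwalk E (tp e (Suc m)) (x - int (Suc m) * q) (Suc m) (\<lambda>i. case i of 0 \<Rightarrow> u | Suc j \<Rightarrow> P j)"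
    unfolding rwalk_def
  proof (intro allI impI)
    fix i assume i: "i < Suc m"
    show "(case i of 0 \<Rightarrow> u | Suc j \<Rightarrow> P j, tp (tp e (Suc m)) i, sg (x - int (Suc m) * q + int i * q),
        case Suc i of 0 \<Rightarrow> u | Suc j \<Rightarrow> P j) \<in> E"
    proof (cases i)
      case 0
      have e: "x - int (Suc m) * q + int i * q = x - int m * q - q" using 0 by (simp add: algebra_simps)
      show ?thesis unfolding e using 0 assms(2) by simp
    next
      case (Suc j)
      then have "(P j, tp (tp e m) j, sg (x - int m * q + int j * q), P (Suc j)) \<in> E"
        using assms(1) i unfolding back_walk_def rwalk_def by simp
      moreover have e: "x - int (Suc m) * q + int i * q = x - int m * q + int j * q"
        using Suc by (simp add: algebra_simps)
      ultimately show ?thesis unfolding e using Suc by (simp add: tp_not)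
    qed
  qed
qed

lemma back_walk_mono:
  assumes "back_walk E (v, e, x) m P" "k \<le> m"
  shows "back_walk E (v, e, x) k (\<lambda>i. P (m - k + i))"
proof -
  have m: "m = (m - k) + k" using assms(2) by simp
  have "rwalk E (tp e m) (x - int m * q) ((m - k) + k) P" using assms unfolding back_walk_def by simp
  from rwalk_drop[OF this]
  have "rwalk E (tp (tp e m) (m - k)) (x - int m * q + int (m - k) * q) k (\<lambda>i. P (m - k + i))" .
  moreover have "tp (tp e m) (m - k) = tp e k" using assms(2) by (auto simp: tp_def)
  moreover have "x - int m * q + int (m - k) * q = x - int k * q"
    using assms(2) by (simp add: of_nat_diff algebra_simps)
  ultimately have "rwalk E (tp e k) (x - int k * q) k (\<lambda>i. P (m - k + i))" by (simp only:)
  then show ?thesis using assms unfolding back_walk_def by simp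
qed

lemma exits_phase: "(v, e, x) \<in> exits V E \<Longrightarrow> 0 \<le> x \<and> x < 2 * p" by (simp add: exits_def)

lemma mod_phase: "2 * p dvd x mod (2 * p) - x"
  by (metis dvd_minus_mod dvd_diff_commute)

context
  fixes V E v e x
  assumes gr: "graph_on V E" and f: "(v, e, x) \<in> exits V E" and bd: "bounded_back E (v, e, x)"
begin

private definition "m = blen E (v, e, x)"
private definition "P = bwalk E (v, e, x)"
private definition "y = q - 1 - (x - int m * q)"

private lemma P: "rwalk E (tp e m) (x - int m * q) m P" "P m = v"
  using blen_walk(1)[OF bd] unfolding back_walk_def m_def P_def by auto

private lemma par: "par_of E (v, e, x) = (P 0, \<not> tp e m, y mod (2 * p))"
  by (simp add: par_of_def m_def P_def y_def)

private lemma sgy: "sg (y mod (2 * p)) \<longleftrightarrow> \<not> sg (x - int m * q - q)"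
proof -
  have "sg (y mod (2 * p)) = sg y" by (rule sgn_of_cong[OF p_pos mod_phase])
  moreover have "y = - 1 - (x - int m * q - q)" by (simp add: y_def)
  ultimately show ?thesis using sgn_of_reflect[OF p_pos] by simp
qed

private lemma P0_V: "P 0 \<in> V"
proof (cases m)
  case 0
  then show ?thesis using P(2) f unfolding exits_def by simp
next
  case (Suc k)
  then have "(P 0, tp e m, sg (x - int m * q), P (Suc 0)) \<in> E" using rwalkD[OF P(1), of 0] by simp
  then show ?thesis by (rule graph_onD(1)[OF gr])
qed

lemma par_of_exits: "par_of E (v, e, x) \<in> exits V E"
proof -
  have "\<not> (\<exists>u. (P 0, \<not> tp e m, sg (y mod (2 * p)), u) \<in> E)"
  proof
    assume "\<exists>u. (P 0, \<not> tp e m, sg (y mod (2 * p)), u) \<in> E"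
    then obtain u where "(P 0, \<not> tp e m, sg (y mod (2 * p)), u) \<in> E" by blast
    then have "(u, \<not> tp e m, sg (x - int m * q - q), P 0) \<in> E" using graph_onD(3)[OF gr] sgy by fastforce
    then have "back_walk E (v, e, x) (Suc m) (\<lambda>i. case i of 0 \<Rightarrow> u | Suc j \<Rightarrow> P j)"
      using P by (intro back_walk_extend) (auto simp: back_walk_def)
    then show False using blen_max[OF bd] unfolding m_def by fastforce
  qed
  then show ?thesis using P0_V p_pos unfolding par exits_def by simp
qed

private lemma rev_walk: "back_walk E (par_of E (v, e, x)) m (\<lambda>i. P (m - i))"
proof -
  have "rwalk E (\<not> tp (tp e m) m) (- 1 - (x - int m * q) - (int m - 1) * q) m (\<lambda>i. P (m - i))"
    by (rule rwalk_reverse[OF gr P(1)])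
  moreover have "2 * p dvd (- 1 - (x - int m * q) - (int m - 1) * q) - (y mod (2 * p) - int m * q)"
  proof -
    have "(- 1 - (x - int m * q) - (int m - 1) * q) - (y mod (2 * p) - int m * q) = - (y mod (2 * p) - y)"
      by (simp add: y_def algebra_simps)
    then show ?thesis using mod_phase[of y] by (metis dvd_minus_iff)
  qed
  ultimately show ?thesis
    using rwalk_cong_phase unfolding par back_walk_def by (simp add: tp_not)
qed

text \<open>Reversed once more, a longer walk would supply the very edge that is missing at the
  original flag.\<close>

private lemma rev_walk_max: "back_walk E (par_of E (v, e, x)) k Q \<Longrightarrow> k \<le> m"
proof (rule ccontr)
  assume *: "back_walk E (par_of E (v, e, x)) k Q" and "\<not> k \<le> m"
  then have "Suc m \<le> k" by simp
  then obtain R where R: "back_walk E (par_of E (v, e, x)) (Suc m) R"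
    using back_walk_mono * unfolding par by blast
  then have R': "rwalk E (e) (y mod (2 * p) - int (Suc m) * q) (Suc m) R" "R (Suc m) = P 0"
    unfolding par back_walk_def by (simp_all add: tp_not)
  let ?z = "- 1 - (y mod (2 * p) - int (Suc m) * q) - (int (Suc m) - 1) * q"
  have r: "rwalk E (tp e m) ?z (Suc m) (\<lambda>i. R (Suc m - i))"
    using rwalk_reverse[OF gr R'(1)] by simp
  have "2 * p dvd ?z - (x - int m * q)"
  proof -
    have "?z - (x - int m * q) = - (y mod (2 * p) - y)" by (simp add: y_def algebra_simps)
    then show ?thesis using mod_phase[of y] by (metis dvd_minus_iff)
  qed
  then have r: "rwalk E (tp e m) (x - int m * q) (Suc m) (\<lambda>i. R (Suc m - i))"
    using r rwalk_cong_phase by blast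
  have "P m = R (Suc m - m)"
    using rwalk_det[OF gr P(1) r, of m] R'(2) by simp
  then have "(v, tp (tp e m) m, sg (x - int m * q + int m * q), R 0) \<in> E"
    using rwalkD[OF r, of m] P(2) by simp
  then show False using f unfolding exits_def by simp
qed

lemma par_of_bounded: "bounded_back E (par_of E (v, e, x))"
  using rev_walk_max blen_walk(2)[OF bd] unfolding bounded_back_def m_def by (meson le_less_trans)

lemma blen_par: "blen E (par_of E (v, e, x)) = blen E (v, e, x)"
  using rev_walk_max[OF blen_walk(1)[OF par_of_bounded]] blen_max[OF par_of_bounded rev_walk]
  unfolding m_def by simp

lemma par_of_par_of: "par_of E (par_of E (v, e, x)) = (v, e, x)"
proof -
  let ?g = "par_of E (v, e, x)"
  have b: "blen E ?g = m" using blen_par unfolding m_def .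
  then have "back_walk E ?g m (bwalk E ?g)" using blen_walk(1)[OF par_of_bounded] by simp
  then have "rwalk E (tp (\<not> tp e m) m) (y mod (2 * p) - int m * q) m (bwalk E ?g)" "bwalk E ?g m = P 0"
    unfolding par back_walk_def by simp_all
  moreover have "rwalk E (tp (\<not> tp e m) m) (y mod (2 * p) - int m * q) m (\<lambda>i. P (m - i))"
    using rev_walk unfolding par back_walk_def by simp
  ultimately have "bwalk E ?g 0 = v"
  proof -
    let ?A = "bwalk E ?g" and ?B = "\<lambda>i. P (m - i)"
    assume A: "rwalk E (tp (\<not> tp e m) m) (y mod (2 * p) - int m * q) m ?A" "?A m = P 0"
      and B: "rwalk E (tp (\<not> tp e m) m) (y mod (2 * p) - int m * q) m ?B"
    have "?A (m - k) = ?B (m - k)" if "k \<le> m" for k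
      using that
    proof (induction k)
      case 0
      then show ?case using A(2) by simp
    next
      case (Suc k)
      then have s: "Suc (m - Suc k) = m - k" by simp
      have "?A (m - k) = ?B (m - k)" using Suc by simp
      then show ?case
        using rwalkD[OF A(1), of "m - Suc k"] rwalkD[OF B, of "m - Suc k"] Suc.prems
        unfolding s using graph_on_det_back[OF gr] by (metis Suc_le_lessD diff_less_mono2 s less_Suc_eq_le zero_less_Suc le_eq_less_or_eq diff_Suc_less gr_implies_not_zero not_gr_zero)
    qed
    from this[of m] show "?A 0 = v" using P(2) by simp
  qed
  moreover have "(q - 1 - (y mod (2 * p) - int m * q)) mod (2 * p) = x"
  proof -
    have "2 * p dvd (q - 1 - (y mod (2 * p) - int m * q)) - x"
    proof -
      have "(q - 1 - (y mod (2 * p) - int m * q)) - x = - (y mod (2 * p) - y)"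
        by (simp add: y_def algebra_simps)
      then show ?thesis using mod_phase[of y] by (metis dvd_minus_iff)
    qed
    then have "(q - 1 - (y mod (2 * p) - int m * q)) mod (2 * p) = x mod (2 * p)"
      by (simp add: mod_eq_dvd_iff)
    then show ?thesis using exits_phase[OF f] by simp
  qed
  moreover have "snd (snd ?g) = y mod (2 * p)" "fst (snd ?g) = (\<not> tp e m)" unfolding par by simp_all
  ultimately show ?thesis unfolding par_of_def[of E ?g] b by (simp add: tp_not)
qed

text \<open>A parity argument: equal types make the length \<open>m\<close> odd, and then the two
  phases differ by an odd number, hence not by a multiple of \<open>2 * p\<close>.\<close>

lemma par_of_neq: "par_of E (v, e, x) \<noteq> (v, e, x)"
proof
  assume "par_of E (v, e, x) = (v, e, x)"
  then have 1: "(\<not> tp e m) = e" and 2: "y mod (2 * p) = x" unfolding par by simp_all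
  have "odd m" using 1 by (auto simp: tp_def)
  have "2 * p dvd x - y" using mod_phase[of y] 2 by simp
  then have "even (x - y)" by (meson dvd_mult_left dvd_trans dvd_triv_left)
  moreover have "x - y = 2 * x + 1 - q * (1 + int m)" by (simp add: y_def algebra_simps)
  ultimately show False using \<open>odd m\<close> by simp
qed

end

definition determines :: "flag set \<Rightarrow> flag \<Rightarrow> nat \<Rightarrow> bool" where
  "determines T f k \<longleftrightarrow> (case f of (v, e, x) \<Rightarrow> \<forall>y. (v, e, y) \<in> T \<longrightarrow> rel x k = rel y k \<longrightarrow> y = x)"

text \<open>A place for the joining edge such that, from either end, the branch together with that
  edge identifies its flag; this provides \<open>ident\<close> on both sides.\<close>

definition splits :: "graph \<Rightarrow> flag set \<Rightarrow> flag \<Rightarrow> nat \<Rightarrow> bool" where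
  "splits E T f k \<longleftrightarrow> k < rlen - blen E f \<and> determines T f (Suc k) \<and>
     determines T (par_of E f) (rlen - blen E f - k)"

text \<open>Both ends must agree on one joining edge. They share the set
  \<open>{f, par_of E f}\<close>, so \<open>SOME\<close> singles out the same end for both; that end
  chooses, and the other takes the complementary place.\<close>

definition split_pt :: "graph \<Rightarrow> flag set \<Rightarrow> flag \<Rightarrow> nat" where
  "split_pt E T f = (if f = (SOME g. g \<in> {f, par_of E f}) then SOME k. splits E T f k
     else rlen - blen E f - 1 - (SOME k. splits E T (par_of E f) k))"

end

locale attach = heckoid +
  fixes V E T
  assumes gr: "graph_on V E" and fresh: "fresh_for V E" and T_exits: "T \<subseteq> exits V E"
    and bounded: "f \<in> T \<Longrightarrow> bounded_back E f"
    and par_of_T: "f \<in> T \<Longrightarrow> par_of E f \<in> T"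
    and splittable: "f \<in> T \<Longrightarrow> \<exists>k. splits E T f k"
begin

lemma pp: "f \<in> T \<Longrightarrow> par_of E (par_of E f) = f" "f \<in> T \<Longrightarrow> blen E (par_of E f) = blen E f"
   "f \<in> T \<Longrightarrow> par_of E f \<noteq> f"
  using T_exits bounded par_of_par_of[OF gr] blen_par[OF gr] par_of_neq[OF gr]
  by (metis subsetD prod_cases3)+

lemma splits_par:
  assumes "f \<in> T" "splits E T f k" shows "splits E T (par_of E f) (rlen - blen E f - 1 - k)"
  using assms pp[OF assms(1)] unfolding splits_def by (auto simp: Suc_diff_Suc)

lemma split_pt: 
  assumes f: "f \<in> T"
  shows "splits E T f (split_pt E T f)"
    and "split_pt E T f + split_pt E T (par_of E f) + 1 = rlen - blen E f"
proof -
  let ?g = "par_of E f" and ?r = "SOME g. g \<in> {f, par_of E f}"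
  have g: "?g \<in> T" using par_of_T f .
  have ks: "splits E T f (SOME k. splits E T f k)" "splits E T ?g (SOME k. splits E T ?g k)"
    using someI_ex[OF splittable[OF f]] someI_ex[OF splittable[OF g]] by auto
  have r: "?r = f \<or> ?r = ?g" using someI[of "\<lambda>h. h \<in> {f, ?g}" f] by blast
  have r': "(SOME h. h \<in> {?g, par_of E ?g}) = ?r" using pp(1)[OF f] by (simp add: insert_commute)
  have k2: "splits E T f (rlen - blen E f - 1 - (SOME k. splits E T ?g k))"
    using splits_par[OF g ks(2)] pp[OF f] by simp
  have lt: "(SOME k. splits E T f k) < rlen - blen E f" "(SOME k. splits E T ?g k) < rlen - blen E f"
    using ks pp(2)[OF f] unfolding splits_def by auto
  from r show "splits E T f (split_pt E T f)"
    using ks(1) k2 pp(3)[OF f] unfolding split_pt_def by auto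
  from r show "split_pt E T f + split_pt E T ?g + 1 = rlen - blen E f"
  proof
    assume 1: "?r = f"
    then have "split_pt E T f = (SOME k. splits E T f k)" unfolding split_pt_def by simp
    moreover have "split_pt E T ?g = rlen - blen E f - 1 - (SOME k. splits E T f k)"
      using 1 r' pp[OF f] unfolding split_pt_def by simp
    ultimately show ?thesis using lt by simp
  next
    assume 1: "?r = ?g"
    then have "split_pt E T f = rlen - blen E f - 1 - (SOME k. splits E T ?g k)"
      using pp(3)[OF f] unfolding split_pt_def by simp
    moreover have "split_pt E T ?g = (SOME k. splits E T ?g k)" using 1 r' unfolding split_pt_def by simp
    ultimately show ?thesis using lt by simp
  qed
qed

lemma blen_lt: "f \<in> T \<Longrightarrow> blen E f < rlen" using blen_walk(2)[OF bounded] .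

sublocale layer q p n V E T "par_of E" "split_pt E T"
proof
  show "graph_on V E" "fresh_for V E" by (rule gr, rule fresh)
  show "\<And>v e x. (v, e, x) \<in> T \<Longrightarrow> v \<in> V" using T_exits unfolding exits_def by blast
  show "\<And>v e x u. (v, e, x) \<in> T \<Longrightarrow> (v, e, sg x, u) \<notin> E" using T_exits unfolding exits_def by blast
  show "\<And>f. f \<in> T \<Longrightarrow> par_of E f \<in> T" by (rule par_of_T)
  show "\<And>f. f \<in> T \<Longrightarrow> par_of E (par_of E f) = f" by (rule pp)
  fix v e x assume f: "(v, e, x) \<in> T"
  let ?m = "blen E (v, e, x)" and ?s = "split_pt E T (v, e, x)" and ?s' = "split_pt E T (par_of E (v, e, x))"
  have sum: "?s + ?s' + 1 + ?m = rlen" using split_pt(2)[OF f] blen_lt[OF f] by simp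
  show "e' = tp (tp e ?s) ?s'" if "par_of E (v, e, x) = (v', e', x')" for v' e' x'
  proof -
    have "e' = (\<not> tp e ?m)" using that unfolding par_of_def by simp
    moreover have "even (?s + ?s' + 1 + ?m)" unfolding sum by (rule even_rlen)
    then have "odd (?s + ?s') \<longleftrightarrow> even ?m" by simp
    ultimately show ?thesis unfolding tp_add[symmetric] by (auto simp: tp_def)
  qed
  show "2 * p dvd x' + 1 + x + (int ?s + int ?s') * q" if "par_of E (v, e, x) = (v', e', x')" for v' e' x'
  proof -
    let ?y = "q - 1 - (x - int ?m * q)"
    have "x' = ?y mod (2 * p)" using that unfolding par_of_def by simp
    then have 1: "2 * p dvd x' - ?y" using mod_phase by simp
    have "int ?s + int ?s' + 1 + int ?m = int rlen" using sum by linarith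
    then have s: "int ?s + int ?s' = int rlen - 1 - int ?m" by linarith
    have "x' + 1 + x + (int ?s + int ?s') * q = (x' - ?y) + (x + int rlen * q - x)"
      unfolding s by (simp add: algebra_simps)
    then show ?thesis using dvd_add[OF 1 rlen_period[of x]] by (simp only:)
  qed
  show "x = y" if "(v, e, y) \<in> T" "rel x (Suc ?s) = rel y (Suc ?s)" for y
    using split_pt(1)[OF f] that unfolding splits_def determines_def by auto
next
  fix f assume "f \<in> T"
  from split_pt(2)[OF this] show "split_pt E T f < rlen" by linarith
qed

lemma len_eq: "f \<in> T \<Longrightarrow> len f = rlen - blen E f"
  using split_pt(2) by (simp add: len_def)

text \<open>The attached path and the maximal walk \<open>bwalk\<close> that was already present
  make up one relator.\<close>

lemma T_closed: assumes f: "(v, e, x) \<in> T" shows "closed_at E1 v e x"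
proof -
  let ?m = "blen E (v, e, x)" and ?L = "len (v, e, x)" and ?P = "bwalk E (v, e, x)"
  have sum: "?L + ?m = rlen" using len_eq[OF f] blen_lt[OF f] by simp
  have "back_walk E (v, e, x) ?m ?P" by (rule blen_walk(1)[OF bounded[OF f]])
  then have P: "rwalk E (tp e ?m) (x - int ?m * q) ?m ?P" "?P ?m = v" unfolding back_walk_def by simp_all
  have "even (?L + ?m)" unfolding sum by (rule even_rlen)
  then have tpL: "tp e ?L = tp e ?m" by (auto simp: tp_def)
  have dvd: "2 * p dvd (x - int ?m * q) - (x + int ?L * q)"
  proof -
    have "int ?L + int ?m = int rlen" using sum by linarith
    then have s: "int ?L = int rlen - int ?m" by linarith
    have "(x - int ?m * q) - (x + int ?L * q) = - (x + int rlen * q - x)"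
      unfolding s by (simp add: algebra_simps)
    then show ?thesis using rlen_period by (metis dvd_minus_iff)
  qed
  have 2: "rwalk E1 (tp e ?L) (x + int ?L * q) ?m ?P"
    unfolding tpL using rwalk_mono[OF P(1) E_E1 order_refl] rwalk_cong_phase[OF dvd] by blast
  have e: "pos (v, e, x) ?L = ?P 0" using pos_len[OF f] unfolding par_of_def by simp
  define Q where "Q = (\<lambda>i. if i \<le> ?L then pos (v, e, x) i else ?P (i - ?L))"
  have "rwalk E1 e x rlen Q"
    using rwalk_append[OF rwalk_pos[OF f] 2 e] unfolding sum Q_def .
  moreover have "Q 0 = v" using pos_0[OF f] by (simp add: Q_def)
  moreover have "Q rlen = v"
  proof (cases "?m = 0")
    case True
    then have "rlen = ?L" using sum by simp
    then show ?thesis using e P(2) True by (simp add: Q_def)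
  next
    case False
    then have "\<not> rlen \<le> ?L" "rlen - ?L = ?m" using sum by auto
    then show ?thesis using P(2) by (simp add: Q_def)
  qed
  ultimately show ?thesis unfolding closed_at_def by blast
qed

end

context heckoid begin

section \<open>The tower of graphs\<close>

text \<open>The line \<open>W\<close> leaves the graph at time \<open>k\<close> for \<open>l\<close> letters of a relator; the walk \<open>P\<close> in the graph
  reads the other letters of that relator and cannot be prolonged.\<close>

definition detour :: "node set \<Rightarrow> graph \<Rightarrow> (int \<Rightarrow> node) \<Rightarrow> (int \<Rightarrow> bool) \<Rightarrow> int \<Rightarrow> nat \<Rightarrow> int \<Rightarrow> (nat \<Rightarrow> node) \<Rightarrow> bool" where
  "detour V E W s k l x P \<longleftrightarrow> 0 < l \<and> l \<le> rlen \<and> W k \<in> V \<and> W (k + int l) \<in> V \<and>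
     (\<forall>i. 0 < i \<longrightarrow> i < l \<longrightarrow> W (k + int i) \<notin> V) \<and>
     (\<forall>i<l. s (k + int i) = sg (x + int i * q)) \<and>
     rwalk E (tp (odd k) (rlen - l)) (x - int (rlen - l) * q) (rlen - l) P \<and>
     P (rlen - l) = W k \<and> P 0 = W (k + int l) \<and>
     \<not> (\<exists>u. (W k, odd k, sg x, u) \<in> E) \<and>
     \<not> (\<exists>u. (P 0, \<not> tp (odd k) (rlen - l), \<not> sg (x - int (rlen - l) * q - q), u) \<in> E)"

text \<open>The condition for attaching one more layer: every open relator lacks a fat piece, and
  fat pieces have room for a joining edge that identifies the flag on both sides.\<close>

definition fatg :: "node set \<Rightarrow> graph \<Rightarrow> bool" where
  "fatg V E \<longleftrightarrow> (\<forall>e x m P. P 0 \<in> V \<longrightarrow> rwalk E e x m P \<longrightarrow> \<not> closed_at E (P 0) e x \<longrightarrow>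
      m < rlen \<and> fat (x + int m * q) (rlen - m))"

text \<open>The stronger condition that each layer establishes anew: the part of an open relator
  that is present never reveals its phase.\<close>

definition thin :: "node set \<Rightarrow> graph \<Rightarrow> bool" where
  "thin V E \<longleftrightarrow> (\<forall>e x m P. P 0 \<in> V \<longrightarrow> rwalk E e x m P \<longrightarrow> \<not> closed_at E (P 0) e x \<longrightarrow> \<not> rich x m)"

lemma not_rich_compl: "\<not> rich x m \<Longrightarrow> m < rlen \<and> fat y (rlen - m)"
proof -
  assume "\<not> rich x m"
  then have "int m \<le> p - 1" by (rule not_rich_short)
  then have "int m + 2 * p - 1 \<le> int rlen" "int m < int rlen" using rlen_ge p_pos by auto
  then have "m < rlen" "int (rlen - m) \<ge> 2 * p - 1" by linarith+
  then show ?thesis using fat_long by blast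
qed

lemma thin_imp_fatg: "thin V E \<Longrightarrow> fatg V E"
  unfolding thin_def fatg_def using not_rich_compl by blast

lemma not_closed_if_stuck:
  assumes "graph_on V E" "rwalk E e x m P" "\<not> (\<exists>u. (P m, tp e m, sg (x + int m * q), u) \<in> E)"
  shows "\<not> closed_at E (P 0) e x"
proof
  assume "closed_at E (P 0) e x"
  then have "closed_at E (P m) (tp e m) (x + int m * q)"
    using closed_at_forward[OF assms(1) _ assms(2)] by simp
  then obtain u where "(P m, tp e m, sg (x + int m * q), u) \<in> E"
    by (rule closed_at_Suc[OF assms(1)])
  then show False using assms(3) by blast
qed

lemma rwalk_start_in:
  assumes "graph_on V E" "rwalk E e x m P" "P m \<in> V" shows "P 0 \<in> V"
proof (cases m)
  case (Suc k)
  then have "(P 0, e, sg x, P (Suc 0)) \<in> E" using rwalkD[OF assms(2), of 0] by simp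
  then show ?thesis by (rule graph_onD(1)[OF assms(1)])
qed (use assms(3) in simp)

lemma back_walk_not_closed:
  assumes gr: "graph_on V E" and f: "(v, e, x) \<in> exits V E" and P: "back_walk E (v, e, x) m P"
  shows "P 0 \<in> V" "\<not> closed_at E (P 0) (tp e m) (x - int m * q)"
proof -
  have r: "rwalk E (tp e m) (x - int m * q) m P" "P m = v" using P unfolding back_walk_def by auto
  show "P 0 \<in> V" using rwalk_start_in[OF gr r(1)] r(2) f unfolding exits_def by simp
  show "\<not> closed_at E (P 0) (tp e m) (x - int m * q)"
    by (rule not_closed_if_stuck[OF gr r(1)]) (use f r(2) in \<open>simp add: exits_def\<close>)
qed

lemma exits_eq:
  assumes "(v, e, x) \<in> exits V E" "(v', e', y) \<in> exits V E" "2 * p dvd x - y" shows "x = y"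
proof -
  have "x mod (2 * p) = y mod (2 * p)" using assms(3) by (simp add: mod_eq_dvd_iff)
  then show ?thesis using exits_phase[OF assms(1)] exits_phase[OF assms(2)] by simp
qed

lemma rich_imp_determines:
  assumes "T \<subseteq> exits V E" "(v, e, x) \<in> T" "rich x k" shows "determines T (v, e, x) k"
  unfolding determines_def prod.case
proof (intro allI impI)
  fix y assume y: "(v, e, y) \<in> T" "rel x k = rel y k"
  then have "2 * p dvd x - y" using rich_determines[OF assms(3)] by (simp add: rel_eq_iff)
  then show "y = x" using exits_eq assms(1,2) y(1) by (metis subsetD)
qed

lemma par_of_phase:
  assumes "blen E (v, e, x) \<le> rlen"
  shows "2 * p dvd snd (snd (par_of E (v, e, x))) - (- 1 - x - (int (rlen - blen E (v, e, x)) - 1) * q)"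
proof -
  let ?m = "blen E (v, e, x)"
  let ?y = "q - 1 - (x - int ?m * q)"
  have 1: "snd (snd (par_of E (v, e, x))) = ?y mod (2 * p)" unfolding par_of_def by simp
  have s: "int (rlen - ?m) = int rlen - int ?m" using assms by simp
  have "?y mod (2 * p) - (- 1 - x - (int (rlen - ?m) - 1) * q) = (?y mod (2 * p) - ?y) + (x + int rlen * q - x)"
    unfolding s by (simp add: algebra_simps)
  then show ?thesis unfolding 1 using dvd_add[OF mod_phase[of ?y] rlen_period[of x]] by (simp only:)
qed

text \<open>The two overlapping parts from \<open>fat_split\<close> are read from opposite ends; the
  second is rich from its own end by reflection. Rich pieces determine phases, hence flags.\<close>

lemma fat_imp_splits:
  assumes gr: "graph_on V E" and T: "T \<subseteq> exits V E" and f: "(v, e, x) \<in> T" "par_of E (v, e, x) \<in> T"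
    and bd: "bounded_back E (v, e, x)" and fat: "fat x (rlen - blen E (v, e, x))"
  shows "\<exists>k. splits E T (v, e, x) k"
proof -
  let ?L = "rlen - blen E (v, e, x)"
  have m: "blen E (v, e, x) < rlen" by (rule blen_walk(2)[OF bd])
  obtain k where k: "k < ?L" "rich x (Suc k)" "rich (x + int k * q) (?L - k)"
    using fat_split[OF fat] .
  obtain v' e' x' where par: "par_of E (v, e, x) = (v', e', x')" by (metis prod_cases3)
  have e: "- 1 - (x + int k * q) - (int (?L - k) - 1) * q = - 1 - x - (int ?L - 1) * q"
    using k(1) by (simp add: of_nat_diff algebra_simps)
  have "rich (- 1 - (x + int k * q) - (int (?L - k) - 1) * q) (?L - k)"
    using k(3) rich_reflect by blast
  then have "rich x' (?L - k)"
    unfolding e using rich_cong[OF par_of_phase[of E v e x]] m par by simp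
  then have "determines T (v', e', x') (?L - k)" using rich_imp_determines[OF T] f(2) par by simp
  then show ?thesis
    using k rich_imp_determines[OF T f(1) k(2)] par unfolding splits_def by (intro exI[of _ k]) simp
qed

end

context attach begin

lemma follows_detour:
  assumes "follows W s k f" shows "detour V E W s k (len f) (snd (snd f)) (bwalk E f)"
proof -
  obtain v e x where f: "f = (v, e, x)" by (metis prod_cases3)
  have fT: "(v, e, x) \<in> T" and W: "v = W k" "e = odd k" "\<And>i. i < len f \<Longrightarrow> s (k + int i) = sg (x + int i * q)"
    "\<And>i. i \<le> len f \<Longrightarrow> W (k + int i) = pos f i"
    using assms unfolding follows_def f by auto
  let ?m = "blen E (v, e, x)"
  have m: "?m < rlen" using blen_lt[OF fT] .
  have len: "len f = rlen - ?m" using len_eq[OF fT] f by simp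
  then have rl: "rlen - len f = ?m" using m by simp
  have bd: "bounded_back E (v, e, x)" using bounded[OF fT] .
  have ex: "(v, e, x) \<in> exits V E" using T_exits fT by blast
  have P: "rwalk E (tp e ?m) (x - int ?m * q) ?m (bwalk E f)" "bwalk E f ?m = v"
    using blen_walk(1)[OF bd] f unfolding back_walk_def by auto
  have end1: "W (k + int (len f)) = bwalk E f 0"
    using W(4)[of "len f"] pos_len[OF fT] f unfolding par_of_def by simp
  have "par_of E (v, e, x) \<in> exits V E" using par_of_exits[OF gr ex bd] .
  moreover have "par_of E (v, e, x) = (bwalk E f 0, \<not> tp e ?m, (q - 1 - (x - int ?m * q)) mod (2 * p))"
    unfolding par_of_def f by simp
  ultimately have A: "\<not> (\<exists>u. (bwalk E f 0, \<not> tp e ?m, sg ((q - 1 - (x - int ?m * q)) mod (2 * p)), u) \<in> E)"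
    and V: "bwalk E f 0 \<in> V" unfolding exits_def by auto
  have s1: "sg ((q - 1 - (x - int ?m * q)) mod (2 * p)) = sg (q - 1 - (x - int ?m * q))"
    by (rule sgn_of_cong[OF p_pos mod_phase])
  have "q - 1 - (x - int ?m * q) = - 1 - (x - int ?m * q - q)" by simp
  then have s2: "sg (q - 1 - (x - int ?m * q)) = (\<not> sg (x - int ?m * q - q))"
    using sgn_of_reflect[OF p_pos, of "x - int ?m * q - q"] by (simp only:)
  have B: "\<not> (\<exists>u. (bwalk E f 0, \<not> tp e ?m, \<not> sg (x - int ?m * q - q), u) \<in> E)"
    using A unfolding s1 s2 .
  have inner: "W (k + int i) \<notin> V" if "0 < i" "i < len f" for i
    using pos_inner[of f i] W(4)[of i] fT f that by simp
  have C: "\<not> (\<exists>u. (W k, odd k, sg x, u) \<in> E)" "W k \<in> V" using ex W(1,2) unfolding exits_def by auto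
  have "detour V E W s k (len f) x (bwalk E f)"
    unfolding detour_def rl
  proof (intro conjI allI impI)
    show "0 < len f" "len f \<le> rlen" using m len by simp_all
    show "W k \<in> V" "\<not> (\<exists>u. (W k, odd k, sg x, u) \<in> E)" by (rule C(2), rule C(1))
    show "W (k + int (len f)) \<in> V" "bwalk E f 0 = W (k + int (len f))" using V end1 by simp_all
    show "\<And>i. 0 < i \<Longrightarrow> i < len f \<Longrightarrow> W (k + int i) \<notin> V" by (rule inner)
    show "\<And>i. i < len f \<Longrightarrow> s (k + int i) = sg (x + int i * q)" by (rule W(3))
    show "rwalk E (tp (odd k) ?m) (x - int ?m * q) ?m (bwalk E f)" "bwalk E f ?m = W k"
      using P W(1) unfolding W(2) by simp_all
    show "\<not> (\<exists>u. (bwalk E f 0, \<not> tp (odd k) ?m, \<not> sg (x - int ?m * q - q), u) \<in> E)"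
      using B unfolding W(2) .
  qed
  then show ?thesis unfolding f by simp
qed

lemma new_edge_detour:
  assumes W: "\<And>i::int. W i \<in> V1 - V \<Longrightarrow>
      (W (i - 1), odd (i - 1), s (i - 1), W i) \<in> E1 \<and> (W i, odd i, s i, W (i + 1)) \<in> E1"
    and new: "(W k, odd k, s k, W (k + 1)) \<in> E1 - E"
  shows "\<exists>k0 l x P. detour V E W s k0 l x P \<and> k0 \<le> k \<and> k < k0 + int l"
  using follows_new_edge[OF W new] follows_detour by blast

end

section \<open>Layers over a graph and their union\<close>

context heckoid begin

definition walks :: "graph \<Rightarrow> (int \<Rightarrow> node) \<Rightarrow> (int \<Rightarrow> bool) \<Rightarrow> bool" where
  "walks E W s \<longleftrightarrow> (\<forall>i. (W i, odd i, s i, W (i + 1)) \<in> E)"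

definition layer_over :: "node set \<Rightarrow> graph \<Rightarrow> node set \<Rightarrow> graph \<Rightarrow> bool" where
  "layer_over V E V1 E1 \<longleftrightarrow> V \<subseteq> V1 \<and> E \<subseteq> E1 \<and> (\<forall>v\<in>V. \<forall>e x. closed_at E1 v e x) \<and>
     (\<forall>W s k. walks E1 W s \<longrightarrow> (W k, odd k, s k, W (k + 1)) \<notin> E \<longrightarrow>
        (\<exists>k0 l x P. detour V E W s k0 l x P \<and> k0 \<le> k \<and> k < k0 + int l))"

lemma layer_exists:
  assumes gr: "graph_on V E" and fresh: "fresh_for V E" and fatg: "fatg V E"
  shows "\<exists>V1 E1. graph_on V1 E1 \<and> fresh_for V1 E1 \<and> thin V1 E1 \<and> layer_over V E V1 E1"
proof -
  let ?T = "exits V E"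
  have bd: "bounded_back E f" if "f \<in> ?T" for f
  proof -
    obtain v e x where f: "f = (v, e, x)" by (metis prod_cases3)
    show ?thesis
      unfolding bounded_back_def f
    proof (intro allI impI)
      fix m P assume P: "back_walk E (v, e, x) m P"
      then have "rwalk E (tp e m) (x - int m * q) m P" unfolding back_walk_def by simp
      then show "m < rlen" using back_walk_not_closed[OF gr _ P] that f fatg unfolding fatg_def by blast
    qed
  qed
  interpret A: attach q p n V E ?T
  proof
    show "graph_on V E" "fresh_for V E" "?T \<subseteq> ?T" using gr fresh by auto
    fix f assume f: "f \<in> ?T"
    show "bounded_back E f" by (rule bd[OF f])
    obtain v e x where vex: "f = (v, e, x)" by (metis prod_cases3)
    show pT: "par_of E f \<in> ?T" using par_of_exits[OF gr] f bd[OF f] vex by simp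
    let ?m = "blen E (v, e, x)"
    have w: "back_walk E (v, e, x) ?m (bwalk E (v, e, x))" using blen_walk(1) bd f vex by blast
    then have "rwalk E (tp e ?m) (x - int ?m * q) ?m (bwalk E (v, e, x))" unfolding back_walk_def by simp
    then have "fat (x - int ?m * q + int ?m * q) (rlen - ?m)"
      using back_walk_not_closed[OF gr _ w] f vex fatg unfolding fatg_def by blast
    then have "fat x (rlen - ?m)" by simp
    then show "\<exists>k. splits E ?T f k"
      using fat_imp_splits[OF gr order_refl, of v e x] f pT bd[OF f] unfolding vex by blast
  qed
  \<comment> \<open>A relator at an old vertex is read as far as possible. Where it stops there is
    an exit, whose cycle has been attached; rotating back along the walk closes the relator at
    \<open>v\<close>.\<close>
  have closed: "closed_at A.E1 v e x" if v: "v \<in> V" for v e x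
  proof (cases "closed_at E v e x")
    case True
    then show ?thesis using closed_at_mono A.E_E1 by blast
  next
    case False
    have ex0: "\<exists>P. P 0 = v \<and> rwalk E e x 0 P" unfolding rwalk_def by (intro exI[of _ "\<lambda>_. v"]) simp
    have bdk: "m < rlen" if "P 0 = v" "rwalk E e x m P" for m P
      using that False v fatg unfolding fatg_def by blast
    define k where "k = (GREATEST m. \<exists>P. P 0 = v \<and> rwalk E e x m P)"
    have "\<exists>P. P 0 = v \<and> rwalk E e x k P"
      unfolding k_def
      by (rule GreatestI_nat[where P = "\<lambda>m. \<exists>P. P 0 = v \<and> rwalk E e x m P" and b = rlen, OF ex0])
        (use bdk in \<open>auto intro: less_imp_le\<close>)
    then obtain P where P: "P 0 = v" "rwalk E e x k P" by blast
    have kmax: "m \<le> k" if "P 0 = v" "rwalk E e x m P" for m P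
      unfolding k_def by (rule Greatest_le_nat[where b = rlen]) (use bdk that in \<open>auto intro: less_imp_le\<close>)
    have stuck: "\<not> (\<exists>u. (P k, tp e k, sg (x + int k * q), u) \<in> E)"
    proof
      assume "\<exists>u. (P k, tp e k, sg (x + int k * q), u) \<in> E"
      then obtain u where u: "(P k, tp e k, sg (x + int k * q), u) \<in> E" by blast
      have "rwalk E e x (Suc k) (P(Suc k := u))"
        unfolding rwalk_def using u rwalkD[OF P(2)] by (auto simp: less_Suc_eq)
      then show False using kmax[of "P(Suc k := u)" "Suc k"] P(1) by simp
    qed
    have "P k \<in> V"
    proof (cases k)
      case 0
      then show ?thesis using P(1) v by simp
    next
      case (Suc j)
      then show ?thesis using rwalkD[OF P(2), of j] graph_onD(2)[OF gr] by blast
    qed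
    moreover have ph: "2 * p dvd (x + int k * q) mod (2 * p) - (x + int k * q)" by (rule mod_phase)
    moreover have "sg ((x + int k * q) mod (2 * p)) = sg (x + int k * q)" by (rule sgn_of_cong[OF p_pos ph])
    ultimately have "(P k, tp e k, (x + int k * q) mod (2 * p)) \<in> ?T"
      using stuck p_pos unfolding exits_def by simp
    then have "closed_at A.E1 (P k) (tp e k) ((x + int k * q) mod (2 * p))" by (rule A.T_closed)
    then have "closed_at A.E1 (P k) (tp e k) (x + int k * q)" using closed_at_cong[OF ph] by blast
    then have "closed_at A.E1 (P 0) e x"
      using closed_at_backward[OF A.graph_on_E1 rwalk_mono[OF P(2) A.E_E1 order_refl]] by blast
    then show ?thesis using P(1) by simp
  qed
  \<comment> \<open>An open relator walk now avoids \<open>V\<close> entirely, since it would close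
    at any old vertex it meets.\<close>
  have "thin A.V1 A.E1"
    unfolding thin_def
  proof (intro allI impI)
    fix e x m P assume P: "P 0 \<in> A.V1" "rwalk A.E1 e x m P" "\<not> closed_at A.E1 (P 0) e x"
    have "P i \<notin> V" if "i \<le> m" for i
    proof
      assume "P i \<in> V"
      then have "closed_at A.E1 (P i) (tp e i) (x + int i * q)" by (rule closed)
      then show False
        using closed_at_backward[OF A.graph_on_E1 rwalk_mono[OF P(2) order_refl that]] P(3) by blast
    qed
    then show "\<not> rich x m" using A.new_walk_not_rich[OF A.T_closed P(2) _ P(3,1)] by blast
  qed
  moreover have "layer_over V E A.V1 A.E1"
    unfolding layer_over_def
  proof (intro conjI ballI allI impI)
    show "V \<subseteq> A.V1" "E \<subseteq> A.E1" by (rule A.V_V1, rule A.E_E1)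
    show "\<And>v e x. v \<in> V \<Longrightarrow> closed_at A.E1 v e x" by (rule closed)
    fix W s k assume W: "walks A.E1 W s" "(W k, odd k, s k, W (k + 1)) \<notin> E"
    have "(W (i - 1), odd (i - 1), s (i - 1), W i) \<in> A.E1 \<and> (W i, odd i, s i, W (i + 1)) \<in> A.E1" for i
      using W(1)[unfolded walks_def, rule_format, of "i - 1"] W(1)[unfolded walks_def, rule_format, of i] by simp
    moreover from this[of k] have "(W k, odd k, s k, W (k + 1)) \<in> A.E1 - E" using W(2) by blast
    ultimately show "\<exists>k0 l x P. detour V E W s k0 l x P \<and> k0 \<le> k \<and> k < k0 + int l"
      by (intro A.new_edge_detour)
  qed
  ultimately show ?thesis using A.graph_on_E1 A.fresh_for_E1 by blast
qed

text \<open>Whatever a line reads of a relator, a rich piece is left unread. A detour would require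
  that piece in the old graph as part of an open relator, which a thin graph does not
  contain.\<close>

definition no_long :: "(int \<Rightarrow> bool) \<Rightarrow> bool" where
  "no_long s \<longleftrightarrow> (\<forall>k m x. (\<forall>i<m. s (k + int i) = sg (x + int i * q)) \<longrightarrow>
      m < rlen \<and> rich (x + int m * q) (rlen - m))"

lemma detour_rich:
  assumes "no_long s" "detour V E W s k l x P"
  shows "rich (x - int (rlen - l) * q) (rlen - l)" "l < rlen"
proof -
  have *: "l < rlen \<and> rich (x + int l * q) (rlen - l)"
    using assms unfolding no_long_def detour_def by blast
  then show "l < rlen" by simp
  have "(x - int (rlen - l) * q) - (x + int l * q) = - (x + int rlen * q - x)"
    using * by (simp add: of_nat_diff algebra_simps)
  then have "2 * p dvd (x - int (rlen - l) * q) - (x + int l * q)"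
    using rlen_period by (metis dvd_minus_iff)
  then show "rich (x - int (rlen - l) * q) (rlen - l)" using * rich_cong by blast
qed

lemma detour_not_closed:
  assumes "graph_on V E" "detour V E W s k l x P"
  shows "\<not> closed_at E (P 0) (tp (odd k) (rlen - l)) (x - int (rlen - l) * q)"
proof (rule not_closed_if_stuck[OF assms(1)])
  show "rwalk E (tp (odd k) (rlen - l)) (x - int (rlen - l) * q) (rlen - l) P"
    "\<nexists>u. (P (rlen - l), tp (tp (odd k) (rlen - l)) (rlen - l),
           sg (x - int (rlen - l) * q + int (rlen - l) * q), u) \<in> E"
    using assms(2) unfolding detour_def by auto
qed

lemma thin_no_new:
  assumes gr: "graph_on V E" and "thin V E" "layer_over V E V1 E1" "no_long s" "walks E1 W s"
  shows "walks E W s"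
  unfolding walks_def
proof (rule allI, rule ccontr)
  fix k assume "(W k, odd k, s k, W (k + 1)) \<notin> E"
  then obtain k0 l x P where d: "detour V E W s k0 l x P"
    using assms(3,5) unfolding layer_over_def by blast
  have "rich (x - int (rlen - l) * q) (rlen - l)" by (rule detour_rich[OF assms(4) d])
  moreover have "P 0 \<in> V" "rwalk E (tp (odd k0) (rlen - l)) (x - int (rlen - l) * q) (rlen - l) P"
    using d unfolding detour_def by auto
  ultimately show False using detour_not_closed[OF gr d] assms(2) unfolding thin_def by blast
qed

text \<open>The period is even because types are the parities of times.\<close>

definition periodic :: "(int \<Rightarrow> 'a) \<Rightarrow> bool" where
  "periodic W \<longleftrightarrow> (\<exists>k>0. \<forall>i::int. W (i + 2 * k) = W i)"

text \<open>A periodic line uses finitely many edges of the union and therefore lies in one stage.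
  Thin stages let it be pushed down one layer at a time, as far as the first layer; the starting
  graph is merely \<open>fatg\<close>, so there the descent stops.\<close>

theorem tower:
  assumes gr: "graph_on V E" and fresh: "fresh_for V E" and fatg: "fatg V E"
  obtains V' E' V1 E1 where "graph_on V' E'" "V \<subseteq> V'"
    "\<And>v e b. v \<in> V' \<Longrightarrow> \<exists>u. (v, e, b, u) \<in> E'" "\<And>v e x. v \<in> V' \<Longrightarrow> closed_at E' v e x"
    "E \<subseteq> E'"  "layer_over V E V1 E1"
    "\<And>W s. \<lbrakk>walks E' W s; periodic W; periodic s; no_long s\<rbrakk> \<Longrightarrow> walks E1 W s"
proof -
  let ?inv = "\<lambda>i::nat. \<lambda>(V1, E1). graph_on V1 E1 \<and> fresh_for V1 E1 \<and> fatg V1 E1 \<and>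
      (i = 0 \<longrightarrow> (V1, E1) = (V, E)) \<and> (0 < i \<longrightarrow> thin V1 E1)"
  have "\<exists>G. \<forall>i. ?inv i (G i) \<and> (\<lambda>(V1, E1) (V2, E2). layer_over V1 E1 V2 E2) (G i) (G (Suc i))"
  proof (rule dependent_nat_choice)
    show "\<exists>G. ?inv 0 G" using assms by (intro exI[of _ "(V, E)"]) simp
    fix G i assume "?inv i G"
    then show "\<exists>G'. ?inv (Suc i) G' \<and> (\<lambda>(V1, E1) (V2, E2). layer_over V1 E1 V2 E2) G G'"
    proof -
      assume inv: "?inv i G"
      obtain V1 E1 where G: "G = (V1, E1)" by (cases G)
      obtain V2 E2 where 2: "graph_on V2 E2" "fresh_for V2 E2" "thin V2 E2" "layer_over V1 E1 V2 E2"
        using layer_exists[of V1 E1] inv unfolding G by auto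
      show ?thesis
        using 2 thin_imp_fatg[OF 2(3)] unfolding G by (intro exI[of _ "(V2, E2)"]) simp
    qed
  qed
  then obtain G where GG: "\<forall>i. ?inv i (G i) \<and> (\<lambda>(V1, E1) (V2, E2). layer_over V1 E1 V2 E2) (G i) (G (Suc i))" ..
  have G: "?inv i (G i)" "(\<lambda>(V1, E1) (V2, E2). layer_over V1 E1 V2 E2) (G i) (G (Suc i))" for i
    using GG[rule_format, of i] by (rule conjunct1, rule conjunct2)
  define Vs Es where "Vs i = fst (G i)" and "Es i = snd (G i)" for i
  have I: "graph_on (Vs i) (Es i)" "fresh_for (Vs i) (Es i)" "fatg (Vs i) (Es i)" for i
    using G(1)[of i] unfolding Vs_def Es_def by (auto simp: case_prod_beta)
  have th: "0 < i \<Longrightarrow> thin (Vs i) (Es i)" for i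
    using G(1)[of i] unfolding Vs_def Es_def by (auto simp: case_prod_beta)
  have G0: "Vs 0 = V" "Es 0 = E" using G(1)[of 0] unfolding Vs_def Es_def by (auto simp: case_prod_beta)
  have L: "layer_over (Vs i) (Es i) (Vs (Suc i)) (Es (Suc i))" for i
    using G(2)[of i] unfolding Vs_def Es_def by (simp add: case_prod_beta)
  have "Vs i \<subseteq> Vs (Suc i)" "Es i \<subseteq> Es (Suc i)" for i
    using L[of i] unfolding layer_over_def by simp_all
  then have Vm: "Vs i \<subseteq> Vs j" and Em: "Es i \<subseteq> Es j" if "i \<le> j" for i j
    using lift_Suc_mono_le[of Vs i j] lift_Suc_mono_le[of Es i j] that by simp_all
  have cl: "closed_at (Es (Suc i)) v e x" if "v \<in> Vs i" for v e x i
    using L[of i] that unfolding layer_over_def by simp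
  let ?V = "\<Union>i. Vs i" and ?E = "\<Union>i. Es i"
  have gr': "graph_on ?V ?E"
    unfolding graph_on_def
  proof (intro conjI allI impI)
    fix v e b w assume "(v, e, b, w) \<in> ?E"
    then obtain i where i: "(v, e, b, w) \<in> Es i" by blast
    then show "v \<in> ?V" "(w, e, \<not> b, v) \<in> ?E" using graph_onD[OF I(1) i] by blast+
  next
    fix v e b w w' assume "(v, e, b, w) \<in> ?E" "(v, e, b, w') \<in> ?E"
    then obtain i j where "(v, e, b, w) \<in> Es i" "(v, e, b, w') \<in> Es j" by blast
    then have "(v, e, b, w) \<in> Es (max i j)" "(v, e, b, w') \<in> Es (max i j)"
      using Em[of i "max i j"] Em[of j "max i j"] by auto
    then show "w = w'" using graph_on_det[OF I(1)] by blast
  qed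
  have cl': "closed_at ?E v e x" if v: "v \<in> ?V" for v e x
  proof -
    obtain i where "v \<in> Vs i" using v by blast
    then have "closed_at (Es (Suc i)) v e x" by (rule cl)
    then show ?thesis by (rule closed_at_mono) blast
  qed
  have comp: "\<exists>u. (v, e, b, u) \<in> ?E" if v: "v \<in> ?V" for v e b
  proof -
    \<comment> \<open>Phase 0 begins with a positive letter and phase \<open>p\<close> with a
      negative one, so closed relators provide edges of both signs.\<close>
    define x where "x = (if b then 0 else p)"
    have x: "sg x = b" using p_pos by (simp add: x_def sgn_of_def)
    obtain u where "(v, e, sg x, u) \<in> ?E" using closed_at_Suc[OF gr' cl'[OF v]] .
    then show ?thesis using x by blast
  qed
  have W1: "walks (Es 1) W s" if W: "walks ?E W s" "periodic W" "periodic s" "no_long s" for W s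
  proof -
    obtain a b where a: "0 < a" "\<And>i. W (i + 2 * a) = W i" and b: "0 < b" "\<And>i. s (i + 2 * b) = s i"
      using W(2,3) unfolding periodic_def by blast
    have Wk: "W (i + 2 * a * k) = W i" for i k
    proof (induction k rule: int_induct[where k = 0])
      case (step1 k)
      then show ?case using a(2)[of "i + 2 * a * k"] by (simp add: algebra_simps)
    next
      case (step2 k)
      then show ?case using a(2)[of "i + 2 * a * (k - 1)"] by (simp add: algebra_simps)
    qed simp
    have sk: "s (i + 2 * b * k) = s i" for i k
    proof (induction k rule: int_induct[where k = 0])
      case (step1 k)
      then show ?case using b(2)[of "i + 2 * b * k"] by (simp add: algebra_simps)
    next
      case (step2 k)
      then show ?case using b(2)[of "i + 2 * b * (k - 1)"] by (simp add: algebra_simps)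
    qed simp
    let ?N = "2 * a * b"
    have N: "0 < ?N" using a(1) b(1) by simp
    have per: "W (i + ?N * k) = W i" "s (i + ?N * k) = s i" for i k
    proof -
      have e: "?N * k = 2 * a * (b * k)" "?N * k = 2 * b * (a * k)" by simp_all
      show "W (i + ?N * k) = W i" unfolding e(1) by (rule Wk)
      show "s (i + ?N * k) = s i" unfolding e(2) by (rule sk)
    qed
    have "\<forall>i. \<exists>j. (W i, odd i, s i, W (i + 1)) \<in> Es j" using W(1) unfolding walks_def by blast
    then obtain J where J: "\<And>i. (W i, odd i, s i, W (i + 1)) \<in> Es (J i)" by metis
    define M where "M = Max (J ` {0..<?N})"
    have "walks (Es M) W s"
      unfolding walks_def
    proof
      fix i
      let ?r = "i mod ?N"
      have r: "i = ?r + ?N * (i div ?N)" by simp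
      have "?r \<in> {0..<?N}" using N by simp
      then have "J ?r \<le> M" unfolding M_def by (intro Max_ge) auto
      then have "(W ?r, odd ?r, s ?r, W (?r + 1)) \<in> Es M" using J[of ?r] Em by blast
      moreover have "W ?r = W i" "s ?r = s i" "W (?r + 1) = W (i + 1)"
        using per[of ?r "i div ?N"] per(1)[of "?r + 1" "i div ?N"] r by (simp_all add: algebra_simps)
      moreover have "odd ?r = odd i"
      proof -
        have "even (?N * (i div ?N))" by simp
        then show ?thesis using r by (metis even_add)
      qed
      ultimately show "(W i, odd i, s i, W (i + 1)) \<in> Es M" by simp
    qed
    moreover have "walks (Es 1) W s" if "walks (Es j) W s" "1 \<le> j" for j
      using that
    proof (induction j)
      case (Suc j)
      show ?case
      proof (cases "j = 0")
        case False
        then have "walks (Es j) W s" using thin_no_new[OF I(1) th L W(4)] Suc.prems(1) by simp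
        then show ?thesis using Suc.IH False by simp
      qed (use Suc.prems in simp)
    qed simp
    moreover have "walks (Es (Suc M)) W s" using calculation(1) Em[of M "Suc M"] unfolding walks_def by auto
    ultimately show ?thesis by simp
  qed
  show ?thesis
  proof (rule that[of ?V ?E "Vs 1" "Es 1"])
    show "graph_on ?V ?E" by (rule gr')
    show "V \<subseteq> ?V" "E \<subseteq> ?E" using G0 by blast+
    show "layer_over V E (Vs 1) (Es 1)" using L[of 0] G0 by simp
    show "\<And>v e b. v \<in> ?V \<Longrightarrow> \<exists>u. (v, e, b, u) \<in> ?E" by (rule comp)
    show "\<And>v e x. v \<in> ?V \<Longrightarrow> closed_at ?E v e x" by (rule cl')
    show "\<And>W s. walks ?E W s \<Longrightarrow> periodic W \<Longrightarrow> periodic s \<Longrightarrow> no_long s \<Longrightarrow> walks (Es 1) W s"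
      by (rule W1)
  qed
qed

end

section \<open>Lines and lattice points\<close>

text \<open>The tool for comparing linear growth rates: a discrepancy that stays bounded over
  arbitrarily many turns is zero.\<close>

lemma bounded_multiples_zero:
  fixes z B :: int assumes "\<And>a::nat. \<bar>int a * z\<bar> \<le> B" shows "z = 0"
proof (rule ccontr)
  assume "z \<noteq> 0"
  have "B \<ge> 0" using assms[of 0] by simp
  have "\<bar>int (nat B + 1) * z\<bar> = (B + 1) * \<bar>z\<bar>" using \<open>B \<ge> 0\<close> by (simp add: abs_mult)
  also have "\<dots> \<ge> (B + 1) * 1" using \<open>z \<noteq> 0\<close> \<open>B \<ge> 0\<close> by (intro mult_left_mono) auto
  finally show False using assms[of "nat B + 1"] by simp
qed

lemma div_bounds:
  fixes x d :: int assumes "d > 0"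
  shows "d * (x div d) \<le> x" "x < d * (x div d + 1)"
proof -
  have "x = d * (x div d) + x mod d" by simp
  moreover have "0 \<le> x mod d" "x mod d < d" using assms by auto
  ultimately show "d * (x div d) \<le> x" "x < d * (x div d + 1)"
    unfolding distrib_left by linarith+
qed

context heckoid begin

text \<open>Letters of relators are parities of \<open>F\<close>, letters of the loop of slope \<open>N/d\<close> are parities of \<open>line\<close>.
  At marks the value of \<open>F\<close> is as close as possible to a jump, so agreement of \<open>F\<close> and \<open>line\<close> at
  a mark bounds \<open>gap\<close> from one side.\<close>

definition F :: "int \<Rightarrow> int \<Rightarrow> int" where "F c i = (c + i * q) div p"

definition line :: "int \<Rightarrow> int \<Rightarrow> int \<Rightarrow> int \<Rightarrow> int" where "line N d h i = (h + i * N) div d"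

definition in_range :: "int \<Rightarrow> int \<Rightarrow> bool" where
  "in_range N d \<longleftrightarrow> 0 < d \<and> (q div p) * d \<le> N \<and> N \<le> (q div p + 1) * d"

text \<open>The determinant of the two slopes, positive exactly when \<open>N / d\<close> lies to
  the left of \<open>q / p\<close> (for positive \<open>d\<close>).\<close>

definition dt :: "int \<Rightarrow> int \<Rightarrow> int" where "dt N d = d * q - p * N"

text \<open>\<open>p * d\<close> times the height of the line of slope \<open>N / d\<close> above
  the line of the relator, at place \<open>i\<close>; it falls by \<open>dt N d\<close> with each
  step.\<close>

definition gap :: "int \<Rightarrow> int \<Rightarrow> int \<Rightarrow> int \<Rightarrow> int \<Rightarrow> int" where
  "gap N d h c i = p * (h + i * N) - d * (c + i * q)"

definition mark0 :: "int \<Rightarrow> int \<Rightarrow> bool" where "mark0 c i \<longleftrightarrow> p dvd c + i * q"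
definition mark1 :: "int \<Rightarrow> int \<Rightarrow> bool" where "mark1 c i \<longleftrightarrow> p dvd c + i * q + 1"

definition rich_on :: "int \<Rightarrow> int \<Rightarrow> int \<Rightarrow> bool" where
  "rich_on c a b \<longleftrightarrow> (\<exists>i. a \<le> i \<and> i < b \<and> mark0 c i) \<and> (\<exists>i. a \<le> i \<and> i < b \<and> mark1 c i)"

lemma in_rangeD: "in_range N d \<Longrightarrow> d > 0" by (simp add: in_range_def)

lemma steps_line: "in_range N d \<Longrightarrow> steps_in (q div p) (line N d h)"
  unfolding in_range_def line_def using steps_in_div by blast

lemma steps_F: "steps_in (q div p) (F c)"
  unfolding F_def using steps_in_rel by blast

lemma F_shift: "F (c + 2 * p * z) i = F c i + 2 * z"
proof -
  have "c + 2 * p * z + i * q = (c + i * q) + p * (2 * z)" by simp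
  then show ?thesis unfolding F_def using p_pos by (simp only: div_mult_self2)
qed

lemma sg_F: "sg (c + i * q) \<longleftrightarrow> even (F c i)" by (simp add: sgn_of_def F_def)

lemma F_mono: "c \<le> c' \<Longrightarrow> F c i \<le> F c' i"
  unfolding F_def using p_pos by (intro zdiv_mono1) auto

lemma F_less: "F c i < F c' i \<Longrightarrow> c < c'"
  using F_mono[of c' c i] by linarith

lemma line_shift: "in_range N d \<Longrightarrow> line N d (h + 2 * d * z) i = line N d h i + 2 * z"
proof -
  assume "in_range N d"
  then have d: "d \<noteq> 0" by (simp add: in_range_def)
  have e: "h + 2 * d * z + i * N = (h + i * N) + d * (2 * z)" by simp
  show ?thesis unfolding line_def e using div_mult_self2[OF d] by simp
qed

lemma gap_diff: "gap N d h c j = gap N d h c i - (j - i) * dt N d"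
  by (simp add: gap_def dt_def algebra_simps)

lemma gap_c: "gap N d h (c + k) i = gap N d h c i - d * k"
  by (simp add: gap_def algebra_simps)

lemma gap_mark0:
  assumes "in_range N d" "mark0 c i" "F c i = line N d h i" shows "0 \<le> gap N d h c i"
proof -
  have d: "d > 0" using assms(1) by (rule in_rangeD)
  have "c + i * q = p * F c i" using assms(2) unfolding mark0_def F_def by simp
  moreover have "d * line N d h i \<le> h + i * N"
    unfolding line_def by (rule div_bounds(1)[OF d])
  then have "p * (d * line N d h i) \<le> p * (h + i * N)" using p_pos by simp
  ultimately show ?thesis unfolding gap_def assms(3) by (simp add: algebra_simps)
qed

lemma gap_mark1:
  assumes "in_range N d" "mark1 c i" "F c i = line N d h i" shows "gap N d h c i < d"
proof -
  have d: "d > 0" using assms(1) by (rule in_rangeD)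
  obtain k where k: "c + i * q + 1 = p * k" using assms(2) unfolding mark1_def by (elim dvdE)
  have "c + i * q = p * (k - 1) + (p - 1)" using k by (simp add: algebra_simps)
  then have "F c i = k - 1" unfolding F_def using p_pos by (intro int_div_pos_eq[where r = "p - 1"]) auto
  then have e: "c + i * q + 1 = p * (F c i + 1)" using k by simp
  have "h + i * N < d * (line N d h i + 1)"
    unfolding line_def by (rule div_bounds(2)[OF d])
  then have "p * (h + i * N) < p * (d * (line N d h i + 1))" using p_pos by simp
  also have "\<dots> = d * (c + i * q + 1)" unfolding e assms(3) by simp
  finally show ?thesis unfolding gap_def by (simp add: algebra_simps)
qed

lemma gap_above:
  assumes "in_range N d" "F c i < line N d h i" shows "d \<le> gap N d h c i"
proof -
  have d: "d > 0" using assms(1) by (rule in_rangeD)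
  have "d * line N d h i \<le> h + i * N"
    unfolding line_def by (rule div_bounds(1)[OF d])
  moreover have "d * (F c i + 1) \<le> d * line N d h i" using assms(2) d by simp
  ultimately have "d * (F c i + 1) \<le> h + i * N" by linarith
  then have 1: "p * (d * (F c i + 1)) \<le> p * (h + i * N)" using p_pos by simp
  have "c + i * q < p * (F c i + 1)"
    unfolding F_def by (rule div_bounds(2)[OF p_pos])
  then have "d * (c + i * q + 1) \<le> d * (p * (F c i + 1))" using d by simp
  then show ?thesis using 1 unfolding gap_def by (simp add: algebra_simps)
qed

lemma gap_below:
  assumes "in_range N d" "line N d h i < F c i" shows "gap N d h c i < 0"
proof -
  have d: "d > 0" using assms(1) by (rule in_rangeD)
  have "h + i * N < d * (line N d h i + 1)"
    unfolding line_def by (rule div_bounds(2)[OF d])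
  moreover have "d * (line N d h i + 1) \<le> d * F c i" using assms(2) d by simp
  ultimately have "h + i * N < d * F c i" by linarith
  then have 1: "p * (h + i * N) < p * (d * F c i)" using p_pos by simp
  have "p * F c i \<le> c + i * q"
    unfolding F_def by (rule div_bounds(1)[OF p_pos])
  then have "d * (p * F c i) \<le> d * (c + i * q)" using d by simp
  then show ?thesis using 1 unfolding gap_def by (simp add: algebra_simps)
qed

text \<open>Equal parities give floors that differ by a constant even number, and a phase shift by a
  multiple of \<open>2 * p\<close> absorbs it without changing any letter of the relator.\<close>

lemma exact_lift:
  assumes N: "in_range N d" and ab: "a < b"
    and par: "\<And>i. a \<le> i \<Longrightarrow> i < b \<Longrightarrow> even (line N d h i) \<longleftrightarrow> even (F c i)"
  obtains z where "\<And>i. a \<le> i \<Longrightarrow> i < b \<Longrightarrow> F (c + 2 * p * z) i = line N d h i"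
proof -
  have "even (line N d h a - F c a)" using par[of a] ab by simp
  then obtain z where z: "line N d h a - F c a = 2 * z" by (elim dvdE)
  show ?thesis
  proof (rule that[of z])
    fix i assume "a \<le> i" "i < b"
    show "F (c + 2 * p * z) i = line N d h i"
      by (rule steps_in_parity_eq_up[OF steps_F steps_line[OF N], of _ a _ i])
        (use z par \<open>a \<le> i\<close> \<open>i < b\<close> in \<open>auto simp: F_shift\<close>)
  qed
qed

lemma exact_extend:
  assumes N: "in_range N d" and k: "a \<le> k" "k < b" "F c k = line N d h k"
    and par: "\<And>i. a \<le> i \<Longrightarrow> i < b \<Longrightarrow> even (line N d h i) \<longleftrightarrow> even (F c i)"
    and i: "a \<le> i" "i < b"
  shows "F c i = line N d h i"
  using steps_in_parity_eq[where k = k and i = a and j = "b - 1" and t = i, OF steps_F steps_line[OF N]]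
    assms by auto

text \<open>The gap is non-negative at the residue 0 and below \<open>d\<close> at the residue -1.
  As it falls by \<open>dt N d\<close> per step, the two marks cannot be arbitrarily far apart in
  the wrong order.\<close>

lemma span:
  assumes N: "in_range N d" and eq: "\<And>i. a \<le> i \<Longrightarrow> i < b \<Longrightarrow> F c i = line N d h i"
    and i0: "mark0 c i0" "a \<le> i0" "i0 < b" and i1: "mark1 c i1" "a \<le> i1" "i1 < b"
  shows "(i0 - i1) * dt N d < d"
  using gap_mark0[OF N i0(1) eq[OF i0(2,3)]] gap_mark1[OF N i1(1) eq[OF i1(2,3)]]
    gap_diff[of N d h c i0 i1] by linarith

lemma mark0_add: "mark0 c (i + p * k) \<longleftrightarrow> mark0 c i"
proof -
  have "c + (i + p * k) * q = (c + i * q) + p * (k * q)" by (simp add: algebra_simps)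
  then show ?thesis unfolding mark0_def by (simp only: dvd_add_left_iff[OF dvd_triv_left])
qed

lemma mark1_add: "mark1 c (i + p * k) \<longleftrightarrow> mark1 c i"
  using mark0_add[of "c + 1" i k] by (simp add: mark0_def mark1_def algebra_simps)

lemma mark1_mark0: "mark1 c i \<longleftrightarrow> mark0 (c + 1) i" by (simp add: mark0_def mark1_def algebra_simps)

lemma mark0_diff: "mark0 c i \<Longrightarrow> mark0 c j \<Longrightarrow> p dvd i - j"
proof -
  assume "mark0 c i" "mark0 c j"
  then have "p dvd (c + i * q) - (c + j * q)" unfolding mark0_def by (rule dvd_diff)
  then have "p dvd (i - j) * q" by (simp add: algebra_simps)
  then show ?thesis using coprime_qp by (simp add: coprime_commute coprime_dvd_mult_left_iff)
qed

lemma mark1_diff: "mark1 c i \<Longrightarrow> mark1 c j \<Longrightarrow> p dvd i - j"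
  unfolding mark1_mark0 by (rule mark0_diff)

lemma last_mark0:
  assumes "a \<le> i" "i < b" "mark0 c i" 
  obtains j where "a \<le> j" "j < b" "mark0 c j" "b \<le> j + p" "i \<le> j"
proof (rule that[of "i + p * ((b - 1 - i) div p)"])
  have nn: "(b - 1 - i) div p \<ge> 0" using assms(2) p_pos by (simp add: pos_imp_zdiv_nonneg_iff)
  have m: "p * ((b - 1 - i) div p) = (b - 1 - i) - (b - 1 - i) mod p" by (simp add: minus_mod_eq_mult_div)
  have m': "0 \<le> (b - 1 - i) mod p" "(b - 1 - i) mod p < p" using p_pos by auto
  have "0 \<le> p * ((b - 1 - i) div p)" using nn p_pos by simp
  then show "a \<le> i + p * ((b - 1 - i) div p)" "i \<le> i + p * ((b - 1 - i) div p)" using assms(1) by auto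
  show "i + p * ((b - 1 - i) div p) < b" "b \<le> i + p * ((b - 1 - i) div p) + p" using m m' by linarith+
  show "mark0 c (i + p * ((b - 1 - i) div p))" using assms(3) mark0_add by simp
qed

lemma first_mark0:
  assumes "a \<le> i" "i < b" "mark0 c i" 
  obtains j where "a \<le> j" "j < b" "mark0 c j" "j - p < a" "j \<le> i"
proof (rule that[of "i + p * (- ((i - a) div p))"])
  have nn: "(i - a) div p \<ge> 0" using assms(1) p_pos by (simp add: pos_imp_zdiv_nonneg_iff)
  have m: "p * ((i - a) div p) = (i - a) - (i - a) mod p" by (simp add: minus_mod_eq_mult_div)
  have m': "0 \<le> (i - a) mod p" "(i - a) mod p < p" using p_pos by auto
  have nn': "0 \<le> p * ((i - a) div p)" using nn p_pos by simp
  have e: "i + p * (- ((i - a) div p)) = i - p * ((i - a) div p)" by simp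
  show "i + p * (- ((i - a) div p)) < b" "i + p * (- ((i - a) div p)) \<le> i" unfolding e using assms(2) nn' by auto
  show "a \<le> i + p * (- ((i - a) div p))" "i + p * (- ((i - a) div p)) - p < a" unfolding e using m m' by linarith+
  show "mark0 c (i + p * (- ((i - a) div p)))" using assms(3) mark0_add[of c i "- ((i - a) div p)"] by simp
qed

lemma last_mark1:
  assumes "a \<le> i" "i < b" "mark1 c i" 
  obtains j where "a \<le> j" "j < b" "mark1 c j" "b \<le> j + p" "i \<le> j"
  using last_mark0[of a i b "c + 1"] assms unfolding mark1_mark0 by blast

lemma first_mark1:
  assumes "a \<le> i" "i < b" "mark1 c i" 
  obtains j where "a \<le> j" "j < b" "mark1 c j" "j - p < a" "j \<le> i"
  using first_mark0[of a i b "c + 1"] assms unfolding mark1_mark0 by blast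

lemma mark0_in_window:
  obtains i where "a \<le> i" "i < a + p" "mark0 c i"
proof -
  obtain l where l: "l < nat p" "p dvd (c + a * q) + int l * q" using ex_mark by blast
  have "mark0 c (a + int l)" using l(2) by (simp add: mark0_def algebra_simps)
  then show ?thesis using that[of "a + int l"] l(1) by simp
qed

lemma mark1_in_window:
  obtains i where "a \<le> i" "i < a + p" "mark1 c i"
  using mark0_in_window[of a "c + 1"] unfolding mark1_mark0 by blast

lemma rich_iff_rich_on: "rich x m \<longleftrightarrow> rich_on (x - a * q) a (a + int m)"
proof -
  have e: "x - a * q + i * q = x + (i - a) * q" for i by (simp add: algebra_simps)
  have 1: "(\<exists>l<m. p dvd x + int l * q) \<longleftrightarrow> (\<exists>i. a \<le> i \<and> i < a + int m \<and> mark0 (x - a * q) i)"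
  proof
    assume "\<exists>l<m. p dvd x + int l * q"
    then obtain l where "l < m" "p dvd x + int l * q" by blast
    then show "\<exists>i. a \<le> i \<and> i < a + int m \<and> mark0 (x - a * q) i"
      unfolding mark0_def e by (intro exI[of _ "a + int l"]) simp
  next
    assume "\<exists>i. a \<le> i \<and> i < a + int m \<and> mark0 (x - a * q) i"
    then obtain i where "a \<le> i" "i < a + int m" "p dvd x + (i - a) * q" unfolding mark0_def e by blast
    then show "\<exists>l<m. p dvd x + int l * q" by (intro exI[of _ "nat (i - a)"]) auto
  qed
  have 2: "(\<exists>l<m. p dvd x + int l * q + 1) \<longleftrightarrow> (\<exists>i. a \<le> i \<and> i < a + int m \<and> mark1 (x - a * q) i)"
  proof
    assume "\<exists>l<m. p dvd x + int l * q + 1"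
    then obtain l where "l < m" "p dvd x + int l * q + 1" by blast
    then show "\<exists>i. a \<le> i \<and> i < a + int m \<and> mark1 (x - a * q) i"
      unfolding mark1_def e by (intro exI[of _ "a + int l"]) simp
  next
    assume "\<exists>i. a \<le> i \<and> i < a + int m \<and> mark1 (x - a * q) i"
    then obtain i where "a \<le> i" "i < a + int m" "p dvd x + (i - a) * q + 1" unfolding mark1_def e by blast
    then show "\<exists>l<m. p dvd x + int l * q + 1" by (intro exI[of _ "nat (i - a)"]) auto
  qed
  show ?thesis unfolding rich_def rich_on_def 1 2 ..
qed

lemma mark0_cong: "p dvd c - c' \<Longrightarrow> mark0 c i \<longleftrightarrow> mark0 c' i"
  unfolding mark0_def using dvd_add_right_iff[of p "c - c'" "c' + i * q"] by (simp add: algebra_simps)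

lemma rich_on_cong:
  assumes "p dvd c - c'" shows "rich_on c a b \<longleftrightarrow> rich_on c' a b"
proof -
  have *: "p dvd (c + 1) - (c' + 1)" using assms by simp
  show ?thesis unfolding rich_on_def mark1_mark0 using mark0_cong[OF assms] mark0_cong[OF *] by simp
qed

lemma rich_on_bigger: "rich_on c a b \<Longrightarrow> a' \<le> a \<Longrightarrow> b \<le> b' \<Longrightarrow> rich_on c a' b'"
  unfolding rich_on_def by (meson order_trans less_le_trans)

text \<open>The gap decreases. Leaving on the other side would carry its value at the exit to a mark
  inside the stretch and violate the bound there.\<close>

lemma exit_side:
  assumes N: "in_range N d" and D: "0 < dt N d" and r: "rich_on c a b"
    and eq: "\<And>i. a \<le> i \<Longrightarrow> i < b \<Longrightarrow> F c i = line N d h i"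
  shows "F c b \<noteq> line N d h b \<Longrightarrow> line N d h b < F c b"
    and "F c (a - 1) \<noteq> line N d h (a - 1) \<Longrightarrow> F c (a - 1) < line N d h (a - 1)"
proof -
  obtain i0 i1 where i0: "a \<le> i0" "i0 < b" "mark0 c i0" and i1: "a \<le> i1" "i1 < b" "mark1 c i1"
    using r unfolding rich_on_def by blast
  show "line N d h b < F c b" if "F c b \<noteq> line N d h b"
  proof (rule ccontr)
    assume "\<not> ?thesis"
    then have "d \<le> gap N d h c b" using that gap_above[OF N] by (metis linorder_neqE)
    moreover have "0 \<le> (b - i1) * dt N d" using i1 D by simp
    ultimately have "d \<le> gap N d h c i1" using gap_diff[of N d h c b i1] by linarith
    then show False using gap_mark1[OF N i1(3) eq[OF i1(1,2)]] by linarith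
  qed
  show "F c (a - 1) < line N d h (a - 1)" if "F c (a - 1) \<noteq> line N d h (a - 1)"
  proof (rule ccontr)
    assume "\<not> ?thesis"
    then have "gap N d h c (a - 1) < 0" using that gap_below[OF N] by (metis linorder_neqE)
    moreover have "0 \<le> (i0 - (a - 1)) * dt N d" using i0 D by simp
    ultimately have "gap N d h c i0 < 0" using gap_diff[of N d h c i0 "a - 1"] by linarith
    then show False using gap_mark0[OF N i0(3) eq[OF i0(1,2)]] by linarith
  qed
qed

lemma exit_side_neg:
  assumes N: "in_range N d" and D: "dt N d < 0" and r: "rich_on c a b"
    and eq: "\<And>i. a \<le> i \<Longrightarrow> i < b \<Longrightarrow> F c i = line N d h i"
  shows "F c b \<noteq> line N d h b \<Longrightarrow> F c b < line N d h b"
proof -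
  obtain i0 where i0: "a \<le> i0" "i0 < b" "mark0 c i0" using r unfolding rich_on_def by blast
  assume ne: "F c b \<noteq> line N d h b"
  show "F c b < line N d h b"
  proof (rule ccontr)
    assume "\<not> ?thesis"
    then have "gap N d h c b < 0" using ne gap_below[OF N] by (metis linorder_neqE)
    moreover have "(b - i0) * dt N d \<le> 0" using i0 D by (simp add: mult_nonneg_nonpos)
    ultimately have "gap N d h c i0 < 0" using gap_diff[of N d h c b i0] by linarith
    then show False using gap_mark0[OF N i0(3) eq[OF i0(1,2)]] by linarith
  qed
qed

end

text \<open>\<open>pm\<close> and \<open>pp\<close> are the denominators of the end points \<open>e\<^sub>-\<close> and \<open>e\<^sub>+\<close> of the fundamental domain next
  to \<open>q/p\<close>, and the two inequalities of \<open>slope\<close> say \<open>N/d \<le> e\<^sub>-\<close> and \<open>e\<^sub>+ \<le> N/d\<close>.\<close>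

locale farey_pair = heckoid +
  fixes pm pp :: int
  assumes pm_pos: "0 < pm" and pp_pos: "0 < pp" and pm_pp: "pm + pp = 2 * int n * p"
    and pm_q: "p dvd pm * q - 1"
begin

definition slope :: "int \<Rightarrow> int \<Rightarrow> bool" where
  "slope N d \<longleftrightarrow> in_range N d \<and> dt N d \<noteq> 0 \<and> (0 < dt N d \<longrightarrow> d \<le> pm * dt N d) \<and>
     (dt N d < 0 \<longrightarrow> d \<le> pp * (- dt N d))"

end

text \<open>A step of \<open>pm\<close> or \<open>pp\<close> from a mark among the first
  \<open>p\<close> letters of a relator then stays before the corresponding mark among the last
  \<open>p\<close> letters. Lopsided fundamental domains fail this.\<close>

locale heckoid_pair = farey_pair +
  assumes pm_less: "pm < (2 * int n - 1) * p" and pp_less: "pp < (2 * int n - 1) * p"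
begin

text \<open>\<open>pm\<close> is inverse to \<open>q\<close> modulo \<open>p\<close>, and
  \<open>pp\<close> is congruent to \<open>- pm\<close>.\<close>

lemma mark_step:
  "mark1 c i \<Longrightarrow> mark0 c (i + pm)" "mark0 c i \<Longrightarrow> mark1 c (i - pm)"
  "mark0 c i \<Longrightarrow> mark1 c (i + pp)" "mark1 c i \<Longrightarrow> mark0 c (i - pp)"
proof -
  have A: "mark0 c (i + pm) \<longleftrightarrow> mark1 c i" for i
  proof -
    have "c + (i + pm) * q = (pm * q - 1) + (c + i * q + 1)" by (simp add: algebra_simps)
    then show ?thesis unfolding mark0_def mark1_def using dvd_add_right_iff[OF pm_q] by (simp only:)
  qed
  have B: "i + pp = i - pm + p * (2 * int n)" "i - pp = i + pm + p * (- 2 * int n)" for i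
    using pm_pp by (simp_all add: algebra_simps)
  show "mark1 c i \<Longrightarrow> mark0 c (i + pm)" "mark0 c i \<Longrightarrow> mark1 c (i - pm)" using A[of i] A[of "i - pm"] by auto
  show "mark0 c i \<Longrightarrow> mark1 c (i + pp)" "mark1 c i \<Longrightarrow> mark0 c (i - pp)"
    unfolding B mark0_add mark1_add using A[of i] A[of "i - pm"] by auto
qed

text \<open>An unread part that is not rich lacks one kind of mark, so the read part contains the
  first and the last mark of that kind in a whole relator. Between them fit a step by
  \<open>pm\<close> and a step by \<open>pp\<close>, and \<open>span\<close> forbids one of these
  according to the side of the slope.\<close>

lemma no_long_line:
  assumes s: "slope N d" shows "no_long (\<lambda>i. even (line N d h i))"
  unfolding no_long_def
proof (intro allI impI)
  fix k :: int and m :: nat and x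
  assume agree: "\<forall>i<m. even (line N d h (k + int i)) = sg (x + int i * q)"
  have N: "in_range N d" using s unfolding slope_def by simp
  have *: False if m': "m' \<le> m" "m' \<le> rlen" and nr: "\<not> rich (x + int m' * q) (rlen - m')" for m'
  proof -
    have "int (rlen - m') \<le> p - 1" using nr by (rule not_rich_short)
    then have "int rlen - int m' \<le> p - 1" using m'(2) by linarith
    then have m'p: "0 < int m'" using rlen_ge p_pos by linarith
    let ?c = "x - k * q"
    have par: "even (line N d h i) \<longleftrightarrow> even (F ?c i)" if "k \<le> i" "i < k + int m'" for i
    proof -
      have "even (line N d h (k + int (nat (i - k)))) = sg (x + int (nat (i - k)) * q)"
        using agree that m'(1) by (intro agree[rule_format]) linarith
      then have "even (line N d h i) = sg (x + (i - k) * q)" using that by simp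
      also have "x + (i - k) * q = ?c + i * q" by (simp add: algebra_simps)
      finally show ?thesis unfolding sg_F .
    qed
    obtain z where z: "\<And>i. k \<le> i \<Longrightarrow> i < k + int m' \<Longrightarrow> F (?c + 2 * p * z) i = line N d h i"
      using exact_lift[OF N _ par, of k "k + int m'"] m'p by auto
    define c where "c = ?c + 2 * p * z"
    have sp: "(i0 - i1) * dt N d < d" if "mark0 c i0" "k \<le> i0" "i0 < k + int m'" "mark1 c i1" "k \<le> i1" "i1 < k + int m'" for i0 i1
      using span[OF N z[folded c_def] that] .
    have short: False if "mark1 c i1" "mark0 c (i1 + pm)" "k \<le> i1" "i1 + pm < k + int m'" 
        "mark0 c i0" "mark1 c (i0 + pp)" "k \<le> i0" "i0 + pp < k + int m'" for i0 i1
    proof (cases "0 < dt N d")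
      case True
      then have "d \<le> pm * dt N d" using s unfolding slope_def by blast
      moreover have "(i1 + pm - i1) * dt N d < d" using that pm_pos by (intro sp) auto
      ultimately show False by simp
    next
      case False
      then have "d \<le> pp * (- dt N d)" using s unfolding slope_def by simp
      moreover have "(i0 - (i0 + pp)) * dt N d < d" using that pp_pos by (intro sp) auto
      ultimately show False by simp
    qed
    have cong: "p dvd (x + int m' * q - (k + int m') * q) - c"
    proof -
      have "(x + int m' * q - (k + int m') * q) - c = p * (- 2 * z)" unfolding c_def by (simp add: algebra_simps)
      then show ?thesis by simp
    qed
    have "\<not> rich_on c (k + int m') (k + int m' + int (rlen - m'))"
      using nr rich_iff_rich_on[of "x + int m' * q" "rlen - m'" "k + int m'"] rich_on_cong[OF cong] by simp
    moreover have "k + int m' + int (rlen - m') = k + 2 * int n * p" using m'(2) int_rlen by (simp add: algebra_simps)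
    ultimately consider (0) "\<And>i. k + int m' \<le> i \<Longrightarrow> i < k + 2 * int n * p \<Longrightarrow> \<not> mark0 c i"
      | (1) "\<And>i. k + int m' \<le> i \<Longrightarrow> i < k + 2 * int n * p \<Longrightarrow> \<not> mark1 c i"
      unfolding rich_on_def by auto
    then show False
    proof cases
      case 0
      obtain b where b: "k \<le> b" "b < k + p" "mark0 c b" by (rule mark0_in_window)
      \<comment> \<open>The last mark in one full relator; it is in the part that was read because
        the rest has no mark of this kind.\<close>
      let ?b = "b + p * (2 * int n - 1)"
      have b': "mark0 c ?b" using b(3) mark0_add by simp
      have lt: "?b < k + 2 * int n * p" using b(2) by (simp add: algebra_simps)
      then have "?b < k + int m'" using 0[of ?b] b' by linarith
      moreover have "k \<le> ?b - pm" "b + pp < ?b" using b(1) pm_less pp_less by (simp_all add: algebra_simps)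
      ultimately show False
        using short[of "?b - pm" b] mark_step(2)[OF b'] mark_step(3)[OF b(3)] b' b by simp
    next
      case 1
      obtain b where b: "k \<le> b" "b < k + p" "mark1 c b" by (rule mark1_in_window)
      let ?b = "b + p * (2 * int n - 1)"
      have b': "mark1 c ?b" using b(3) mark1_add by simp
      have lt: "?b < k + 2 * int n * p" using b(2) by (simp add: algebra_simps)
      then have "?b < k + int m'" using 1[of ?b] b' by linarith
      moreover have "k \<le> ?b - pp" "b + pm < ?b" using b(1) pm_less pp_less by (simp_all add: algebra_simps)
      ultimately show False
        using short[of b "?b - pp"] mark_step(1)[OF b(3)] mark_step(4)[OF b'] b' b by simp
    qed
  qed
  have "m < rlen"
  proof (rule ccontr)
    assume "\<not> m < rlen"
    then show False using *[of rlen] rich_imp_pos by fastforce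
  qed
  then show "m < rlen \<and> rich (x + int m * q) (rlen - m)" using *[of m] by auto
qed

end

context heckoid begin

text \<open>A face is a maximal stretch \<open>[a, b)\<close> of the line on which it follows a relator.\<close>

definition face :: "int \<Rightarrow> int \<Rightarrow> int \<Rightarrow> int \<Rightarrow> int \<Rightarrow> int \<Rightarrow> bool" where
  "face N d h c a b \<longleftrightarrow> a < b \<and> rich_on c a b \<and> (\<forall>i. a \<le> i \<longrightarrow> i < b \<longrightarrow> F c i = line N d h i) \<and>
     (even (line N d h b) \<longleftrightarrow> odd (F c b)) \<and> (even (line N d h (a - 1)) \<longleftrightarrow> odd (F c (a - 1)))"

lemma faceD:
  assumes "face N d h c a b"
  shows "a < b" "rich_on c a b" "\<And>i. a \<le> i \<Longrightarrow> i < b \<Longrightarrow> F c i = line N d h i"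
    "F c b \<noteq> line N d h b" "F c (a - 1) \<noteq> line N d h (a - 1)"
  using assms unfolding face_def by auto

lemma face_exit:
  assumes "in_range N d" "0 < dt N d" "face N d h c a b"
  shows "line N d h b < F c b" "F c (a - 1) < line N d h (a - 1)"
  using exit_side[OF assms(1,2) faceD(2)[OF assms(3)] faceD(3)[OF assms(3)]] faceD(4,5)[OF assms(3)] by auto

lemma mark0_less:
  assumes "mark0 c' i" "c < c'" shows "F c i < F c' i"
proof -
  have e: "c' + i * q = p * F c' i" using assms(1) unfolding mark0_def F_def by simp
  have "p * F c i \<le> c + i * q" unfolding F_def by (rule div_bounds(1)[OF p_pos])
  then have "p * F c i < p * F c' i" using e assms(2) by linarith
  then show ?thesis using p_pos by simp
qed

lemma mark1_less:
  assumes "mark1 c i" "c < c'" shows "F c i < F c' i"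
proof -
  obtain k where k: "c + i * q + 1 = p * k" using assms(1) unfolding mark1_def by (elim dvdE)
  then have "p * k \<le> c' + i * q" using assms(2) by linarith
  then have "p * k div p \<le> F c' i" unfolding F_def using p_pos by (rule zdiv_mono1)
  then have "k \<le> F c' i" using p_pos by simp
  moreover have "p * F c i \<le> c + i * q" unfolding F_def by (rule div_bounds(1)[OF p_pos])
  then have "p * F c i < p * k" using k by linarith
  ultimately show ?thesis using p_pos by simp
qed

text \<open>One line follows two relator lines, \<open>c\<close> near a mark of residue -1 and
  \<open>c'\<close> near a mark of residue 0. Both bounds on the gap together limit how far
  \<open>c'\<close> lies above \<open>c\<close>.\<close>

lemma cross_marks:
  assumes N: "in_range N d"
    and 1: "mark1 c i1" "F c i1 = line N d h i1" and 0: "mark0 c' i0" "F c' i0 = line N d h i0"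
  shows "(c' - c - 1) * d < (i1 - i0) * dt N d"
proof -
  have "gap N d h c i1 < d" by (rule gap_mark1[OF N 1])
  moreover have "0 \<le> gap N d h c' i0" by (rule gap_mark0[OF N 0])
  moreover have "gap N d h c' i0 = gap N d h c i0 - d * (c' - c)"
    using gap_c[of N d h c "c' - c" i0] by simp
  moreover have "gap N d h c i1 = gap N d h c i0 - (i1 - i0) * dt N d" by (rule gap_diff)
  ultimately have "d * (c' - c) - (i1 - i0) * dt N d < d" by linarith
  then show ?thesis by (simp add: algebra_simps)
qed

lemma cross_marks_cong:
  assumes "mark1 c i1" "mark0 c' i0" shows "p dvd (i1 - i0) * q - (c' - c - 1)"
proof -
  have "p dvd (c + i1 * q + 1) - (c' + i0 * q)" using assms unfolding mark0_def mark1_def by (rule dvd_diff)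
  then show ?thesis by (simp add: algebra_simps)
qed

lemma mark_gap_inverse:
  assumes "mark0 c i0" "mark1 c i1" shows "p dvd (i0 - i1) * q - 1"
  using cross_marks_cong[OF assms(2,1)] dvd_minus_iff[of p "(i1 - i0) * q + 1"] by (simp add: algebra_simps)

lemma inverse_cong:
  assumes "p dvd a * q - 1" "p dvd b * q - 1" shows "p dvd a - b"
proof -
  have "p dvd (a * q - 1) - (b * q - 1)" using assms by (rule dvd_diff)
  then have "p dvd (a - b) * q" by (simp add: algebra_simps)
  then show ?thesis using coprime_qp by (simp add: coprime_commute coprime_dvd_mult_left_iff)
qed

text \<open>\<open>X\<close> and \<open>A * z\<close> are congruent modulo \<open>p\<close> and
  \<open>X\<close> is larger, so it is larger by at least \<open>p\<close>. In this way an
  inequality between slopes gains a whole period.\<close>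

lemma lattice_bound:
  assumes A: "1 \<le> A" "A * d < X * D" and D: "0 < D"
    and cong: "p dvd X * q - A" and z: "p dvd z * q - 1" "z * D < d"
  shows "A * z + p \<le> X"
proof -
  have "p dvd (X * q - A) - A * (z * q - 1)" using cong z(1) by simp
  then have "p dvd (X - A * z) * q" by (simp add: algebra_simps)
  then have "p dvd X - A * z" using coprime_qp by (simp add: coprime_commute coprime_dvd_mult_left_iff)
  then obtain B where B: "X - A * z = p * B" by (elim dvdE)
  have "A * (z * D) < A * d" using A(1) z(2) by simp
  then have "A * (z * D) < X * D" using A(2) by linarith
  then have "0 < (X - A * z) * D" by (simp add: algebra_simps)
  then have "0 < p * B" unfolding B using D by (simp add: zero_less_mult_iff)
  then have "1 \<le> B" using p_pos by (simp add: zero_less_mult_iff)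
  then have "p * 1 \<le> p * B" using p_pos by simp
  then show ?thesis using B by linarith
qed

lemma F_bounds: "p * F c i \<le> c + i * q" "c + i * q < p * (F c i + 1)"
  unfolding F_def using div_bounds[OF p_pos] by auto

text \<open>The face of \<open>c'\<close> begins and ends before that of \<open>c\<close>; they
  overlap in \<open>[v, w)\<close>, or just touch when \<open>v = w\<close>.\<close>

definition join :: "int \<Rightarrow> int \<Rightarrow> int \<Rightarrow> int \<Rightarrow> int \<Rightarrow> int \<Rightarrow> int \<Rightarrow> int \<Rightarrow> int \<Rightarrow> bool" where
  "join N d h c v e c' u w \<longleftrightarrow> in_range N d \<and> 0 < dt N d \<and> face N d h c v e \<and> face N d h c' u w \<and>
     u < v \<and> v \<le> w \<and> w < e"

lemma joinD:
  assumes "join N d h c v e c' u w"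
  shows "in_range N d" "0 < dt N d" "face N d h c v e" "face N d h c' u w" "u < v" "v \<le> w" "w < e"
  using assms unfolding join_def by auto

lemma join_order:
  assumes j: "join N d h c v e c' u w"
  shows "line N d h (v - 1) = F c' (v - 1)" "F c (v - 1) < F c' (v - 1)"
    "line N d h w = F c w" "F c w < F c' w" "c < c'"
proof -
  note J = joinD[OF j]
  show 1: "line N d h (v - 1) = F c' (v - 1)" using faceD(3)[OF J(4), of "v - 1"] J(5,6) by simp
  show 2: "F c (v - 1) < F c' (v - 1)" using face_exit(2)[OF J(1-3)] 1 by simp
  show 3: "line N d h w = F c w" using faceD(3)[OF J(3), of w] J(6,7) by simp
  show "F c w < F c' w" using face_exit(1)[OF J(1,2,4)] 3 by simp
  show "c < c'" using F_less[OF 2] .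
qed

lemma join_overlap:
  assumes j: "join N d h c v e c' u w" and i: "v \<le> i" "i < w"
  shows "F c i = F c' i" "F c i = line N d h i" "\<not> mark1 c i" "\<not> mark0 c' i"
proof -
  note J = joinD[OF j]
  show 1: "F c i = line N d h i" using faceD(3)[OF J(3), of i] i J(7) by simp
  then show 2: "F c i = F c' i" using faceD(3)[OF J(4), of i] i J(5) by simp
  show "\<not> mark1 c i" "\<not> mark0 c' i"
    using mark1_less[of c i c'] mark0_less[of c' i c] join_order(5)[OF j] 2 by auto
qed

text \<open>A pair of consecutive faces that meet in a single vertex: then both faces step up there,
  which makes the two lattice lines far apart.\<close>

lemma empty_join:
  assumes j: "join N d h c v e c' u v"
  shows "F c v = line N d h v" "F c' v = line N d h v + 1" "F c (v - 1) = line N d h (v - 1) - 1"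
    "line N d h v = line N d h (v - 1) + q div p"
    "2 \<le> c' - c" "c' - c \<le> 2 * p - 2"
proof -
  note J = joinD[OF j] and O = join_order[OF j]
  let ?f = "q div p"
  have sY: "line N d h v = line N d h (v - 1) + ?f \<or> line N d h v = line N d h (v - 1) + ?f + 1"
    using steps_line[OF J(1)] unfolding steps_in_def by (metis diff_add_cancel)
  have sF: "F c v = F c (v - 1) + ?f \<or> F c v = F c (v - 1) + ?f + 1" for c
    using steps_F[of c] unfolding steps_in_def by (metis diff_add_cancel)
  show a: "F c v = line N d h v" using O(3) by simp
  show b: "F c' v = line N d h v + 1" "F c (v - 1) = line N d h (v - 1) - 1"
     "line N d h v = line N d h (v - 1) + ?f"
    using sY sF[of c] sF[of c'] O a by linarith+
  define g where "g = line N d h v"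
  have qm: "0 \<le> q mod p" "q mod p < p" using p_pos by auto
  have v1: "c + v * q = (c + (v - 1) * q) + q" "c' + v * q = (c' + (v - 1) * q) + q" by (simp_all add: algebra_simps)
  have Fv: "F c v = g" "F c' v = g + 1" "F c (v - 1) = g - ?f - 1" "F c' (v - 1) = g - ?f"
    using a b O(1) unfolding g_def by linarith+
  have c1: "p * g \<le> c + v * q" using F_bounds(1)[of c v] Fv by simp
  have c2: "p * (g + 1) \<le> c' + v * q" using F_bounds(1)[of c' v] Fv by simp
  have d1: "c + (v - 1) * q < p * (g - ?f)" using F_bounds(2)[of c "v - 1"] Fv by simp
  have d2: "c' + (v - 1) * q < p * (g - ?f + 1)" using F_bounds(2)[of c' "v - 1"] Fv by simp
  have e: "p * (g - ?f) = p * g - p * ?f" "p * (g - ?f + 1) = p * g - p * ?f + p" "p * (g + 1) = p * g + p"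
    by (simp_all add: algebra_simps)
  define a b m where "a = p * ?f" and "b = p * g" and "m = q mod p"
  have "q = a + m" unfolding a_def m_def by simp
  moreover have "0 \<le> m" "m < p" using qm unfolding m_def by auto
  moreover have "b \<le> c + v * q" "b + p \<le> c' + v * q"
    "c + (v - 1) * q < b - a" "c' + (v - 1) * q < b - a + p"
    using c1 c2 d1 d2 e unfolding a_def b_def by simp_all
  ultimately show "2 \<le> c' - c" "c' - c \<le> 2 * p - 2" using v1 by linarith+
qed

text \<open>The first mark of residue -1 after the touching point and the last mark of residue 0
  before it are both within \<open>p\<close> letters of it, while \<open>lattice_bound\<close> keeps
  them apart. Equality pushes both to the extreme places.\<close>

lemma empty_join_bound:
  assumes j: "join N d h c v e c' u v" and z: "p dvd z * q - 1" "z * dt N d < d"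
  shows "(c' - c - 1) * z \<le> p - 1"
    and "(c' - c - 1) * z = p - 1 \<Longrightarrow> mark1 c (v + p - 1) \<and> mark0 c' (v - p)"
proof -
  note J = joinD[OF j]
  obtain i1 where i1: "v \<le> i1" "i1 < e" "mark1 c i1" "i1 - p < v"
    using faceD(2)[OF J(3)] first_mark1 unfolding rich_on_def by metis
  obtain i0 where i0: "u \<le> i0" "i0 < v" "mark0 c' i0" "v \<le> i0 + p"
    using faceD(2)[OF J(4)] last_mark0 unfolding rich_on_def by metis
  have "(c' - c - 1) * d < (i1 - i0) * dt N d"
    using cross_marks[OF J(1) i1(3) _ i0(3)] faceD(3)[OF J(3) i1(1,2)] faceD(3)[OF J(4) i0(1,2)] by simp
  moreover have "1 \<le> c' - c - 1" using empty_join(5)[OF j] by simp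
  ultimately have b: "(c' - c - 1) * z + p \<le> i1 - i0"
    using lattice_bound[OF _ _ J(2) cross_marks_cong[OF i1(3) i0(3)] z] by blast
  then show "(c' - c - 1) * z \<le> p - 1" using i1(4) i0(4) by linarith
  assume "(c' - c - 1) * z = p - 1"
  then have "i1 = v + p - 1" "i0 = v - p" using b i1(4) i0(4) by linarith+
  then show "mark1 c (v + p - 1) \<and> mark0 c' (v - p)" using i1(3) i0(3) by simp
qed

definition reads :: "int \<Rightarrow> int \<Rightarrow> int \<Rightarrow> int \<Rightarrow> int \<Rightarrow> int \<Rightarrow> bool" where
  "reads N d h c a b \<longleftrightarrow> (\<forall>i. a \<le> i \<longrightarrow> i < b \<longrightarrow> (even (line N d h i) \<longleftrightarrow> even (F c i)))"

lemma readsD: "reads N d h c a b \<Longrightarrow> a \<le> i \<Longrightarrow> i < b \<Longrightarrow> even (line N d h i) \<longleftrightarrow> even (F c i)"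
  unfolding reads_def by blast

text \<open>At \<open>w\<close> the relator \<open>c'\<close> is one unit above \<open>c\<close>, so
  a line that goes on with \<open>c'\<close> must leave the lift of \<open>c\<close> there, and the
  sign of \<open>dt N' d'\<close> decides on which side. Above, \<open>c'\<close> continues with the
  same lift. Below, the faces only touch and the lift drops by \<open>2 * p\<close>.\<close>

lemma join_read:
  assumes j: "join N d h c v e c' u w" and N': "in_range N' d'"
    and r1: "reads N' d' h' c (v - l) w" "0 < l" "rich_on c (v - l) v"
    and r2: "reads N' d' h' c' v (w + l')" "0 < l'"
    and ex: "\<And>i. v - l \<le> i \<Longrightarrow> i < v \<Longrightarrow> F (c + 2 * p * z) i = line N' d' h' i"
  shows "dt N' d' < 0 \<Longrightarrow> v < w \<and> (\<forall>i. v - l \<le> i \<longrightarrow> i < w \<longrightarrow> F (c + 2 * p * z) i = line N' d' h' i) \<and>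
       (\<forall>i. v \<le> i \<longrightarrow> i < w + l' \<longrightarrow> F (c' + 2 * p * z) i = line N' d' h' i)"
    and "0 < dt N' d' \<Longrightarrow> v = w \<and> (\<forall>i. v \<le> i \<longrightarrow> i < w + l' \<longrightarrow> F (c' + 2 * p * (z - 1)) i = line N' d' h' i)"
proof -
  note J = joinD[OF j] and O = join_order[OF j]
  let ?c = "c + 2 * p * z" and ?c' = "c' + 2 * p * z"
  have par: "even (line N' d' h' i) \<longleftrightarrow> even (F ?c i)" if "v - l \<le> i" "i < w" for i
    using readsD[OF r1(1) that] by (simp add: F_shift)
  have par': "even (line N' d' h' i) \<longleftrightarrow> even (F (c' + 2 * p * k) i)" if "v \<le> i" "i < w + l'" for i k
    using readsD[OF r2(1) that] by (simp add: F_shift)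
  have ex1: "F ?c i = line N' d' h' i" if "v - l \<le> i" "i < w" for i
    using exact_extend[OF N', where k = "v - 1" and a = "v - l" and b = w and i = i] par ex[of "v - 1"] r1(2) J(6) that by simp
  have "even (line N' d' h' w) \<longleftrightarrow> even (F c' w)" using readsD[OF r2(1)] J(6) r2(2) by simp
  moreover have step: "F c' w = F c w + 1"
  proof (cases "v = w")
    case True
    then show ?thesis using empty_join(1,2) j by simp
  next
    case False
    then have "F c (w - 1) = F c' (w - 1)" using join_overlap(1)[OF j, of "w - 1"] J(6) by simp
    moreover have st: "F c w = F c (w - 1) + q div p \<or> F c w = F c (w - 1) + q div p + 1" for c
      using steps_F[of c] unfolding steps_in_def by (metis diff_add_cancel)
    ultimately show ?thesis using O(4) st[of c] st[of c'] by linarith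
  qed
  ultimately have ne: "F ?c w \<noteq> line N' d' h' w" unfolding F_shift by presburger
  have rich: "rich_on ?c (v - l) w"
  proof -
    have "p dvd ?c - c" by simp
    then have "rich_on ?c (v - l) v" using r1(3) rich_on_cong by blast
    then show ?thesis using rich_on_bigger J(6) by blast
  qed
  \<comment> \<open>With touching faces \<open>c\<close> makes the larger of the two steps into
    \<open>w\<close>. A line that deviates from it therefore makes the smaller one and falls
    below.\<close>
  have empty_side: "line N' d' h' w < F ?c w \<and> line N' d' h' w = F (c' + 2 * p * (z - 1)) w" if "v = w"
  proof -
    have jv: "join N d h c v e c' u v" using j that by simp
    note E = empty_join[OF jv]
    have "line N' d' h' v = line N' d' h' (v - 1) + q div p \<or> line N' d' h' v = line N' d' h' (v - 1) + q div p + 1"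
      using steps_line[OF N'] unfolding steps_in_def by (metis diff_add_cancel)
    moreover have "line N' d' h' (v - 1) = F c (v - 1) + 2 * z" using ex[of "v - 1"] r1(2) by (simp add: F_shift)
    moreover have "F c v = F c (v - 1) + q div p + 1" using E by linarith
    ultimately have "line N' d' h' v = F c v + 2 * z - 1" using ne that by (auto simp: F_shift)
    then show ?thesis using that E(1,2) by (simp add: F_shift)
  qed
  have up: "F ?c w < line N' d' h' w \<and> (\<forall>i. v \<le> i \<longrightarrow> i < w + l' \<longrightarrow> F ?c' i = line N' d' h' i)" if vw: "v < w"
  proof -
    have "F ?c' v = line N' d' h' v"
      using ex1[of v] join_overlap(1)[OF j, of v] vw r1(2) by (simp add: F_shift)
    then have ex2: "F ?c' i = line N' d' h' i" if "v \<le> i" "i < w + l'" for i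
      using exact_extend[OF N', where k = v and a = v and b = "w + l'" and i = i] par' vw r2(2) that by simp
    have "F ?c' w = line N' d' h' w" by (rule ex2) (use vw r2(2) in auto)
    then have "F ?c w < line N' d' h' w" using O(4) by (simp add: F_shift)
    then show ?thesis using ex2 by blast
  qed
  show "v < w \<and> (\<forall>i. v - l \<le> i \<longrightarrow> i < w \<longrightarrow> F ?c i = line N' d' h' i) \<and>
       (\<forall>i. v \<le> i \<longrightarrow> i < w + l' \<longrightarrow> F ?c' i = line N' d' h' i)" if D: "dt N' d' < 0"
  proof -
    have "F ?c w < line N' d' h' w" using exit_side_neg[OF N' D rich ex1 ne] .
    then have "v \<noteq> w" using empty_side by auto
    then show ?thesis using up ex1 J(6) by simp
  qed
  show "v = w \<and> (\<forall>i. v \<le> i \<longrightarrow> i < w + l' \<longrightarrow> F (c' + 2 * p * (z - 1)) i = line N' d' h' i)" if D: "0 < dt N' d'"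
  proof -
    have "line N' d' h' w < F ?c w" using exit_side(1)[OF N' D rich ex1 ne] .
    then have vw: "v = w" using up J(6) by force
    have "F (c' + 2 * p * (z - 1)) v = line N' d' h' v" using empty_side[OF vw] vw by simp
    then have "F (c' + 2 * p * (z - 1)) i = line N' d' h' i" if "v \<le> i" "i < w + l'" for i
      using exact_extend[OF N', where k = v and a = v and b = "w + l'" and i = i] par' vw r2(2) that by simp
    then show ?thesis using vw by blast
  qed
qed

lemma window_unique:
  assumes "a \<le> x" "x < a + p" "a \<le> y" "y < a + p" "p dvd x - y" shows "x = (y::int)"
proof -
  have "\<bar>x - y\<bar> < p" using assms by linarith
  then show ?thesis using assms(5) dvd_imp_le_int[of "x - y" p] p_pos by fastforce
qed

lemma dvd_sub_p: "p dvd x - y \<Longrightarrow> p dvd x - (y + p)"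
  using dvd_diff[of p "x - y" p] by (simp add: algebra_simps)

lemma inverse_not_zero: "p dvd z * q - 1 \<Longrightarrow> z mod p \<noteq> 0"
proof
  assume "p dvd z * q - 1" "z mod p = 0"
  then have "p dvd z * q" by auto
  from dvd_diff[OF this \<open>p dvd z * q - 1\<close>] have "\<bar>p\<bar> = 1" by simp
  then show False using p_ge by simp
qed

lemma mod_le_if: 
  assumes "z \<le> p - 1" shows "z \<le> z mod p"
proof (cases "z < 0")
  case True
  then show ?thesis using p_pos pos_mod_sign[of p z] by linarith
next
  case False
  then show ?thesis using assms by simp
qed

lemma F_add_period: "F c (i + 2 * p * int n) = F c i + 2 * (int n * q)"
proof -
  have e: "c + (i + 2 * p * int n) * q = (c + 2 * p * (int n * q)) + i * q" by (simp add: algebra_simps)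
  have "F c (i + 2 * p * int n) = F (c + 2 * p * (int n * q)) i" unfolding F_def e ..
  then show ?thesis by (simp add: F_shift)
qed

lemma rich_on_shift: "rich_on c (a + p * k) (b + p * k) \<longleftrightarrow> rich_on c a b"
proof -
  have "(\<exists>i. a + p * k \<le> i \<and> i < b + p * k \<and> mark0 c i) \<longleftrightarrow> (\<exists>i. a \<le> i \<and> i < b \<and> mark0 c i)" for c
  proof
    assume "\<exists>i. a + p * k \<le> i \<and> i < b + p * k \<and> mark0 c i"
    then obtain i where "a + p * k \<le> i" "i < b + p * k" "mark0 c i" by blast
    then show "\<exists>i. a \<le> i \<and> i < b \<and> mark0 c i"
      using mark0_add[of c "i - p * k" k] by (intro exI[of _ "i - p * k"]) simp
  next
    assume "\<exists>i. a \<le> i \<and> i < b \<and> mark0 c i"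
    then obtain i where "a \<le> i" "i < b" "mark0 c i" by blast
    then show "\<exists>i. a + p * k \<le> i \<and> i < b + p * k \<and> mark0 c i"
      using mark0_add[of c i k] by (intro exI[of _ "i + p * k"]) simp
  qed
  then show ?thesis unfolding rich_on_def mark1_mark0 by simp
qed

end

section \<open>Rings of relators\<close>

text \<open>At time \<open>t a\<close> the line of slope \<open>N'/d'\<close> leaves the cycle of slope \<open>N/d\<close> at position \<open>i a\<close>. It runs
  through the complement of a face and comes back at position \<open>i a - m a\<close>, then follows the cycle for
  \<open>l a\<close> letters.\<close>

locale ring_walk = heckoid +
  fixes N d N' d' h' :: int and t i m c l :: "nat \<Rightarrow> int"
  assumes N: "in_range N d" and D: "0 < dt N d" and N': "in_range N' d'" 
    and faces: "face N d 0 (c a) (i a - m a) (i a)"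
    and m_less: "m a < 2 * p * int n"
    and A_rich: "rich_on (c a) (i a) (i a - m a + 2 * p * int n)"
    and A_reads: "t a \<le> s \<Longrightarrow> s < t a + 2 * p * int n - m a \<Longrightarrow>
        even (line N' d' h' s) \<longleftrightarrow> even (F (c a) (s - t a + i a))"
    and l_nonneg: "0 \<le> l a" and l_less: "l a < m a" "l a < m (Suc a)"
    and i_Suc: "i (Suc a) = i a - m a + l a" and t_Suc: "t (Suc a) = t a + 2 * p * int n - m a + l a"
    and S_reads: "i a - m a \<le> j \<Longrightarrow> j < i (Suc a) \<Longrightarrow>
        even (line N' d' h' (j + t (Suc a) - i (Suc a))) \<longleftrightarrow> even (line N d 0 j)"
begin

abbreviation v :: "nat \<Rightarrow> int" where "v a \<equiv> i a - m a"

lemma joins: "join N d 0 (c a) (i a - m a) (i a) (c (Suc a)) (i (Suc a) - m (Suc a)) (i (Suc a))"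
proof -
  have "v a \<le> i (Suc a)" "i (Suc a) < i a" "v (Suc a) < v a"
    using l_nonneg[of a] l_less[of a] i_Suc[of a] by linarith+
  then show ?thesis unfolding join_def using N D faces[of a] faces[of "Suc a"] by blast
qed

text \<open>Per turn, time on the outer line gains exactly one relator length on the position on the
  cycle.\<close>

lemma t_i: "t a - i a = (t 0 - i 0) + 2 * p * int n * int a"
  by (induction a) (simp_all add: i_Suc t_Suc algebra_simps)

text \<open>Re-indexes the outer line by positions on the cycle as they stand at departure
  \<open>a\<close>, so that both lines and the relator lines share coordinates.\<close>

definition hh :: "nat \<Rightarrow> int" where "hh a = h' + (t a - i a) * N'"

lemma line_hh: "line N' d' (hh a) j = line N' d' h' (j + t a - i a)"
  unfolding line_def hh_def by (rule arg_cong[where f = "\<lambda>x. x div d'"]) (simp add: algebra_simps)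

lemma line_hh_Suc: "line N' d' (hh a) (j + 2 * p * int n) = line N' d' (hh (Suc a)) j"
  unfolding line_hh i_Suc t_Suc by (simp add: algebra_simps)

lemma reads_arc: "reads N' d' (hh a) (c a) (i a) (i a - m a + 2 * p * int n)"
  unfolding reads_def
proof (intro allI impI)
  fix j assume "i a \<le> j" "j < i a - m a + 2 * p * int n"
  then show "even (line N' d' (hh a) j) \<longleftrightarrow> even (F (c a) j)"
    using A_reads[of a "j + t a - i a"] by (simp add: line_hh)
qed

lemma ex_lift: "\<exists>z. \<forall>j. i a \<le> j \<longrightarrow> j < i a - m a + 2 * p * int n \<longrightarrow> F (c a + 2 * p * z) j = line N' d' (hh a) j"
proof -
  have "i a < i a - m a + 2 * p * int n" using m_less[of a] by simp
  then obtain z where "\<And>j. i a \<le> j \<Longrightarrow> j < i a - m a + 2 * p * int n \<Longrightarrow> F (c a + 2 * p * z) j = line N' d' (hh a) j"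
    using exact_lift[OF N', of "i a" "i a - m a + 2 * p * int n" "hh a" "c a"] reads_arc[of a]
    unfolding reads_def by blast
  then show ?thesis by blast
qed

text \<open>The multiple of \<open>2 * p\<close> by which relator \<open>a\<close> has to be raised
  to lie exactly under the outer line, not only to agree in parity.\<close>

definition z :: "nat \<Rightarrow> int" where
  "z a = (SOME z. \<forall>j. i a \<le> j \<longrightarrow> j < i a - m a + 2 * p * int n \<longrightarrow> F (c a + 2 * p * z) j = line N' d' (hh a) j)"

lemma z_exact: "i a \<le> j \<Longrightarrow> j < i a - m a + 2 * p * int n \<Longrightarrow> F (c a + 2 * p * z a) j = line N' d' (hh a) j"
  using someI_ex[OF ex_lift[of a]] unfolding z_def by blast

lemma z_unique:
  assumes "F (c a + 2 * p * z') (i a) = line N' d' (hh a) (i a)" shows "z' = z a"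
  using assms z_exact[of a "i a"] m_less[of a] by (simp add: F_shift)

text \<open>The coordinates of the next turn are moved by one relator length, along which
  \<open>F\<close> grows by \<open>2 * int n * q\<close>.\<close>

lemma z_exact_back:
  assumes "i a - 2 * p * int n \<le> j" "j < v a"
  shows "F (c a + 2 * p * (z a + int n * q)) j = line N' d' (hh (Suc a)) j"
  using z_exact[of a "j + 2 * p * int n"] assms F_add_period[of "c a + 2 * p * z a" j]
  unfolding line_hh_Suc by (simp add: F_shift)

lemma A_rich_back: "rich_on (c a) (i a - 2 * p * int n) (v a)"
  using A_rich[of a] rich_on_shift[of "c a" "i a - 2 * p * int n" "2 * int n" "v a"] by (simp add: algebra_simps)

lemma v_length: "v a - (2 * p * int n - m a) = i a - 2 * p * int n" by simp

lemma reads_1: "reads N' d' (hh (Suc a)) (c a) (v a - (2 * p * int n - m a)) (i (Suc a))"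
  unfolding reads_def v_length
proof (intro allI impI)
  fix j assume j: "i a - 2 * p * int n \<le> j" "j < i (Suc a)"
  show "even (line N' d' (hh (Suc a)) j) \<longleftrightarrow> even (F (c a) j)"
  proof (cases "j < v a")
    case True
    then show ?thesis
      using readsD[OF reads_arc[of a], of "j + 2 * p * int n"] j F_add_period[of "c a" j]
      unfolding line_hh_Suc by simp
  next
    case False
    then have "even (line N' d' (hh (Suc a)) j) \<longleftrightarrow> even (line N d 0 j)"
      using S_reads[of a j] j by (simp add: line_hh)
    then show ?thesis using join_overlap(2)[OF joins, of a j] False j by simp
  qed
qed

lemma reads_2: "reads N' d' (hh (Suc a)) (c (Suc a)) (v a) (i (Suc a) + (2 * p * int n - m (Suc a)))"
  unfolding reads_def
proof (intro allI impI)
  fix j assume j: "v a \<le> j" "j < i (Suc a) + (2 * p * int n - m (Suc a))"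
  show "even (line N' d' (hh (Suc a)) j) \<longleftrightarrow> even (F (c (Suc a)) j)"
  proof (cases "j < i (Suc a)")
    case True
    then have "even (line N' d' (hh (Suc a)) j) \<longleftrightarrow> even (line N d 0 j)"
      using S_reads[of a j] j by (simp add: line_hh)
    then show ?thesis using join_overlap(1,2)[OF joins, of a j] True j by simp
  next
    case False
    then show ?thesis using readsD[OF reads_arc[of "Suc a"], of j] j by simp
  qed
qed

lemma read_join:
  shows "dt N' d' < 0 \<Longrightarrow> v a < i (Suc a) \<and> z (Suc a) = z a + int n * q"
    and "0 < dt N' d' \<Longrightarrow> v a = i (Suc a) \<and> z (Suc a) = z a + int n * q - 1"
proof -
  have pos: "0 < 2 * p * int n - m a" "0 < 2 * p * int n - m (Suc a)" using m_less by auto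
  have ex: "\<And>j. v a - (2 * p * int n - m a) \<le> j \<Longrightarrow> j < v a \<Longrightarrow>
      F (c a + 2 * p * (z a + int n * q)) j = line N' d' (hh (Suc a)) j"
    using z_exact_back unfolding v_length by blast
  have rb: "rich_on (c a) (v a - (2 * p * int n - m a)) (v a)" using A_rich_back[of a] unfolding v_length .
  note R = join_read[OF joins[of a] N' reads_1[of a] pos(1) rb reads_2[of a] pos(2), of "z a + int n * q"]
  have vi: "v a \<le> i (Suc a)" using l_nonneg[of a] i_Suc[of a] by simp
  show "v a < i (Suc a) \<and> z (Suc a) = z a + int n * q" if "dt N' d' < 0"
    using R(1)[OF _ that] ex z_unique[of "Suc a" "z a + int n * q"] pos(2) vi by auto
  show "v a = i (Suc a) \<and> z (Suc a) = z a + int n * q - 1" if "0 < dt N' d'"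
    using R(2)[OF _ that] ex z_unique[of "Suc a" "z a + int n * q - 1"] pos(2) vi by auto
qed

lemma last_mark0_face:
  obtains j where "v a \<le> j" "j < i a" "mark0 (c a) j" "i a \<le> j + p"
  using faceD(2)[OF faces[of a]] last_mark0 unfolding rich_on_def by metis

lemma first_mark1_face:
  obtains j where "v a \<le> j" "j < i a" "mark1 (c a) j" "j - p < v a"
  using faceD(2)[OF faces[of a]] first_mark1 unfolding rich_on_def by metis

lemma last_mark1_arc:
  obtains j where "i a - 2 * p * int n \<le> j" "j < v a" "mark1 (c a) j" "v a \<le> j + p"
  using A_rich_back[of a] last_mark1 unfolding rich_on_def by metis

lemma last_mark0_arc:
  obtains j where "i a - 2 * p * int n \<le> j" "j < v a" "mark0 (c a) j" "v a \<le> j + p"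
  using A_rich_back[of a] last_mark0 unfolding rich_on_def by metis

lemma first_mark0_arc:
  obtains j where "i a - 2 * p * int n \<le> j" "j < v a" "mark0 (c a) j" "j - p < i a - 2 * p * int n"
  using A_rich_back[of a] first_mark0 unfolding rich_on_def by metis

lemma first_mark1_arc:
  obtains j where "i a - 2 * p * int n \<le> j" "j < v a" "mark1 (c a) j" "j - p < i a - 2 * p * int n"
  using A_rich_back[of a] first_mark1 unfolding rich_on_def by metis

lemma face_exact: "v a \<le> j \<Longrightarrow> j < i a \<Longrightarrow> F (c a) j = line N d 0 j"
  using faceD(3)[OF faces[of a]] .

lemma mark0_shift: "mark0 (x + 2 * p * k) j \<longleftrightarrow> mark0 x j"
  by (rule mark0_cong) simp

lemma mark1_shift: "mark1 (x + 2 * p * k) j \<longleftrightarrow> mark1 x j"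
  unfolding mark1_mark0 using mark0_shift[of "x + 1" k j] by (simp add: algebra_simps)

text \<open>If neighbouring relator lines were further apart, \<open>cross_marks\<close> for the
  cycle and for the outer line, combined with \<open>span\<close> for one and the same relator on
  both sides, would give \<open>n < 2\<close>.\<close>

lemma kappa_one:
  assumes D': "dt N' d' < 0" shows "c (Suc a) = c a + 1"
proof (rule ccontr)
  assume ne: "c (Suc a) \<noteq> c a + 1"
  let ?c = "c a" and ?c' = "c (Suc a)"
  note J = joins[of a]
  have k: "1 \<le> ?c' - ?c - 1" using join_order(5)[OF J] ne by simp
  have d: "0 < d" "0 < d'" using N N' by (auto dest: in_rangeD)
  have zS: "z (Suc a) = z a + int n * q" using read_join(1)[OF D'] by blast
  obtain i1 where i1: "v a \<le> i1" "i1 < i a" "mark1 ?c i1" "i1 - p < v a" by (rule first_mark1_face)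
  obtain i0 where i0: "v (Suc a) \<le> i0" "i0 < i (Suc a)" "mark0 ?c' i0" "i (Suc a) \<le> i0 + p"
    by (rule last_mark0_face[of "Suc a"])
  obtain j1 where j1: "i a - 2 * p * int n \<le> j1" "j1 < v a" "mark1 ?c j1" "v a \<le> j1 + p" by (rule last_mark1_arc)
  have "i1 = j1 + p"
    by (rule window_unique[of "v a"]) (use i1 j1 dvd_sub_p[OF mark1_diff[OF i1(3) j1(3)]] p_pos in auto)
  have i0v: "i0 < v a" using join_overlap(4)[OF J, of i0] i0 by force
  obtain j0 where j0: "i (Suc a) \<le> j0" "j0 < v (Suc a) + 2 * p * int n" "mark0 ?c' j0" "j0 - p < i (Suc a)"
    using A_rich[of "Suc a"] first_mark0 unfolding rich_on_def by metis
  have "j0 = i0 + p"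
    by (rule window_unique[of "i (Suc a)"]) (use i0 j0 dvd_sub_p[OF mark0_diff[OF j0(3) i0(3)]] p_pos in auto)
  have A: "(?c' - ?c - 1) * d < (i1 - i0) * dt N d"
    using cross_marks[OF N i1(3) _ i0(3)] face_exact[of a i1] face_exact[of "Suc a" i0] i1 i0 by simp
  have B: "(?c' - ?c - 1) * d' < (j1 - j0) * dt N' d'"
  proof -
    have "F (?c + 2 * p * (z a + int n * q)) j1 = line N' d' (hh (Suc a)) j1"
      by (rule z_exact_back) (use j1 in auto)
    moreover have "F (?c' + 2 * p * (z a + int n * q)) j0 = line N' d' (hh (Suc a)) j0"
      using z_exact[of "Suc a" j0] j0 zS by simp
    ultimately have "((?c' + 2 * p * (z a + int n * q)) - (?c + 2 * p * (z a + int n * q)) - 1) * d' < (j1 - j0) * dt N' d'"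
      using cross_marks[OF N', of "?c + 2 * p * (z a + int n * q)" j1 "hh (Suc a)" "?c' + 2 * p * (z a + int n * q)" j0]
        j1(3) j0(3) mark0_shift mark1_shift by simp
    then show ?thesis by simp
  qed
  obtain r where r: "v a \<le> r" "r < i a" "mark0 ?c r" "i a \<le> r + p" by (rule last_mark0_face)
  obtain s where s: "i a - 2 * p * int n \<le> s" "s < v a" "mark0 ?c s" "s - p < i a - 2 * p * int n"
    by (rule first_mark0_arc)
  have rs: "s = r + p - 2 * p * int n"
  proof (rule window_unique[of "i a - 2 * p * int n"])
    have "p dvd s - r" by (rule mark0_diff[OF s(3) r(3)])
    moreover have "p dvd p * (1 - 2 * int n)" by simp
    ultimately have "p dvd (s - r) - p * (1 - 2 * int n)" by (rule dvd_diff)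
    then show "p dvd s - (r + p - 2 * p * int n)" by (simp add: algebra_simps)
  qed (use r s in auto)
  have C: "(r - i1) * dt N d < d"
    using span[OF N, of "v a" "i a" ?c 0 r i1] face_exact r i1 by blast
  have E: "(s - j1) * dt N' d' < d'"
    using span[OF N', of "i a - 2 * p * int n" "v a" "?c + 2 * p * (z a + int n * q)" "hh (Suc a)" s j1]
      z_exact_back s j1 mark0_shift mark1_shift by blast
  have dd: "d \<le> (?c' - ?c - 1) * d" "d' \<le> (?c' - ?c - 1) * d'"
    using k d mult_right_mono[of 1 "?c' - ?c - 1"] by auto
  have "(r - i1) * dt N d < (i1 - i0) * dt N d" using A C dd by linarith
  then have 1: "r - i1 < i1 - i0" using D by simp
  have "(s - j1) * dt N' d' < (j1 - j0) * dt N' d'" using B E dd by linarith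
  then have 2: "j1 - j0 < s - j1" using D' by simp
  have "2 * p * int n - 2 * p < 2 * p" using 1 2 rs \<open>i1 = j1 + p\<close> \<open>j0 = i0 + p\<close> by linarith
  then have "2 * p * int n < 2 * p * 2" by simp
  then have "int n < 2" using p_pos by simp
  then show False using n_ge by simp
qed

text \<open>The gap at the departures stays bounded over all turns. Hence positions and numbers of
  relator lines grow proportionally, and \<open>gap_read\<close> says the same for the outer
  line.\<close>

lemma gap_base: "- (p * dt N d) \<le> - (i a * dt N d) - d * c a" "- (i a * dt N d) - d * c a < d"
proof -
  have e: "gap N d 0 (c a) (i a) = - (i a * dt N d) - d * c a" by (simp add: gap_def dt_def algebra_simps)
  obtain r where r: "v a \<le> r" "r < i a" "mark0 (c a) r" "i a \<le> r + p" by (rule last_mark0_face)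
  have "0 \<le> gap N d 0 (c a) r" by (rule gap_mark0[OF N r(3) face_exact[OF r(1,2)]])
  moreover have "(i a - r) * dt N d \<le> p * dt N d" using r(4) D by (intro mult_right_mono) auto
  ultimately have "- (p * dt N d) \<le> gap N d 0 (c a) (i a)"
    using gap_diff[of N d 0 "c a" "i a" r] by linarith
  then show "- (p * dt N d) \<le> - (i a * dt N d) - d * c a" using e by simp
  obtain s where s: "v a \<le> s" "s < i a" "mark1 (c a) s" by (rule first_mark1_face)
  have "gap N d 0 (c a) s < d" by (rule gap_mark1[OF N s(3) face_exact[OF s(1,2)]])
  moreover have "0 \<le> (i a - s) * dt N d" using s(2) D by simp
  ultimately have "gap N d 0 (c a) (i a) < d"
    using gap_diff[of N d 0 "c a" "i a" s] by linarith
  then show "- (i a * dt N d) - d * c a < d" using e by simp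
qed

lemma gap_read:
  "\<bar>p * h' - t a * dt N' d' - d' * (c a + 2 * p * z a - (t a - i a) * q)\<bar> \<le> d' + p * \<bar>dt N' d'\<bar>"
proof -
  let ?c = "c a + 2 * p * z a"
  let ?g = "gap N' d' (hh a) ?c"
  have d': "d' > 0" using N' by (rule in_rangeD)
  have e: "?g (i a) = p * h' - t a * dt N' d' - d' * (?c - (t a - i a) * q)"
    by (simp add: gap_def dt_def hh_def algebra_simps)
  obtain r0 where r0: "i a \<le> r0" "r0 < v a + 2 * p * int n" "mark0 (c a) r0" "r0 - p < i a"
    using A_rich[of a] first_mark0 unfolding rich_on_def by metis
  obtain s0 where s0: "i a \<le> s0" "s0 < v a + 2 * p * int n" "mark1 (c a) s0" "s0 - p < i a"
    using A_rich[of a] first_mark1 unfolding rich_on_def by metis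
  have "0 \<le> ?g r0" using gap_mark0[OF N', of ?c r0 "hh a"] z_exact[of a r0] r0 mark0_shift by simp
  moreover have "?g s0 < d'" using gap_mark1[OF N', of ?c s0 "hh a"] z_exact[of a s0] s0 mark1_shift by simp
  moreover have "\<bar>(i a - r0) * dt N' d'\<bar> \<le> p * \<bar>dt N' d'\<bar>" "\<bar>(i a - s0) * dt N' d'\<bar> \<le> p * \<bar>dt N' d'\<bar>"
    unfolding abs_mult using r0 s0 by (intro mult_right_mono; simp)+
  ultimately have "\<bar>?g (i a)\<bar> \<le> d' + p * \<bar>dt N' d'\<bar>"
    using gap_diff[of N' d' "hh a" ?c "i a" r0] gap_diff[of N' d' "hh a" ?c "i a" s0] d' by linarith
  then show ?thesis unfolding e .
qed

text \<open>On average a turn moves back by \<open>d / dt N d\<close> on the cycle and forward by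
  \<open>d' / (- dt N' d')\<close> on the outer line. By \<open>t_i\<close> the two add up to the
  length of a relator.\<close>

lemma opposite_sides:
  assumes D': "dt N' d' < 0"
  shows "d' * dt N d + d * (- dt N' d') = 2 * p * int n * (dt N d * (- dt N' d'))"
proof -
  define E E' where "E = dt N d" and "E' = - dt N' d'"
  define K where "K = t 0 - i 0"
  have E: "0 < E" "0 < E'" using D D' unfolding E_def E'_def by auto
  have ca: "c a = c 0 + int a" for a by (induction a) (simp_all add: kappa_one[OF D'])
  have za: "z a = z 0 + int a * (int n * q)" for a
    by (induction a) (simp_all add: read_join(1)[OF D'] algebra_simps)
  define G1 where "G1 a = - (i a * E) - d * c a" for a
  define G2 where "G2 a = p * h' + t a * E' - d' * (c a + 2 * p * z a - (t a - i a) * q)" for a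
  have G1: "\<bar>G1 a\<bar> \<le> d + p * E" for a
  proof -
    have "0 < d" using N by (rule in_rangeD)
    moreover have "0 \<le> p * E" using E p_pos by simp
    ultimately show ?thesis using gap_base[of a] unfolding G1_def E_def by linarith
  qed
  have G2: "\<bar>G2 a\<bar> \<le> d' + p * E'" for a
  proof -
    have "\<bar>dt N' d'\<bar> = E'" using D' unfolding E'_def by simp
    then show ?thesis using gap_read[of a] unfolding G2_def E'_def by simp
  qed
  have i1: "i a * E = - G1 a - d * c 0 - d * int a" for a
    unfolding G1_def ca[of a] by (simp add: algebra_simps)
  have t1: "t a * E' = G2 a - p * h' + d' * (c 0 + 2 * p * z 0 - K * q) + d' * int a" for a
  proof -
    have "c a + 2 * p * z a - (t a - i a) * q = c 0 + 2 * p * z 0 - K * q + int a"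
      unfolding ca[of a] za[of a] t_i[of a] K_def[symmetric] by (simp add: algebra_simps)
    then show ?thesis unfolding G2_def by (simp only:) (simp add: algebra_simps)
  qed
  define Z where "Z = d' * E + d * E' - 2 * p * int n * (E * E')"
  have key: "int a * Z = E * E' * K - E * (G2 a - p * h' + d' * (c 0 + 2 * p * z 0 - K * q)) - E' * (G1 a + d * c 0)" for a
  proof -
    have "t a = i a + (K + 2 * p * int n * int a)" using t_i[of a] unfolding K_def by simp
    then have "E * (t a * E') = E' * (i a * E) + E * E' * (K + 2 * p * int n * int a)"
      by (simp add: algebra_simps)
    then show ?thesis unfolding t1 i1 Z_def by (simp add: algebra_simps)
  qed
  define X where "X = E * E' * K - E * (- p * h' + d' * (c 0 + 2 * p * z 0 - K * q)) - E' * (d * c 0)"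
  have key2: "int a * Z = X - E * G2 a - E' * G1 a" for a
    unfolding key X_def by (simp add: algebra_simps)
  have "Z = 0"
  proof (rule bounded_multiples_zero)
    fix a
    have "\<bar>E * G2 a\<bar> \<le> E * (d' + p * E')" "\<bar>E' * G1 a\<bar> \<le> E' * (d + p * E)"
      unfolding abs_mult using E G1[of a] G2[of a] by (simp_all add: mult_left_mono)
    then show "\<bar>int a * Z\<bar> \<le> \<bar>X\<bar> + E * (d' + p * E') + E' * (d + p * E)" unfolding key2 by linarith
  qed
  then show ?thesis unfolding Z_def E_def E'_def by simp
qed

text \<open>On the same side all joins are empty. The cycle bounds the distance \<open>k\<close> of
  neighbouring relator lines, the outer line bounds \<open>2 p - k\<close> in the same way, and the
  marks around one relator leave only \<open>n = 2\<close>. The inverse of \<open>q\<close> in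
  question is then 1 and \<open>k = p\<close>.\<close>

lemma same_side_faces:
  assumes D': "0 < dt N' d'"
  shows "n = 2" "c (Suc a) = c a + p" "m (Suc a) = 2 * p"
proof -
  have vi: "v a = i (Suc a)" for a using read_join(2)[OF D'] by blast
  have zS: "z (Suc a) = z a + int n * q - 1" for a using read_join(2)[OF D'] by blast
  have J: "join N d 0 (c a) (v a) (i a) (c (Suc a)) (v (Suc a)) (v a)" for a
    using joins[of a] unfolding vi[of a] .
  define k where "k a = c (Suc a) - c a" for a
  have k: "2 \<le> k a" "k a \<le> 2 * p - 2" for a using empty_join(5,6)[OF J] unfolding k_def by auto
  have s_bound: "(k a - 1) * y \<le> p - 1" if "p dvd y * q - 1" "y * dt N d < d" for y a
    using empty_join_bound(1)[OF J that] unfolding k_def .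
  have r_bound: "(2 * p - k a - 1) * y \<le> p - 1" if y: "p dvd y * q - 1" "y * dt N' d' < d'" for y a
  proof -
    let ?c = "c a + 2 * p * (z a + int n * q)" and ?c' = "c (Suc a) + 2 * p * z (Suc a)"
    \<comment> \<open>Neighbouring lifts differ by \<open>2 * p\<close>, so seen from outside the
      order is reversed and the distance is \<open>2 * p - k a\<close>.\<close>
    have cc: "?c - ?c' - 1 = 2 * p - k a - 1" unfolding zS k_def by (simp add: algebra_simps)
    obtain i0 where i0: "i a - 2 * p * int n \<le> i0" "i0 < v a" "mark0 (c a) i0" "v a \<le> i0 + p" by (rule last_mark0_arc)
    obtain i1 where i1: "v a \<le> i1" "i1 < v (Suc a) + 2 * p * int n" "mark1 (c (Suc a)) i1" "i1 - p < v a"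
      using A_rich[of "Suc a"] first_mark1 unfolding rich_on_def vi by metis
    have m: "mark0 ?c i0" "mark1 ?c' i1" using i0(3) i1(3) mark0_shift mark1_shift by auto
    have "(?c - ?c' - 1) * d' < (i1 - i0) * dt N' d'"
      using cross_marks[OF N' m(2) _ m(1), of "hh (Suc a)"] z_exact_back[of a i0] z_exact[of "Suc a" i1] i0 i1 vi[of a] by simp
    moreover have "p dvd (i1 - i0) * q - (?c - ?c' - 1)" by (rule cross_marks_cong[OF m(2,1)])
    moreover have "1 \<le> 2 * p - k a - 1" using k[of a] by simp
    ultimately have "(2 * p - k a - 1) * y + p \<le> i1 - i0"
      using lattice_bound[OF _ _ D' _ y] unfolding cc by blast
    then show ?thesis using i0(4) i1(4) by linarith
  qed
  have le: "y \<le> p - 1" if "w * y \<le> p - 1" "1 \<le> w" for w y :: int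
  proof (cases "0 \<le> y")
    case True
    then have "1 * y \<le> w * y" using that(2) by (intro mult_right_mono) auto
    then show ?thesis using that(1) by simp
  qed (use p_pos in simp)
  have zeta: "n = 2 \<and> (\<exists>y. y * dt N d < d \<and> y * dt N' d' < d' \<and> p dvd y * q - 1 \<and> 1 \<le> y \<and> y \<le> p - 1)" 
  proof -
    fix a
    obtain i1 where i1: "v a \<le> i1" "i1 < i a" "mark1 (c a) i1" "i1 - p < v a" by (rule first_mark1_face)
    obtain i0 where i0: "v a \<le> i0" "i0 < i a" "mark0 (c a) i0" "i a \<le> i0 + p" by (rule last_mark0_face)
    obtain j1 where j1: "i a - 2 * p * int n \<le> j1" "j1 < v a" "mark1 (c a) j1" "j1 - p < i a - 2 * p * int n"
      by (rule first_mark1_arc)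
    obtain j0 where j0: "i a - 2 * p * int n \<le> j0" "j0 < v a" "mark0 (c a) j0" "v a \<le> j0 + p" by (rule last_mark0_arc)
    let ?y = "i0 - i1" and ?y' = "j0 - j1"
    have y: "?y * dt N d < d" using span[OF N, of "v a" "i a" "c a" 0 i0 i1] face_exact i0 i1 by blast
    have y': "?y' * dt N' d' < d'"
      using span[OF N', of "i a - 2 * p * int n" "v a" "c a + 2 * p * (z a + int n * q)" "hh (Suc a)" j0 j1]
        z_exact_back j0 j1 mark0_shift mark1_shift by blast
    have inv: "p dvd ?y * q - 1" "p dvd ?y' * q - 1" "p dvd (j0 - i1) * q - 1" "p dvd (i0 - j1) * q - 1"
      using mark_gap_inverse i0(3) i1(3) j0(3) j1(3) by auto
    have y1: "?y \<le> p - 1" using le[OF s_bound[OF inv(1) y, of a]] k[of a] by simp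
    have y1': "?y' \<le> p - 1" using le[OF r_bound[OF inv(2) y', of a]] k[of a] by simp
    define r where "r = ?y mod p"
    have r: "1 \<le> r" "r \<le> p - 1"
      using inverse_not_zero[OF inv(1)] pos_mod_sign[OF p_pos, of ?y] pos_mod_bound[OF p_pos, of ?y]
      unfolding r_def by linarith+
    have cong: "x mod p = r" if "p dvd x * q - 1" for x
      using inverse_cong[OF that inv(1)] unfolding r_def by (simp add: mod_eq_dvd_iff)
    have "?y \<le> r" using mod_le_if[OF y1] unfolding r_def .
    have "?y' \<le> r" using mod_le_if[OF y1'] cong[OF inv(2)] by simp
    have low: "r - p * w \<le> x" if x: "p dvd x * q - 1" "- (p * w) < x" for x w
    proof -
      have "x mod p = (x + p * w) mod p" by simp
      then have "r = (x + p * w) mod p" using cong[OF x(1)] by simp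
      also have "\<dots> \<le> x + p * w" using x(2) by (intro zmod_le_nonneg_dividend) simp
      finally show ?thesis by simp
    qed
    have "r - p * 2 \<le> j0 - i1" by (rule low[OF inv(3)]) (use j0(4) i1(4) in simp)
    moreover have "r - p * (2 - 2 * int n) \<le> i0 - j1"
      by (rule low[OF inv(4)]) (use i0(4) j1(4) in \<open>simp add: algebra_simps\<close>)
    \<comment> \<open>The two distances just bounded have the sum \<open>?y + ?y'\<close>, and
      modulo \<open>p\<close> each of them is congruent to \<open>r\<close>.\<close>
    ultimately have sum: "2 * r + 2 * p * int n - 4 * p \<le> ?y + ?y'" by (simp add: algebra_simps)
    then have "2 * p * int n \<le> 2 * p * 2" using \<open>?y \<le> r\<close> \<open>?y' \<le> r\<close> by simp
    then have "int n \<le> 2" using p_pos by simp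
    then have n: "n = 2" using n_ge by simp
    then have "?y = r" "?y' = r" using sum \<open>?y \<le> r\<close> \<open>?y' \<le> r\<close> by auto
    then show ?thesis using n y y' inv r by auto
  qed
  then show "n = 2" by blast
  obtain y where y: "y * dt N d < d" "y * dt N' d' < d'" "p dvd y * q - 1" "1 \<le> y" "y \<le> p - 1"
    using zeta by blast
  \<comment> \<open>The bounds from inside and from outside are added, whereby \<open>k a\<close>
    cancels.\<close>
  have y1: "y = 1"
  proof -
    have "(2 * p - 2) * y \<le> (2 * p - 2) * 1"
      using s_bound[OF y(3,1), of 0] r_bound[OF y(3,2), of 0] by (simp add: algebra_simps)
    then show ?thesis using p_ge y(4) by simp
  qed
  have kp: "k a = p" for a using s_bound[OF y(3,1), of a] r_bound[OF y(3,2), of a] y1 by simp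
  then show "c (Suc a) = c a + p" unfolding k_def by (simp add: algebra_simps)
  have M: "mark1 (c a) (v a + p - 1)" "mark0 (c (Suc a)) (v a - p)" for a
    using empty_join_bound(2)[OF J y(3,1), of a] kp[of a] y1 unfolding k_def by auto
  let ?b = "Suc a"
  obtain i1 where i1: "v ?b \<le> i1" "i1 < i ?b" "mark1 (c ?b) i1" "i1 - p < v ?b" by (rule first_mark1_face)
  obtain i0 where i0: "v ?b \<le> i0" "i0 < i ?b" "mark0 (c ?b) i0" "i ?b \<le> i0 + p" by (rule last_mark0_face)
  have "i1 = v ?b + p - 1"
    by (rule window_unique[of "v ?b"]) (use i1 mark1_diff[OF i1(3) M(1)[of ?b]] p_pos in auto)
  moreover have "i0 = i ?b - p"
    by (rule window_unique[of "i ?b - p"]) (use i0 mark0_diff[OF i0(3) M(2)[of a]] p_pos vi[of a] in auto)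
  moreover have "i0 - i1 = 1"
  proof -
    have inv: "p dvd (i0 - i1) * q - 1" by (rule mark_gap_inverse[OF i0(3) i1(3)])
    have sp: "(i0 - i1) * dt N d < d" using span[OF N, of "v ?b" "i ?b" "c ?b" 0 i0 i1] face_exact i0 i1 by blast
    have le1: "i0 - i1 \<le> p - 1" using le[OF s_bound[OF inv sp, of a]] k[of a] by simp
    have c: "p dvd i0 - i1 - 1" using inverse_cong[OF inv y(3)] y1 by simp
    obtain j1 where j1: "i ?b - 2 * p * int n \<le> j1" "j1 < v ?b" "mark1 (c ?b) j1" "j1 - p < i ?b - 2 * p * int n"
      by (rule first_mark1_arc)
    obtain j0 where j0: "i ?b - 2 * p * int n \<le> j0" "j0 < v ?b" "mark0 (c ?b) j0" "v ?b \<le> j0 + p" by (rule last_mark0_arc)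
    have inv': "p dvd (j0 - j1) * q - 1" by (rule mark_gap_inverse[OF j0(3) j1(3)])
    have sp': "(j0 - j1) * dt N' d' < d'"
      using span[OF N', of "i ?b - 2 * p * int n" "v ?b" "c ?b + 2 * p * (z ?b + int n * q)" "hh (Suc ?b)" j0 j1]
        z_exact_back j0 j1 mark0_shift mark1_shift by blast
    have le2: "j0 - j1 \<le> p - 1" using le[OF r_bound[OF inv' sp', of a]] k[of a] by simp
    have c': "p dvd j0 - j1 - 1" using inverse_cong[OF inv' y(3)] y1 by simp
    have e1: "x \<le> 1" if "x \<le> p - 1" "p dvd x - 1" for x
    proof (rule ccontr)
      assume "\<not> x \<le> 1"
      then have "p \<le> x - 1" using zdvd_imp_le[OF that(2)] by simp
      then show False using that(1) by simp
    qed
    have "i0 - i1 + (j0 - j1) \<ge> 2"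
    proof -
      have cc: "p dvd (j0 - i1) - 1" "p dvd (i0 - j1) - 1"
        using inverse_cong[OF mark_gap_inverse[OF j0(3) i1(3)] y(3)]
          inverse_cong[OF mark_gap_inverse[OF i0(3) j1(3)] y(3)] y1 by auto
      have low: "1 - p * w \<le> x" if x: "p dvd x - 1" "- (p * w) < x" for x w
      proof (rule ccontr)
        assume "\<not> ?thesis"
        then have "0 \<le> x - 1 + p * w" "x - 1 + p * w < 0" using x(2) by linarith+
        then show False by simp
      qed
      have "1 - p * 2 \<le> j0 - i1" by (rule low[OF cc(1)]) (use j0(4) i1(4) in simp)
      moreover have "1 - p * (2 - 2 * int n) \<le> i0 - j1"
        by (rule low[OF cc(2)]) (use i0(4) j1(4) in \<open>simp add: algebra_simps\<close>)
      ultimately show ?thesis using \<open>n = 2\<close> by simp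
    qed
    then show ?thesis using e1[OF le1 c] e1[OF le2 c'] by linarith
  qed
  ultimately show "m (Suc a) = 2 * p" by linarith
qed

text \<open>Each turn recedes by \<open>2 * p\<close> letters and raises the relator line by
  \<open>p\<close>. Bounded gaps turn these rates into the slopes, both equal to
  \<open>(2 q - 1) / (2 p)\<close>.\<close>

lemma same_side:
  assumes D': "0 < dt N' d'" shows "d = 2 * dt N d" "d' = 2 * dt N' d'"
proof -
  note S = same_side_faces[OF D']
  have n2: "n = 2" by (rule S(1))
  have li: "l a = 0" for a using read_join(2)[OF D', of a] i_Suc[of a] by simp
  have c: "c (Suc a) = c 1 + p * int a" for a
  proof (induction a)
    case (Suc a)
    then show ?case using S(2)[of "Suc a"] by (simp add: algebra_simps)
  qed simp
  have i: "i (Suc a) = i 1 - 2 * p * int a" for a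
  proof (induction a)
    case (Suc a)
    then show ?case using i_Suc[of "Suc a"] S(3)[of a] li[of "Suc a"] by (simp add: algebra_simps)
  qed simp
  have z: "z (Suc a) = z 1 + (2 * q - 1) * int a" for a
  proof (induction a)
    case (Suc a)
    then show ?case using read_join(2)[OF D', of "Suc a"] n2 by (simp add: algebra_simps)
  qed simp
  have t: "t (Suc a) = t 1 + 2 * p * int a" for a
    using t_i[of "Suc a"] t_i[of 1] i[of a] n2 by (simp add: algebra_simps)
  have d: "0 < d" "0 < d'" using N N' by (auto dest: in_rangeD)
  have "p * (2 * dt N d - d) = 0"
  proof (rule bounded_multiples_zero)
    fix a
    have "int a * (p * (2 * dt N d - d)) = - (i (Suc a) * dt N d) - d * c (Suc a) + (i 1 * dt N d + d * c 1)"
      unfolding i[of a] c[of a] by (simp add: algebra_simps)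
    moreover have "0 \<le> p * dt N d" using D p_pos by simp
    ultimately show "\<bar>int a * (p * (2 * dt N d - d))\<bar> \<le> d + p * dt N d + \<bar>i 1 * dt N d + d * c 1\<bar>"
      using gap_base[of "Suc a"] d by linarith
  qed
  then show "d = 2 * dt N d" using p_pos by simp
  have "p * (d' - 2 * dt N' d') = 0"
  proof (rule bounded_multiples_zero)
    fix a
    let ?G = "\<lambda>a. p * h' - t a * dt N' d' - d' * (c a + 2 * p * z a - (t a - i a) * q)"
    have "int a * (p * (d' - 2 * dt N' d')) = ?G (Suc a) - ?G 1"
      unfolding i[of a] c[of a] t[of a] z[of a] by (simp add: algebra_simps)
    then show "\<bar>int a * (p * (d' - 2 * dt N' d'))\<bar> \<le> d' + p * \<bar>dt N' d'\<bar> + \<bar>?G 1\<bar>"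
      using gap_read[of "Suc a"] by linarith
  qed
  then show "d' = 2 * dt N' d'" using p_pos by simp
qed

end

section \<open>Faces with a complement that is not fat, and bridges between them\<close>

context heckoid begin

lemma rich_at: "rich (c + a * q) m \<longleftrightarrow> rich_on c a (a + int m)"
  using rich_iff_rich_on[of "c + a * q" m a] by simp

text \<open>If the marks of the face were closer, its complement would contain a mark of residue 0,
  later one of residue -1, and from there on a full window of \<open>p\<close> letters. Each cut
  then leaves a rich part.\<close>

lemma not_fat_span:
  assumes N: "in_range N d" and f: "face N d h c v e" and m: "e - v < 2 * p * int n"
    and nf: "\<not> fat (c + e * q) (nat (2 * p * int n - (e - v)))"
  shows "\<exists>y. p dvd y * q - 1 \<and> y * dt N d < d \<and> (2 * int n - 3) * p \<le> y"
proof -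
  obtain i1 where i1: "v \<le> i1" "i1 < e" "mark1 c i1" "i1 - p < v"
    using faceD(2)[OF f] first_mark1 unfolding rich_on_def by metis
  obtain i0 where i0: "v \<le> i0" "i0 < e" "mark0 c i0" "e \<le> i0 + p"
    using faceD(2)[OF f] last_mark0 unfolding rich_on_def by metis
  let ?L = "nat (2 * p * int n - (e - v))"
  have L: "e + int ?L = v + 2 * p * int n" using m by simp
  have "(2 * int n - 3) * p \<le> i0 - i1"
  proof (rule ccontr)
    assume "\<not> ?thesis"
    then have lt: "i0 - i1 < 2 * int n * p - 3 * p" by (simp add: algebra_simps)
    let ?A = "i0 + p * 1" and ?B = "i1 + p * (2 * int n - 2)" and ?B1 = "i1 + p * (2 * int n - 1)"
    have A: "mark0 c ?A" "e \<le> ?A" using mark0_add[of c i0 1] i0 by auto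
    have B: "mark1 c ?B" using mark1_add i1(3) by blast
    have AB: "?A < ?B" using lt by (simp add: algebra_simps)
    have B1: "?B + p < v + 2 * p * int n" using i1(4) by (simp add: algebra_simps)
    have "fat (c + e * q) ?L"
      unfolding fat_def
    proof (intro allI impI)
      fix t assume t: "t \<le> ?L"
      show "rich (c + e * q) t \<or> rich (c + e * q + int t * q) (?L - t)"
      proof (cases "?B < e + int t")
        case True
        then have "e \<le> ?A \<and> ?A < e + int t \<and> mark0 c ?A" "e \<le> ?B \<and> ?B < e + int t \<and> mark1 c ?B"
          using A B AB by linarith+
        then have "rich_on c e (e + int t)" unfolding rich_on_def by blast
        then show ?thesis using rich_at by simp
      next
        case False
        obtain j where j: "?B \<le> j" "j < ?B + p" "mark0 c j" by (rule mark0_in_window)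
        have L': "e + int t + int (?L - t) = v + 2 * p * int n" using t L by linarith
        have "e + int t \<le> j \<and> j < v + 2 * p * int n \<and> mark0 c j"
          "e + int t \<le> ?B \<and> ?B < v + 2 * p * int n \<and> mark1 c ?B"
          using False j B B1 p_pos by linarith+
        then have "rich_on c (e + int t) (e + int t + int (?L - t))"
          unfolding L' rich_on_def by blast
        then have "rich (c + (e + int t) * q) (?L - t)" unfolding rich_at .
        moreover have "c + e * q + int t * q = c + (e + int t) * q" by (simp add: algebra_simps)
        ultimately have "rich (c + e * q + int t * q) (?L - t)" by (simp only:)
        then show ?thesis ..
      qed
    qed
    then show False using nf by simp
  qed
  moreover have "(i0 - i1) * dt N d < d" using span[OF N faceD(3)[OF f] i0(3,1,2) i1(3,1,2)] .
  ultimately show ?thesis using mark_gap_inverse[OF i0(3) i1(3)] by blast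
qed

lemma not_rich_on_short: "\<not> rich_on c a b \<Longrightarrow> b - a \<le> p - 1"
proof (rule ccontr)
  assume nr: "\<not> rich_on c a b" and "\<not> b - a \<le> p - 1"
  then have ab: "a + p \<le> b" by simp
  obtain i where i: "a \<le> i" "i < a + p" "mark0 c i" by (rule mark0_in_window)
  obtain j where j: "a \<le> j" "j < a + p" "mark1 c j" by (rule mark1_in_window)
  have "i < b" "j < b" using i(2) j(2) ab by linarith+
  then show False using nr i(1,3) j(1,3) unfolding rich_on_def by blast
qed

lemma F_parity_eq:
  assumes "F c k = F c' k" "a \<le> k" "k < b" "\<And>i. a \<le> i \<Longrightarrow> i < b \<Longrightarrow> even (F c i) \<longleftrightarrow> even (F c' i)" "a \<le> i" "i < b"
  shows "F c i = F c' i"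
  by (rule steps_in_parity_eq[OF steps_F steps_F, where k = k and i = a and j = "b - 1" and t = i]) (use assms in simp_all)

end

context heckoid_pair begin

text \<open>The line of the bridging relator is squeezed strictly between those of \<open>c\<close>
  and \<open>c'\<close>, so it has no mark of residue 0 before \<open>w\<close> and none of residue
  -1 from \<open>v\<close> on. The remaining letters, read by the line of slope
  \<open>N' / d'\<close>, contain marks whose distance contradicts the bounds on
  \<open>pm\<close>.\<close>

lemma forbidden_bridge:
  assumes j: "join N d h c v e c' u w" and s: "slope N d" and s': "slope N' d'"
    and y: "p dvd y * q - 1" "y * dt N d < d" "(2 * int n - 3) * p \<le> y"
    and b: "\<And>i. v - k \<le> i \<Longrightarrow> i < v \<Longrightarrow> even (F b i) \<longleftrightarrow> even (F c i)"
      "\<And>i. v \<le> i \<Longrightarrow> i < w \<Longrightarrow> even (F b i) \<longleftrightarrow> even (line N d h i)"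
      "\<And>i. w \<le> i \<Longrightarrow> i < w + k' \<Longrightarrow> even (F b i) \<longleftrightarrow> even (F c' i)"
    and k: "0 < k" "0 < k'"
    and nr: "\<not> rich_on b (v - k) w" "\<not> rich_on b v (w + k')" and r: "rich_on b (v - k) (w + k')"
    and rd: "reads N' d' h' b (w + k') (v - k + 2 * p * int n)"
  shows False
proof -
  note J = joinD[OF j] and O = join_order[OF j]
  have n: "1 \<le> 2 * int n - 3" using n_ge by simp
  have "1 * p \<le> (2 * int n - 3) * p" by (rule mult_right_mono[OF n]) (use p_pos in simp)
  then have yp: "p \<le> y" using y(3) by simp
  have vw: "v < w"
  proof (rule ccontr)
    assume "\<not> v < w"
    then have "v = w" using J(6) by simp
    then have jv: "join N d h c v e c' u v" using j by simp
    have "1 * y \<le> (c' - c - 1) * y" using empty_join(5)[OF jv] yp p_pos by (intro mult_right_mono) auto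
    then show False using empty_join_bound(1)[OF jv y(1,2)] yp by simp
  qed
  obtain z where z: "\<And>i. v \<le> i \<Longrightarrow> i < w \<Longrightarrow> F (b + 2 * p * z) i = line N d h i"
    using exact_lift[OF J(1) vw, of h b] b(2) by blast
  define B where "B = b + 2 * p * z"
  have Bv: "F B v = F c v" "F B v = F c' v" using z[of v] join_overlap(1,2)[OF j, of v] vw unfolding B_def by auto
  have Bc: "F B i = F c i" if "v - k \<le> i" "i < w" for i
  proof (rule F_parity_eq[OF Bv(1), of "v - k" w])
    fix i assume i: "v - k \<le> i" "i < w"
    show "even (F B i) \<longleftrightarrow> even (F c i)"
      using b(1,2)[of i] i join_overlap(2)[OF j, of i] unfolding B_def F_shift by (cases "i < v") auto
  qed (use vw k that in auto)
  have Bc': "F B i = F c' i" if "v \<le> i" "i < w + k'" for i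
  proof (rule F_parity_eq[OF Bv(2), of v "w + k'"])
    fix i assume i: "v \<le> i" "i < w + k'"
    show "even (F B i) \<longleftrightarrow> even (F c' i)"
      using b(2,3)[of i] i join_overlap(1,2)[OF j, of i] unfolding B_def F_shift by (cases "i < w") auto
  qed (use vw k that in auto)
  have "F c w < F B w" using Bc'[of w] O(4) vw k by simp
  then have cB: "c < B" by (rule F_less)
  have "F B (v - 1) < F c' (v - 1)" using Bc[of "v - 1"] O(2) vw k by simp
  then have Bc_less: "B < c'" by (rule F_less)
  have no0: "\<not> mark0 B i" if "v - k \<le> i" "i < w" for i
    using mark0_less[of B i c] cB Bc[OF that] by auto
  have no1: "\<not> mark1 B i" if "v \<le> i" "i < w + k'" for i
    using mark1_less[of B i c'] Bc_less Bc'[OF that] by auto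
  have cong: "p dvd B - b" unfolding B_def by simp
  have nr': "\<not> rich_on B (v - k) w" "\<not> rich_on B v (w + k')" "rich_on B (v - k) (w + k')"
    using nr r rich_on_cong[OF cong] by auto
  have kp: "k < p" "k' < p" using not_rich_on_short[OF nr'(1)] not_rich_on_short[OF nr'(2)] J(6) by auto
  obtain a0 a1 where a0: "v - k \<le> a0" "a0 < w + k'" "mark0 B a0" and a1: "v - k \<le> a1" "a1 < w + k'" "mark1 B a1"
    using nr'(3) unfolding rich_on_def by blast
  have "w \<le> a0" using no0[of a0] a0 by force
  have "a1 < v" using no1[of a1] a1 by force
  have a1p: "w + k' \<le> a1 + p"
  proof (rule ccontr)
    assume "\<not> ?thesis"
    moreover have "mark1 B (a1 + p * 1)" using mark1_add a1(3) by blast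
    moreover have "v \<le> a1 + p" using a1(1) kp by linarith
    ultimately show False using no1[of "a1 + p"] by simp
  qed
  have a0p: "a0 - p < v - k"
  proof (rule ccontr)
    assume "\<not> ?thesis"
    moreover have "mark0 B (a0 + p * (- 1))" using mark0_add a0(3) by blast
    moreover have "a0 - p < w" using a0(2) kp by linarith
    ultimately show False using no0[of "a0 - p"] by simp
  qed
  have pn: "4 * p \<le> 2 * p * int n" using int_rlen rlen_ge by simp
  have N': "in_range N' d'" using s' unfolding slope_def by simp
  have len: "w + k' < v - k + 2 * p * int n" using a1p \<open>a1 < v\<close> kp pn p_pos by linarith
  obtain z' where z': "\<And>i. w + k' \<le> i \<Longrightarrow> i < v - k + 2 * p * int n \<Longrightarrow> F (b + 2 * p * z') i = line N' d' h' i"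
    using exact_lift[OF N' len, of h' b] rd unfolding reads_def by blast
  define B' where "B' = b + 2 * p * z'"
  have "p dvd B' - B" unfolding B'_def B_def by simp
  then have mk: "mark0 B' i \<longleftrightarrow> mark0 B i" "mark1 B' i \<longleftrightarrow> mark1 B i" for i
    using mark0_cong[of B' B i] mark0_cong[of "B' + 1" "B + 1" i] unfolding mark1_mark0 by auto
  have up0: "mark0 B' (a0 + p)" "mark0 B' (a0 - p + 2 * p * int n)" 
    and up1: "mark1 B' (a1 + p)" "mark1 B' (a1 - p + 2 * p * int n)"
    unfolding mk using a0(3) a1(3) mark0_add[of B a0 1] mark0_add[of B a0 "2 * int n - 1"]
      mark1_add[of B a1 1] mark1_add[of B a1 "2 * int n - 1"] by (simp_all add: algebra_simps)
  have ay: "p dvd (a0 - a1) * q - 1" by (rule mark_gap_inverse[OF a0(3) a1(3)])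
  have pmc: "p dvd pm - (a0 - a1)" by (rule inverse_cong[OF pm_q ay])
  then obtain B2 where B2: "pm - (a0 - a1) = p * B2" by (elim dvdE)
  have range: "0 < a0 - a1" "a0 - a1 < p" using \<open>w \<le> a0\<close> \<open>a1 < v\<close> J(6) a0(2) a1p by linarith+
  show False
  proof (cases "0 < dt N' d'")
    case True
    have "(a0 - p + 2 * p * int n - (a1 + p)) * dt N' d' < d'"
      by (rule span[where a = "w + k'" and b = "v - k + 2 * p * int n", OF N' z'[folded B'_def] up0(2) _ _ up1(1)])
        (use a0p a1p \<open>w \<le> a0\<close> \<open>a1 < v\<close> kp pn p_pos in linarith)+
    moreover have "d' \<le> pm * dt N' d'" using s' True unfolding slope_def by blast
    ultimately have "(a0 - p + 2 * p * int n - (a1 + p)) * dt N' d' < pm * dt N' d'" by linarith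
    then have "a0 - a1 + 2 * p * int n - 2 * p < pm" using True by simp
    then have "p * (2 * int n - 2) < p * B2" using B2 by (simp add: algebra_simps)
    then have "2 * int n - 2 < B2" using p_pos by simp
    then have "2 * int n - 1 \<le> B2" by simp
    then have "p * (2 * int n - 1) \<le> p * B2" using p_pos by simp
    then show False using B2 pm_less range by (simp add: algebra_simps)
  next
    case False
    then have D': "dt N' d' < 0" using s' unfolding slope_def by simp
    have "(a0 + p - (a1 - p + 2 * p * int n)) * dt N' d' < d'"
      by (rule span[where a = "w + k'" and b = "v - k + 2 * p * int n", OF N' z'[folded B'_def] up0(1) _ _ up1(2)])
        (use a0 a1 a0p a1p \<open>w \<le> a0\<close> \<open>a1 < v\<close> J(6) kp pn p_pos in linarith)+
    moreover have "d' \<le> pp * (- dt N' d')" using s' D' unfolding slope_def by blast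
    ultimately have "(a1 - p + 2 * p * int n - (a0 + p)) * (- dt N' d') < pp * (- dt N' d')"
      by (simp add: algebra_simps)
    then have "a1 - p + 2 * p * int n - (a0 + p) < pp" using D' by simp
    then have "pm < 2 * p + (a0 - a1)" using pm_pp by (simp add: algebra_simps)
    then have "p * B2 < p * 2" using B2 by simp
    then have "B2 < 2" using p_pos by simp
    then have "p * B2 \<le> p * 1" using p_pos by simp
    then have pm1: "pm < 2 * p" using B2 range by linarith
    \<comment> \<open>On the right side the outer line yields only \<open>pm < 2 * p\<close>. The
      contradiction needs the long face of the cycle: its inverse \<open>y\<close> is at least
      \<open>p\<close>, less than \<open>pm\<close> and congruent to it.\<close>
    have "d \<le> pm * dt N d" using s J(2) unfolding slope_def by blast
    then have "y * dt N d < pm * dt N d" using y(2) by linarith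
    then have "y < pm" using J(2) by simp
    moreover have "p dvd pm - y" by (rule inverse_cong[OF pm_q y(1)])
    ultimately have "p \<le> pm - y" using zdvd_imp_le by simp
    then show False using pm1 yp by linarith
  qed
qed

end

context heckoid begin

lemma line_reflect: "in_range N d \<Longrightarrow> even (line N d (- 1 - h) (- i)) \<longleftrightarrow> odd (line N d h i)"
proof -
  assume "in_range N d"
  then have d: "d > 0" by (rule in_rangeD)
  have "- 1 - h + - i * N = - 1 - (h + i * N)" by simp
  then have "line N d (- 1 - h) (- i) = - 1 - line N d h i"
    unfolding line_def using minus_one_minus_div[OF d] by (simp only:)
  then show ?thesis by simp
qed

lemma line_add: "line N d h (i + k) = line N d (h + k * N) i"
  unfolding line_def by (simp add: algebra_simps)

lemma line_period: "in_range N d \<Longrightarrow> line N d h (i + 2 * d * k) = line N d h i + 2 * (k * N)"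
  using line_shift[of N d h "k * N" i] unfolding line_add[of N d h i "2 * d * k"] by (simp add: mult.assoc)

lemma fat_reflect: "fat (- 1 - x - (int m - 1) * q) m \<longleftrightarrow> fat x m"
proof -
  have 1: "fat x m" if f: "fat (- 1 - x - (int m - 1) * q) m" for x
    unfolding fat_def
  proof (intro allI impI)
    fix t assume t: "t \<le> m"
    let ?y = "- 1 - x - (int m - 1) * q"
    have "?y = - 1 - (x + int t * q) - (int (m - t) - 1) * q" using t by (simp add: of_nat_diff algebra_simps)
    then have "rich ?y (m - t) \<longleftrightarrow> rich (x + int t * q) (m - t)"
      using rich_reflect[of "x + int t * q" "m - t"] by (simp only:)
    moreover have "?y + int (m - t) * q = - 1 - x - (int t - 1) * q" using t by (simp add: of_nat_diff algebra_simps)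
    then have "rich (?y + int (m - t) * q) (m - (m - t)) \<longleftrightarrow> rich x t"
      using rich_reflect[of x t] t by (simp only: diff_diff_cancel)
    ultimately show "rich x t \<or> rich (x + int t * q) (m - t)"
      using f t unfolding fat_def by (meson diff_le_self)
  qed
  have "- 1 - (- 1 - x - (int m - 1) * q) - (int m - 1) * q = x" by simp
  then show ?thesis using 1[of x] 1[of "- 1 - x - (int m - 1) * q"] by (simp only:) blast
qed

end

section \<open>The cycle of a slope\<close>

locale base = heckoid_pair +
  fixes N d :: int
  assumes slope_base: "slope N d" and dt_pos: "0 < dt N d"
begin

lemma N: "in_range N d" using slope_base unfolding slope_def by blast

abbreviation bs :: "int \<Rightarrow> node" where "bs i \<equiv> Base (i mod (2 * d))"
abbreviation cd :: "int \<Rightarrow> bool" where "cd i \<equiv> even (line N d 0 i)"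

definition cyc :: graph where
  "cyc = range (\<lambda>i. (bs i, odd i, cd i, bs (i + 1))) \<union> range (\<lambda>i. (bs (i + 1), odd i, \<not> cd i, bs i))"

definition cycV :: "node set" where "cycV = range bs"

lemma bs_eqD:
  assumes "bs i = bs j" shows "odd i = odd j" "cd (i + k) = cd (j + k)" "bs (i + k) = bs (j + k)"
proof -
  have "i mod (2 * d) = j mod (2 * d)" using assms by simp
  then have "2 * d dvd i - j" by (simp add: mod_eq_dvd_iff)
  then obtain z where "i - j = 2 * d * z" by (elim dvdE)
  then have z: "i = j + 2 * d * z" by simp
  show "odd i = odd j" using z by simp
  have e: "i + k = (j + k) + 2 * d * z" using z by simp
  show "cd (i + k) = cd (j + k)" unfolding e line_period[OF N] by simp
  show "bs (i + k) = bs (j + k)" unfolding e by simp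
qed

lemma bs_in [simp]: "bs i \<in> cycV" by (simp add: cycV_def)

text \<open>The length \<open>2 * d\<close> of the cycle is even, so positions have a parity, and at
  each vertex one type leads forward and the other backward.\<close>

lemma cyc_out: "(bs i, e, b, u) \<in> cyc \<longleftrightarrow>
    (if odd i = e then b = cd i \<and> u = bs (i + 1) else b = (\<not> cd (i - 1)) \<and> u = bs (i - 1))"
proof
  assume "(bs i, e, b, u) \<in> cyc"
  then consider j where "bs i = bs j" "e = odd j" "b = cd j" "u = bs (j + 1)"
    | j where "bs i = bs (j + 1)" "e = odd j" "b = (\<not> cd j)" "u = bs j"
    unfolding cyc_def by auto
  then show "if odd i = e then b = cd i \<and> u = bs (i + 1) else b = (\<not> cd (i - 1)) \<and> u = bs (i - 1)"
  proof cases
    case 1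
    show ?thesis using 1(2-4) bs_eqD(1)[OF 1(1)] bs_eqD(2)[OF 1(1), of 0] bs_eqD(3)[OF 1(1), of 1] by simp
  next
    case 2
    have "odd i = odd (j + 1)" by (rule bs_eqD(1)[OF 2(1)])
    then show ?thesis using 2(2-4) bs_eqD(2,3)[OF 2(1), of "- 1"] by simp
  qed
next
  assume a: "if odd i = e then b = cd i \<and> u = bs (i + 1) else b = (\<not> cd (i - 1)) \<and> u = bs (i - 1)"
  show "(bs i, e, b, u) \<in> cyc"
  proof (cases "odd i = e")
    case True
    then have "(bs i, e, b, u) = (bs i, odd i, cd i, bs (i + 1))" using a by simp
    then show ?thesis unfolding cyc_def by blast
  next
    case False
    then have "(bs i, e, b, u) = (bs (i - 1 + 1), odd (i - 1), \<not> cd (i - 1), bs (i - 1))" using a by auto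
    then show ?thesis unfolding cyc_def by blast
  qed
qed

lemma cyc_V: "(v, e, b, u) \<in> cyc \<Longrightarrow> v \<in> cycV" "(v, e, b, u) \<in> cyc \<Longrightarrow> u \<in> cycV"
  unfolding cyc_def by auto

lemma cyc_V_obtain: assumes "v \<in> cycV" obtains i where "v = bs i"
  using assms unfolding cycV_def by blast

lemma graph_on_cyc: "graph_on cycV cyc"
  unfolding graph_on_def
proof (intro conjI allI impI)
  fix v e b w assume "(v, e, b, w) \<in> cyc"
  then show "v \<in> cycV" "(w, e, \<not> b, v) \<in> cyc" unfolding cyc_def by auto
next
  fix v e b w w' assume *: "(v, e, b, w) \<in> cyc" "(v, e, b, w') \<in> cyc"
  then obtain i where "v = bs i" using cyc_V cyc_V_obtain by metis
  then show "w = w'" using * cyc_out by (metis (full_types))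
qed

lemma fresh_for_cyc: "fresh_for cycV cyc" unfolding fresh_for_def cycV_def by auto

lemma odd_add_tp: "odd i = e \<Longrightarrow> odd (i + int j) = tp e j" "odd i \<noteq> e \<Longrightarrow> odd (i - int j) \<noteq> tp e j"
  by (auto simp: tp_def)

lemma cyc_walk_forward:
  assumes P: "rwalk cyc e x m P" "P 0 = bs i" "odd i = e"
  shows "j \<le> m \<Longrightarrow> P j = bs (i + int j)" "j < m \<Longrightarrow> sg (x + int j * q) = cd (i + int j)"
proof -
  have A: "P j = bs (i + int j)" if "j \<le> m" for j
    using that
  proof (induction j)
    case (Suc j)
    then have "(bs (i + int j), tp e j, sg (x + int j * q), P (Suc j)) \<in> cyc"
      using rwalkD[OF P(1), of j] by simp
    then show ?case unfolding cyc_out using odd_add_tp(1)[OF P(3)] by (simp add: algebra_simps)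
  qed (use P in simp)
  then show "j \<le> m \<Longrightarrow> P j = bs (i + int j)" .
  assume "j < m"
  then have "(bs (i + int j), tp e j, sg (x + int j * q), P (Suc j)) \<in> cyc"
    using rwalkD[OF P(1), of j] A[of j] by simp
  then show "sg (x + int j * q) = cd (i + int j)" unfolding cyc_out using odd_add_tp(1)[OF P(3)] by simp
qed

lemma cyc_walk_backward:
  assumes P: "rwalk cyc e x m P" "P 0 = bs i" "odd i \<noteq> e"
  shows "j \<le> m \<Longrightarrow> P j = bs (i - int j)" "j < m \<Longrightarrow> sg (x + int j * q) = (\<not> cd (i - 1 - int j))"
proof -
  have A: "P j = bs (i - int j)" if "j \<le> m" for j
    using that
  proof (induction j)
    case (Suc j)
    then have "(bs (i - int j), tp e j, sg (x + int j * q), P (Suc j)) \<in> cyc"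
      using rwalkD[OF P(1), of j] by simp
    then show ?case unfolding cyc_out using odd_add_tp(2)[OF P(3)] by (simp add: algebra_simps)
  qed (use P in simp)
  then show "j \<le> m \<Longrightarrow> P j = bs (i - int j)" .
  assume "j < m"
  then have "(bs (i - int j), tp e j, sg (x + int j * q), P (Suc j)) \<in> cyc"
    using rwalkD[OF P(1), of j] A[of j] by simp
  then have "sg (x + int j * q) = (\<not> cd (i - int j - 1))"
    unfolding cyc_out using odd_add_tp(2)[OF P(3), of j] by (simp split: if_splits)
  moreover have "i - int j - 1 = i - 1 - int j" by simp
  ultimately show "sg (x + int j * q) = (\<not> cd (i - 1 - int j))" by (simp only:)
qed

lemma cyc_start: 
  assumes "rwalk cyc e x m P" "P m \<in> cycV" obtains i where "P 0 = bs i"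
  using rwalk_start_in[OF graph_on_cyc assms] cyc_V_obtain by metis

lemma cyc_no_long:
  assumes P: "rwalk cyc e x m P" shows "m < rlen \<and> rich (x + int m * q) (rlen - m)"
proof (cases "m = 0")
  case True
  have "p \<le> int rlen" using rlen_ge p_pos by linarith
  moreover from this have "0 < rlen" using p_pos by linarith
  ultimately show ?thesis using True rich_long[of rlen] by simp
next
  case False
  then have "(P 0, tp e 0, sg (x + int 0 * q), P (Suc 0)) \<in> cyc" using rwalkD[OF P, of 0] by simp
  then obtain i where i: "P 0 = bs i" using cyc_V(1) cyc_V_obtain by metis
  show ?thesis
  proof (cases "odd i = e")
    case True
    have "\<forall>j<m. cd (i + int j) = sg (x + int j * q)" using cyc_walk_forward(2)[OF P i True] by simp
    then show ?thesis using no_long_line[OF slope_base, of 0] unfolding no_long_def by metis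
  next
    case False
    have "even (line N d (- 1) (1 - i + int j)) = sg (x + int j * q)" if "j < m" for j
    proof -
      have "even (line N d (- 1 - 0) (- (i - 1 - int j))) \<longleftrightarrow> odd (line N d 0 (i - 1 - int j))"
        by (rule line_reflect[OF N])
      then show ?thesis using cyc_walk_backward(2)[OF P i False that] by (simp add: algebra_simps)
    qed
    then have "\<forall>j<m. even (line N d (- 1) (1 - i + int j)) = sg (x + int j * q)" by blast
    then show ?thesis using no_long_line[OF slope_base, of "- 1"] unfolding no_long_def by metis
  qed
qed

lemma cyc_bounded: "bounded_back cyc f"
proof (cases f)
  case (fields v e x)
  show ?thesis unfolding bounded_back_def back_walk_def fields prod.case using cyc_no_long by blast
qed

text \<open>The type at the common end decides from which side both walks arrive, so they run over
  the same edges.\<close>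

lemma cyc_back_agree:
  assumes Q: "rwalk cyc e x k Q" and Q': "rwalk cyc e y k Q'" and v: "Q k = Q' k" "Q k \<in> cycV" and l: "l < k"
  shows "sg (x + int l * q) = sg (y + int l * q)"
proof -
  obtain i where i: "Q 0 = bs i" using cyc_start[OF Q v(2)] by metis
  obtain i' where i': "Q' 0 = bs i'" using cyc_start[OF Q'] v by metis
  show ?thesis
  proof (cases "odd i = e"; cases "odd i' = e")
    assume o: "odd i = e" "odd i' = e"
    have "bs (i + int k) = bs (i' + int k)"
      using cyc_walk_forward(1)[OF Q i o(1), of k] cyc_walk_forward(1)[OF Q' i' o(2), of k] v by simp
    from bs_eqD(2)[OF this, of "int l - int k"] show ?thesis
      using cyc_walk_forward(2)[OF Q i o(1) l] cyc_walk_forward(2)[OF Q' i' o(2) l] by simp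
  next
    assume o: "odd i \<noteq> e" "odd i' \<noteq> e"
    have "bs (i - int k) = bs (i' - int k)"
      using cyc_walk_backward(1)[OF Q i o(1), of k] cyc_walk_backward(1)[OF Q' i' o(2), of k] v by simp
    from bs_eqD(2)[OF this, of "int k - 1 - int l"] have "cd (i - 1 - int l) = cd (i' - 1 - int l)"
      by (simp add: algebra_simps)
    then show ?thesis
      using cyc_walk_backward(2)[OF Q i o(1) l] cyc_walk_backward(2)[OF Q' i' o(2) l] by simp
  next
    assume o: "odd i = e" "odd i' \<noteq> e"
    have "bs (i + int k) = bs (i' - int k)"
      using cyc_walk_forward(1)[OF Q i o(1), of k] cyc_walk_backward(1)[OF Q' i' o(2), of k] v by simp
    then have "odd (i + int k) = odd (i' - int k)" by (rule bs_eqD(1))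
    then have "odd i = odd i'" by auto
    then show ?thesis using o by simp
  next
    assume o: "odd i \<noteq> e" "odd i' = e"
    have "bs (i - int k) = bs (i' + int k)"
      using cyc_walk_backward(1)[OF Q i o(1), of k] cyc_walk_forward(1)[OF Q' i' o(2), of k] v by simp
    then have "odd (i - int k) = odd (i' + int k)" by (rule bs_eqD(1))
    then have "odd i = odd i'" by auto
    then show ?thesis using o by simp
  qed
qed

lemma cyc_back_unique:
  assumes e: "(v, e, x) \<in> exits cycV cyc" "(v, e, y) \<in> exits cycV cyc"
    and P: "back_walk cyc (v, e, x) m P" "p \<le> int m" and P': "back_walk cyc (v, e, y) m' P'" "p \<le> int m'"
  shows "x = y"
proof -
  define k where "k = nat p"
  have k: "k \<le> m" "k \<le> m'" using P(2) P'(2) unfolding k_def by simp_all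
  obtain Q where Q: "rwalk cyc (tp e k) (x - int k * q) k Q" "Q k = v"
    using back_walk_mono[OF P(1) k(1)] unfolding back_walk_def by auto
  obtain Q' where Q': "rwalk cyc (tp e k) (y - int k * q) k Q'" "Q' k = v"
    using back_walk_mono[OF P'(1) k(2)] unfolding back_walk_def by auto
  have v: "v \<in> cycV" using e unfolding exits_def by simp
  have eq: "sg (x - int k * q + int l * q) = sg (y - int k * q + int l * q)" if l: "l < k" for l
    by (rule cyc_back_agree[OF Q(1) Q'(1) _ _ l]) (use Q(2) Q'(2) v in simp_all)
  have "rich (x - int k * q) k" by (rule rich_long) (use p_pos in \<open>simp add: k_def\<close>)
  then have "2 * p dvd (x - int k * q) - (y - int k * q)" using eq by (rule rich_determines)
  then show ?thesis using exits_eq[OF e] by simp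
qed

text \<open>Relator cycles whose missing part is not fat. There is at most one of them at each node and type,
  so that they can be attached before all others without being identified by their letters.\<close>

definition bad :: "flag set" where
  "bad = {f \<in> exits cycV cyc. \<not> fat (snd (snd f)) (rlen - blen cyc f)}"

lemma bad_blen: "f \<in> bad \<Longrightarrow> int rlen - 2 * p + 1 < int (blen cyc f)"
proof -
  assume f: "f \<in> bad"
  have "blen cyc f < rlen" by (rule blen_walk(2)[OF cyc_bounded])
  moreover have "\<not> 2 * p - 1 \<le> int (rlen - blen cyc f)"
    using f fat_long[of "rlen - blen cyc f"] unfolding bad_def by blast
  ultimately show ?thesis by linarith
qed

lemma bad_rich_back: "(v, e, x) \<in> bad \<Longrightarrow> p \<le> int (blen cyc (v, e, x))"
  using bad_blen[of "(v, e, x)"] rlen_ge p_pos by linarith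

lemma bad_unique: "(v, e, x) \<in> bad \<Longrightarrow> (v, e, y) \<in> bad \<Longrightarrow> x = y"
  using cyc_back_unique[OF _ _ blen_walk(1)[OF cyc_bounded] _ blen_walk(1)[OF cyc_bounded]] bad_rich_back
  unfolding bad_def by blast

lemma bad_rich: "(v, e, x) \<in> bad \<Longrightarrow> rich x (rlen - blen cyc (v, e, x))"
  using cyc_no_long[of "tp e (blen cyc (v, e, x))" "x - int (blen cyc (v, e, x)) * q" "blen cyc (v, e, x)"]
    blen_walk(1)[OF cyc_bounded, of "(v, e, x)"] unfolding back_walk_def by auto

lemma bad_par: "f \<in> bad \<Longrightarrow> par_of cyc f \<in> bad"
proof -
  assume f: "f \<in> bad"
  obtain v e x where fe: "f = (v, e, x)" by (cases f)
  have ex: "(v, e, x) \<in> exits cycV cyc" using f fe unfolding bad_def by simp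
  obtain v' e' x' where g: "par_of cyc (v, e, x) = (v', e', x')" by (cases "par_of cyc (v, e, x)")
  let ?L = "rlen - blen cyc (v, e, x)"
  have "blen cyc (v, e, x) \<le> rlen" using blen_walk(2)[OF cyc_bounded] by (rule less_imp_le)
  then have "2 * p dvd x' - (- 1 - x - (int ?L - 1) * q)" using par_of_phase[of cyc v e x] g by simp
  then have "fat x' ?L \<longleftrightarrow> fat (- 1 - x - (int ?L - 1) * q) ?L" by (rule fat_cong)
  also have "\<dots> \<longleftrightarrow> fat x ?L" by (rule fat_reflect)
  finally have "\<not> fat x' ?L" using f fe unfolding bad_def by simp
  then show ?thesis
    using par_of_exits[OF graph_on_cyc ex cyc_bounded] blen_par[OF graph_on_cyc ex cyc_bounded]
    unfolding bad_def fe g by simp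
qed

sublocale pre: attach q p n cycV cyc bad
proof
  show "graph_on cycV cyc" "fresh_for cycV cyc" by (rule graph_on_cyc, rule fresh_for_cyc)
  show "bad \<subseteq> exits cycV cyc" unfolding bad_def by blast
  show "bounded_back cyc f" for f by (rule cyc_bounded)
  show "f \<in> bad \<Longrightarrow> par_of cyc f \<in> bad" for f by (rule bad_par)
  fix f assume f: "f \<in> bad"
  \<comment> \<open>With at most one bad flag per vertex and type nothing has to be told apart, so
    the joining edge may be placed at once, at 0.\<close>
  have det: "determines bad g k" if "g \<in> bad" for g k
    using that bad_unique unfolding determines_def by (cases g) auto
  have "splits cyc bad f 0"
    unfolding splits_def using det f bad_par blen_walk(2)[OF cyc_bounded, of f] by simp
  then show "\<exists>k. splits cyc bad f k" ..
qed

text \<open>Translates a maximal relator walk on the cycle into lattice terms: the edges missing at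
  its two ends are the deviations of the line from the relator at both ends of the face.\<close>

lemma cyc_face:
  assumes P: "back_walk cyc (bs w, odd w, x) m P" and r: "rich (x - int m * q) m"
    and out: "\<not> (\<exists>u. (bs w, odd w, sg x, u) \<in> cyc)"
    and inn: "\<not> (\<exists>u. (P 0, \<not> tp (odd w) m, \<not> sg (x - int m * q - q), u) \<in> cyc)"
  obtains c where "face N d 0 c (w - int m) w" "2 * p dvd x - (c + w * q)" "P 0 = bs (w - int m)"
     "\<And>j. j \<le> m \<Longrightarrow> P j = bs (w - int m + int j)"
proof -
  have W: "rwalk cyc (tp (odd w) m) (x - int m * q) m P" "P m = bs w" using P unfolding back_walk_def by auto
  obtain i where i: "P 0 = bs i" using cyc_start[OF W(1)] W(2) by auto
  have o: "odd i = tp (odd w) m"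
  proof (rule ccontr)
    assume *: "odd i \<noteq> tp (odd w) m"
    have "bs w = bs (i - int m)" using cyc_walk_backward(1)[OF W(1) i *, of m] W(2) by simp
    then have "odd w = odd (i - int m)" by (rule bs_eqD(1))
    then show False using * by (auto simp: tp_def)
  qed
  have "bs w = bs (i + int m)" using cyc_walk_forward(1)[OF W(1) i o, of m] W(2) by simp
  note w = bs_eqD(2,3)[OF this]
  define v where "v = w - int m"
  have v: "P 0 = bs v" using w(2)[of "- int m"] i unfolding v_def by simp
  have ov: "odd v = tp (odd w) m" unfolding v_def by (auto simp: tp_def)
  have Pj: "P j = bs (v + int j)" if "j \<le> m" for j using cyc_walk_forward(1)[OF W(1) v ov that] .
  have m0: "0 < m" using rich_imp_pos[OF r] .
  define c0 where "c0 = x - w * q"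
  have par: "even (line N d 0 j) \<longleftrightarrow> even (F c0 j)" if "v \<le> j" "j < w" for j
  proof -
    have j: "j = v + int (nat (j - v))" "nat (j - v) < m" using that unfolding v_def by auto
    have "sg (x - int m * q + int (nat (j - v)) * q) = cd j"
      using cyc_walk_forward(2)[OF W(1) v ov j(2)] unfolding j(1)[symmetric] .
    moreover have "x - int m * q + int (nat (j - v)) * q = c0 + j * q"
      using that unfolding c0_def v_def by (simp add: algebra_simps)
    ultimately show ?thesis using sg_F[of c0 j] by simp
  qed
  have vw: "v < w" using m0 unfolding v_def by simp
  obtain z where z: "\<And>j. v \<le> j \<Longrightarrow> j < w \<Longrightarrow> F (c0 + 2 * p * z) j = line N d 0 j"
    using exact_lift[OF N vw par] by blast
  have 1: "sg x \<noteq> cd w" using out cyc_out[of w "odd w" "sg x"] by auto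
  have "sg x \<longleftrightarrow> even (F c0 w)" using sg_F[of c0 w] unfolding c0_def by simp
  then have 1: "even (line N d 0 w) \<longleftrightarrow> odd (F (c0 + 2 * p * z) w)" using 1 unfolding F_shift by auto
  have "\<not> (\<not> sg (x - int m * q - q) \<longleftrightarrow> \<not> cd (v - 1))"
    using inn cyc_out[of v "\<not> tp (odd w) m" "\<not> sg (x - int m * q - q)"] ov v by auto
  moreover have "x - int m * q - q = c0 + (v - 1) * q" unfolding c0_def v_def by (simp add: algebra_simps)
  then have "sg (x - int m * q - q) \<longleftrightarrow> even (F c0 (v - 1))" using sg_F[of c0 "v - 1"] by simp
  ultimately have 2: "even (line N d 0 (v - 1)) \<longleftrightarrow> odd (F (c0 + 2 * p * z) (v - 1))" unfolding F_shift by auto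
  have "x - int m * q - v * q = c0" unfolding c0_def v_def by (simp add: algebra_simps)
  then have "rich_on c0 v w" using r unfolding rich_iff_rich_on[of _ m v] v_def by simp
  moreover have "p dvd c0 + 2 * p * z - c0" by simp
  ultimately have 3: "rich_on (c0 + 2 * p * z) v w" using rich_on_cong by blast
  have "face N d 0 (c0 + 2 * p * z) v w" unfolding face_def using vw 1 2 3 z by blast
  moreover have "2 * p dvd x - (c0 + 2 * p * z + w * q)" unfolding c0_def by simp
  ultimately show ?thesis using that[of "c0 + 2 * p * z"] v Pj unfolding v_def by simp
qed

lemma exit_face:
  assumes f: "(bs w, odd w, x) \<in> exits cycV cyc" and m: "m = blen cyc (bs w, odd w, x)" and r: "rich (x - int m * q) m"
  obtains c where "face N d 0 c (w - int m) w" "2 * p dvd x - (c + w * q)"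
    "fst (par_of cyc (bs w, odd w, x)) = bs (w - int m)"
proof -
  let ?P = "bwalk cyc (bs w, odd w, x)"
  have P: "back_walk cyc (bs w, odd w, x) m ?P" unfolding m by (rule blen_walk(1)[OF cyc_bounded])
  have inn: "\<not> (\<exists>u. (?P 0, \<not> tp (odd w) m, \<not> sg (x - int m * q - q), u) \<in> cyc)"
  proof
    assume "\<exists>u. (?P 0, \<not> tp (odd w) m, \<not> sg (x - int m * q - q), u) \<in> cyc"
    then obtain u where "(?P 0, \<not> tp (odd w) m, \<not> sg (x - int m * q - q), u) \<in> cyc" ..
    from graph_onD(3)[OF graph_on_cyc this] have "(u, \<not> tp (odd w) m, sg (x - int m * q - q), ?P 0) \<in> cyc" by simp
    from blen_max[OF cyc_bounded back_walk_extend[OF P this]] show False unfolding m by simp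
  qed
  have out: "\<not> (\<exists>u. (bs w, odd w, sg x, u) \<in> cyc)" using f unfolding exits_def by simp
  obtain c where "face N d 0 c (w - int m) w" "2 * p dvd x - (c + w * q)" "?P 0 = bs (w - int m)"
    using cyc_face[OF P r out inn] by metis
  then show ?thesis using that unfolding par_of_def by simp
qed

section \<open>Relator walks after the bad cycles have been attached\<close>

abbreviation E1 :: graph where "E1 \<equiv> pre.E1"
abbreviation V1 :: "node set" where "V1 \<equiv> pre.V1"

lemma closed_along:
  assumes "rwalk E1 e x m P" "i \<le> m" "closed_at E1 (P i) (tp e i) (x + int i * q)"
  shows "closed_at E1 (P 0) e x"
  using closed_at_backward[OF pre.graph_on_E1 rwalk_mono[OF assms(1) order_refl assms(2)] assms(3)] .

lemma bad_closed: "(v, e, y) \<in> bad \<Longrightarrow> 2 * p dvd x - y \<Longrightarrow> closed_at E1 v e x"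
  using pre.T_closed closed_at_cong by blast

text \<open>The walk takes the letters of a bad path without having its phase, as it is open. If it
  shared all \<open>blen\<close> letters before the exit, at least \<open>p\<close> of them, the
  phases would agree; so it shares fewer and the piece from \<open>a\<close> on is not rich.\<close>

lemma tail_follows:
  assumes P: "rwalk E1 e x m P" and b: "b < m" "P b \<in> cycV" and R: "rwalk cyc (tp e a) (x + int a * q) (b - a) (\<lambda>i. P (a + i))" "a \<le> b"
    and out: "\<And>i. b < i \<Longrightarrow> i < m \<Longrightarrow> P i \<notin> cycV" and new: "(P b, tp e b, sg (x + int b * q), P (Suc b)) \<notin> cyc"
    and nc: "\<not> closed_at E1 (P 0) e x"
  obtains y where "(P b, tp e b, y) \<in> bad" "\<And>i. i < m - b \<Longrightarrow> sg (x + int b * q + int i * q) = sg (y + int i * q)"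
    "b - a < blen cyc (P b, tp e b, y)" "\<not> rich (x + int a * q) (m - a)"
proof -
  have "\<exists>y. (P b, tp e b, y) \<in> bad \<and> m - b \<le> pre.len (P b, tp e b, y) \<and>
      (\<forall>i<m - b. sg (x + int b * q + int i * q) = sg (y + int i * q)) \<and>
      (\<forall>i\<le>m - b. P (b + i) = pre.pos (P b, tp e b, y) i)"
  proof (rule pre.excursion)
    have "rwalk E1 (tp e b) (x + int b * q) (m - b) (\<lambda>i. P (b + i))" by (rule rwalk_drop) (use P b in simp)
    from rwalkD[OF this] show "(P (b + i), tp (tp e b) i, sg (x + int b * q + int i * q), P (b + Suc i)) \<in> E1" if "i < m - b" for i
      using that .
  qed (use b out new in auto)
  then obtain y where y: "(P b, tp e b, y) \<in> bad"
    and eq: "\<And>i. i < m - b \<Longrightarrow> sg (x + int b * q + int i * q) = sg (y + int i * q)" by blast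
  have ncong: "\<not> 2 * p dvd (x + int b * q) - y"
    using closed_along[OF P less_imp_le[OF b(1)]] bad_closed[OF y] nc by blast
  let ?m = "blen cyc (P b, tp e b, y)"
  let ?Q = "bwalk cyc (P b, tp e b, y)"
  have bw: "back_walk cyc (P b, tp e b, y) ?m ?Q" by (rule blen_walk(1)[OF cyc_bounded])
  have agree: "sg (x + int (b - k) * q + int l * q) = sg (y - int k * q + int l * q)"
    if k: "k \<le> b - a" "k \<le> ?m" and l: "l < k" for k l
  proof -
    obtain Q where Q: "rwalk cyc (tp (tp e b) k) (y - int k * q) k Q" "Q k = P b"
      using back_walk_mono[OF bw k(2)] unfolding back_walk_def by auto
    have "rwalk cyc (tp (tp e a) (b - a - k)) (x + int a * q + int (b - a - k) * q) k (\<lambda>i. P (a + (b - a - k + i)))"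
      by (rule rwalk_drop) (use R k in simp)
    moreover have "tp (tp e a) (b - a - k) = tp (tp e b) k"
      using k R(2) by (auto simp: tp_def)
    moreover have "x + int a * q + int (b - a - k) * q = x + int (b - k) * q"
      using k R(2) by (simp add: of_nat_diff algebra_simps)
    ultimately have R': "rwalk cyc (tp (tp e b) k) (x + int (b - k) * q) k (\<lambda>i. P (a + (b - a - k + i)))" by (simp only:)
    have "P (a + (b - a - k + k)) = P b" using k R(2) by simp
    then show ?thesis using cyc_back_agree[OF R' Q(1) _ _ l] Q(2) b(2) by simp
  qed
  have lt: "b - a < ?m"
  proof (rule ccontr)
    assume "\<not> b - a < ?m"
    then have le: "?m \<le> b - a" by simp
    have "rich (x + int (b - ?m) * q) ?m" by (rule rich_long[OF bad_rich_back[OF y]])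
    then have "2 * p dvd x + int (b - ?m) * q - (y - int ?m * q)"
      using agree[OF le order_refl] by (rule rich_determines)
    moreover have "x + int (b - ?m) * q - (y - int ?m * q) = x + int b * q - y"
      using le by (simp add: of_nat_diff algebra_simps)
    ultimately show False using ncong by simp
  qed
  have "\<not> rich (x + int a * q) (m - a)"
  proof
    assume r: "rich (x + int a * q) (m - a)"
    have "sg (x + int a * q + int l * q) = sg (y - int (b - a) * q + int l * q)" if l: "l < m - a" for l
    proof (cases "l < b - a")
      case True
      have "b - (b - a) = a" using R(2) by simp
      then show ?thesis using agree[OF order_refl _ True] lt by simp
    next
      case False
      define i where "i = l - (b - a)"
      have i: "i < m - b" using l False R(2) unfolding i_def by simp
      have e1: "x + int a * q + int l * q = x + int b * q + int i * q"
        "y - int (b - a) * q + int l * q = y + int i * q"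
        using False R(2) unfolding i_def by (simp_all add: of_nat_diff algebra_simps)
      show ?thesis unfolding e1 by (rule eq[OF i])
    qed
    from rich_determines[OF r this] have "2 * p dvd x + int a * q - (y - int (b - a) * q)" .
    moreover have "x + int a * q - (y - int (b - a) * q) = x + int b * q - y"
      using R(2) by (simp add: of_nat_diff algebra_simps)
    ultimately show False using ncong by simp
  qed
  then show ?thesis using that y eq lt by blast
qed

text \<open>The missing part of a bad relator is rich, because the cycle contains no long piece. A
  walk along all of it has the phase of that relator and is closed.\<close>

lemma no_return:
  assumes P: "rwalk E1 e x m P" and i: "i0 < i1" "i1 \<le> m" "P i0 \<in> cycV" "P i1 \<in> cycV"
    and out: "\<And>i. i0 < i \<Longrightarrow> i < i1 \<Longrightarrow> P i \<notin> cycV" and nc: "\<not> closed_at E1 (P 0) e x"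
  shows "(P i0, tp e i0, sg (x + int i0 * q), P (Suc i0)) \<in> cyc"
proof (rule ccontr)
  assume new: "\<not> ?thesis"
  have "\<exists>y. (P i0, tp e i0, y) \<in> bad \<and> i1 - i0 \<le> pre.len (P i0, tp e i0, y) \<and>
      (\<forall>i<i1 - i0. sg (x + int i0 * q + int i * q) = sg (y + int i * q)) \<and>
      (\<forall>i\<le>i1 - i0. P (i0 + i) = pre.pos (P i0, tp e i0, y) i)"
  proof (rule pre.excursion)
    have "rwalk E1 (tp e i0) (x + int i0 * q) (m - i0) (\<lambda>i. P (i0 + i))" by (rule rwalk_drop) (use P i in simp)
    from rwalkD[OF this] show "(P (i0 + i), tp (tp e i0) i, sg (x + int i0 * q + int i * q), P (i0 + Suc i)) \<in> E1" if "i < i1 - i0" for i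
      using that i by simp
  qed (use i out new in auto)
  then obtain y where y: "(P i0, tp e i0, y) \<in> bad" "i1 - i0 \<le> pre.len (P i0, tp e i0, y)"
     "P (i0 + (i1 - i0)) = pre.pos (P i0, tp e i0, y) (i1 - i0)"
    and eq: "\<And>i. i < i1 - i0 \<Longrightarrow> sg (x + int i0 * q + int i * q) = sg (y + int i * q)" by blast
  have "i1 - i0 = pre.len (P i0, tp e i0, y)"
  proof (rule ccontr)
    assume "i1 - i0 \<noteq> pre.len (P i0, tp e i0, y)"
    then have "pre.pos (P i0, tp e i0, y) (i1 - i0) \<notin> cycV" using pre.pos_inner[OF y(1)] y(2) i(1) by simp
    then show False using y(3) i by simp
  qed
  then have "rich y (i1 - i0)" using bad_rich[OF y(1)] pre.len_eq[OF y(1)] by simp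
  then have "2 * p dvd y - (x + int i0 * q)" by (rule rich_determines) (simp add: eq)
  then have "2 * p dvd (x + int i0 * q) - y" by (simp add: dvd_diff_commute)
  from closed_along[OF P _ bad_closed[OF y(1) this]] show False using i nc by simp
qed

lemma walk_cases:
  assumes P: "rwalk E1 e x m P" "P 0 \<in> V1" and nc: "\<not> closed_at E1 (P 0) e x" and r: "rich x m"
  obtains a b where "a \<le> b" "b \<le> m" "P a \<in> cycV" "P b \<in> cycV" "\<And>i. i < a \<Longrightarrow> P i \<notin> cycV"
    "\<And>i. b < i \<Longrightarrow> i \<le> m \<Longrightarrow> P i \<notin> cycV" "rwalk cyc (tp e a) (x + int a * q) (b - a) (\<lambda>i. P (a + i))"
proof -
  obtain i0 where i0: "i0 \<le> m" "P i0 \<in> cycV"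
    using pre.new_walk_not_rich[OF pre.T_closed P(1) _ nc P(2)] r by blast
  define a where "a = (LEAST i. P i \<in> cycV)"
  have a: "P a \<in> cycV" "a \<le> i0" using i0 unfolding a_def by (auto intro: LeastI Least_le)
  have a': "P i \<notin> cycV" if "i < a" for i using not_less_Least[of i "\<lambda>i. P i \<in> cycV"] that unfolding a_def by simp
  obtain b where b: "b \<le> m" "P b \<in> cycV" and b': "\<And>i. i \<le> m \<Longrightarrow> P i \<in> cycV \<Longrightarrow> i \<le> b"
    using ex_has_greatest_nat[of "\<lambda>i. i \<le> m \<and> P i \<in> cycV" i0 "\<lambda>i. i" "Suc m"] i0 by auto
  have ab: "a \<le> b" using b'[OF i0] a(2) by simp
  have all: "P (a + i) \<in> cycV \<and> (\<forall>j<i. (P (a + j), tp e (a + j), sg (x + int (a + j) * q), P (Suc (a + j))) \<in> cyc)"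
    if "a + i \<le> b" for i
    using that
  proof (induction i)
    case (Suc i)
    then have IH: "P (a + i) \<in> cycV" "\<forall>j<i. (P (a + j), tp e (a + j), sg (x + int (a + j) * q), P (Suc (a + j))) \<in> cyc" by auto
    define i1 where "i1 = (LEAST k. a + i < k \<and> P k \<in> cycV)"
    have "a + i < b \<and> P b \<in> cycV" using Suc.prems b by simp
    then have i1: "a + i < i1" "P i1 \<in> cycV" "i1 \<le> b"
      using LeastI[of "\<lambda>k. a + i < k \<and> P k \<in> cycV" b] Least_le[of "\<lambda>k. a + i < k \<and> P k \<in> cycV" b]
      unfolding i1_def by auto
    have "P k \<notin> cycV" if "a + i < k" "k < i1" for k
      using not_less_Least[of k "\<lambda>k. a + i < k \<and> P k \<in> cycV"] that unfolding i1_def by simp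
    then have "(P (a + i), tp e (a + i), sg (x + int (a + i) * q), P (Suc (a + i))) \<in> cyc"
      using no_return[OF P(1) i1(1) _ IH(1) i1(2) _ nc] i1(3) b(1) by simp
    then show ?case using IH(2) cyc_V(2) less_Suc_eq by auto
  qed (use a in simp)
  have "rwalk cyc (tp e a) (x + int a * q) (b - a) (\<lambda>i. P (a + i))"
    unfolding rwalk_def
  proof (intro allI impI)
    fix i assume "i < b - a"
    then have "(P (a + i), tp e (a + i), sg (x + int (a + i) * q), P (Suc (a + i))) \<in> cyc"
      using all[of "b - a"] ab by simp
    moreover have "x + int (a + i) * q = x + int a * q + int i * q" by (simp add: algebra_simps)
    ultimately show "(P (a + i), tp (tp e a) i, sg (x + int a * q + int i * q), P (a + Suc i)) \<in> cyc"
      unfolding tp_add by (simp only: add_Suc_right)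
  qed
  moreover have "P i \<notin> cycV" if "b < i" "i \<le> m" for i using b'[of i] that by auto
  ultimately show ?thesis using that[OF ab b(1) a(1) b(2) a'] by blast
qed

lemma cyc_exit_edge: "P (Suc b) \<notin> cycV \<Longrightarrow> (u, e, s, P (Suc b)) \<notin> cyc"
  using cyc_V(2) by blast

lemma tail:
  assumes P: "rwalk E1 e x m P" and nc: "\<not> closed_at E1 (P 0) e x"
    and ab: "a \<le> b" "b < m" "P b \<in> cycV" and out: "\<And>i. b < i \<Longrightarrow> i \<le> m \<Longrightarrow> P i \<notin> cycV"
    and R: "rwalk cyc (tp e a) (x + int a * q) (b - a) (\<lambda>i. P (a + i))"
  obtains y where "(P b, tp e b, y) \<in> bad" "\<And>i. i < m - b \<Longrightarrow> sg (x + int b * q + int i * q) = sg (y + int i * q)"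
    "b - a < blen cyc (P b, tp e b, y)" "\<not> rich (x + int a * q) (m - a)"
  by (rule tail_follows[OF P ab(2,3) R ab(1) _ _ nc]) (use out ab cyc_exit_edge[of P b] in auto)

lemma reverse_not_closed:
  assumes P: "rwalk E1 e x m P" and nc: "\<not> closed_at E1 (P 0) e x"
  shows "\<not> closed_at E1 (P m) (\<not> tp e m) (- 1 - x - (int m - 1) * q)"
proof
  assume "closed_at E1 (P m) (\<not> tp e m) (- 1 - x - (int m - 1) * q)"
  from closed_at_reverse[OF pre.graph_on_E1 this]
  have "closed_at E1 (P m) (tp e m) (q - 1 - (- 1 - x - (int m - 1) * q))" by simp
  moreover have "q - 1 - (- 1 - x - (int m - 1) * q) = x + int m * q" by (simp add: algebra_simps)
  ultimately show False using closed_along[OF P order_refl] nc by simp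
qed

lemma cyc_reverse:
  assumes R: "rwalk cyc (tp e a) (x + int a * q) (b - a) (\<lambda>i. P (a + i))" and ab: "a \<le> b" "b \<le> m"
  shows "rwalk cyc (tp (\<not> tp e m) (m - b)) (- 1 - x - (int m - 1) * q + int (m - b) * q) (m - a - (m - b)) (\<lambda>i. P (m - (m - b + i)))"
proof -
  have "rwalk cyc (\<not> tp (tp e a) (b - a)) (- 1 - (x + int a * q) - (int (b - a) - 1) * q) (b - a) (\<lambda>i. P (a + (b - a - i)))"
    by (rule rwalk_reverse[OF graph_on_cyc R])
  moreover have "(\<not> tp (tp e a) (b - a)) = tp (\<not> tp e m) (m - b)" using ab by (auto simp: tp_def)
  moreover have "- 1 - (x + int a * q) - (int (b - a) - 1) * q = - 1 - x - (int m - 1) * q + int (m - b) * q"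
    using ab by (simp add: of_nat_diff algebra_simps)
  moreover have "m - a - (m - b) = b - a" using ab by simp
  ultimately have 1: "rwalk cyc (tp (\<not> tp e m) (m - b)) (- 1 - x - (int m - 1) * q + int (m - b) * q) (m - a - (m - b)) (\<lambda>i. P (a + (b - a - i)))"
    by (simp only:)
  have "a + (b - a - i) = m - (m - b + i)" if "i \<le> b - a" for i using that ab by simp
  then show ?thesis using 1 ab unfolding rwalk_def by simp
qed

text \<open>The mirror image of \<open>tail\<close>. The initial piece up to \<open>b\<close> alone
  is reversed, so the statement on richness concerns that piece.\<close>

lemma head:
  assumes P: "rwalk E1 e x m P" and nc: "\<not> closed_at E1 (P 0) e x"
    and ab: "0 < a" "a \<le> b" "b \<le> m" "P a \<in> cycV" and out: "\<And>i. i < a \<Longrightarrow> P i \<notin> cycV"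
    and R: "rwalk cyc (tp e a) (x + int a * q) (b - a) (\<lambda>i. P (a + i))"
  obtains y where "(P a, \<not> tp e a, y) \<in> bad" "\<And>i. i < a \<Longrightarrow> sg (- 1 - x - (int a - 1) * q + int i * q) = sg (y + int i * q)"
    "b - a < blen cyc (P a, \<not> tp e a, y)" "\<not> rich x b"
proof -
  define x' where "x' = - 1 - x - (int b - 1) * q"
  have Pb: "rwalk E1 e x b P" by (rule rwalk_mono[OF P order_refl ab(3)])
  have P': "rwalk E1 (\<not> tp e b) x' b (\<lambda>i. P (b - i))" unfolding x'_def by (rule rwalk_reverse[OF pre.graph_on_E1 Pb])
  have nc': "\<not> closed_at E1 (P (b - 0)) (\<not> tp e b) x'" unfolding x'_def using reverse_not_closed[OF Pb nc] by simp
  have R': "rwalk cyc (tp (\<not> tp e b) 0) (x' + int 0 * q) (b - a - 0) (\<lambda>i. P (b - (0 + i)))"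
    using cyc_reverse[OF R ab(2) order_refl] unfolding x'_def by simp
  have t: "tp (\<not> tp e b) (b - a) = (\<not> tp e a)" using ab by (auto simp: tp_def)
  have bba: "b - (b - a) = a" using ab by simp
  have x': "x' + int (b - a) * q = - 1 - x - (int a - 1) * q" unfolding x'_def using ab by (simp add: of_nat_diff algebra_simps)
  obtain y where y: "(P a, \<not> tp e a, y) \<in> bad"
      "\<And>i. i < a \<Longrightarrow> sg (x' + int (b - a) * q + int i * q) = sg (y + int i * q)"
      "b - a < blen cyc (P a, \<not> tp e a, y)" "\<not> rich x' b"
  proof (rule tail[OF P' nc' _ _ _ _ R'])
    fix y assume "(P (b - (b - a)), tp (\<not> tp e b) (b - a), y) \<in> bad"
      "\<And>i. i < b - (b - a) \<Longrightarrow> sg (x' + int (b - a) * q + int i * q) = sg (y + int i * q)"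
      "b - a - 0 < blen cyc (P (b - (b - a)), tp (\<not> tp e b) (b - a), y)" "\<not> rich (x' + int 0 * q) (b - 0)"
    then show thesis using that[of y] unfolding t bba by simp
  qed (use ab out in auto)
  have "\<not> rich x b" using y(4) unfolding x'_def rich_reflect .
  then show ?thesis using that y(1-3) unfolding x' by blast
qed

text \<open>The walk is prolonged on the cycle until it stops. That exit is not bad, as the relator
  would be closed otherwise, so the missing part is fat, and it is contained in the complement of
  the original walk.\<close>

lemma cyc_walk_fat:
  assumes P: "rwalk cyc e x m P" "P 0 \<in> cycV" and nc: "\<not> closed_at E1 (P 0) e x"
  shows "fat (x + int m * q) (rlen - m)"
proof -
  let ?Q = "\<lambda>k. \<exists>P'. rwalk cyc e x k P' \<and> P' 0 = P 0"
  have bd: "\<forall>k. ?Q k \<longrightarrow> k < rlen" using cyc_no_long by blast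
  have "\<exists>k. ?Q k \<and> (\<forall>j. ?Q j \<longrightarrow> j \<le> k)"
    by (rule ex_has_greatest_nat[of ?Q m "\<lambda>k. k" rlen]) (use P(1) bd in blast)+
  then obtain k where "?Q k \<and> (\<forall>j. ?Q j \<longrightarrow> j \<le> k)" by (rule exE)
  then have k: "?Q k" "\<forall>j. ?Q j \<longrightarrow> j \<le> k" by (rule conjunct1, rule conjunct2)
  obtain P' where P': "rwalk cyc e x k P'" "P' 0 = P 0" using k(1) by blast
  have mk: "m \<le> k" using k(2) P(1) by blast
  let ?x = "x + int k * q"
  have stuck: "\<not> (\<exists>u. (P' k, tp e k, sg ?x, u) \<in> cyc)"
  proof
    assume "\<exists>u. (P' k, tp e k, sg ?x, u) \<in> cyc"
    then obtain u where u: "(P' k, tp e k, sg ?x, u) \<in> cyc" ..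
    define R where "R = (\<lambda>i. if i \<le> k then P' i else u)"
    have "rwalk cyc e x (Suc k) R"
      unfolding rwalk_def R_def
    proof (intro allI impI)
      fix i assume "i < Suc k"
      then consider "i < k" | "i = k" by linarith
      then show "(if i \<le> k then P' i else u, tp e i, sg (x + int i * q), if Suc i \<le> k then P' (Suc i) else u) \<in> cyc"
      proof cases
        case 1
        then show ?thesis using rwalkD[OF P'(1), of i] by simp
      next
        case 2
        then show ?thesis using u by simp
      qed
    qed
    moreover have "R 0 = P 0" unfolding R_def using P'(2) by simp
    ultimately have "?Q (Suc k)" by (intro exI conjI)
    then have "Suc k \<le> k" using k(2) by (simp only:)
    then show False by simp
  qed
  define y where "y = ?x mod (2 * p)"
  have dvd: "2 * p dvd y - ?x" unfolding y_def by (rule mod_phase)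
  have sgy: "sg y \<longleftrightarrow> sg ?x" using dvd by (rule sgn_of_cong[OF p_pos])
  have k': "P' k \<in> cycV"
  proof (cases k)
    case (Suc j)
    then show ?thesis using rwalkD[OF P'(1), of j] cyc_V(2) by auto
  qed (use P P' in simp)
  have ex: "(P' k, tp e k, y) \<in> exits cycV cyc"
    unfolding exits_def using stuck k' p_pos sgy by (auto simp: y_def)
  have "(P' k, tp e k, y) \<notin> bad"
  proof
    assume b: "(P' k, tp e k, y) \<in> bad"
    have "2 * p dvd ?x - y" using dvd by (simp add: dvd_diff_commute)
    from bad_closed[OF b this] have "closed_at E1 (P' 0) e x"
      using closed_along[OF rwalk_mono[OF P'(1) pre.E_E1 order_refl] order_refl] by blast
    then show False using nc P' by simp
  qed
  then have "fat y (rlen - blen cyc (P' k, tp e k, y))" using ex unfolding bad_def by simp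
  then have f: "fat ?x (rlen - blen cyc (P' k, tp e k, y))" using fat_cong[OF dvd] by simp
  let ?b = "blen cyc (P' k, tp e k, y)"
  have "2 * p dvd x - (y - int k * q)" using dvd by (simp add: dvd_diff_commute algebra_simps)
  then have "rwalk cyc e (y - int k * q) k P'" using P'(1) rwalk_cong_phase by blast
  then have "back_walk cyc (P' k, tp e k, y) k P'" unfolding back_walk_def by simp
  then have kb: "k \<le> ?b" by (rule blen_max[OF cyc_bounded])
  have "fat (x + int m * q + int (k - m) * q) (rlen - ?b)"
    using f mk by (simp add: of_nat_diff algebra_simps)
  from fat_extend[OF this, of "?b - k"]
  have "fat (x + int m * q) (k - m + (rlen - ?b) + (?b - k))" .
  moreover have "k - m + (rlen - ?b) + (?b - k) = rlen - m"
    using mk kb blen_walk(2)[OF cyc_bounded, of "(P' k, tp e k, y)"] by simp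
  ultimately show ?thesis by simp
qed

text \<open>A rich open walk not confined to the cycle has both a head and a tail on new paths.
  Neither may be rich together with the middle part, so the walk has at most \<open>2 p - 2\<close>
  letters and its complement is long.\<close>

lemma fatg_pre: "fatg V1 E1"
  unfolding fatg_def
proof (intro allI impI)
  fix e x m P assume P: "P 0 \<in> V1" "rwalk E1 e x m P" and nc: "\<not> closed_at E1 (P 0) e x"
  show "m < rlen \<and> fat (x + int m * q) (rlen - m)"
  proof (cases "rich x m")
    case True
    obtain a b where ab: "a \<le> b" "b \<le> m" "P a \<in> cycV" "P b \<in> cycV" "\<And>i. i < a \<Longrightarrow> P i \<notin> cycV"
      "\<And>i. b < i \<Longrightarrow> i \<le> m \<Longrightarrow> P i \<notin> cycV" and R: "rwalk cyc (tp e a) (x + int a * q) (b - a) (\<lambda>i. P (a + i))"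
      by (rule walk_cases[OF P(2,1) nc True]) (rule that)
    consider "a = 0" "b = m" | "0 < a" | "b < m" using ab(2) by linarith
    then show ?thesis
    proof cases
      case 1
      then have R': "rwalk cyc e x m P" using R by simp
      then show ?thesis using cyc_walk_fat[OF R' _ nc] ab(3) 1(1) cyc_no_long by blast
    next
      case 2
      have nb: "\<not> rich x b" using head[OF P(2) nc 2 ab(1,2,3,5) R] by metis
      then have "b \<noteq> m" using True by blast
      then have bm: "b < m" using ab(2) by simp
      have na: "\<not> rich (x + int a * q) (m - a)" using tail[OF P(2) nc ab(1) bm ab(4,6) R] by metis
      have le: "int m \<le> 2 * p - 2" using not_rich_short[OF nb] not_rich_short[OF na] ab(1,2) by linarith
      then have mr: "m < rlen" "2 * p - 1 \<le> int (rlen - m)" using rlen_ge p_pos by linarith+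
      then show ?thesis using fat_long by blast
    next
      case 3
      have na: "\<not> rich (x + int a * q) (m - a)" using tail[OF P(2) nc ab(1) 3 ab(4,6) R] by metis
      have "a \<noteq> 0"
      proof
        assume "a = 0"
        then show False using na True by simp
      qed
      then have a0: "0 < a" by simp
      have nb: "\<not> rich x b" using head[OF P(2) nc a0 ab(1,2,3,5) R] by metis
      have le: "int m \<le> 2 * p - 2" using not_rich_short[OF nb] not_rich_short[OF na] ab(1,2) by linarith
      then have mr: "m < rlen" "2 * p - 1 \<le> int (rlen - m)" using rlen_ge p_pos by linarith+
      then show ?thesis using fat_long by blast
    qed
  qed (rule not_rich_compl)
qed

text \<open>Head and tail run on two bad paths whose faces overlap along the middle part of the
  walk. As a line reads the rest of the relator, this is the configuration of
  \<open>forbidden_bridge\<close>.\<close>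

lemma no_bridge_forward:
  assumes P: "rwalk E1 e x m P" and nc: "\<not> closed_at E1 (P 0) e x" and r: "rich x m"
    and ab: "0 < a" "a \<le> b" "b < m" "P a \<in> cycV" "P b \<in> cycV" 
    and out1: "\<And>i. i < a \<Longrightarrow> P i \<notin> cycV" and out2: "\<And>i. b < i \<Longrightarrow> i \<le> m \<Longrightarrow> P i \<notin> cycV"
    and R: "rwalk cyc (tp e a) (x + int a * q) (b - a) (\<lambda>i. P (a + i))"
    and v: "P a = bs v" "odd v = tp e a"
    and s: "slope N' d'" and rd: "\<And>j. int j < int rlen - int m \<Longrightarrow> sg (x + int (m + j) * q) \<longleftrightarrow> even (line N' d' h' (int j))"
  shows False
proof -
  have bm: "b \<le> m" using ab(3) by simp
  define w where "w = v + int (b - a)"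
  have w: "P b = bs w" using cyc_walk_forward(1)[OF R _ v(2), of "b - a"] v(1) ab unfolding w_def by simp
  have ow: "odd w = tp e b" using v(2) ab(2) unfolding w_def by (auto simp: tp_def)
  obtain y where y0: "(P b, tp e b, y) \<in> bad" and ylet: "\<And>i. i < m - b \<Longrightarrow> sg (x + int b * q + int i * q) = sg (y + int i * q)"
    and ylen: "b - a < blen cyc (P b, tp e b, y)" and nr2: "\<not> rich (x + int a * q) (m - a)"
    by (rule tail[OF P nc ab(2,3,5) out2 R]) blast+
  obtain y' where y0': "(P a, \<not> tp e a, y') \<in> bad"
    and ylet': "\<And>i. i < a \<Longrightarrow> sg (- 1 - x - (int a - 1) * q + int i * q) = sg (y' + int i * q)"
    and ylen': "b - a < blen cyc (P a, \<not> tp e a, y')" and nr1: "\<not> rich x b"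
    by (rule head[OF P nc ab(1,2) bm ab(4) out1 R]) blast+
  define mg where "mg = blen cyc (bs w, odd w, y)"
  define mf where "mf = blen cyc (bs v, \<not> odd v, y')"
  have g: "(bs w, odd w, y) \<in> bad" using y0 w ow by simp
  have f: "(bs v, \<not> odd v, y') \<in> bad" using y0' v by simp
  have mg: "b - a < mg" using ylen w ow unfolding mg_def by simp
  have mf: "b - a < mf" using ylen' v unfolding mf_def by simp
  have gx: "(bs w, odd w, y) \<in> exits cycV cyc" and fx: "(bs v, \<not> odd v, y') \<in> exits cycV cyc"
    using f g unfolding bad_def by auto
  have "rich (y - int mg * q) mg" unfolding mg_def by (rule rich_long[OF bad_rich_back[OF g]])
  then obtain c' where c': "face N d 0 c' (w - int mg) w" "2 * p dvd y - (c' + w * q)"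
    using exit_face[OF gx mg_def] by blast
  define ee where "ee = v + int mf"
  obtain x'' where par: "par_of cyc (bs v, \<not> odd v, y') = (bs ee, odd ee, x'')"
    and x'': "2 * p dvd x'' - (q - 1 - y' - v * q + ee * q)"
  proof -
    let ?Q = "bwalk cyc (bs v, \<not> odd v, y')"
    have "back_walk cyc (bs v, \<not> odd v, y') mf ?Q" unfolding mf_def by (rule blen_walk(1)[OF cyc_bounded])
    then have Q: "rwalk cyc (tp (\<not> odd v) mf) (y' - int mf * q) mf ?Q" "?Q mf = bs v" unfolding back_walk_def by auto
    obtain i where i: "?Q 0 = bs i" using cyc_start[OF Q(1)] Q(2) by auto
    have o: "odd i \<noteq> tp (\<not> odd v) mf"
    proof
      assume *: "odd i = tp (\<not> odd v) mf"
      have "bs v = bs (i + int mf)" using cyc_walk_forward(1)[OF Q(1) i *, of mf] Q(2) by simp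
      then have "odd v = odd (i + int mf)" by (rule bs_eqD(1))
      then show False using * by (auto simp: tp_def)
    qed
    have "bs v = bs (i - int mf)" using cyc_walk_backward(1)[OF Q(1) i o, of mf] Q(2) by simp
    from bs_eqD(3)[OF this, of "int mf"] have "?Q 0 = bs ee" unfolding ee_def i by simp
    moreover have "odd ee = (\<not> tp (\<not> odd v) mf)" unfolding ee_def by (auto simp: tp_def)
    moreover have "2 * p dvd (q - 1 - (y' - int mf * q)) mod (2 * p) - (q - 1 - y' - v * q + ee * q)"
      using mod_phase[of "q - 1 - (y' - int mf * q)"] unfolding ee_def by (simp add: algebra_simps)
    ultimately show ?thesis using that unfolding par_of_def mf_def by simp
  qed
  have pf: "(bs ee, odd ee, x'') \<in> bad" using bad_par[OF f] unfolding par .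
  have pm: "mf = blen cyc (bs ee, odd ee, x'')" 
    using blen_par[OF graph_on_cyc fx cyc_bounded] unfolding par mf_def by simp
  have pfx: "(bs ee, odd ee, x'') \<in> exits cycV cyc" using pf unfolding bad_def by simp
  have "rich (x'' - int mf * q) mf" unfolding pm by (rule rich_long[OF bad_rich_back[OF pf]])
  then obtain c where c: "face N d 0 c (ee - int mf) ee" "2 * p dvd x'' - (c + ee * q)"
    using exit_face[OF pfx pm] by blast
  have cf: "face N d 0 c v ee" using c(1) unfolding ee_def by simp
  have mfr: "mf < rlen" unfolding mf_def by (rule blen_walk(2)[OF cyc_bounded])
  have jn: "join N d 0 c v ee c' (w - int mg) w"
    unfolding join_def using N dt_pos cf c'(1) mg mf unfolding w_def ee_def by simp
  have "\<exists>y. p dvd y * q - 1 \<and> y * dt N d < d \<and> (2 * int n - 3) * p \<le> y"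
  proof (rule not_fat_span[OF N cf])
    show "ee - v < 2 * p * int n" using mfr int_rlen unfolding ee_def by linarith
    have "nat (2 * p * int n - (ee - v)) = rlen - mf" using int_rlen unfolding ee_def by linarith
    moreover have "\<not> fat x'' (rlen - mf)" using pf pm unfolding bad_def by simp
    ultimately show "\<not> fat (c + ee * q) (nat (2 * p * int n - (ee - v)))" using fat_cong[OF c(2)] by simp
  qed
  then obtain z where z: "p dvd z * q - 1" "z * dt N d < d" "(2 * int n - 3) * p \<le> z" by blast
  have cc: "2 * p dvd c - (q - 1 - y' - v * q)"
    using dvd_diff[OF x'' c(2)] by (simp add: algebra_simps)
  \<comment> \<open>The phase re-indexed by positions on the cycle; position \<open>v\<close> is
    reached after \<open>a\<close> letters.\<close>
  define B where "B = x + (int a - v) * q"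
  have Bi: "B + i * q = x + (int a - v + i) * q" for i unfolding B_def by (simp add: algebra_simps)
  show False
  proof (rule forbidden_bridge[OF jn slope_base s z, where b = B and k = "int a" and k' = "int (m - b)"])
    fix i assume i: "v - int a \<le> i" "i < v"
    define l where "l = nat (v - 1 - i)"
    have l: "l < a" "i = v - 1 - int l" using i unfolding l_def by auto
    have "- 1 - x - (int a - 1) * q + int l * q = - 1 - (B + i * q)" unfolding Bi l(2) by (simp add: algebra_simps)
    then have "sg (y' + int l * q) = sg (- 1 - (B + i * q))" using ylet'[OF l(1)] by (simp only:)
    then have "sg (y' + int l * q) \<longleftrightarrow> \<not> sg (B + i * q)" using sgn_of_reflect[OF p_pos, of "B + i * q"] by simp
    moreover have "sg (c + i * q) \<longleftrightarrow> sg (- 1 - (y' + int l * q))"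
    proof (rule sgn_of_cong[OF p_pos])
      have "c + i * q - (- 1 - (y' + int l * q)) = c - (q - 1 - y' - v * q)" unfolding l(2) by (simp add: algebra_simps)
      then show "2 * p dvd c + i * q - (- 1 - (y' + int l * q))" using cc by (simp only:)
    qed
    moreover have "sg (- 1 - (y' + int l * q)) \<longleftrightarrow> \<not> sg (y' + int l * q)" by (rule sgn_of_reflect[OF p_pos])
    ultimately show "even (F B i) \<longleftrightarrow> even (F c i)" unfolding sg_F[symmetric] by blast
  next
    fix i assume i: "v \<le> i" "i < w"
    define l where "l = nat (i - v)"
    have l: "l < b - a" "i = v + int l" using i unfolding l_def w_def by auto
    have "sg (x + int a * q + int l * q) = cd (v + int l)"
      by (rule cyc_walk_forward(2)[OF R _ v(2) l(1)]) (use v(1) in simp)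
    moreover have "x + int a * q + int l * q = B + i * q" unfolding Bi l(2) by (simp add: algebra_simps)
    ultimately show "even (F B i) \<longleftrightarrow> even (line N d 0 i)" using sg_F l(2) by simp
  next
    fix i assume i: "w \<le> i" "i < w + int (m - b)"
    define l where "l = nat (i - w)"
    have l: "l < m - b" "i = w + int l" using i unfolding l_def by auto
    have "x + int b * q + int l * q = B + i * q" unfolding Bi l(2) w_def using ab(2) by (simp add: of_nat_diff algebra_simps)
    then have "sg (y + int l * q) \<longleftrightarrow> sg (B + i * q)" using ylet[OF l(1)] by simp
    moreover have "sg (c' + i * q) \<longleftrightarrow> sg (y + int l * q)"
    proof (rule sgn_of_cong[OF p_pos])
      have "c' + i * q - (y + int l * q) = - (y - (c' + w * q))" unfolding l(2) by (simp add: algebra_simps)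
      then show "2 * p dvd c' + i * q - (y + int l * q)" using c'(2) by (simp only: dvd_minus_iff)
    qed
    ultimately show "even (F B i) \<longleftrightarrow> even (F c' i)" using sg_F by simp
  next
    show "0 < int a" "0 < int (m - b)" using ab by auto
    have e1: "x - (v - int a) * q = B" "x + int a * q - v * q = B" unfolding B_def by (simp_all add: algebra_simps)
    have e2: "v - int a + int b = w" "v + int (m - a) = w + int (m - b)" "v - int a + int m = w + int (m - b)"
      unfolding w_def using ab by auto
    show "\<not> rich_on B (v - int a) w" using nr1 unfolding rich_iff_rich_on[of x b "v - int a"] e1 e2 .
    show "\<not> rich_on B v (w + int (m - b))" using nr2 unfolding rich_iff_rich_on[of _ "m - a" v] e1 e2 .
    show "rich_on B (v - int a) (w + int (m - b))" using r unfolding rich_iff_rich_on[of x m "v - int a"] e1 e2 .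
    show "reads N' d' (h' + (- (w + int (m - b))) * N') B (w + int (m - b)) (v - int a + 2 * p * int n)"
      unfolding reads_def
    proof (intro allI impI)
      fix i assume i: "w + int (m - b) \<le> i" "i < v - int a + 2 * p * int n"
      define j where "j = nat (i - (w + int (m - b)))"
      have j: "i = w + int (m - b) + int j" using i(1) unfolding j_def by simp
      have "int j < int rlen - int m" using i unfolding int_rlen j w_def using ab by linarith
      from rd[OF this] have "sg (x + int (m + j) * q) \<longleftrightarrow> even (line N' d' h' (int j))" .
      moreover have "x + int (m + j) * q = B + i * q" unfolding Bi j w_def using ab by (simp add: of_nat_diff algebra_simps)
      moreover have "line N' d' (h' + (- (w + int (m - b))) * N') i = line N' d' h' (int j)"
        unfolding line_add[symmetric] j by simp
      ultimately show "even (line N' d' (h' + (- (w + int (m - b))) * N') i) \<longleftrightarrow> even (F B i)"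
        unfolding sg_F[symmetric] by (simp only:)
    qed
  qed
qed

text \<open>Applied to the present part of a detour: by this lemma it lies on the cycle, so the bad
  paths contribute nothing to it.\<close>

lemma no_bridge:
  assumes P: "rwalk E1 e x m P" "P 0 \<in> V1" and nc: "\<not> closed_at E1 (P 0) e x" and r: "rich x m"
    and s: "slope N' d'" and rd: "\<And>j. int j < int rlen - int m \<Longrightarrow> sg (x + int (m + j) * q) \<longleftrightarrow> even (line N' d' h' (int j))"
  shows "rwalk cyc e x m P"
proof -
  obtain a b where ab: "a \<le> b" "b \<le> m" "P a \<in> cycV" "P b \<in> cycV" "\<And>i. i < a \<Longrightarrow> P i \<notin> cycV"
    "\<And>i. b < i \<Longrightarrow> i \<le> m \<Longrightarrow> P i \<notin> cycV" and R: "rwalk cyc (tp e a) (x + int a * q) (b - a) (\<lambda>i. P (a + i))"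
    by (rule walk_cases[OF P nc r]) (rule that)
  have N': "in_range N' d'" using s unfolding slope_def by blast
  have False if a0: "0 < a" and bm: "b < m"
  proof -
    obtain v where v: "P a = bs v" using ab(3) cyc_V_obtain by blast
    show False
    proof (cases "odd v = tp e a")
      case True
      show False by (rule no_bridge_forward[OF P(1) nc r a0 ab(1) bm ab(3,4,5,6) R v True s rd])
    next
      case False
      let ?x = "- 1 - x - (int m - 1) * q"
      have P': "rwalk E1 (\<not> tp e m) ?x m (\<lambda>i. P (m - i))" by (rule rwalk_reverse[OF pre.graph_on_E1 P(1)])
      have nc': "\<not> closed_at E1 (P (m - 0)) (\<not> tp e m) ?x" using reverse_not_closed[OF P(1) nc] by simp
      have r': "rich ?x m" using r unfolding rich_reflect .
      have R': "rwalk cyc (tp (\<not> tp e m) (m - b)) (?x + int (m - b) * q) (m - a - (m - b)) (\<lambda>i. P (m - (m - b + i)))"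
        by (rule cyc_reverse[OF R ab(1,2)])
      have Pb: "P b = bs (v - int (b - a))"
        using cyc_walk_backward(1)[OF R _ False, of "b - a"] v ab(1) by simp
      have ob: "odd (v - int (b - a)) = tp (\<not> tp e m) (m - b)"
        using False ab(1,2) by (auto simp: tp_def)
      show False
      proof (rule no_bridge_forward[OF P' nc' r' _ _ _ _ _ _ _ R' _ ob s])
        show "0 < m - b" "m - b \<le> m - a" "m - a < m" "P (m - (m - b)) \<in> cycV" "P (m - (m - a)) \<in> cycV"
          "P (m - (m - b)) = bs (v - int (b - a))"
          using a0 bm ab Pb by auto
        show "P (m - i) \<notin> cycV" if "i < m - b" for i using ab(6)[of "m - i"] that by simp
        show "P (m - i) \<notin> cycV" if "m - a < i" "i \<le> m" for i using ab(5)[of "m - i"] that by simp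
        fix j assume j: "int j < int rlen - int m"
        define j' where "j' = rlen - m - 1 - j"
        have j': "int j' = int rlen - int m - 1 - int j" using j unfolding j'_def by linarith
        have "sg (?x + int (m + j) * q) \<longleftrightarrow> sg (- 1 - (x + int (m + j') * q))"
        proof (rule sgn_of_cong[OF p_pos])
          have "?x + int (m + j) * q - (- 1 - (x + int (m + j') * q)) = x + int rlen * q - x"
          proof -
            have e: "int rlen = int j' + int m + 1 + int j" using j' by simp
            show ?thesis unfolding e by (simp add: algebra_simps)
          qed
          then show "2 * p dvd ?x + int (m + j) * q - (- 1 - (x + int (m + j') * q))" using rlen_period by simp
        qed
        also have "\<dots> \<longleftrightarrow> \<not> sg (x + int (m + j') * q)" by (rule sgn_of_reflect[OF p_pos])
        also have "\<dots> \<longleftrightarrow> odd (line N' d' h' (int j'))" using rd[of j'] j' by simp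
        also have "\<dots> \<longleftrightarrow> even (line N' d' (- 1 - h') (- int j'))" using line_reflect[OF N'] by simp
        also have "- int j' = int j + (int m + 1 - int rlen)" using j' by simp
        also have "line N' d' (- 1 - h') (int j + (int m + 1 - int rlen)) =
            line N' d' (- 1 - h' + (int m + 1 - int rlen) * N') (int j)" by (rule line_add)
        finally show "sg (?x + int (m + j) * q) \<longleftrightarrow> even (line N' d' (- 1 - h' + (int m + 1 - int rlen) * N') (int j))" .
      qed
    qed
  qed
  moreover have "b = m" if "a = 0"
  proof (rule ccontr)
    assume "b \<noteq> m"
    then have "b < m" using ab(2) by simp
    from tail[OF P(1) nc ab(1) this ab(4,6) R] have "\<not> rich (x + int a * q) (m - a)" by metis
    then show False using r that by simp
  qed
  moreover have "b \<noteq> m" if "0 < a"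
  proof
    assume "b = m"
    then show False using head[OF P(1) nc that ab(1,2,3,5) R] r by metis
  qed
  ultimately have "a = 0" "b = m" using ab(2) by fastforce+
  then show ?thesis using R by simp
qed

theorem base_tower:
  obtains V' E' where "graph_on V' E'" "\<And>v e b. v \<in> V' \<Longrightarrow> \<exists>u. (v, e, b, u) \<in> E'"
    "\<And>v e x. v \<in> V' \<Longrightarrow> closed_at E' v e x" "cycV \<subseteq> V'" "cyc \<subseteq> E'"
    "\<And>W N' d' h' k. slope N' d' \<Longrightarrow> periodic W \<Longrightarrow> walks E' W (\<lambda>i. even (line N' d' h' i)) \<Longrightarrow>
       (W k, odd k, even (line N' d' h' k), W (k + 1)) \<in> cyc \<or>
       (\<exists>k0 l x P. detour cycV cyc W (\<lambda>i. even (line N' d' h' i)) k0 l x P \<and> k0 \<le> k \<and> k < k0 + int l)"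
proof -
  obtain V' E' V2 E2 where T: "graph_on V' E'" "V1 \<subseteq> V'" "\<And>v e b. v \<in> V' \<Longrightarrow> \<exists>u. (v, e, b, u) \<in> E'"
     "\<And>v e x. v \<in> V' \<Longrightarrow> closed_at E' v e x" "E1 \<subseteq> E'" "layer_over V1 E1 V2 E2"
     "\<And>W s. \<lbrakk>walks E' W s; periodic W; periodic s; no_long s\<rbrakk> \<Longrightarrow> walks E2 W s"
    using tower[OF pre.graph_on_E1 pre.fresh_for_E1 fatg_pre] by metis
  have V: "cycV \<subseteq> V'" "cyc \<subseteq> E'" using T(2,5) pre.V_V1 pre.E_E1 by auto
  show ?thesis
  proof (rule that[OF T(1,3,4) V])
    fix W :: "int \<Rightarrow> node" and N' d' h' k
    assume s: "slope N' d'" and pW: "periodic W" and W: "walks E' W (\<lambda>i. even (line N' d' h' i))"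
    let ?s = "\<lambda>i. even (line N' d' h' i)"
    have N': "in_range N' d'" using s unfolding slope_def by blast
    have "periodic ?s" unfolding periodic_def using line_period[OF N', of h' _ 1] in_rangeD[OF N'] by auto
    have nl: "no_long ?s" by (rule no_long_line[OF s])
    have W2: "walks E2 W ?s" by (rule T(7)[OF W pW \<open>periodic ?s\<close> nl])
    have lay: "\<exists>k0 l x P. detour V1 E1 W ?s k0 l x P \<and> k0 \<le> k \<and> k < k0 + int l"
      if "(W k, odd k, ?s k, W (k + 1)) \<notin> E1" for k
      using T(6) W2 that unfolding layer_over_def by blast
    \<comment> \<open>The existing part of such a detour is an open rich walk whose complement is
      read by a line, so \<open>no_bridge\<close> puts it on the cycle.\<close>
    have det: "detour cycV cyc W ?s k0 l x P" if D: "detour V1 E1 W ?s k0 l x P" for k0 l x P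
    proof -
      let ?m = "rlen - l"
      let ?x = "x - int ?m * q"
      have l: "0 < l" "l < rlen" "rich ?x ?m" using D detour_rich[OF nl D] unfolding detour_def by auto
      have R: "rwalk E1 (tp (odd k0) ?m) ?x ?m P" "P ?m = W k0" "P 0 = W (k0 + int l)" "W (k0 + int l) \<in> V1"
        and lt: "\<forall>i<l. ?s (k0 + int i) = sg (x + int i * q)"
        using D unfolding detour_def by auto
      have C: "rwalk cyc (tp (odd k0) ?m) ?x ?m P"
      proof (rule no_bridge[OF R(1) _ _ l(3) s])
        show "P 0 \<in> V1" using R by simp
        show "\<not> closed_at E1 (P 0) (tp (odd k0) ?m) ?x" by (rule detour_not_closed[OF pre.graph_on_E1 D])
        fix j assume "int j < int rlen - int ?m"
        then have j: "j < l" using l by linarith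
        have "?x + int (?m + j) * q = x + int j * q" by (simp add: algebra_simps)
        then have "sg (?x + int (?m + j) * q) = ?s (k0 + int j)" using lt j by (simp only:)
        also have "line N' d' h' (k0 + int j) = line N' d' (h' + k0 * N') (int j)"
          unfolding add.commute[of k0] line_add ..
        finally show "sg (?x + int (?m + j) * q) \<longleftrightarrow> even (line N' d' (h' + k0 * N') (int j))" .
      qed
      have m0: "0 < ?m" using l(2) by simp
      have "(P 0, tp (tp (odd k0) ?m) 0, sg (?x + int 0 * q), P (Suc 0)) \<in> cyc" by (rule rwalkD[OF C m0])
      then have V0: "P 0 \<in> cycV" by (rule cyc_V(1))
      have "?m - 1 < ?m" using m0 by simp
      from cyc_V(2)[OF rwalkD[OF C this]] have Vm: "P ?m \<in> cycV" using m0 by (simp only: Suc_diff_1)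
      have out: "W (k0 + int i) \<notin> V1" if "0 < i" "i < l" for i using D that unfolding detour_def by blast
      have st: "\<not> (\<exists>u. (W k0, odd k0, sg x, u) \<in> E1)" "\<not> (\<exists>u. (P 0, \<not> tp (odd k0) ?m, \<not> sg (?x - q), u) \<in> E1)"
        using D unfolding detour_def by blast+
      have le: "l \<le> rlen" using l(2) by simp
      show ?thesis
        unfolding detour_def
      proof (intro conjI allI impI)
        show "W k0 \<in> cycV" using Vm unfolding R(2) .
        show "W (k0 + int l) \<in> cycV" using V0 unfolding R(3) .
        show "W (k0 + int i) \<notin> cycV" if "0 < i" "i < l" for i using out[OF that] pre.V_V1 by blast
        show "?s (k0 + int i) = sg (x + int i * q)" if "i < l" for i using lt that by blast
        show "\<not> (\<exists>u. (W k0, odd k0, sg x, u) \<in> cyc)" using st(1) pre.E_E1 by blast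
        show "\<not> (\<exists>u. (P 0, \<not> tp (odd k0) ?m, \<not> sg (?x - q), u) \<in> cyc)" using st(2) pre.E_E1 by blast
      qed (rule l(1) le C R(2,3))+
    qed
    have end_V: "W k0 \<in> cycV" "W (k0 + int l) \<in> cycV" "\<And>i. 0 < i \<Longrightarrow> i < l \<Longrightarrow> W (k0 + int i) \<notin> V1"
      if "detour V1 E1 W ?s k0 l x P" for k0 l x P
      using that det[OF that] unfolding detour_def by auto
    \<comment> \<open>Detours begin and end on the cycle and avoid \<open>V1\<close> in between. At
      an inner node of a bad path both edges of the line are therefore edges of
      \<open>E1\<close>.\<close>
    have in_E1: "(W j, odd j, ?s j, W (j + 1)) \<in> E1" if "W i \<in> V1 - cycV" "j = i \<or> j = i - 1" for i j
    proof (rule ccontr)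
      assume "\<not> ?thesis"
      then obtain k0 l x P where D: "detour V1 E1 W ?s k0 l x P" "k0 \<le> j" "j < k0 + int l" using lay by blast
      then have i: "k0 \<le> i" "i \<le> k0 + int l" using that(2) by auto
      then have e: "i = k0 + int (nat (i - k0))" by simp
      consider "i = k0" | "i = k0 + int l" | "0 < nat (i - k0)" "nat (i - k0) < l" using i by linarith
      then show False
      proof cases
        case 3
        from end_V(3)[OF D(1) this] show False using that(1) unfolding e[symmetric] by simp
      qed (use end_V(1,2)[OF D(1)] that(1) in auto)
    qed
    show "(W k, odd k, ?s k, W (k + 1)) \<in> cyc \<or> (\<exists>k0 l x P. detour cycV cyc W ?s k0 l x P \<and> k0 \<le> k \<and> k < k0 + int l)"
    proof (cases "(W k, odd k, ?s k, W (k + 1)) \<in> E1")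
      case True
      show ?thesis
      proof (cases "(W k, odd k, ?s k, W (k + 1)) \<in> cyc")
        case False
        have "\<exists>k0 l x P. detour cycV cyc W ?s k0 l x P \<and> k0 \<le> k \<and> k < k0 + int l"
        proof (rule pre.new_edge_detour)
          fix i assume i: "W i \<in> V1 - cycV"
          show "(W (i - 1), odd (i - 1), ?s (i - 1), W i) \<in> E1 \<and> (W i, odd i, ?s i, W (i + 1)) \<in> E1"
            using in_E1[OF i, of i] in_E1[OF i, of "i - 1"] by simp
        qed (use True False in blast)
        then show ?thesis ..
      qed simp
    next
      case False
      then show ?thesis using lay det by blast
    qed
  qed
qed

end

section \<open>Lines that leave the cycle and come back to it\<close>

context heckoid begin

text \<open>Equal parities become equal floors after a vertical shift, so the two lines stay at
  bounded distance and have the same slope.\<close>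

lemma same_parity_forever:
  assumes N: "in_range N d" and N': "in_range N' d'"
    and eq: "\<And>j::nat. even (line N' d' h' (t + int j)) \<longleftrightarrow> even (line N d h (i + int j))"
  shows "N' * d = N * d'"
proof -
  have d: "0 < d" "0 < d'" using in_rangeD[OF N] in_rangeD[OF N'] by auto
  define g g' where "g = h + i * N" and "g' = h' + t * N'"
  have e: "line N d h (i + j) = line N d g j" "line N' d' h' (t + j) = line N' d' g' j" for j
    unfolding g_def g'_def add.commute[of i] add.commute[of t] line_add by simp_all
  have ev: "even (line N' d' g' j) \<longleftrightarrow> even (line N d g j)" if "0 \<le> j" for j
    using eq[of "nat j"] that unfolding e by simp
  have "even (line N' d' g' 0 - line N d g 0)" using ev[of 0] by simp
  then obtain z where z: "line N' d' g' 0 - line N d g 0 = 2 * z" by (elim dvdE)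
  have L: "line N' d' g' j = line N d (g + 2 * d * z) j" if "0 \<le> j" for j
  proof (rule steps_in_parity_eq_up[OF steps_line[OF N'] steps_line[OF N], of g' 0 "g + 2 * d * z" j])
    show "line N' d' g' 0 = line N d (g + 2 * d * z) 0" using z line_shift[OF N, of g z 0] by simp
    show "even (line N' d' g' t) \<longleftrightarrow> even (line N d (g + 2 * d * z) t)" if "0 \<le> t" for t
      using ev[OF that] line_shift[OF N, of g z t] by simp
  qed (use that in auto)
  have "N' * d - N * d' = 0"
  proof (rule bounded_multiples_zero)
    fix a :: nat
    let ?h = "g + 2 * d * z"
    let ?Y = "line N d ?h (int a)"
    have "d * ?Y \<le> ?h + int a * N" "?h + int a * N < d * (?Y + 1)" unfolding line_def by (rule div_bounds[OF d(1)])+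
    moreover have "d' * ?Y \<le> g' + int a * N'" "g' + int a * N' < d' * (?Y + 1)"
      using div_bounds[OF d(2), of "g' + int a * N'"] L[of "int a"] unfolding line_def by simp_all
    ultimately have 1: "d' * (d * ?Y) \<le> d' * (?h + int a * N)" "d' * (?h + int a * N) \<le> d' * (d * (?Y + 1))"
      "d * (d' * ?Y) \<le> d * (g' + int a * N')" "d * (g' + int a * N') \<le> d * (d' * (?Y + 1))"
      using d by (simp_all add: mult_left_mono)
    have "\<bar>d * (g' + int a * N') - d' * (?h + int a * N)\<bar> \<le> d * d'"
      using 1 by (simp add: algebra_simps abs_le_iff)
    moreover have "int a * (N' * d - N * d') = (d * (g' + int a * N') - d' * (?h + int a * N)) - (d * g' - d' * ?h)"
      by (simp add: algebra_simps)
    ultimately show "\<bar>int a * (N' * d - N * d')\<bar> \<le> d * d' + \<bar>d * g' - d' * ?h\<bar>" by linarith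
  qed
  then show ?thesis by simp
qed

lemma no_long_full:
  assumes "no_long s" "\<And>j. k \<le> j \<Longrightarrow> j < k + 2 * p * int n \<Longrightarrow> s j \<longleftrightarrow> even (F c (j - k + i))"
  shows False
proof -
  have "\<forall>j<rlen. s (k + int j) = sg (c + i * q + int j * q)"
  proof (intro allI impI)
    fix j assume "j < rlen"
    then have "int j < 2 * p * int n" using int_rlen by linarith
    then have "s (k + int j) \<longleftrightarrow> even (F c (int j + i))" using assms(2)[of "k + int j"] by simp
    moreover have "c + i * q + int j * q = c + (int j + i) * q" by (simp add: algebra_simps)
    ultimately show "s (k + int j) = sg (c + i * q + int j * q)" by (simp only: sg_F)
  qed
  then show False using assms(1) unfolding no_long_def by blast
qed

end

lemma (in heckoid) walks_reverse:
  assumes "graph_on V E" "walks E W s" shows "walks E (\<lambda>j. W (1 - j)) (\<lambda>j. \<not> s (- j))"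
  unfolding walks_def
proof
  fix j :: int
  have "(W (- j), odd (- j), s (- j), W (- j + 1)) \<in> E" using assms(2) unfolding walks_def by blast
  from graph_onD(3)[OF assms(1) this]
  show "(W (1 - j), odd j, \<not> s (- j), W (1 - (j + 1))) \<in> E" by simp
qed

locale reading = base +
  fixes N' d' h' :: int and W :: "int \<Rightarrow> node"
  assumes slope': "slope N' d'" and different: "N' * d \<noteq> N * d'"
    and on_base: "(W k, odd k, even (line N' d' h' k), W (k + 1)) \<in> cyc \<or>
       (\<exists>k0 l x P. detour cycV cyc W (\<lambda>i. even (line N' d' h' i)) k0 l x P \<and> k0 \<le> k \<and> k < k0 + int l)"
begin

lemma N': "in_range N' d'" using slope' unfolding slope_def by blast

abbreviation s :: "int \<Rightarrow> bool" where "s k \<equiv> even (line N' d' h' k)"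

lemma nl: "no_long s" by (rule no_long_line[OF slope'])

text \<open>Agreement of the parities means that the line runs forward along the cycle, not against
  it.\<close>

definition rides :: "int \<Rightarrow> int \<Rightarrow> bool" where "rides t i \<longleftrightarrow> W t = bs i \<and> odd t = odd i"

definition leaves :: "int \<Rightarrow> int \<Rightarrow> bool" where
  "leaves t i \<longleftrightarrow> rides t i \<and> (W t, odd t, s t, W (t + 1)) \<notin> cyc"

lemma rides_step: "rides t i \<Longrightarrow> \<not> leaves t i \<Longrightarrow> rides (t + 1) (i + 1) \<and> s t = cd i"
  unfolding rides_def leaves_def using cyc_out[of i "odd t" "s t" "W (t + 1)"] by auto

lemma leaves_exists:
  assumes "rides t i"
  obtains l where "leaves (t + int l) (i + int l)" "\<And>j. j < l \<Longrightarrow> s (t + int j) = cd (i + int j)"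
proof -
  have "\<exists>l. leaves (t + int l) (i + int l)"
  proof (rule ccontr)
    assume no: "\<not> ?thesis"
    have "rides (t + int j) (i + int j)" for j
    proof (induction j)
      case (Suc j)
      then show ?case using rides_step[OF Suc] no by (simp add: algebra_simps)
    qed (use assms in simp)
    then have "s (t + int j) = cd (i + int j)" for j using rides_step no by blast
    then show False using same_parity_forever[OF N N', of h' t 0 i] different by blast
  qed
  then obtain l where l: "leaves (t + int l) (i + int l)" "\<forall>j<l. \<not> leaves (t + int j) (i + int j)"
    using exists_least_iff[of "\<lambda>l. leaves (t + int l) (i + int l)"] by blast
  have "rides (t + int j) (i + int j)" if "j \<le> l" for j
    using that
  proof (induction j)
    case (Suc j)
    then have "rides (t + int j) (i + int j)" "\<not> leaves (t + int j) (i + int j)" using l(2) by auto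
    from rides_step[OF this] show ?case by (simp add: algebra_simps)
  qed (use assms in simp)
  then have "s (t + int j) = cd (i + int j)" if "j < l" for j using rides_step l(2) that by (meson less_imp_le)
  then show ?thesis using that l(1) by blast
qed

definition jump :: "int \<Rightarrow> int \<Rightarrow> int \<Rightarrow> int \<Rightarrow> bool" where
  "jump t i m c \<longleftrightarrow> face N d 0 c (i - m) i \<and> m < 2 * p * int n \<and> rich_on c i (i - m + 2 * p * int n) \<and>
     (\<forall>j. t \<le> j \<longrightarrow> j < t + 2 * p * int n - m \<longrightarrow> s j = even (F c (j - t + i)))"

text \<open>The detour begins exactly at \<open>t\<close>, as its inner vertices are off the cycle.
  Its existing part is a face ending at \<open>i\<close>; the line goes round the other side of that
  relator and returns at the beginning of the face.\<close>

lemma leaves_jump: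
  assumes "leaves t i" obtains m c where "jump t i m c" "rides (t + 2 * p * int n - m) (i - m)"
proof -
  have Wt: "W t = bs i" "odd t = odd i" and out: "(W t, odd t, s t, W (t + 1)) \<notin> cyc"
    using assms unfolding leaves_def rides_def by auto
  obtain k0 l x P where D: "detour cycV cyc W s k0 l x P" and k: "k0 \<le> t" "t < k0 + int l"
    using on_base[of t] out by blast
  have k0: "k0 = t"
  proof (rule ccontr)
    assume "k0 \<noteq> t"
    then have "0 < nat (t - k0)" "nat (t - k0) < l" using k by auto
    then have "W (k0 + int (nat (t - k0))) \<notin> cycV" using D unfolding detour_def by blast
    then show False using k(1) Wt by simp
  qed
  define m where "m = rlen - l"
  have r: "rich (x - int m * q) m" "l < rlen" using detour_rich[OF nl D] unfolding m_def by auto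
  have le: "l + m = rlen" using r(2) unfolding m_def by simp
  have lm: "int l = 2 * p * int n - int m" unfolding int_rlen[symmetric] le[symmetric] by simp
  have m0: "m < rlen" using D le unfolding detour_def by auto
  have P: "rwalk cyc (tp (odd t) m) (x - int m * q) m P" "P m = W t" "P 0 = W (t + int l)"
    and lt: "\<forall>i<l. s (t + int i) = sg (x + int i * q)"
    and st: "\<not> (\<exists>u. (W t, odd t, sg x, u) \<in> cyc)" "\<not> (\<exists>u. (P 0, \<not> tp (odd t) m, \<not> sg (x - int m * q - q), u) \<in> cyc)"
    using D unfolding detour_def k0 m_def by blast+
  have bw: "back_walk cyc (bs i, odd i, x) m P" unfolding back_walk_def using P Wt by simp
  obtain c where c: "face N d 0 c (i - int m) i" "2 * p dvd x - (c + i * q)" "P 0 = bs (i - int m)"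
  proof (rule cyc_face[OF bw r(1)])
    show "\<not> (\<exists>u. (bs i, odd i, sg x, u) \<in> cyc)" using st(1) Wt by simp
    show "\<not> (\<exists>u. (P 0, \<not> tp (odd i) m, \<not> sg (x - int m * q - q), u) \<in> cyc)" using st(2) Wt by simp
  qed (rule that)
  have "2 * p dvd x - (c + i * q)" by (rule c(2))
  then have sgc: "sg (x + z) = sg (c + i * q + z)" for z by (intro sgn_of_cong[OF p_pos]) simp
  have "rich (x - int m * q + int m * q) (rlen - m)" using cyc_no_long[OF P(1)] by blast
  then have "rich (c + i * q) l" using rich_cong[OF c(2)] le by (simp add: m_def)
  then have arc: "rich_on c i (i - int m + 2 * p * int n)"
    unfolding rich_iff_rich_on[of _ l i] lm by (simp add: algebra_simps)
  have let': "s j = even (F c (j - t + i))" if "t \<le> j" "j < t + 2 * p * int n - int m" for j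
  proof -
    have j: "j = t + int (nat (j - t))" "nat (j - t) < l" using that lm by auto
    have "s j = sg (x + int (nat (j - t)) * q)" using lt j by metis
    also have "\<dots> = sg (c + i * q + int (nat (j - t)) * q)" by (rule sgc)
    also have "c + i * q + int (nat (j - t)) * q = c + (j - t + i) * q" using that by (simp add: algebra_simps)
    finally show ?thesis using sg_F by simp
  qed
  have "jump t i (int m) c" unfolding jump_def using c(1) m0 int_rlen arc let' by auto
  moreover have "rides (t + 2 * p * int n - int m) (i - int m)"
  proof -
    have e: "t + 2 * p * int n - int m = t + int l" using lm by simp
    have "W (t + int l) = bs (i - int m)" using P(3) c(3) by simp
    moreover have "odd (t + 2 * p * int n - int m) = odd (i - int m)" using Wt(2) by simp
    ultimately show ?thesis unfolding rides_def e by blast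
  qed
  ultimately show ?thesis by (rule that)
qed

lemma next_jump:
  assumes "leaves t i"
  obtains m c l where "jump t i m c" "0 \<le> l" "leaves (t + 2 * p * int n - m + l) (i - m + l)"
    "\<And>j. i - m \<le> j \<Longrightarrow> j < i - m + l \<Longrightarrow> s (j + (t - i + 2 * p * int n)) = cd j"
proof -
  obtain m c where mc: "jump t i m c" "rides (t + 2 * p * int n - m) (i - m)" using leaves_jump[OF assms] .
  obtain l where l: "leaves (t + 2 * p * int n - m + int l) (i - m + int l)"
    "\<And>j. j < l \<Longrightarrow> s (t + 2 * p * int n - m + int j) = cd (i - m + int j)"
    using leaves_exists[OF mc(2)] by metis
  have "s (j + (t - i + 2 * p * int n)) = cd j" if "i - m \<le> j" "j < i - m + int l" for j
  proof -
    have "j + (t - i + 2 * p * int n) = t + 2 * p * int n - m + int (nat (j - i + m))" "nat (j - i + m) < l"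
      "i - m + int (nat (j - i + m)) = j" using that by auto
    then show ?thesis using l(2) by metis
  qed
  then show ?thesis using that mc(1) l(1) by (metis of_nat_0_le_iff)
qed

text \<open>Otherwise the line would follow the cycle along the whole face right after reading its
  complement, and so read a full relator.\<close>

lemma jump_short:
  assumes j: "jump t i m c" and l: "\<And>j. i - m \<le> j \<Longrightarrow> j < i - m + l \<Longrightarrow> s (j + (t - i + 2 * p * int n)) = cd j"
  shows "l < m"
proof (rule ccontr)
  assume nl': "\<not> l < m"
  show False
  proof (rule no_long_full[OF nl, of t c i])
    fix k assume k: "t \<le> k" "k < t + 2 * p * int n"
    show "s k \<longleftrightarrow> even (F c (k - t + i))"
    proof (cases "k < t + 2 * p * int n - m")
      case True
      then show ?thesis using j k unfolding jump_def by blast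
    next
      case False
      define j' where "j' = k - t + i - 2 * p * int n"
      have j': "i - m \<le> j'" "j' < i" "j' + (t - i + 2 * p * int n) = k" "k - t + i = j' + 2 * p * int n"
        using False k unfolding j'_def by auto
      have "s k = cd j'" using l[of j'] j' nl' by simp
      also have "line N d 0 j' = F c j'" using j j' unfolding jump_def face_def by simp
      finally show ?thesis unfolding j'(4) F_add_period by simp
    qed
  qed
qed

lemma jump_short_before:
  assumes j: "jump t i m c" and l: "\<And>j. i - l \<le> j \<Longrightarrow> j < i \<Longrightarrow> s (j + (t - i)) = cd j"
  shows "l < m"
proof (rule ccontr)
  assume nl': "\<not> l < m"
  show False
  proof (rule no_long_full[OF nl, of "t - m" c "i - m"])
    fix k assume k: "t - m \<le> k" "k < t - m + 2 * p * int n"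
    have e: "k - (t - m) + (i - m) = k - t + i" by simp
    show "s k \<longleftrightarrow> even (F c (k - (t - m) + (i - m)))"
      unfolding e
    proof (cases "t \<le> k")
      case True
      then show "s k \<longleftrightarrow> even (F c (k - t + i))" using j k unfolding jump_def by (simp add: algebra_simps)
    next
      case False
      define j' where "j' = k - t + i"
      have j': "i - m \<le> j'" "j' < i" "j' + (t - i) = k" using False k unfolding j'_def by auto
      have "s k = cd j'" using l[of j'] j' nl' by simp
      also have "line N d 0 j' = F c j'" using j j' unfolding jump_def face_def by simp
      finally show "s k \<longleftrightarrow> even (F c (k - t + i))" unfolding j'_def .
    qed
  qed
qed

lemma ring:
  assumes "rides t0 i0"
  obtains t i m c l where "ring_walk q p n N d N' d' h' t i m c l"
proof -
  define nxt where "nxt z z' \<longleftrightarrow> (case z of (t, i, m, c, l) \<Rightarrow> case z' of (t', i', m', c', l') \<Rightarrow>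
      t' = t + 2 * p * int n - m + l \<and> i' = i - m + l)" for z z' :: "int \<times> int \<times> int \<times> int \<times> int"
  define good where "good z \<longleftrightarrow> (case z of (t, i, m, c, l) \<Rightarrow> leaves t i \<and> jump t i m c \<and> 0 \<le> l \<and>
      leaves (t + 2 * p * int n - m + l) (i - m + l) \<and>
      (\<forall>j. i - m \<le> j \<longrightarrow> j < i - m + l \<longrightarrow> s (j + (t - i + 2 * p * int n)) = cd j))" for z
  have ex: "\<exists>m c l. good (t, i, m, c, l)" if lv: "leaves t i" for t i
  proof -
    obtain m c l where "jump t i m c" "0 \<le> l" "leaves (t + 2 * p * int n - m + l) (i - m + l)"
      "\<And>j. i - m \<le> j \<Longrightarrow> j < i - m + l \<Longrightarrow> s (j + (t - i + 2 * p * int n)) = cd j"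
      using next_jump[OF lv] by metis
    then have "good (t, i, m, c, l)" using lv unfolding good_def by simp
    then show ?thesis by blast
  qed
  obtain k where "leaves (t0 + int k) (i0 + int k)" using leaves_exists[OF assms] by metis
  then have "\<exists>z. good z" using ex by blast
  moreover have "\<exists>z'. good z' \<and> nxt z z'" if "good z" for z
  proof -
    obtain t i m c l where z: "z = (t, i, m, c, l)" by (cases z)
    then have "leaves (t + 2 * p * int n - m + l) (i - m + l)" using that unfolding good_def by simp
    from ex[OF this] obtain m' c' l' where
      "good (t + 2 * p * int n - m + l, i - m + l, m', c', l')" by blast
    then show ?thesis unfolding nxt_def z by (intro exI[of _ "(t + 2 * p * int n - m + l, i - m + l, m', c', l')"]) simp
  qed
  ultimately obtain f where f: "\<And>a. good (f a)" "\<And>a. nxt (f a) (f (Suc a))"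
    using dependent_nat_choice[of "\<lambda>_. good" "\<lambda>_. nxt"] by metis
  define t i m c l where "t a = fst (f a)" and "i a = fst (snd (f a))" and "m a = fst (snd (snd (f a)))"
    and "c a = fst (snd (snd (snd (f a))))" and "l a = snd (snd (snd (snd (f a))))" for a
  have fa: "f a = (t a, i a, m a, c a, l a)" for a
    unfolding t_def i_def m_def c_def l_def by simp
  have J: "jump (t a) (i a) (m a) (c a)" and l0: "0 \<le> l a"
    and rd: "\<And>j. i a - m a \<le> j \<Longrightarrow> j < i a - m a + l a \<Longrightarrow> s (j + (t a - i a + 2 * p * int n)) = cd j" for a
    using f(1)[of a] unfolding fa good_def by auto
  have tS: "t (Suc a) = t a + 2 * p * int n - m a + l a" and iS: "i (Suc a) = i a - m a + l a" for a
    using f(2)[of a] unfolding fa nxt_def by auto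
  have "ring_walk q p n N d N' d' h' t i m c l"
  proof
    show "in_range N d" "0 < dt N d" "in_range N' d'" by (rule N, rule dt_pos, rule N')
    fix a
    show "face N d 0 (c a) (i a - m a) (i a)" "m a < 2 * p * int n"
      "rich_on (c a) (i a) (i a - m a + 2 * p * int n)"
      using J[of a] unfolding jump_def by auto
    show "even (line N' d' h' k) \<longleftrightarrow> even (F (c a) (k - t a + i a))"
      if "t a \<le> k" "k < t a + 2 * p * int n - m a" for k
      using J[of a] that unfolding jump_def by blast
    show "0 \<le> l a" by (rule l0)
    show "l a < m a" by (rule jump_short[OF J rd])
    show "l a < m (Suc a)"
    proof (rule jump_short_before[OF J])
      fix j assume "i (Suc a) - l a \<le> j" "j < i (Suc a)"
      then show "s (j + (t (Suc a) - i (Suc a))) = cd j" using rd[of a j] unfolding tS iS by (simp add: algebra_simps)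
    qed
    show "i (Suc a) = i a - m a + l a" "t (Suc a) = t a + 2 * p * int n - m a + l a" by (rule iS, rule tS)
    show "even (line N' d' h' (j + t (Suc a) - i (Suc a))) \<longleftrightarrow> even (line N d 0 j)"
      if "i a - m a \<le> j" "j < i (Suc a)" for j
      using rd[of a j] that unfolding tS iS by (simp add: algebra_simps)
  qed
  then show ?thesis by (rule that)
qed

text \<open>\<open>slope\<close> gives \<open>d / dt N d \<le> pm\<close> and
  \<open>d' / (- dt N' d') \<le> pp\<close>, while the ring requires the sum \<open>pm + pp\<close>.
  Both inequalities are therefore equalities.\<close>

lemma at_extreme_slopes:
  assumes "rides t0 i0" shows "d = pm * dt N d" "d' = pp * (- dt N' d')"
proof -
  obtain t i m c l where rw: "ring_walk q p n N d N' d' h' t i m c l" using ring[OF assms] by blast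
  have neg: "dt N' d' < 0"
  proof (rule ccontr)
    assume "\<not> ?thesis"
    then have "0 < dt N' d'" using slope' unfolding slope_def by simp
    then have "d = 2 * dt N d" "d' = 2 * dt N' d'" using ring_walk.same_side[OF rw] by blast+
    \<comment> \<open>Both slopes would be \<open>(2 q - 1) / (2 p)\<close>, hence equal.\<close>
    then have "p * (2 * (N' * d)) = d * (d' * (2 * q - 1))" "p * (2 * (N * d')) = d * (d' * (2 * q - 1))"
      unfolding dt_def by algebra+
    then have "p * (2 * (N' * d)) = p * (2 * (N * d'))" by (simp only:)
    then show False using different p_pos by simp
  qed
  let ?E = "dt N d" and ?E' = "- dt N' d'"
  have "d' * ?E + d * ?E' = 2 * p * int n * (?E * ?E')" by (rule ring_walk.opposite_sides[OF rw neg])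
  also have "\<dots> = (pm + pp) * (?E * ?E')" unfolding pm_pp by simp
  finally have sum: "?E' * (pm * ?E - d) + ?E * (pp * ?E' - d') = 0" by (simp add: algebra_simps)
  have E: "0 < ?E" "0 < ?E'" "d \<le> pm * ?E" "d' \<le> pp * ?E'"
    using slope_base slope' neg dt_pos unfolding slope_def by auto
  then have "0 \<le> ?E' * (pm * ?E - d)" "0 \<le> ?E * (pp * ?E' - d')"
    by (intro mult_nonneg_nonneg; linarith)+
  then have "?E' * (pm * ?E - d) = 0" "?E * (pp * ?E' - d') = 0" using sum by linarith+
  then show "d = pm * ?E" "d' = pp * ?E'" using E(1,2) by auto
qed

lemma meets_base: obtains t i where "W t = bs i"
proof -
  have "\<exists>t. W t \<in> cycV"
    using on_base[of 0]
  proof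
    assume "(W 0, odd (0::int), s 0, W (0 + 1)) \<in> cyc"
    then show ?thesis using cyc_V by blast
  next
    assume "\<exists>k0 l x P. detour cycV cyc W s k0 l x P \<and> k0 \<le> 0 \<and> 0 < k0 + int l"
    then show ?thesis unfolding detour_def by blast
  qed
  then show ?thesis using that cyc_V_obtain by metis
qed

end

context base begin

theorem base_action:
  obtains V' E' where "graph_on V' E'" "\<And>v e b. v \<in> V' \<Longrightarrow> \<exists>u. (v, e, b, u) \<in> E'"
    "\<And>v e x. v \<in> V' \<Longrightarrow> closed_at E' v e x" "cycV \<subseteq> V'" "cyc \<subseteq> E'"
    "\<And>W N' d' h'. slope N' d' \<Longrightarrow> periodic W \<Longrightarrow> walks E' W (\<lambda>i. even (line N' d' h' i)) \<Longrightarrow>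
       N' * d = N * d' \<or> (d = pm * dt N d \<and> d' = pp * (- dt N' d'))"
proof -
  obtain V' E' where T: "graph_on V' E'" "\<And>v e b. v \<in> V' \<Longrightarrow> \<exists>u. (v, e, b, u) \<in> E'"
    "\<And>v e x. v \<in> V' \<Longrightarrow> closed_at E' v e x" "cycV \<subseteq> V'" "cyc \<subseteq> E'"
    and on: "\<And>W N' d' h' k. slope N' d' \<Longrightarrow> periodic W \<Longrightarrow> walks E' W (\<lambda>i. even (line N' d' h' i)) \<Longrightarrow>
       (W k, odd k, even (line N' d' h' k), W (k + 1)) \<in> cyc \<or>
       (\<exists>k0 l x P. detour cycV cyc W (\<lambda>i. even (line N' d' h' i)) k0 l x P \<and> k0 \<le> k \<and> k < k0 + int l)"
    by (rule base_tower) blast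
  show ?thesis
  proof (rule that[OF T])
    fix W N' d' h'
    assume s: "slope N' d'" and pW: "periodic W" and W: "walks E' W (\<lambda>i. even (line N' d' h' i))"
    have N': "in_range N' d'" using s unfolding slope_def by blast
    show "N' * d = N * d' \<or> (d = pm * dt N d \<and> d' = pp * (- dt N' d'))"
    proof (cases "N' * d = N * d'")
      case df: False
      have r1: "reading q p n pm pp N d N' d' h' W"
        using on[OF s pW W] s df by unfold_locales blast+
      obtain t i where ti: "W t = bs i" using reading.meets_base[OF r1] by blast
      have "d = pm * dt N d \<and> d' = pp * (- dt N' d')"
      proof (cases "odd t = odd i")
        case True
        then have "reading.rides d W t i" using ti unfolding reading.rides_def[OF r1] by simp
        then show ?thesis using reading.at_extreme_slopes[OF r1] by blast
      next
        case False
        \<comment> \<open>A line that runs against the cycle is reversed. By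
          \<open>line_reflect\<close> it remains a line of the same slope, with another
          offset.\<close>
        define W' where "W' j = W (1 - j)" for j
        have pW': "periodic W'"
        proof -
          obtain k where k: "k > 0" "\<And>i. W (i + 2 * k) = W i" using pW unfolding periodic_def by blast
          have "W' (i + 2 * k) = W' i" for i
            using k(2)[of "1 - (i + 2 * k)"] unfolding W'_def by simp
          then show ?thesis using k(1) unfolding periodic_def by blast
        qed
        have W': "walks E' W' (\<lambda>i. even (line N' d' (- 1 - h') i))"
        proof -
          have "walks E' W' (\<lambda>j. odd (line N' d' h' (- j)))" using walks_reverse[OF T(1) W] unfolding W'_def .
          then show ?thesis using line_reflect[OF N', of h' "- _"] by simp
        qed
        have r2: "reading q p n pm pp N d N' d' (- 1 - h') W'"
          using on[OF s pW' W'] s df by unfold_locales blast+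
        have "W' (1 - t) = bs i" "odd (1 - t) = odd i" using ti False unfolding W'_def by auto
        then have "reading.rides d W' (1 - t) i" unfolding reading.rides_def[OF r2] by simp
        then show ?thesis using reading.at_extreme_slopes[OF r2] by blast
      qed
      then show ?thesis ..
    qed simp
  qed
qed

end

section \<open>Parabolic moves and mirror images\<close>

definition lpath :: "graph \<Rightarrow> (int \<Rightarrow> int) \<Rightarrow> int \<Rightarrow> nat \<Rightarrow> node \<Rightarrow> node \<Rightarrow> bool" where
  "lpath E g a k v u \<longleftrightarrow> (\<exists>P. P 0 = v \<and> P k = u \<and>
     (\<forall>j<k. (P j, odd (a + int j), even (g (a + int j)), P (Suc j)) \<in> E))"

lemma lpath_0 [simp]: "lpath E g a 0 v u \<longleftrightarrow> u = v"
  unfolding lpath_def by auto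

lemma lpath_append:
  assumes "lpath E g a k v u" "lpath E g (a + int k) l u w" shows "lpath E g a (k + l) v w"
proof -
  obtain P where P: "P 0 = v" "P k = u" "\<forall>j<k. (P j, odd (a + int j), even (g (a + int j)), P (Suc j)) \<in> E"
    using assms(1) unfolding lpath_def by blast
  obtain Q where Q: "Q 0 = u" "Q l = w"
    "\<forall>j<l. (Q j, odd (a + int k + int j), even (g (a + int k + int j)), Q (Suc j)) \<in> E"
    using assms(2) unfolding lpath_def by blast
  define R where "R = (\<lambda>j. if j \<le> k then P j else Q (j - k))"
  have "(R j, odd (a + int j), even (g (a + int j)), R (Suc j)) \<in> E" if j: "j < k + l" for j
  proof (cases "j < k")
    case False
    define i where "i = j - k"
    have i: "j = k + i" "i < l" using False j unfolding i_def by auto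
    have "R j = Q i" "R (Suc j) = Q (Suc i)" "a + int k + int i = a + int j"
      using i P(2) Q(1) unfolding R_def by auto
    then show ?thesis using Q(3)[rule_format, OF i(2)] by (simp only:)
  next
    case True
    then show ?thesis using P(3) unfolding R_def by simp
  qed
  moreover have "R 0 = v" "R (k + l) = w" using P(1,2) Q(1,2) unfolding R_def by auto
  ultimately show ?thesis unfolding lpath_def by (intro exI[of _ R]) simp
qed

lemma lpath_split:
  assumes "lpath E g a (k + l) v w" obtains u where "lpath E g a k v u" "lpath E g (a + int k) l u w"
proof -
  obtain P where P: "P 0 = v" "P (k + l) = w"
    "\<forall>j<k + l. (P j, odd (a + int j), even (g (a + int j)), P (Suc j)) \<in> E"
    using assms unfolding lpath_def by blast
  have "lpath E g a k v (P k)" unfolding lpath_def using P by (intro exI[of _ P]) auto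
  moreover have "lpath E g (a + int k) l (P k) w"
    unfolding lpath_def
  proof (intro exI[of _ "\<lambda>j. P (k + j)"] conjI allI impI)
    fix j assume "j < l"
    then show "(P (k + j), odd (a + int k + int j), even (g (a + int k + int j)), P (k + Suc j)) \<in> E"
      using P(3)[rule_format, of "k + j"] by (simp add: add.assoc)
  qed (use P in auto)
  ultimately show ?thesis by (rule that)
qed

lemma lpath_cong:
  assumes "\<And>i. a \<le> i \<Longrightarrow> i < a + int k \<Longrightarrow> even (g i) \<longleftrightarrow> even (g' i)"
  shows "lpath E g a k v u \<longleftrightarrow> lpath E g' a k v u"
proof -
  have "even (g (a + int j)) = even (g' (a + int j))" if "j < k" for j using assms that by simp
  then show ?thesis unfolding lpath_def by simp
qed

text \<open>Letter \<open>i\<close> of the reversed path is the inverse of letter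
  \<open>c - i\<close>; evenness of \<open>c\<close> keeps the types.\<close>

lemma lpath_reverse:
  assumes gr: "graph_on V E" and P: "lpath E g a k v u" and c: "even c" and b: "b = c - a - int k + 1"
    and g': "\<And>i. b \<le> i \<Longrightarrow> i < b + int k \<Longrightarrow> even (g' i) \<longleftrightarrow> odd (g (c - i))"
  shows "lpath E g' b k u v"
proof -
  obtain P where P: "P 0 = v" "P k = u" "\<forall>j<k. (P j, odd (a + int j), even (g (a + int j)), P (Suc j)) \<in> E"
    using P unfolding lpath_def by blast
  have "(P (k - j), odd (b + int j), even (g' (b + int j)), P (k - Suc j)) \<in> E" if j: "j < k" for j
  proof -
    define i where "i = k - Suc j"
    have i: "i < k" "k - j = Suc i" using j unfolding i_def by auto
    have e: "c - (b + int j) = a + int i" using j unfolding i_def b by (simp add: of_nat_diff)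
    have "(P (Suc i), odd (a + int i), \<not> even (g (a + int i)), P i) \<in> E"
      by (rule graph_onD(3)[OF gr]) (use P(3) i(1) in blast)
    moreover have "odd (a + int i) = odd (b + int j)" unfolding e[symmetric] using c by simp
    moreover have "even (g' (b + int j)) \<longleftrightarrow> \<not> even (g (a + int i))" using g'[of "b + int j"] j unfolding e by simp
    ultimately show ?thesis unfolding i(2) i_def[symmetric] by simp
  qed
  then show ?thesis unfolding lpath_def using P by (intro exI[of _ "\<lambda>j. P (k - j)"]) simp
qed

lemma lpath_det:
  assumes gr: "graph_on V E" and "lpath E g a k v u" "lpath E g a k v u'" shows "u = u'"
proof -
  obtain P where P: "P 0 = v" "P k = u" "\<forall>j<k. (P j, odd (a + int j), even (g (a + int j)), P (Suc j)) \<in> E"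
    using assms(2) unfolding lpath_def by blast
  obtain Q where Q: "Q 0 = v" "Q k = u'" "\<forall>j<k. (Q j, odd (a + int j), even (g (a + int j)), Q (Suc j)) \<in> E"
    using assms(3) unfolding lpath_def by blast
  have "P j = Q j" if "j \<le> k" for j
    using that
  proof (induction j)
    case (Suc j)
    then have "P j = Q j" "j < k" by auto
    then show ?case using P(3) Q(3) graph_on_det[OF gr] by metis
  qed (use P(1) Q(1) in simp)
  then show ?thesis using P(2) Q(2) by blast
qed

definition complete_graph :: "node set \<Rightarrow> graph \<Rightarrow> bool" where
  "complete_graph V E \<longleftrightarrow> graph_on V E \<and> (\<forall>v\<in>V. \<forall>e b. \<exists>u. (v, e, b, u) \<in> E)"

lemma lpath_total:
  assumes E: "complete_graph V E" and v: "v \<in> V" obtains u where "u \<in> V" "lpath E g a k v u"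
proof -
  have "\<exists>u\<in>V. lpath E g a k v u"
  proof (induction k)
    case 0
    show ?case using v by simp
  next
    case (Suc k)
    then obtain u where u: "u \<in> V" "lpath E g a k v u" by blast
    then obtain w where w: "(u, odd (a + int k), even (g (a + int k)), w) \<in> E"
      using E unfolding complete_graph_def by blast
    have "lpath E g (a + int k) 1 u w"
      unfolding lpath_def using w by (intro exI[of _ "\<lambda>j. if j = 0 then u else w"]) simp
    from lpath_append[OF u(2) this] have "lpath E g a (Suc k) v w" by simp
    moreover have "w \<in> V" using E w graph_onD(2) unfolding complete_graph_def by blast
    ultimately show ?case by blast
  qed
  then show ?thesis using that by blast
qed

lemma walks_lpath:
  assumes "\<And>i. (W i, odd i, even (g i), W (i + 1)) \<in> E" shows "lpath E g a k (W a) (W (a + int k))"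
  unfolding lpath_def
proof (intro exI[of _ "\<lambda>j. W (a + int j)"] conjI allI impI)
  fix j
  show "(W (a + int j), odd (a + int j), even (g (a + int j)), W (a + int (Suc j))) \<in> E"
    using assms[of "a + int j"] by (simp add: algebra_simps)
qed auto

lemma lpath_closed_walk:
  assumes P: "lpath E g a k v v" and k: "0 < k" "even k" and per: "\<And>i. even (g (i + int k)) \<longleftrightarrow> even (g i)"
  obtains W where "\<And>i. (W i, odd i, even (g i), W (i + 1)) \<in> E" "\<And>i. W (i + int k) = W i" "W a = v"
proof -
  obtain P where P: "P 0 = v" "P k = v" "\<forall>j<k. (P j, odd (a + int j), even (g (a + int j)), P (Suc j)) \<in> E"
    using P unfolding lpath_def by blast
  define W where "W i = P (nat ((i - a) mod int k))" for i
  have per': "even (g (i + int k * z)) \<longleftrightarrow> even (g i)" for i z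
  proof (induction z rule: int_induct[where k = 0])
    case (step1 z)
    then show ?case using per[of "i + int k * z"] by (simp add: algebra_simps)
  next
    case (step2 z)
    then show ?case using per[of "i + int k * (z - 1)"] by (simp add: algebra_simps)
  qed simp
  have "(W i, odd i, even (g i), W (i + 1)) \<in> E" for i
  proof -
    define j where "j = nat ((i - a) mod int k)"
    have j: "int j = (i - a) mod int k" "j < k" using k(1) unfolding j_def by (simp_all add: nat_less_iff)
    have i: "i = a + int j + int k * ((i - a) div int k)" unfolding j(1) by simp
    have "W (i + 1) = P (Suc j)"
    proof -
      have "i + 1 - a = 1 + (i - a)" by simp
      then have m: "(i + 1 - a) mod int k = (1 + int j) mod int k" unfolding j(1) by (simp only: mod_add_right_eq)
      show ?thesis
      proof (cases "Suc j = k")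
        case True
        then have "(1 + int j) mod int k = 0" by auto
        then show ?thesis unfolding W_def m using True P(1,2) by simp
      next
        case False
        then have "(1 + int j) mod int k = int (Suc j)" using j(2) by simp
        then show ?thesis unfolding W_def m by (simp only: nat_int)
      qed
    qed
    moreover have "W i = P j" unfolding W_def j_def ..
    moreover have "odd i = odd (a + int j)" by (subst i) (use k(2) in simp)
    moreover have "even (g i) = even (g (a + int j))" by (subst i) (rule per')
    ultimately show ?thesis using P(3) j(2) by simp
  qed
  moreover have "W (i + int k) = W i" for i
  proof -
    have "i + int k - a = (i - a) + int k" by simp
    then show ?thesis unfolding W_def by (simp only: mod_add_self2)
  qed
  moreover have "W a = v" unfolding W_def using P(1) by simp
  ultimately show ?thesis by (rule that)
qed

section \<open>Closed lines in an action, and the parabolic move\<close>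

context heckoid begin

text \<open>The line has offset 0, so \<open>W 0\<close> is a vertex fixed by the
  \<open>M\<close>-th power of the word of slope \<open>N / d\<close>.\<close>

definition cycles :: "graph \<Rightarrow> int \<Rightarrow> int \<Rightarrow> nat \<Rightarrow> bool" where
  "cycles E N d M \<longleftrightarrow> (\<exists>W. walks E W (\<lambda>i. even (line N d 0 i)) \<and> (\<forall>i. W (i + 2 * d * int M) = W i))"

lemma cycles_periodic: 
  "0 < d \<Longrightarrow> 0 < M \<Longrightarrow> cycles E N d M \<Longrightarrow> \<exists>W. periodic W \<and> walks E W (\<lambda>i. even (line N d 0 i))"
  unfolding cycles_def periodic_def by (metis mult.assoc mult_pos_pos of_nat_0_less_iff)

lemma lpath_cycles:
  assumes d: "in_range N d" and M: "0 < M" and P: "lpath E (line N d 0) a (nat (2 * d * int M)) v v"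
  shows "cycles E N d M"
proof -
  have d0: "0 < d" using d by (rule in_rangeD)
  have k: "int (nat (2 * d * int M)) = 2 * d * int M" using d0 by simp
  obtain W where "\<And>i. (W i, odd i, even (line N d 0 i), W (i + 1)) \<in> E" "\<And>i. W (i + int (nat (2 * d * int M))) = W i"
  proof (rule lpath_closed_walk[OF P])
    show "0 < nat (2 * d * int M)" using d0 M by simp
    have "even (int (nat (2 * d * int M)))" unfolding k by simp
    then show "even (nat (2 * d * int M))" by (simp only: even_of_nat_iff)
    show "even (line N d 0 (i + int (nat (2 * d * int M)))) \<longleftrightarrow> even (line N d 0 i)" for i
      unfolding k line_period[OF d] by simp
  qed (rule that)
  then show ?thesis unfolding cycles_def walks_def k by blast
qed

lemma cycles_lpath:
  assumes d: "in_range N d" and "cycles E N d M"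
  shows "\<exists>w. lpath E (line N d 0) a (nat (2 * d * int M)) w w"
proof -
  have d0: "0 < d" using d by (rule in_rangeD)
  have k: "int (nat (2 * d * int M)) = 2 * d * int M" using d0 by simp
  obtain W where W: "walks E W (\<lambda>i. even (line N d 0 i))" "\<And>i. W (i + 2 * d * int M) = W i"
    using assms(2) unfolding cycles_def by blast
  have "lpath E (line N d 0) a (nat (2 * d * int M)) (W a) (W a)" for a
    using walks_lpath[of W "line N d 0" E a "nat (2 * d * int M)"] W(1) unfolding walks_def k W(2) by blast
  then show ?thesis by blast
qed

text \<open>Completeness makes each generator a permutation of \<open>V\<close>, and closed relators
  let the resulting action factor through the Heckoid group.\<close>

definition action :: "node set \<Rightarrow> graph \<Rightarrow> bool" where
  "action V E \<longleftrightarrow> complete_graph V E \<and> (\<forall>v\<in>V. \<forall>e x. closed_at E v e x)"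

lemma action_relator:
  assumes A: "action V E" and v: "v \<in> V" shows "lpath E (F c) a rlen v v"
proof -
  have "closed_at E v (odd a) (c + a * q)" using A v unfolding action_def by blast
  then obtain P where P: "rwalk E (odd a) (c + a * q) rlen P" "P 0 = v" "P rlen = v" unfolding closed_at_def by blast
  have "(P j, odd (a + int j), even (F c (a + int j)), P (Suc j)) \<in> E" if "j < rlen" for j
  proof -
    have "(P j, tp (odd a) j, sg (c + a * q + int j * q), P (Suc j)) \<in> E" by (rule rwalkD[OF P(1) that])
    moreover have "tp (odd a) j = odd (a + int j)" by (auto simp: tp_def)
    moreover have "c + a * q + int j * q = c + (a + int j) * q" by (simp add: algebra_simps)
    ultimately show ?thesis by (simp only: sg_F)
  qed
  then show ?thesis unfolding lpath_def using P(2,3) by blast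
qed

text \<open>With \<open>D = dt N d\<close>, the line of slope \<open>N'/d'\<close> consists of pieces of relators of length about \<open>2 n p - d/D\<close>;
  replacing each of them by the inverse of the complementary piece gives the line of slope \<open>N/d\<close>.\<close>

lemma parabolic:
  assumes A: "action V E" and v: "v \<in> V" and N: "in_range N d" and D: "0 < dt N d"
    and N': "N' = 2 * int n * dt N d * q - N" "d' = 2 * int n * dt N d * p - d" and d': "0 < d'"
  obtains u where "u \<in> V" "lpath E (line N' d' 0) 0 (nat (2 * d' * int M)) v u"
    "lpath E (line N d 0) 1 (nat (2 * d * int M)) v u"
proof -
  define D where "D = dt N d"
  define R where "R = 2 * p * int n"
  have D0: "0 < D" using D unfolding D_def .
  have d0: "0 < d" using N by (rule in_rangeD)
  have gr: "graph_on V E" and E: "complete_graph V E" using A unfolding action_def complete_graph_def by auto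
  have dR: "d' = R * D - d" using N' unfolding R_def D_def by (simp add: algebra_simps)
  \<comment> \<open>Block boundaries: the first \<open>m\<close> relators contribute
    \<open>f m\<close> letters to the line of slope \<open>N / d\<close> and \<open>t m\<close>
    letters to that of slope \<open>N' / d'\<close>, together \<open>R * m\<close>.\<close>
  define f where "f m = (int m * d) div D" for m
  have f: "D * f m \<le> int m * d" "int m * d < D * (f m + 1)" for m unfolding f_def by (rule div_bounds[OF D0])+
  have fS: "f m \<le> f (Suc m)" "f (Suc m) \<le> f m + R" for m
  proof -
    show "f m \<le> f (Suc m)" unfolding f_def by (rule zdiv_mono1[OF _ D0]) (use d0 in \<open>simp add: algebra_simps\<close>)
    have "int (Suc m) * d \<le> int m * d + R * D" using d' dR by (simp add: algebra_simps)
    then have "f (Suc m) \<le> (int m * d + R * D) div D" unfolding f_def by (rule zdiv_mono1[OF _ D0])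
    then show "f (Suc m) \<le> f m + R" unfolding f_def using D0 by simp
  qed
  define t where "t m = R * int m - f m" for m
  have tS: "t m \<le> t (Suc m)" for m using fS(2)[of m] unfolding t_def by (simp add: algebra_simps)
  have t0: "t 0 = 0" "f 0 = 0" unfolding t_def f_def by simp_all
  have f0: "0 \<le> f m" for m unfolding f_def using d0 D0 by (simp add: pos_imp_zdiv_nonneg_iff)
  have tn: "0 \<le> t m" for m by (rule lift_Suc_mono_le[of t 0 m, OF tS, unfolded t0(1)]) simp
  have s': "line N' d' 0 i = F (int m) i" if i: "t m \<le> i" "i < t (Suc m)" for m i
  proof -
    have "int m * d' \<le> i * D"
    proof -
      have "int m * d' = R * int m * D - int m * d" unfolding dR by (simp add: algebra_simps)
      also have "\<dots> < R * int m * D - D * f m + D" using f(1)[of m] D0 by linarith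
      also have "\<dots> = (t m + 1) * D" unfolding t_def by (simp add: algebra_simps)
      finally have "int m * d' < (t m + 1) * D" .
      have "R * int m * D - int m * d \<le> R * int m * D - D * f m" using f(1)[of m] by simp
      also have "\<dots> = t m * D" unfolding t_def by (simp add: algebra_simps)
      also have "\<dots> \<le> i * D" using i(1) D0 by simp
      finally show ?thesis unfolding dR by (simp add: algebra_simps)
    qed
    moreover have "i * D < (int m + 1) * d'"
    proof -
      have "i + 1 \<le> t (Suc m)" using i(2) by simp
      then have "(i + 1) * D \<le> t (Suc m) * D" using D0 by simp
      also have "\<dots> = R * int (Suc m) * D - D * f (Suc m)" unfolding t_def by (simp add: algebra_simps)
      also have "\<dots> < R * int (Suc m) * D - int (Suc m) * d + D" using f(2)[of "Suc m"] by (simp add: algebra_simps)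
      finally show ?thesis unfolding dR by (simp add: algebra_simps)
    qed
    moreover have e: "i * N' * p = i * q * d' + i * D"
      unfolding N' dt_def D_def by (simp add: algebra_simps)
    ultimately have b: "(int m + i * q) * d' \<le> i * N' * p" "i * N' * p < (int m + i * q + 1) * d'"
      by (simp_all add: algebra_simps)
    let ?Y = "F (int m) i"
    have Y: "p * ?Y \<le> int m + i * q" "int m + i * q + 1 \<le> p * (?Y + 1)" using F_bounds[of "int m" i] by simp_all
    have "p * ?Y * d' \<le> (int m + i * q) * d'" using Y(1) d' by (intro mult_right_mono) auto
    then have "p * (?Y * d') \<le> p * (i * N')" using b(1) by (simp add: algebra_simps)
    then have 1: "?Y * d' \<le> i * N'" using p_pos by simp
    have "(int m + i * q + 1) * d' \<le> p * (?Y + 1) * d'" using Y(2) d' by (intro mult_right_mono) auto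
    then have "p * (i * N') < p * ((?Y + 1) * d')" using b(2) by (simp add: algebra_simps)
    then have 2: "i * N' < (?Y + 1) * d'" using p_pos by simp
    have "i * N' = d' * ?Y + (i * N' - d' * ?Y)" by simp
    then show ?thesis unfolding line_def add_0
      by (rule int_div_pos_eq) (use 1 2 in \<open>simp_all add: algebra_simps\<close>)
  qed
  have s: "line N d 0 i = F (- 1 - int m) i" if i: "f m < i" "i \<le> f (Suc m)" for m i
  proof -
    have "int m * d < i * D"
    proof -
      have "D * (f m + 1) \<le> D * i" using i(1) D0 by simp
      then show ?thesis using f(2)[of m] by (simp add: algebra_simps)
    qed
    moreover have "i * D \<le> (int m + 1) * d"
    proof -
      have "D * i \<le> D * f (Suc m)" using i(2) D0 by simp
      then show ?thesis using f(1)[of "Suc m"] by (simp add: algebra_simps)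
    qed
    moreover have "i * N * p = i * q * d - i * D" unfolding dt_def D_def by (simp add: algebra_simps)
    ultimately have b: "(- 1 - int m + i * q) * d \<le> i * N * p" "i * N * p < (- 1 - int m + i * q + 1) * d"
      by (simp_all add: algebra_simps)
    let ?Y = "F (- 1 - int m) i"
    have Y: "p * ?Y \<le> - 1 - int m + i * q" "- 1 - int m + i * q + 1 \<le> p * (?Y + 1)" using F_bounds[of "- 1 - int m" i] by simp_all
    have "p * ?Y * d \<le> (- 1 - int m + i * q) * d" using Y(1) d0 by (intro mult_right_mono) auto
    then have "p * (?Y * d) \<le> p * (i * N)" using b(1) by (simp add: algebra_simps)
    then have 1: "?Y * d \<le> i * N" using p_pos by simp
    have "(- 1 - int m + i * q + 1) * d \<le> p * (?Y + 1) * d" using Y(2) d0 by (intro mult_right_mono) auto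
    then have "p * (i * N) < p * ((?Y + 1) * d)" using b(2) by (simp add: algebra_simps)
    then have 2: "i * N < (?Y + 1) * d" using p_pos by simp
    have "i * N = d * ?Y + (i * N - d * ?Y)" by simp
    then show ?thesis unfolding line_def add_0
      by (rule int_div_pos_eq) (use 1 2 in \<open>simp_all add: algebra_simps\<close>)
  qed
  \<comment> \<open>The second path starts at index 1 because its block \<open>m\<close> consists of
    the indices after \<open>f m\<close> up to and including \<open>f (Suc m)\<close>.\<close>
  have blocks: "\<exists>u\<in>V. lpath E (line N' d' 0) 0 (nat (t m)) v u \<and> lpath E (line N d 0) 1 (nat (f m)) v u" for m
  proof (induction m)
    case 0
    show ?case using v by (simp add: t0)
  next
    case (Suc m)
    then obtain u where u: "u \<in> V" "lpath E (line N' d' 0) 0 (nat (t m)) v u" "lpath E (line N d 0) 1 (nat (f m)) v u"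
      by blast
    define L K where "L = nat (t (Suc m) - t m)" and "K = nat (f (Suc m) - f m)"
    have L: "int L = t (Suc m) - t m" and K: "int K = f (Suc m) - f m" using tS[of m] fS(1)[of m] unfolding L_def K_def by auto
    have LK: "L + K = rlen"
    proof -
      have "int L + int K = int rlen" unfolding L K int_rlen t_def R_def by (simp add: algebra_simps)
      then show ?thesis by linarith
    qed
    obtain w where w: "lpath E (F (int m)) (t m) L u w" "lpath E (F (int m)) (t m + int L) K w u"
      by (rule lpath_split[of E "F (int m)" "t m" L K u u]) (use action_relator[OF A u(1)] LK in simp)
    obtain w' where w': "w' \<in> V" "lpath E (F (int m)) (t m) L u w'" by (rule lpath_total[OF E u(1)])
    have wV: "w \<in> V" using w' lpath_det[OF gr w(1) w'(2)] by simp
    have p1: "lpath E (line N' d' 0) (t m) L u w"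
      using w(1) lpath_cong[of "t m" L "line N' d' 0" "F (int m)"] s'[of m] unfolding L by simp
    have p2: "lpath E (line N d 0) (f m + 1) K u w"
    proof (rule lpath_reverse[OF gr w(2)])
      show "even (R * (int m + 1))" unfolding R_def by simp
      show "f m + 1 = R * (int m + 1) - (t m + int L) - int K + 1" unfolding L K t_def by (simp add: algebra_simps)
      fix i assume "f m + 1 \<le> i" "i < f m + 1 + int K"
      then have i: "line N d 0 i = F (- 1 - int m) i" using s[of m i] unfolding K by simp
      have "- 1 - (int m + (R * (int m + 1) - i) * q) = (- 1 - int m + 2 * p * (- (int n * (int m + 1) * q))) + i * q"
        unfolding R_def by (simp add: algebra_simps)
      then have "sg (- 1 - (int m + (R * (int m + 1) - i) * q)) \<longleftrightarrow> even (F (- 1 - int m + 2 * p * (- (int n * (int m + 1) * q))) i)"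
        by (simp only: sg_F)
      then have "sg (- 1 - (int m + (R * (int m + 1) - i) * q)) \<longleftrightarrow> even (line N d 0 i)"
        unfolding F_shift i by simp
      then show "even (line N d 0 i) \<longleftrightarrow> odd (F (int m) (R * (int m + 1) - i))"
        using sgn_of_reflect[OF p_pos, of "int m + (R * (int m + 1) - i) * q"] sg_F[of "int m" "R * (int m + 1) - i"] by blast
    qed
    have "lpath E (line N' d' 0) (0 + int (nat (t m))) L u w" "lpath E (line N d 0) (1 + int (nat (f m))) K u w"
      using p1 p2 tn[of m] f0[of m] by (simp_all add: add.commute)
    from lpath_append[OF u(2) this(1)] lpath_append[OF u(3) this(2)]
    have "lpath E (line N' d' 0) 0 (nat (t m) + L) v w" "lpath E (line N d 0) 1 (nat (f m) + K) v w" .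
    moreover have "nat (t m) + L = nat (t (Suc m))" "nat (f m) + K = nat (f (Suc m))"
      using L K tn[of m] tn[of "Suc m"] f0[of m] f0[of "Suc m"] by linarith+
    ultimately show ?case using wV by auto
  qed
  \<comment> \<open>After \<open>2 * D * M\<close> relators both lines have completed exactly
    \<open>M\<close> periods.\<close>
  define m where "m = nat (2 * D * int M)"
  have m: "int m = 2 * D * int M" unfolding m_def using D0 by simp
  have e: "int m * d = (2 * d * int M) * D" unfolding m by simp
  have "f m = 2 * d * int M" unfolding f_def e using D0 by simp
  moreover have "t m = 2 * d' * int M" unfolding t_def calculation dR m by (simp add: algebra_simps)
  ultimately show ?thesis using blocks[of m] that by auto
qed

lemma parabolic_cycles:
  assumes A: "action V E" and N: "in_range N d" "in_range N' d'" and D: "0 < dt N d" and M: "0 < M"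
    and N': "N' = 2 * int n * dt N d * q - N" "d' = 2 * int n * dt N d * p - d"
  shows "cycles E N d M \<longleftrightarrow> cycles E N' d' M"
proof -
  have gr: "graph_on V E" using A unfolding action_def complete_graph_def by auto
  have d: "0 < d" "0 < d'" using N in_rangeD by auto
  have vV: "v \<in> V" if "lpath E g a k v v" "0 < k" for g a k v
  proof -
    obtain P where "P 0 = v" "(P 0, odd (a + int 0), even (g (a + int 0)), P (Suc 0)) \<in> E"
      using \<open>lpath E g a k v v\<close> \<open>0 < k\<close> unfolding lpath_def by blast
    then show ?thesis using graph_onD(1)[OF gr] by blast
  qed
  show ?thesis
  proof
    assume "cycles E N d M"
    then obtain w where w: "lpath E (line N d 0) 1 (nat (2 * d * int M)) w w" using cycles_lpath[OF N(1)] by metis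
    have wV: "w \<in> V" using vV[OF w] d M by simp
    obtain u where "lpath E (line N' d' 0) 0 (nat (2 * d' * int M)) w u" "lpath E (line N d 0) 1 (nat (2 * d * int M)) w u"
      using parabolic[OF A wV N(1) D N' d(2)] by metis
    then have "lpath E (line N' d' 0) 0 (nat (2 * d' * int M)) w w" using lpath_det[OF gr w] by metis
    then show "cycles E N' d' M" by (rule lpath_cycles[OF N(2) M])
  next
    assume "cycles E N' d' M"
    then obtain w where w: "lpath E (line N' d' 0) 0 (nat (2 * d' * int M)) w w" using cycles_lpath[OF N(2)] by metis
    have wV: "w \<in> V" using vV[OF w] d M by simp
    obtain u where "lpath E (line N' d' 0) 0 (nat (2 * d' * int M)) w u" "lpath E (line N d 0) 1 (nat (2 * d * int M)) w u"
      using parabolic[OF A wV N(1) D N' d(2)] by metis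
    then have "lpath E (line N d 0) 1 (nat (2 * d * int M)) w w" using lpath_det[OF gr w] by metis
    then show "cycles E N d M" by (rule lpath_cycles[OF N(1) M])
  qed
qed

end

section \<open>Mirror images\<close>

definition flip :: "graph \<Rightarrow> graph" where "flip E = {(v, e, b, u). (v, e, \<not> b, u) \<in> E}"

lemma flip_iff [simp]: "(v, e, b, u) \<in> flip E \<longleftrightarrow> (v, e, \<not> b, u) \<in> E" by (simp add: flip_def)

lemma complete_graph_flip: 
  assumes "complete_graph V E" shows "complete_graph V (flip E)"
proof -
  have gr: "graph_on V E" and c: "\<And>v e b. v \<in> V \<Longrightarrow> \<exists>u. (v, e, b, u) \<in> E" using assms unfolding complete_graph_def by auto
  have "graph_on V (flip E)"
    unfolding graph_on_def
  proof (intro conjI allI impI)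
    fix v e b w assume "(v, e, b, w) \<in> flip E"
    then have *: "(v, e, \<not> b, w) \<in> E" by simp
    show "v \<in> V" by (rule graph_onD(1)[OF gr *])
    show "(w, e, \<not> b, v) \<in> flip E" using graph_onD(3)[OF gr *] by simp
  next
    fix v e b w w' assume "(v, e, b, w) \<in> flip E" "(v, e, b, w') \<in> flip E"
    then show "w = w'" using graph_on_det[OF gr] by simp
  qed
  then show ?thesis unfolding complete_graph_def using c by simp
qed

context heckoid begin

lemma heckoid_uminus: "heckoid (- q) p n"
  by unfold_locales (use p_ge coprime_qp n_ge in simp_all)

text \<open>Inverting both generators negates slopes: with \<open>- q\<close> in place of
  \<open>q\<close>, the phase \<open>- 1 - x\<close> carries exactly the opposite signs of the phase
  \<open>x\<close>.\<close>

lemma action_flip: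
  assumes "heckoid.action (- q) p n V E" shows "action V (flip E)"
proof -
  interpret m: heckoid "- q" p n by (rule heckoid_uminus)
  have c: "complete_graph V E" and cl: "\<And>v e x. v \<in> V \<Longrightarrow> m.closed_at E v e x" using assms unfolding m.action_def by auto
  have "closed_at (flip E) v e x" if v: "v \<in> V" for v e x
  proof -
    obtain P where P: "m.rwalk E e (- 1 - x) rlen P" "P 0 = v" "P rlen = v"
      using cl[OF v, of e "- 1 - x"] unfolding m.closed_at_def by blast
    have "(P i, tp e i, sg (x + int i * q), P (Suc i)) \<in> flip E" if "i < rlen" for i
    proof -
      have "(P i, tp e i, sg (- 1 - x + int i * - q), P (Suc i)) \<in> E" by (rule m.rwalkD[OF P(1) that])
      moreover have e: "- 1 - x + int i * - q = - 1 - (x + int i * q)" by simp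
      have "sg (- 1 - x + int i * - q) = (\<not> sg (x + int i * q))" unfolding e by (rule sgn_of_reflect[OF p_pos])
      ultimately show ?thesis by (simp only: flip_iff)
    qed
    then show ?thesis unfolding closed_at_def rwalk_def using P(2,3) by blast
  qed
  then show ?thesis unfolding action_def using complete_graph_flip[OF c] by blast
qed

lemma cycles_flip:
  assumes gr: "graph_on V E" and N: "in_range N d" shows "cycles (flip E) N d M \<longleftrightarrow> cycles E (- N) d M"
proof -
  have l: "line N d 0 (- j) = line (- N) d 0 j" for j unfolding line_def by simp
  have per: "W (1 - (i + 2 * d * int M)) = W (1 - i)" if "\<forall>i. W (i + 2 * d * int M) = W i" for W :: "int \<Rightarrow> node" and i
    using spec[OF that, of "1 - (i + 2 * d * int M)"] by simp
  have fl: "walks (flip E) W s \<longleftrightarrow> walks E W (\<lambda>i. \<not> s i)" for W s unfolding walks_def by simp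
  show ?thesis
  proof
    assume "cycles (flip E) N d M"
    then obtain W where W: "walks E W (\<lambda>i. odd (line N d 0 i))" "\<forall>i. W (i + 2 * d * int M) = W i"
      unfolding cycles_def fl by blast
    have "walks E (\<lambda>j. W (1 - j)) (\<lambda>j. even (line (- N) d 0 j))" using walks_reverse[OF gr W(1)] unfolding l by simp
    then show "cycles E (- N) d M" unfolding cycles_def using per[OF W(2)] by (intro exI[of _ "\<lambda>j. W (1 - j)"]) simp
  next
    assume "cycles E (- N) d M"
    then obtain W where W: "walks E W (\<lambda>i. even (line (- N) d 0 i))" "\<forall>i. W (i + 2 * d * int M) = W i"
      unfolding cycles_def by blast
    have "walks E (\<lambda>j. W (1 - j)) (\<lambda>j. \<not> even (line N d 0 j))" using walks_reverse[OF gr W(1)] unfolding l[symmetric] by simp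
    then show "cycles (flip E) N d M"
      unfolding cycles_def fl using per[OF W(2)] by (intro exI[of _ "\<lambda>j. W (1 - j)"]) simp
  qed
qed

text \<open>As \<open>p\<close> does not divide \<open>q\<close>, the floor of
  \<open>- q / p\<close> is one less than the negated floor, so the integer interval around the
  slope is reflected onto the one around its negative.\<close>

lemma in_range_uminus: 
  assumes "in_range N d" shows "heckoid.in_range (- q) p (- N) d"
proof -
  interpret m: heckoid "- q" p n by (rule heckoid_uminus)
  have "q mod p \<noteq> 0"
  proof
    assume "q mod p = 0"
    then have "p dvd q" by auto
    then have "p dvd 1" using coprime_qp by (simp add: coprime_absorb_right)
    then show False using p_ge by simp
  qed
  then have e: "- q div p = - (q div p) - 1" using zdiv_zminus1_eq_if[of p q] p_pos by simp
  show ?thesis using assms unfolding in_range_def m.in_range_def e by (simp add: algebra_simps)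
qed

lemma dt_uminus: "heckoid.dt (- q) p (- N) d = - dt N d"
proof -
  interpret m: heckoid "- q" p n by (rule heckoid_uminus)
  show ?thesis unfolding dt_def m.dt_def by (simp add: algebra_simps)
qed

end

context farey_pair begin

lemma farey_pair_uminus: "farey_pair (- q) p n pp pm"
proof -
  interpret m: heckoid "- q" p n by (rule heckoid_uminus)
  have e: "pp = 2 * int n * p - pm" using pm_pp by simp
  have "pp * - q - 1 = (pm * q - 1) - p * (2 * int n * q)" unfolding e by (simp add: algebra_simps)
  moreover have "p dvd p * (2 * int n * q)" by simp
  ultimately have "p dvd pp * - q - 1" using dvd_diff[OF pm_q, of "p * (2 * int n * q)"] by (simp only:)
  then show ?thesis by unfold_locales (use pm_pos pp_pos pm_pp in simp_all)
qed

lemma slope_uminus: assumes "slope N d" shows "farey_pair.slope (- q) p pp pm (- N) d"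
proof -
  interpret m: farey_pair "- q" p n pp pm by (rule farey_pair_uminus)
  show ?thesis using assms in_range_uminus dt_uminus unfolding slope_def m.slope_def by auto
qed

lemma slopeD: assumes "slope N d" shows "in_range N d" "0 < d" "dt N d \<noteq> 0"
  using assms in_rangeD unfolding slope_def by auto

end

section \<open>Actions that separate slopes\<close>

context heckoid_pair begin

lemma separate_from_left:
  assumes s: "slope N d" "slope N' d'" and D: "0 < dt N d" and ne: "N' * d \<noteq> N * d'"
    and ex: "\<not> (d = pm * dt N d \<and> d' = pp * (- dt N' d'))"
  shows "\<exists>V E. action V E \<and> cycles E N d 1 \<and> \<not> cycles E N' d' 1"
proof -
  interpret b: base q p n pm pp N d by unfold_locales (rule s(1), rule D)
  obtain V E where T: "graph_on V E" "\<And>v e b. v \<in> V \<Longrightarrow> \<exists>u. (v, e, b, u) \<in> E"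
    "\<And>v e x. v \<in> V \<Longrightarrow> closed_at E v e x" "b.cyc \<subseteq> E"
    "\<And>W N' d' h'. slope N' d' \<Longrightarrow> periodic W \<Longrightarrow> walks E W (\<lambda>i. even (line N' d' h' i)) \<Longrightarrow>
       N' * d = N * d' \<or> (d = pm * dt N d \<and> d' = pp * (- dt N' d'))"
    by (rule b.base_action) blast
  have "action V E" unfolding action_def complete_graph_def using T(1-3) by blast
  moreover have "walks b.cyc b.bs (\<lambda>i. even (line N d 0 i))" unfolding walks_def b.cyc_out by simp
  then have "walks E b.bs (\<lambda>i. even (line N d 0 i))" using T(4) unfolding walks_def by blast
  then have "cycles E N d 1" unfolding cycles_def by (intro exI[of _ b.bs]) simp
  moreover have "\<not> cycles E N' d' 1"
    using cycles_periodic[OF slopeD(2)[OF s(2)] zero_less_one, of E N'] T(5)[OF s(2)] ne ex by blast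
  ultimately show ?thesis by blast
qed

theorem separate_cycles:
  assumes s: "slope N d" "slope N' d'" and ne: "N' * d \<noteq> N * d'"
    and ex: "\<not> (d = pm * dt N d \<and> d' = pp * (- dt N' d'))" "\<not> (d' = pm * dt N' d' \<and> d = pp * (- dt N d))"
  shows "\<exists>V E. action V E \<and> cycles E N d 1 \<noteq> cycles E N' d' 1"
proof -
  consider "0 < dt N d" | "0 < dt N' d'" | "dt N d < 0" "dt N' d' < 0" using s unfolding slope_def by linarith
  then show ?thesis
  proof cases
    case 1
    then show ?thesis using separate_from_left[OF s 1 ne ex(1)] by blast
  next
    case 2
    then show ?thesis using separate_from_left[OF s(2,1) 2 _ ex(2)] ne by metis
  next
    case 3
    \<comment> \<open>Both slopes lie to the right of \<open>q / p\<close>. The mirror image moves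
      them to the left, where two slopes are never the exceptional pair.\<close>
    interpret m: farey_pair "- q" p n pp pm by (rule farey_pair_uminus)
    interpret m: heckoid_pair "- q" p n pp pm by unfold_locales (rule pp_less, rule pm_less)
    have D: "0 < m.dt (- N) d" "0 < m.dt (- N') d'" using 3 dt_uminus by auto
    have "0 < pm * m.dt (- N') d'" using pm_pos D(2) by simp
    then have "\<not> (d = pp * m.dt (- N) d \<and> d' = pm * (- m.dt (- N') d'))" using slopeD(2)[OF s(2)] by auto
    moreover have "- N' * d \<noteq> - N * d'" using ne by simp
    ultimately obtain V E where E: "m.action V E" "m.cycles E (- N) d 1" "\<not> m.cycles E (- N') d' 1"
      using m.separate_from_left[OF slope_uminus[OF s(1)] slope_uminus[OF s(2)] D(1)] by blast
    have gr: "graph_on V E" using E(1) unfolding m.action_def complete_graph_def by blast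
    have "cycles (flip E) N d 1" "\<not> cycles (flip E) N' d' 1"
      using E(2,3) cycles_flip[OF gr] slopeD(1)[OF s(1)] slopeD(1)[OF s(2)] by blast+
    then show ?thesis using action_flip[OF E(1)] by blast
  qed
qed

text \<open>Relators alternate the generators, so the cycle of a single generator contains at most
  one letter of a relator and is thin. A closed line would already lie on that cycle, which its
  alternating letters exclude.\<close>

theorem cycle_without_line:
  assumes s: "slope N d" and k: "0 < k"
  shows "\<exists>V E P. action V E \<and> P 0 \<in> V \<and> (\<forall>i::nat. (P i, e, b, P (Suc i)) \<in> E) \<and> P k = P 0 \<and>
    (\<forall>M>0. \<not> cycles E N d M)"
proof -
  define B where "B i = Base (i mod int k)" for i
  define V0 where "V0 = range B"
  define E0 where "E0 = range (\<lambda>i. (B i, e, b, B (i + 1))) \<union> range (\<lambda>i. (B (i + 1), e, \<not> b, B i))"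
  have B: "B (i + z) = B (j + z)" if "B i = B j" for i j z
    using that mod_add_cong[of i "int k" j z z] unfolding B_def by simp
  have B1: "B i = B j" if "B (i + 1) = B (j + 1)" for i j using B[OF that, of "- 1"] by simp
  have gr: "graph_on V0 E0"
    unfolding graph_on_def
  proof (intro conjI allI impI)
    fix v t b' w assume "(v, t, b', w) \<in> E0"
    then show "v \<in> V0" "(w, t, \<not> b', v) \<in> E0" unfolding E0_def V0_def by auto
  next
    fix v t b' w w' assume *: "(v, t, b', w) \<in> E0" "(v, t, b', w') \<in> E0"
    show "w = w'"
    proof (cases "b' = b")
      case True
      then obtain i j where "v = B i" "w = B (i + 1)" "v = B j" "w' = B (j + 1)"
        using * unfolding E0_def by fastforce
      then show ?thesis using B[of i j 1] by simp
    next
      case False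
      then obtain i j where "v = B (i + 1)" "w = B i" "v = B (j + 1)" "w' = B j"
        using * unfolding E0_def by fastforce
      then show ?thesis using B1[of i j] by simp
    qed
  qed
  have fr: "fresh_for V0 E0" unfolding fresh_for_def V0_def B_def by auto
  have ty: "t = e" if "(v, t, b, w) \<in> E0" for v t b w using that unfolding E0_def by auto
  have th: "thin V0 E0"
    unfolding thin_def
  proof (intro allI impI)
    fix t x m P assume P: "rwalk E0 t x m P"
    have "m \<le> 1"
    proof (rule ccontr)
      assume "\<not> m \<le> 1"
      then have "t = e" "(\<not> t) = e" using ty[OF rwalkD[OF P, of 0]] ty[OF rwalkD[OF P, of 1]] by simp_all
      then show False by simp
    qed
    show "\<not> rich x m"
    proof
      assume "rich x m"
      then have "p dvd x" "p dvd x + 1" using \<open>m \<le> 1\<close> unfolding rich_def by (auto simp: less_Suc_eq_0_disj le_Suc_eq)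
      then have "p dvd (x + 1) - x" using dvd_diff by blast
      then show False using p_ge by simp
    qed
  qed
  obtain V' E' V1 E1 where T: "graph_on V' E'" "V0 \<subseteq> V'"
    "\<And>v e b. v \<in> V' \<Longrightarrow> \<exists>u. (v, e, b, u) \<in> E'" "\<And>v e x. v \<in> V' \<Longrightarrow> closed_at E' v e x"
    "E0 \<subseteq> E'"  "layer_over V0 E0 V1 E1"
    "\<And>W s. \<lbrakk>walks E' W s; periodic W; periodic s; no_long s\<rbrakk> \<Longrightarrow> walks E1 W s"
    using tower[OF gr fr thin_imp_fatg[OF th]] by metis
  have A: "action V' E'" unfolding action_def complete_graph_def using T(1,3,4) by blast
  have N: "in_range N d" using s unfolding slope_def by blast
  have no: "\<not> cycles E' N d M" if M: "0 < M" for M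
  proof
    assume "cycles E' N d M"
    then obtain W where W: "periodic W" "walks E' W (\<lambda>i. even (line N d 0 i))"
      using cycles_periodic[OF in_rangeD[OF N] M] by blast
    have "periodic (\<lambda>i. even (line N d 0 i))" unfolding periodic_def
      using line_period[OF N, of 0 _ 1] in_rangeD[OF N] by auto
    then have W1: "walks E1 W (\<lambda>i. even (line N d 0 i))" using T(7)[OF W(2,1)] no_long_line[OF s] by blast
    have "walks E0 W (\<lambda>i. even (line N d 0 i))" by (rule thin_no_new[OF gr th T(6) no_long_line[OF s] W1])
    then have "(W 0, odd (0::int), even (line N d 0 0), W (0 + 1)) \<in> E0" "(W 1, odd (1::int), even (line N d 0 1), W (1 + 1)) \<in> E0"
      unfolding walks_def by blast+
    from ty[OF this(1)] ty[OF this(2)] show False by simp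
  qed
  have "B (int 0) \<in> V'" using T(2) unfolding V0_def by blast
  moreover have "(B (int i), e, b, B (int (Suc i))) \<in> E'" for i
    using T(5) unfolding E0_def by (auto simp: add.commute)
  moreover have "B (int k) = B (int 0)" unfolding B_def by simp
  ultimately show ?thesis using A no by (intro exI[of _ V'] exI[of _ E'] exI[of _ "\<lambda>i. B (int i)"]) blast
qed

end

section \<open>Lopsided fundamental domains\<close>

context farey_pair begin

text \<open>With \<open>image_den\<close>, up to a common sign, the image of \<open>N / d\<close>
  under the shift by \<open>2 n\<close> Farey edges at \<open>q / p\<close>.\<close>

definition image_num :: "int \<Rightarrow> int \<Rightarrow> int" where "image_num N d = 2 * int n * dt N d * q - N"
definition image_den :: "int \<Rightarrow> int \<Rightarrow> int" where "image_den N d = 2 * int n * dt N d * p - d"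

lemma dt_image: "dt (image_num N d) (image_den N d) = - dt N d"
  unfolding dt_def image_num_def image_den_def by (simp add: algebra_simps)

lemma image_in_range:
  assumes "0 < dt N d" "dt N d \<le> image_den N d" shows "in_range (image_num N d) (image_den N d)"
proof -
  let ?f = "q div p" and ?N = "image_num N d" and ?d = "image_den N d" and ?D = "dt N d"
  have d: "0 < ?d" using assms by simp
  have N: "p * ?N = ?d * q + ?D" using dt_image[of N d] unfolding dt_def[of ?N] by simp
  have f: "p * ?f \<le> q" "q + 1 \<le> p * (?f + 1)" using div_bounds[OF p_pos, of q] by simp_all
  have "p * (?f * ?d) \<le> q * ?d" using f(1) d by (simp add: mult.assoc[symmetric])
  then have "p * (?f * ?d) \<le> p * ?N" unfolding N using assms(1) by (simp add: mult.commute)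
  moreover have "(q + 1) * ?d \<le> p * (?f + 1) * ?d" using f(2) d by (intro mult_right_mono) auto
  then have "p * ?N \<le> p * ((?f + 1) * ?d)" unfolding N using assms(2) by (simp add: algebra_simps)
  ultimately show ?thesis unfolding in_range_def using d p_pos by simp
qed

text \<open>Both end points move by one Farey edge around \<open>q / p\<close>, the left one away
  from it and the right one towards it. The denominators change by \<open>p\<close> and keep their
  sum.\<close>

lemma shrink_pair:
  assumes "(2 * int n - 1) * p < pm" shows "heckoid_pair q p n (pm - p) (pp + p)"
proof -
  have "p * 4 \<le> p * (2 * int n)" using n_ge p_pos by (intro mult_left_mono) auto
  then have four: "4 * p \<le> 2 * int n * p" by (simp add: algebra_simps)
  have e': "(pm - p) * q - 1 = (pm * q - 1) - p * q" by (simp add: algebra_simps)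
  have dv: "p dvd (pm - p) * q - 1" unfolding e' by (rule dvd_diff[OF pm_q]) simp
  have big: "2 * int n * p - p < pm" using assms by (simp add: algebra_simps)
  have e: "(2 * int n - 1) * p = 2 * int n * p - p" by (simp add: algebra_simps)
  show ?thesis
  proof unfold_locales
    show "0 < pm - p" "0 < pp + p" "pm - p + (pp + p) = 2 * int n * p" "p dvd (pm - p) * q - 1"
      "pm - p < (2 * int n - 1) * p" "pp + p < (2 * int n - 1) * p"
      unfolding e using four big pm_pp pp_pos p_pos dv by linarith+
  qed
qed

text \<open>When \<open>pm\<close> is too large for \<open>heckoid_pair\<close>, the fundamental domain is moved by \<open>parabolic\<close>,
  which carries the slopes next to the left end to slopes on the right of \<open>q/p\<close>.\<close>

lemma moved:
  assumes big: "(2 * int n - 1) * p < pm" and s: "slope N d"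
  obtains N1 d1 where "farey_pair.slope q p (pm - p) (pp + p) N1 d1" "d1 \<noteq> (pp + p) * (- dt N1 d1)"
    "\<And>V E M. action V E \<Longrightarrow> 0 < M \<Longrightarrow> cycles E N d M = cycles E N1 d1 M"
    "N1 = N \<and> d1 = d \<or> N1 = image_num N d \<and> d1 = image_den N d \<and> 0 < dt N d"
proof -
  interpret h: heckoid_pair q p n "pm - p" "pp + p" by (rule shrink_pair[OF big])
  note N = slopeD[OF s]
  show ?thesis
  proof (cases "0 < dt N d \<and> (pm - p) * dt N d < d")
    case False
    show ?thesis
    proof (rule that[of N d])
      show "h.slope N d"
      proof (cases "0 < dt N d")
        case True
        then show ?thesis using N False unfolding h.slope_def by auto
      next
        case nD: False
        then have "d \<le> pp * (- dt N d)" using s N(3) unfolding slope_def by auto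
        moreover have "0 \<le> p * (- dt N d)" using nD p_pos by (simp add: mult_nonneg_nonpos)
        ultimately have "d \<le> (pp + p) * (- dt N d)" by (simp add: algebra_simps)
        then show ?thesis using N nD unfolding h.slope_def by auto
      qed
      show "d \<noteq> (pp + p) * (- dt N d)"
      proof
        assume e: "d = (pp + p) * (- dt N d)"
        then have D: "0 < (pp + p) * (- dt N d)" using N(2) by simp
        have "0 < - dt N d" using zero_less_mult_pos[OF D] pp_pos p_pos by simp
        moreover from this have "d \<le> pp * (- dt N d)" using s unfolding slope_def by auto
        moreover have "0 < p * (- dt N d)" using \<open>0 < - dt N d\<close> p_pos by (simp add: mult_pos_neg)
        ultimately show False using e by (simp add: algebra_simps)
      qed
    qed auto
  next
    case True
    then have D: "0 < dt N d" "(pm - p) * dt N d < d" "d \<le> pm * dt N d" using s unfolding slope_def by auto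
    have dp: "image_den N d = (pm + pp) * dt N d - d" unfolding image_den_def pm_pp by (simp add: algebra_simps)
    have low: "pp * dt N d \<le> image_den N d" and upp: "image_den N d < (pp + p) * dt N d"
      unfolding dp using D by (simp_all add: algebra_simps)
    have "1 * dt N d \<le> pp * dt N d" using pp_pos D(1) by (intro mult_right_mono) auto
    then have r: "in_range (image_num N d) (image_den N d)" using image_in_range[OF D(1)] low by simp
    show ?thesis
    proof (rule that[of "image_num N d" "image_den N d"])
      show "h.slope (image_num N d) (image_den N d)" unfolding h.slope_def dt_image using r upp D(1) by simp
      show "image_den N d \<noteq> (pp + p) * (- dt (image_num N d) (image_den N d))" unfolding dt_image using upp by simp
      show "cycles E N d M = cycles E (image_num N d) (image_den N d) M" if "action V E" "0 < M" for V E M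
        by (rule parabolic_cycles[OF that(1) N(1) r D(1) that(2) image_num_def image_den_def])
    qed (use D in simp)
  qed
qed

text \<open>The image lies between \<open>q / p\<close> and the right end point, beyond which no
  other admissible slope on that side comes closer. A coincidence can occur only at that end point,
  which is the image of the left one, and that pair is excluded.\<close>

lemma image_separate:
  assumes s: "slope N d" "slope N' d'" and D: "0 < dt N d" and ne: "N' * d \<noteq> N * d'"
    and ex: "\<not> (d = pm * dt N d \<and> d' = pp * (- dt N' d'))"
  shows "N' * image_den N d \<noteq> image_num N d * d'"
proof
  let ?N = "image_num N d" and ?d = "image_den N d"
  assume e: "N' * ?d = ?N * d'"
  have "?d * dt N' d' = d' * dt ?N ?d" unfolding dt_def using e by algebra
  then have eq: "?d * - dt N' d' = d' * dt N d" unfolding dt_image by simp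
  have dp: "?d = (pm + pp) * dt N d - d" unfolding image_den_def pm_pp by (simp add: algebra_simps)
  have le: "d \<le> pm * dt N d" using s D unfolding slope_def by auto
  have low: "pp * dt N d \<le> ?d" unfolding dp using le by (simp add: algebra_simps)
  have "0 < pp * dt N d" using pp_pos D by simp
  then have d0: "0 < ?d" using low by simp
  have "0 < ?d * - dt N' d'" unfolding eq using slopeD(2)[OF s(2)] D by simp
  then have D': "0 < - dt N' d'" using zero_less_mult_pos[OF _ d0] by blast
  then have le': "d' \<le> pp * (- dt N' d')" using s(2) unfolding slope_def by auto
  have "pp * dt N d * - dt N' d' \<le> ?d * - dt N' d'" using low D' by (intro mult_right_mono) auto
  then have "pp * (- dt N' d') * dt N d \<le> d' * dt N d" unfolding eq by (simp add: algebra_simps)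
  then have "pp * (- dt N' d') \<le> d'" using D mult_le_cancel_right[of "pp * (- dt N' d')" "dt N d" d'] by auto
  then have e': "d' = pp * (- dt N' d')" using le' by simp
  have "?d * - dt N' d' = pp * dt N d * - dt N' d'" unfolding eq by (subst e') (simp add: algebra_simps)
  then have "?d = pp * dt N d" using D' by simp
  then have "d = pm * dt N d" unfolding dp by (simp add: algebra_simps)
  then show False using ex e' by blast
qed

lemma separate_big:
  assumes big: "(2 * int n - 1) * p < pm" and s: "slope N d" "slope N' d'" and ne: "N' * d \<noteq> N * d'"
    and ex: "\<not> (d = pm * dt N d \<and> d' = pp * (- dt N' d'))" "\<not> (d' = pm * dt N' d' \<and> d = pp * (- dt N d))"
  shows "\<exists>V E. action V E \<and> cycles E N d 1 \<noteq> cycles E N' d' 1"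
proof -
  interpret h: heckoid_pair q p n "pm - p" "pp + p" by (rule shrink_pair[OF big])
  obtain N1 d1 where 1: "h.slope N1 d1" "d1 \<noteq> (pp + p) * (- dt N1 d1)"
    "\<And>V E M. action V E \<Longrightarrow> 0 < M \<Longrightarrow> cycles E N d M = cycles E N1 d1 M"
    "N1 = N \<and> d1 = d \<or> N1 = image_num N d \<and> d1 = image_den N d \<and> 0 < dt N d"
    by (rule moved[OF big s(1)]) blast
  obtain N2 d2 where 2: "h.slope N2 d2" "d2 \<noteq> (pp + p) * (- dt N2 d2)"
    "\<And>V E M. action V E \<Longrightarrow> 0 < M \<Longrightarrow> cycles E N' d' M = cycles E N2 d2 M"
    "N2 = N' \<and> d2 = d' \<or> N2 = image_num N' d' \<and> d2 = image_den N' d' \<and> 0 < dt N' d'"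
    by (rule moved[OF big s(2)]) blast
  have "N2 * d1 \<noteq> N1 * d2"
  proof -
    have both: "image_num N' d' * image_den N d \<noteq> image_num N d * image_den N' d'"
    proof
      assume "image_num N' d' * image_den N d = image_num N d * image_den N' d'"
      then have "N' * d = N * d'" unfolding image_num_def image_den_def dt_def by algebra
      then show False using ne by simp
    qed
    have "N' * image_den N d \<noteq> image_num N d * d'" if "0 < dt N d" by (rule image_separate[OF s that ne ex(1)])
    moreover have "image_num N' d' * d \<noteq> N * image_den N' d'" if "0 < dt N' d'"
      using image_separate[OF s(2,1) that _ ex(2)] ne by metis
    ultimately show ?thesis using 1(4) 2(4) ne both by auto
  qed
  \<comment> \<open>The moved slopes avoid the new right end point, so the exceptional pair of
    \<open>separate_cycles\<close> does not arise.\<close>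
  from h.separate_cycles[OF 1(1) 2(1) this] show ?thesis using 1(2,3) 2(2,3) by (metis zero_less_one)
qed

text \<open>Equality is excluded because \<open>pm\<close> and \<open>pp\<close> are invertible
  modulo \<open>p\<close>.\<close>

lemma pair_cases:
  obtains "heckoid_pair q p n pm pp" | "(2 * int n - 1) * p < pm" | "(2 * int n - 1) * p < pp"
proof -
  have no: "z \<noteq> (2 * int n - 1) * p" if "p dvd z * y - 1" for z y
  proof
    assume "z = (2 * int n - 1) * p"
    then have "p dvd z * y" by simp
    then have "p dvd z * y - (z * y - 1)" using that by (rule dvd_diff)
    then show False using p_ge by simp
  qed
  interpret m: farey_pair "- q" p n pp pm by (rule farey_pair_uminus)
  have "pm \<noteq> (2 * int n - 1) * p" "pp \<noteq> (2 * int n - 1) * p" using no pm_q m.pm_q by blast+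
  moreover have "heckoid_pair q p n pm pp" if "pm < (2 * int n - 1) * p" "pp < (2 * int n - 1) * p"
    using that by unfold_locales
  ultimately show ?thesis using that by linarith
qed

theorem separate:
  assumes s: "slope N d" "slope N' d'" and ne: "N' * d \<noteq> N * d'"
    and ex: "\<not> (d = pm * dt N d \<and> d' = pp * (- dt N' d'))" "\<not> (d' = pm * dt N' d' \<and> d = pp * (- dt N d))"
  shows "\<exists>V E. action V E \<and> cycles E N d 1 \<noteq> cycles E N' d' 1"
proof (rule pair_cases)
  assume "heckoid_pair q p n pm pp"
  then show ?thesis using heckoid_pair.separate_cycles assms by blast
next
  assume "(2 * int n - 1) * p < pm"
  then show ?thesis using separate_big assms by blast
next
  assume big: "(2 * int n - 1) * p < pp"
  interpret m: farey_pair "- q" p n pp pm by (rule farey_pair_uminus)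
  have "- N' * d \<noteq> - N * d'" using ne by simp
  moreover have "\<not> (d = pp * m.dt (- N) d \<and> d' = pm * (- m.dt (- N') d'))"
      "\<not> (d' = pp * m.dt (- N') d' \<and> d = pm * (- m.dt (- N) d))"
    using ex unfolding dt_uminus by auto
  ultimately obtain V E where E: "m.action V E" "m.cycles E (- N) d 1 \<noteq> m.cycles E (- N') d' 1"
    using m.separate_big[OF big slope_uminus[OF s(1)] slope_uminus[OF s(2)]] by blast
  have gr: "graph_on V E" using E(1) unfolding m.action_def complete_graph_def by blast
  have "cycles (flip E) N d 1 \<noteq> cycles (flip E) N' d' 1"
    using E(2) cycles_flip[OF gr slopeD(1)[OF s(1)]] cycles_flip[OF gr slopeD(1)[OF s(2)]] by blast
  then show ?thesis using action_flip[OF E(1)] by blast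
qed

theorem meridian_cycle:
  assumes s: "slope N d" and k: "0 < k"
  shows "\<exists>V E P. action V E \<and> P 0 \<in> V \<and> (\<forall>i::nat. (P i, e, b, P (Suc i)) \<in> E) \<and> P k = P 0 \<and>
    (\<forall>M>0. \<not> cycles E N d M)"
proof (rule pair_cases)
  assume "heckoid_pair q p n pm pp"
  from heckoid_pair.cycle_without_line[OF this s k] show ?thesis .
next
  assume big: "(2 * int n - 1) * p < pm"
  interpret h: heckoid_pair q p n "pm - p" "pp + p" by (rule shrink_pair[OF big])
  obtain N1 d1 where 1: "h.slope N1 d1" "\<And>V E M. action V E \<Longrightarrow> 0 < M \<Longrightarrow> cycles E N d M = cycles E N1 d1 M"
    by (rule moved[OF big s]) blast
  obtain V E P where E: "action V E" "P 0 \<in> V" "\<forall>i::nat. (P i, e, b, P (Suc i)) \<in> E" "P k = P 0"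
    "\<forall>M>0. \<not> cycles E N1 d1 M"
    using h.cycle_without_line[OF 1(1) k, of e b] by blast
  then have "\<forall>M>0. \<not> cycles E N d M" using 1(2)[OF E(1)] by blast
  then show ?thesis using E(1-4) by blast
next
  assume big: "(2 * int n - 1) * p < pp"
  interpret m: farey_pair "- q" p n pp pm by (rule farey_pair_uminus)
  interpret h: heckoid_pair "- q" p n "pp - p" "pm + p" by (rule m.shrink_pair[OF big])
  obtain N1 d1 where 1: "h.slope N1 d1" "\<And>V E M. m.action V E \<Longrightarrow> 0 < M \<Longrightarrow> m.cycles E (- N) d M = m.cycles E N1 d1 M"
    by (rule m.moved[OF big slope_uminus[OF s]]) blast
  obtain V E P where E: "m.action V E" "P 0 \<in> V" "\<forall>i::nat. (P i, e, \<not> b, P (Suc i)) \<in> E" "P k = P 0"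
    "\<forall>M>0. \<not> m.cycles E N1 d1 M"
    using h.cycle_without_line[OF 1(1) k, of e "\<not> b"] by blast
  have gr: "graph_on V E" using E(1) unfolding m.action_def complete_graph_def by blast
  have "\<forall>M>0. \<not> cycles (flip E) N d M"
    using E(5) 1(2)[OF E(1)] cycles_flip[OF gr slopeD(1)[OF s]] by blast
  moreover have "\<forall>i::nat. (P i, e, b, P (Suc i)) \<in> flip E" using E(3) by simp
  ultimately show ?thesis using action_flip[OF E(1)] E(2,4) by blast
qed

end

section \<open>Words acting on graphs\<close>

fun wpath :: "graph \<Rightarrow> meridian word \<Rightarrow> node \<Rightarrow> node \<Rightarrow> bool" where
  "wpath E [] v u \<longleftrightarrow> u = v"
| "wpath E (l # w) v u \<longleftrightarrow> (\<exists>z. (v, fst l = Gen_b, snd l, z) \<in> E \<and> wpath E w z u)"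

lemma wpath_append: "wpath E (x @ y) v u \<longleftrightarrow> (\<exists>z. wpath E x v z \<and> wpath E y z u)"
  by (induction x arbitrary: v) auto

lemma wpath_det: "graph_on V E \<Longrightarrow> wpath E w v u \<Longrightarrow> wpath E w v u' \<Longrightarrow> u = u'"
proof (induction w arbitrary: v)
  case (Cons l w)
  obtain z where z: "(v, fst l = Gen_b, snd l, z) \<in> E" "wpath E w z u" using Cons.prems by auto
  obtain z' where z': "(v, fst l = Gen_b, snd l, z') \<in> E" "wpath E w z' u'" using Cons.prems by auto
  have "z = z'" by (rule graph_on_det[OF Cons.prems(1) z(1) z'(1)])
  then show ?case using Cons.IH[OF Cons.prems(1) z(2)] z'(2) by simp
qed auto

lemma wpath_total: "complete_graph V E \<Longrightarrow> v \<in> V \<Longrightarrow> \<exists>u\<in>V. wpath E w v u"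
proof (induction w arbitrary: v)
  case (Cons l w)
  obtain z where z: "(v, fst l = Gen_b, snd l, z) \<in> E"
    using Cons.prems unfolding complete_graph_def by blast
  have gr: "graph_on V E" using Cons.prems(1) unfolding complete_graph_def by blast
  have "z \<in> V" by (rule graph_onD(2)[OF gr z])
  then obtain u where "u \<in> V" "wpath E w z u" using Cons.IH[OF Cons.prems(1)] by blast
  then show ?case using z by (intro bexI[of _ u]) auto
qed simp

lemma word_inv_word_inv [simp]: "word_inv (word_inv w) = w"
  by (simp add: word_inv_def rev_map comp_def case_prod_unfold)

lemma word_inv_Cons: "word_inv (l # w) = word_inv w @ [(fst l, \<not> snd l)]"
  by (simp add: word_inv_def split: prod.splits)

lemma wpath_inv: "graph_on V E \<Longrightarrow> wpath E w v u \<Longrightarrow> wpath E (word_inv w) u v"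
proof (induction w arbitrary: v)
  case Nil
  then show ?case by (simp add: word_inv_def)
next
  case (Cons l w)
  obtain z where z: "(v, fst l = Gen_b, snd l, z) \<in> E" "wpath E w z u" using Cons.prems by auto
  have "(z, fst l = Gen_b, \<not> snd l, v) \<in> E" by (rule graph_onD(3)[OF Cons.prems(1) z(1)])
  then show ?case using Cons.IH[OF Cons.prems(1) z(2)] unfolding word_inv_Cons wpath_append by auto
qed

lemma wpath_freely_eq:
  assumes E: "complete_graph V E"
  shows "freely_eq w w' \<Longrightarrow> v \<in> V \<Longrightarrow> wpath E w v u \<longleftrightarrow> wpath E w' v u"
proof (induction arbitrary: v u rule: freely_eq.induct)
  case (cancel x l e y)
  have gr: "graph_on V E" using E unfolding complete_graph_def by blast
  have "wpath E [(l, e), (l, \<not> e)] z z' \<longleftrightarrow> z' = z" if z: "z \<in> V" for z z'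
  proof -
    obtain t where t: "(z, l = Gen_b, e, t) \<in> E" using E z unfolding complete_graph_def by blast
    have "(t, l = Gen_b, \<not> e, z) \<in> E" by (rule graph_onD(3)[OF gr t])
    then show ?thesis using t graph_on_det[OF gr t] graph_on_det[OF gr \<open>(t, l = Gen_b, \<not> e, z) \<in> E\<close>]
      unfolding wpath.simps fst_conv snd_conv by blast
  qed
  moreover have "z \<in> V" if "wpath E x v z" for z
    using wpath_total[OF E cancel.prems] wpath_det[OF gr that] by metis
  ultimately have "wpath E [(l, e), (l, \<not> e)] z z' \<longleftrightarrow> z' = z" if "wpath E x v z" for z z'
    using that by blast
  then show ?case unfolding wpath_append[of E x] wpath_append[of E "[(l, e), (l, \<not> e)]"] by metis
qed auto

definition wd :: "(int \<Rightarrow> int) \<Rightarrow> int \<Rightarrow> nat \<Rightarrow> meridian word" where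
  "wd g a k = map (\<lambda>j. (if odd (a + int j) then Gen_b else Gen_a, even (g (a + int j)))) [0..<k]"

lemma wpath_wd: "wpath E (wd g a k) v u \<longleftrightarrow> lpath E g a k v u"
proof (induction k arbitrary: u)
  case (Suc k)
  have 1: "lpath E g b 1 z u \<longleftrightarrow> (z, odd b, even (g b), u) \<in> E" for b z
  proof
    assume "(z, odd b, even (g b), u) \<in> E"
    then show "lpath E g b 1 z u" unfolding lpath_def by (intro exI[of _ "\<lambda>j. if j = 0 then z else u"]) simp
  qed (auto simp: lpath_def)
  have "wpath E (wd g a (Suc k)) v u \<longleftrightarrow> (\<exists>z. lpath E g a k v z \<and> lpath E g (a + int k) 1 z u)"
    using Suc unfolding 1 by (simp add: wd_def wpath_append)
  also have "\<dots> \<longleftrightarrow> lpath E g a (Suc k) v u"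
    using lpath_append[of E g a k v _ 1 u] lpath_split[of E g a k 1 v u] by auto
  finally show ?case .
qed (simp add: wd_def)

lemma wd_add: "wd g a (k + l) = wd g a k @ wd g (a + int k) l"
proof (rule nth_equalityI)
  show "length (wd g a (k + l)) = length (wd g a k @ wd g (a + int k) l)" by (simp add: wd_def)
  show "wd g a (k + l) ! i = (wd g a k @ wd g (a + int k) l) ! i" if "i < length (wd g a (k + l))" for i
    using that by (auto simp: wd_def nth_append add.assoc of_nat_diff)
qed

lemma concat_replicate_Suc: "concat (replicate (Suc k) w) = concat (replicate k w) @ w"
  by (induction k) auto

lemma wd_power:
  assumes "even k" "\<And>i. even (g (i + int k)) \<longleftrightarrow> even (g i)"
  shows "concat (replicate m (wd g 0 k)) = wd g 0 (k * m)"
proof (induction m)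
  case (Suc m)
  have per: "even (g (i + int (k * m))) \<longleftrightarrow> even (g i)" for i
  proof (induction m)
    case (Suc m)
    then show ?case using assms(2)[of "i + int (k * m)"] by (simp add: algebra_simps)
  qed simp
  have "wd g (0 + int (k * m)) k = wd g 0 k"
    unfolding wd_def using assms(1) per[of "int _"] by (simp add: add.commute)
  then show ?case using wd_add[of g 0 "k * m" k] Suc unfolding concat_replicate_Suc by (simp add: add.commute)
qed (simp add: wd_def)

text \<open>The second half continues the floor pattern: for \<open>0 < j < d\<close> the floor at
  \<open>d + j\<close> is \<open>N\<close> plus that at \<open>j\<close>, while the floor at
  \<open>d - j\<close> is \<open>N - 1\<close> minus it. Their parities are opposite, as inversion
  of \<open>uhat\<close> requires, and the middle letter is the one at index
  \<open>d\<close>.\<close>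

lemma uword_wd:
  assumes s: "quotient_of s = (N, d)" shows "uword s = wd (\<lambda>i. (i * N) div d) 0 (nat (2 * d))"
proof -
  define g where "g i = (i * N) div d" for i
  define D where "D = nat d"
  have d: "0 < d" using quotient_of_denom_pos[OF s] .
  have dD: "d = int D" and D: "0 < D" using d unfolding D_def by auto
  have co: "coprime N d" using quotient_of_coprime[OF s] .
  have sN: "s = of_int N / of_int d" using quotient_of_div[OF s] .
  have fl: "\<lfloor>of_nat i * s\<rfloor> = g (int i)" for i
  proof -
    have "of_nat i * s = of_int (int i * N) / of_int d" unfolding sN by simp
    then show ?thesis unfolding g_def using floor_divide_of_int_eq by metis
  qed
  let ?l = "\<lambda>i. (if odd i then Gen_b else Gen_a, even (g (int i)))"
  have uh: "uhat s = map ?l [1..<D]" unfolding uhat_def s snd_conv D_def fl by simp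
  have g0: "g 0 = 0" and gd: "g (int D) = N" unfolding g_def dD using D by simp_all
  have inv: "word_inv (uhat s) = map ?l [D + 1..<2 * D]"
  proof (rule nth_equalityI)
    show "length (word_inv (uhat s)) = length (map ?l [D + 1..<2 * D])" unfolding word_inv_def uh by simp
    fix i assume "i < length (word_inv (uhat s))"
    then have i: "Suc i < D" unfolding word_inv_def uh by simp
    define j where "j = Suc i"
    \<comment> \<open>That \<open>j * s\<close> is not an integer produces the extra -1, hence the
      sign change of the inverse.\<close>
    have "\<not> d dvd int j * N"
    proof
      assume "d dvd int j * N"
      then have "d dvd int j" using co by (simp add: coprime_commute coprime_dvd_mult_left_iff)
      then show False using i zdvd_imp_le[of d "int j"] unfolding dD j_def by simp
    qed
    then have m: "0 < (int j * N) mod d" using pos_mod_sign[OF d, of "int j * N"] by (simp add: dvd_eq_mod_eq_0 less_le)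
    have e: "int j * N = d * g (int j) + (int j * N) mod d" unfolding g_def by simp
    have 1: "g (int (D - j)) = N - g (int j) - 1"
    proof -
      have "int (D - j) * N = d * (N - g (int j) - 1) + (d - (int j * N) mod d)"
        using e i unfolding dD[symmetric] by (simp add: of_nat_diff dD[symmetric] algebra_simps j_def)
      then show ?thesis unfolding g_def
        by (rule int_div_pos_eq) (use m pos_mod_bound[OF d, of "int j * N"] in auto)
    qed
    have 2: "g (int (D + j)) = N + g (int j)"
    proof -
      have "int (D + j) * N = int j * N + N * d" unfolding dD by (simp add: algebra_simps)
      then show ?thesis unfolding g_def using d by simp
    qed
    have "word_inv (uhat s) ! i = (fst (?l (D - j)), \<not> snd (?l (D - j)))"
      unfolding word_inv_def uh j_def using i by (simp add: rev_nth of_nat_diff algebra_simps)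
    moreover have "odd (D - j) \<longleftrightarrow> odd (D + j)" using i unfolding j_def by auto
    moreover have "map ?l [D + 1..<2 * D] ! i = ?l (D + j)" using i unfolding j_def by simp
    ultimately show "word_inv (uhat s) ! i = map ?l [D + 1..<2 * D] ! i" using 1 2 by auto
  qed
  \<comment> \<open>For even \<open>d\<close> the numerator is odd, so the pattern also gives the
    negative exponent prescribed in that case.\<close>
  have mid: "(if odd d then [(Gen_b, even N)] else [(Gen_a, False)]) = [?l D]"
  proof -
    have "odd N" if "even d" using co that coprime_common_divisor[of N d 2] by auto
    then show ?thesis using gd unfolding dD by auto
  qed
  have "uword s = [?l 0] @ uhat s @ [?l D] @ word_inv (uhat s)"
    unfolding uword_def s Let_def prod.case using mid g0 by (cases "odd d") auto
  also have "\<dots> = map ?l ([0..<1] @ [1..<D] @ [D..<D + 1] @ [D + 1..<2 * D])" unfolding inv unfolding uh by simp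
  also have "[0..<1] @ [1..<D] @ [D..<D + 1] @ [D + 1..<2 * D] = [0..<2 * D]"
  proof -
    have "[0..<2 * D] = [0..<D + D]" by (simp add: mult_2)
    also have "\<dots> = [0..<D] @ [D..<D + D]" by (rule upt_add_eq_append) simp
    also have "[0..<D] = 0 # [1..<D]" using D by (simp add: upt_conv_Cons)
    also have "[D..<D + D] = D # [D + 1..<D + D]" using D by (simp add: upt_conv_Cons)
    finally show ?thesis by (simp add: mult_2 upt_conv_Cons)
  qed
  also have "map ?l [0..<2 * D] = wd g 0 (nat (2 * d))" unfolding wd_def dD by (simp add: nat_mult_distrib)
  finally show ?thesis unfolding g_def .
qed

section \<open>The Heckoid group in terms of words\<close>

lemma inv_word_class: "inv\<^bsub>free_group\<^esub> (word_class w) = word_class (word_inv w)"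
proof -
  interpret F: group "free_group :: 'a word set monoid" by (rule group_free_group)
  show ?thesis
  proof (rule F.inv_equality)
    show "word_class (word_inv w) \<otimes>\<^bsub>free_group\<^esub> word_class w = \<one>\<^bsub>free_group\<^esub>"
      unfolding mult_word_class one_free_group word_class_eq_iff by (rule freely_eq_word_inv)
  qed (simp_all add: carrier_free_group)
qed

lemma word_class_power: "word_class w [^]\<^bsub>free_group\<^esub> (k::nat) = word_class (concat (replicate k w))"
proof -
  interpret F: group "free_group :: 'a word set monoid" by (rule group_free_group)
  show ?thesis
  proof (induction k)
    case (Suc k)
    show ?case unfolding F.nat_pow_Suc Suc mult_word_class concat_replicate_Suc ..
  qed (simp add: one_free_group)
qed

lemma mult_heckoid_elt: "heckoid_elt r n u \<otimes>\<^bsub>heckoid_group r n\<^esub> heckoid_elt r n v = heckoid_elt r n (u @ v)"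
  unfolding heckoid_elt_def heckoid_group_def FactGroup_def
  by (simp add: normal.rcos_sum[OF normal_heckoid_kernel] mult_word_class carrier_free_group)

lemma one_heckoid_group: "\<one>\<^bsub>heckoid_group r n\<^esub> = heckoid_elt r n []"
proof -
  interpret F: group "free_group :: meridian word set monoid" by (rule group_free_group)
  have "heckoid_kernel r n \<subseteq> carrier free_group"
    using normal_imp_subgroup[OF normal_heckoid_kernel] subgroup.subset by blast
  then show ?thesis
    unfolding heckoid_group_def heckoid_elt_def FactGroup_def using F.coset_mult_one by (simp add: one_free_group[symmetric])
qed

lemma heckoid_elt_eqI: "freely_eq u v \<Longrightarrow> heckoid_elt r n u = heckoid_elt r n v"
  unfolding heckoid_elt_def by (simp add: word_class_eq_iff[THEN iffD2])

lemma inv_heckoid_elt: "inv\<^bsub>heckoid_group r n\<^esub> heckoid_elt r n w = heckoid_elt r n (word_inv w)"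
proof -
  interpret G: group "heckoid_group r n" by (rule group_heckoid_group)
  show ?thesis
    by (rule G.inv_equality)
      (simp_all add: mult_heckoid_elt one_heckoid_group heckoid_elt_closed heckoid_elt_eqI[OF freely_eq_word_inv])
qed

lemma heckoid_elt_power: "heckoid_elt r n w [^]\<^bsub>heckoid_group r n\<^esub> (k::nat) = heckoid_elt r n (concat (replicate k w))"
proof -
  interpret G: group "heckoid_group r n" by (rule group_heckoid_group)
  show ?thesis
  proof (induction k)
    case (Suc k)
    show ?case unfolding G.nat_pow_Suc Suc mult_heckoid_elt concat_replicate_Suc ..
  qed (simp add: one_heckoid_group)
qed

lemma heckoid_elt_exhaust:
  assumes "x \<in> carrier (heckoid_group r n)" obtains w where "x = heckoid_elt r n w"
  using assms that unfolding heckoid_group_def heckoid_elt_def FactGroup_def RCOSETS_def carrier_free_group by auto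

lemma conjugate_heckoid_elt:
  assumes "conjugate_in (heckoid_group r n) (heckoid_elt r n u) x"
  obtains h where "x = heckoid_elt r n (h @ u @ word_inv h)"
proof -
  obtain y where y: "y \<in> carrier (heckoid_group r n)"
    "x = y \<otimes>\<^bsub>heckoid_group r n\<^esub> heckoid_elt r n u \<otimes>\<^bsub>heckoid_group r n\<^esub> inv\<^bsub>heckoid_group r n\<^esub> y"
    using assms unfolding conjugate_in_def by blast
  obtain h where "y = heckoid_elt r n h" using heckoid_elt_exhaust[OF y(1)] .
  then show ?thesis using that[of h] y(2) by (simp add: inv_heckoid_elt mult_heckoid_elt)
qed

section \<open>Fixed vertices as invariants of conjugacy classes\<close>

locale heckoid_action =
  fixes V :: "node set" and E :: graph and r :: rat and n :: nat
  assumes complete: "complete_graph V E"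
    and relator: "v \<in> V \<Longrightarrow> wpath E (concat (replicate n (uword r))) v v"
begin

lemma gr: "graph_on V E" using complete unfolding complete_graph_def by blast

lemma wpath_V: "v \<in> V \<Longrightarrow> wpath E w v u \<Longrightarrow> u \<in> V"
  using wpath_total[OF complete] wpath_det[OF gr] by metis

text \<open>The kernel of the action. It is normal and contains the relator, hence the normal
  closure of the relator.\<close>

definition trivial :: "meridian word set set" where
  "trivial = {word_class w |w. \<forall>v\<in>V. wpath E w v v}"

lemma trivial_iff: "word_class w \<in> trivial \<longleftrightarrow> (\<forall>v\<in>V. wpath E w v v)"
proof
  assume "word_class w \<in> trivial"
  then obtain w' where "freely_eq w w'" "\<forall>v\<in>V. wpath E w' v v"
    unfolding trivial_def by (auto simp: word_class_eq_iff)
  then show "\<forall>v\<in>V. wpath E w v v" using wpath_freely_eq[OF complete] by blast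
qed (auto simp: trivial_def)

lemma normal_trivial: "trivial \<lhd> free_group"
proof -
  interpret F: group "free_group :: meridian word set monoid" by (rule group_free_group)
  show ?thesis
  proof (rule F.normal_invI)
    show "subgroup trivial free_group"
    proof (rule F.subgroupI)
      show "trivial \<subseteq> carrier free_group" unfolding trivial_def carrier_free_group by blast
      have "word_class [] \<in> trivial" unfolding trivial_iff by simp
      then show "trivial \<noteq> {}" by blast
      fix x assume "x \<in> trivial"
      then obtain w where w: "x = word_class w" "\<forall>v\<in>V. wpath E w v v" unfolding trivial_def by blast
      then show "inv\<^bsub>free_group\<^esub> x \<in> trivial" using wpath_inv[OF gr] by (simp add: inv_word_class trivial_iff)
      fix y assume "y \<in> trivial"
      then obtain w' where w': "y = word_class w'" "\<forall>v\<in>V. wpath E w' v v" unfolding trivial_def by blast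
      have "\<forall>v\<in>V. wpath E (w @ w') v v" using w(2) w'(2) unfolding wpath_append by blast
      then show "x \<otimes>\<^bsub>free_group\<^esub> y \<in> trivial" using w(1) w'(1) by (simp add: mult_word_class trivial_iff)
    qed
    fix x h :: "meridian word set" assume "x \<in> carrier free_group" "h \<in> trivial"
    then obtain w u where w: "x = word_class w" "h = word_class u" "\<forall>v\<in>V. wpath E u v v"
      unfolding trivial_def carrier_free_group by blast
    have "wpath E (w @ u @ word_inv w) v v" if v: "v \<in> V" for v
    proof -
      obtain z where z: "z \<in> V" "wpath E w v z" using wpath_total[OF complete v] by blast
      then show ?thesis using w(3) wpath_inv[OF gr z(2)] unfolding wpath_append by blast
    qed
    then show "x \<otimes>\<^bsub>free_group\<^esub> h \<otimes>\<^bsub>free_group\<^esub> inv\<^bsub>free_group\<^esub> x \<in> trivial"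
      using w by (simp add: mult_word_class inv_word_class trivial_iff)
  qed
qed

lemma kernel_trivial: "heckoid_kernel r n \<subseteq> trivial"
proof -
  have "word_class (uword r) [^]\<^bsub>free_group\<^esub> n \<in> trivial" unfolding word_class_power trivial_iff using relator by blast
  then show ?thesis unfolding heckoid_kernel_def normal_closure_def using normal_trivial by blast
qed

lemma wpath_heckoid_elt:
  assumes "heckoid_elt r n w = heckoid_elt r n w'" "v \<in> V" shows "wpath E w v u \<longleftrightarrow> wpath E w' v u"
proof -
  interpret F: group "free_group :: meridian word set monoid" by (rule group_free_group)
  have "subgroup (heckoid_kernel r n) free_group" by (rule normal_imp_subgroup[OF normal_heckoid_kernel])
  then have "word_class w \<in> heckoid_elt r n w"
    unfolding heckoid_elt_def by (rule F.rcos_self[rotated]) (simp add: carrier_free_group)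
  then have "word_class w \<in> heckoid_kernel r n #>\<^bsub>free_group\<^esub> word_class w'" using assms(1) unfolding heckoid_elt_def by simp
  then obtain k where k: "k \<in> heckoid_kernel r n" "word_class w = k \<otimes>\<^bsub>free_group\<^esub> word_class w'"
    unfolding r_coset_def by blast
  then obtain x where x: "k = word_class x" "\<forall>v\<in>V. wpath E x v v" using kernel_trivial unfolding trivial_def by blast
  then have "freely_eq w (x @ w')" using k(2) by (simp add: mult_word_class word_class_eq_iff)
  then have "wpath E w v u \<longleftrightarrow> wpath E (x @ w') v u" by (rule wpath_freely_eq[OF complete _ assms(2)])
  also have "\<dots> \<longleftrightarrow> wpath E w' v u" unfolding wpath_append using x(2) assms(2) wpath_det[OF gr] by metis
  finally show ?thesis .
qed

text \<open>Having a fixed vertex is invariant under conjugation and inversion, so it is a property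
  of the class of an unoriented loop.\<close>

definition fixed :: "meridian word \<Rightarrow> bool" where "fixed w \<longleftrightarrow> (\<exists>v\<in>V. wpath E w v v)"

lemma fixed_conjugate: "fixed (h @ w @ word_inv h) \<longleftrightarrow> fixed w"
proof
  assume "fixed (h @ w @ word_inv h)"
  then obtain v z z' where v: "v \<in> V" "wpath E h v z" "wpath E w z z'" "wpath E (word_inv h) z' v"
    unfolding fixed_def wpath_append by blast
  have "wpath E h v z'" using wpath_inv[OF gr v(4)] by simp
  then have "z' = z" using wpath_det[OF gr v(2)] by simp
  then show "fixed w" using v(3) wpath_V[OF v(1,2)] unfolding fixed_def by blast
next
  assume "fixed w"
  then obtain z where z: "z \<in> V" "wpath E w z z" unfolding fixed_def by blast
  obtain v where v: "v \<in> V" "wpath E (word_inv h) z v" using wpath_total[OF complete z(1)] by blast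
  have "wpath E h v z" using wpath_inv[OF gr v(2)] by simp
  then show "fixed (h @ w @ word_inv h)" unfolding fixed_def wpath_append using v z(2) by blast
qed

lemma fixed_inv: "fixed (word_inv w) \<longleftrightarrow> fixed w"
proof -
  show ?thesis unfolding fixed_def using wpath_inv[OF gr] word_inv_word_inv by metis
qed

lemma fixed_heckoid_elt: "heckoid_elt r n w = heckoid_elt r n w' \<Longrightarrow> fixed w \<longleftrightarrow> fixed w'"
  unfolding fixed_def using wpath_heckoid_elt by blast

lemma fixed_conjugate_in:
  assumes "conjugate_in (heckoid_group r n) (heckoid_elt r n u) (heckoid_elt r n w)" shows "fixed u \<longleftrightarrow> fixed w"
  using conjugate_heckoid_elt[OF assms] fixed_heckoid_elt fixed_conjugate by metis

lemma fixed_same_loop_class: "same_loop_class r n s s' \<Longrightarrow> fixed (uword s) \<longleftrightarrow> fixed (uword s')"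
  unfolding same_loop_class_def inv_heckoid_elt using fixed_conjugate_in fixed_inv by blast

lemma fixed_conjugate_power: "fixed (concat (replicate k (h @ w @ word_inv h))) \<longleftrightarrow> fixed (concat (replicate k w))"
proof -
  have "heckoid_elt r n (concat (replicate k (h @ w @ word_inv h))) = heckoid_elt r n (h @ concat (replicate k w) @ word_inv h)"
  proof (induction k)
    case 0
    show ?case using heckoid_elt_eqI[OF freely_eq_word_inv[of "word_inv h"]] by simp
  next
    case (Suc k)
    let ?m = "\<lambda>x y. x \<otimes>\<^bsub>heckoid_group r n\<^esub> y"
    have "heckoid_elt r n (concat (replicate (Suc k) (h @ w @ word_inv h)))
        = heckoid_elt r n (h @ concat (replicate k w) @ (word_inv h @ h) @ w @ word_inv h)"
      unfolding concat_replicate_Suc mult_heckoid_elt[symmetric, of r n "concat _"] Suc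
      by (simp add: mult_heckoid_elt)
    also have "\<dots> = heckoid_elt r n (h @ concat (replicate k w) @ [] @ w @ word_inv h)"
      by (intro heckoid_elt_eqI freely_eq_append_left freely_eq_append_right freely_eq_word_inv)
    finally show ?case unfolding concat_replicate_Suc by simp
  qed
  then show ?thesis using fixed_heckoid_elt fixed_conjugate by metis
qed

lemma fixed_loop_peripheral_power:
  assumes P: "P 0 \<in> V" "\<forall>i::nat. (P i, x = Gen_b, True, P (Suc i)) \<in> E" "k = 0 \<or> P (nat \<bar>k\<bar>) = P 0"
    and c: "conjugate_in (heckoid_group r n) (loop_elt r n s) (heckoid_elt r n [(x, True)] [^]\<^bsub>heckoid_group r n\<^esub> k)"
  shows "fixed (uword s)"
proof -
  let ?w = "concat (replicate (nat \<bar>k\<bar>) [(x, True)])"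
  have "wpath E (concat (replicate j [(x, True)])) (P 0) (P j)" for j
  proof (induction j)
    case (Suc j)
    show ?case unfolding concat_replicate_Suc wpath_append using Suc P(2) by auto
  qed simp
  \<comment> \<open>For \<open>k = 0\<close> the word is empty and fixes \<open>P 0\<close> without
    any assumption that the path closes.\<close>
  then have w: "fixed ?w" unfolding fixed_def using P(1,3) by (metis abs_zero nat_0)
  have "heckoid_elt r n [(x, True)] [^]\<^bsub>heckoid_group r n\<^esub> k = heckoid_elt r n (if k < 0 then word_inv ?w else ?w)"
    unfolding int_pow_def2 by (simp add: heckoid_elt_power inv_heckoid_elt)
  from c[unfolded this] have "fixed (uword s) \<longleftrightarrow> fixed (if k < 0 then word_inv ?w else ?w)" by (rule fixed_conjugate_in)
  then show ?thesis using w fixed_inv by (cases "k < 0") auto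
qed

text \<open>Some positive power of a torsion loop is trivial in the group and therefore fixes every
  vertex.\<close>

lemma fixed_loop_torsion:
  assumes "loop_torsion r n s" "V \<noteq> {}" obtains k where "0 < k" "fixed (concat (replicate k (uword s)))"
proof -
  obtain g k where g: "conjugate_in (heckoid_group r n) (loop_elt r n s) g" "0 < k"
     "g [^]\<^bsub>heckoid_group r n\<^esub> (k::nat) = \<one>\<^bsub>heckoid_group r n\<^esub>"
    using assms(1) unfolding loop_torsion_def torsion_elt_def by blast
  obtain h where h: "g = heckoid_elt r n (h @ uword s @ word_inv h)" using conjugate_heckoid_elt[OF g(1)] .
  have "heckoid_elt r n (concat (replicate k (h @ uword s @ word_inv h))) = heckoid_elt r n []"
    using g(3) unfolding h heckoid_elt_power one_heckoid_group .
  then have "fixed (concat (replicate k (h @ uword s @ word_inv h))) \<longleftrightarrow> fixed []" by (rule fixed_heckoid_elt)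
  then have "fixed (concat (replicate k (uword s)))"
    unfolding fixed_conjugate_power using assms(2) by (auto simp: fixed_def)
  then show ?thesis using that g(2) by blast
qed

end

context heckoid begin

lemma F_line: "F 0 = (\<lambda>i. (i * q) div p)" unfolding F_def by auto

lemma heckoid_action:
  assumes A: "action V E" and r: "quotient_of r = (q, p)" shows "heckoid_action V E r n"
proof
  show "complete_graph V E" using A unfolding action_def by blast
  fix v assume v: "v \<in> V"
  have "concat (replicate n (uword r)) = wd (F 0) 0 (nat (2 * p) * n)"
    unfolding uword_wd[OF r] F_line
  proof (rule wd_power)
    show "even (nat (2 * p))" by (simp add: even_nat_iff p_pos less_imp_le)
    fix i
    have "(i + 2 * p) * q = i * q + (2 * q) * p" by (simp add: algebra_simps)
    then have "((i + 2 * p) * q) div p = 2 * q + i * q div p" using p_pos by simp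
    then show "even ((i + int (nat (2 * p))) * q div p) \<longleftrightarrow> even (i * q div p)" using p_pos by simp
  qed
  also have "nat (2 * p) * n = rlen" unfolding rlen_def using p_pos by (simp add: nat_mult_distrib)
  finally show "wpath E (concat (replicate n (uword r))) v v"
    using action_relator[OF A v] by (simp add: wpath_wd)
qed

lemma fixed_power_iff_cycles:
  assumes A: "action V E" and r: "quotient_of r = (q, p)" and s: "quotient_of s = (N, d)" "in_range N d" and M: "0 < M"
  shows "heckoid_action.fixed V E (concat (replicate M (uword s))) \<longleftrightarrow> cycles E N d M"
proof -
  interpret h: heckoid_action V E r n by (rule heckoid_action[OF A r])
  have d: "0 < d" using s(2) by (rule in_rangeD)
  have ln: "(\<lambda>i. i * N div d) = line N d 0" unfolding line_def by auto
  have u: "concat (replicate M (uword s)) = wd (line N d 0) 0 (nat (2 * d * int M))"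
  proof -
    have "concat (replicate M (uword s)) = wd (line N d 0) 0 (nat (2 * d) * M)"
      unfolding uword_wd[OF s(1)] ln
    proof (rule wd_power)
      show "even (nat (2 * d))" by (simp add: even_nat_iff d less_imp_le)
      show "even (line N d 0 (i + int (nat (2 * d)))) \<longleftrightarrow> even (line N d 0 i)" for i
        using line_period[OF s(2), of 0 i 1] d by simp
    qed
    then show ?thesis using d by (simp add: nat_mult_distrib)
  qed
  show ?thesis
  proof
    assume "h.fixed (concat (replicate M (uword s)))"
    then show "cycles E N d M" using lpath_cycles[OF s(2) M] unfolding h.fixed_def u wpath_wd by blast
  next
    assume "cycles E N d M"
    then obtain w where w: "lpath E (line N d 0) 0 (nat (2 * d * int M)) w w" using cycles_lpath[OF s(2)] by blast
    moreover have "w \<in> V"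
    proof -
      have "0 < nat (2 * d * int M)" using d M by simp
      then obtain P where "P 0 = w" "(P 0, odd (0 + int 0), even (line N d 0 (0 + int 0)), P (Suc 0)) \<in> E"
        using w unfolding lpath_def by blast
      then show ?thesis using graph_onD(1)[OF h.gr] by blast
    qed
    ultimately show "h.fixed (concat (replicate M (uword s)))" unfolding h.fixed_def u wpath_wd by blast
  qed
qed

end

section \<open>The fundamental domain\<close>

lemma generate_farey_shift:
  assumes "g \<in> generate (BijGroup UNIV) {farey_shift c m}" shows "\<exists>k. g = farey_shift c (m * k)"
  using assms
proof (induction rule: generate.induct)
  case one
  have "\<one>\<^bsub>BijGroup UNIV\<^esub> = farey_shift c (m * 0)" by (auto simp: BijGroup_def farey_shift_0)
  then show ?case by blast
next
  case (incl h)
  then show ?case by (intro exI[of _ 1]) simp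
next
  case (inv h)
  interpret B: group "BijGroup (UNIV :: qhat set)" by (rule group_BijGroup)
  have "inv\<^bsub>BijGroup UNIV\<^esub> farey_shift c m = farey_shift c (m * - 1)"
  proof (rule B.inv_equality)
    show "farey_shift c (m * - 1) \<otimes>\<^bsub>BijGroup UNIV\<^esub> farey_shift c m = \<one>\<^bsub>BijGroup UNIV\<^esub>"
      using farey_shift_in_BijGroup[of c m] farey_shift_in_BijGroup[of c "m * - 1"]
      by (auto simp: BijGroup_def compose_def fun_eq_iff farey_shift_add farey_shift_0)
  qed (rule farey_shift_in_BijGroup)+
  then show ?case using inv by blast
next
  case (eng h1 h2)
  then obtain k l where k: "h1 = farey_shift c (m * k)" "h2 = farey_shift c (m * l)" by blast
  have "h1 \<otimes>\<^bsub>BijGroup UNIV\<^esub> h2 = farey_shift c (m * (k + l))"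
    unfolding k using farey_shift_in_BijGroup[of c "m * k"] farey_shift_in_BijGroup[of c "m * l"]
    by (auto simp: BijGroup_def compose_def fun_eq_iff farey_shift_add algebra_simps)
  then show ?case by blast
qed

lemma farey_shift_eq:
  assumes r: "quotient_of r = (q, p)" and x: "quotient_of x = (N, d)" and y: "quotient_of y = (N', d')"
    and e: "Fin y = farey_shift (Fin r) m (Fin x)"
  obtains z :: int where "z = 1 \<or> z = - 1" "N' = z * (N + m * q * (p * N - q * d))" "d' = z * (d + m * p * (p * N - q * d))"
proof -
  define a b where "a = N + m * q * (p * N - q * d)" and "b = d + m * p * (p * N - q * d)"
  have co: "coprime a b"
  proof (rule coprimeI)
    fix z assume z: "z dvd a" "z dvd b"
    have s: "p * a - q * b = p * N - q * d" unfolding a_def b_def by (simp add: algebra_simps)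
    have "z dvd p * a - q * b" using z by (intro dvd_diff dvd_mult)
    then have "z dvd p * N - q * d" unfolding s .
    then have "z dvd m * q * (p * N - q * d)" "z dvd m * p * (p * N - q * d)" by (rule dvd_mult)+
    then have "z dvd N" "z dvd d"
      using dvd_diff[OF z(1), of "m * q * (p * N - q * d)"] dvd_diff[OF z(2), of "m * p * (p * N - q * d)"]
      unfolding a_def b_def by simp_all
    then show "is_unit z" using quotient_of_coprime[OF x] coprime_common_divisor by blast
  qed
  have "Fin y = qfrac ((1 + m * p * q) * N - m * q\<^sup>2 * d) (m * p\<^sup>2 * N + (1 - m * p * q) * d)"
    unfolding e farey_shift_def by (simp add: r x Let_def)
  also have "(1 + m * p * q) * N - m * q\<^sup>2 * d = a" unfolding a_def by (simp add: algebra_simps power2_eq_square)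
  also have "m * p\<^sup>2 * N + (1 - m * p * q) * d = b" unfolding b_def by (simp add: algebra_simps power2_eq_square)
  finally have "qfrac a b = Fin y" by simp
  then have "(N' = a \<and> d' = b) \<or> (N' = - a \<and> d' = - b)" using qnum_qden_qfrac[OF co] y by auto
  then show ?thesis using that[of 1] that[of "- 1"] unfolding a_def b_def by auto
qed

text \<open>Each of \<open>g\<close> and the shift by \<open>m\<close> is a power of the other.
  Evaluation at a Farey neighbour of \<open>r\<close>, which only the trivial shift fixes, shows
  that the two exponents have product 1.\<close>

lemma shift_generator:
  assumes r: "quotient_of r = (q, p)" and x: "quotient_of x = (N, d)" "\<bar>p * N - q * d\<bar> = 1" and m: "0 < m"
    and g: "g \<in> shift_group r m" "generate (BijGroup UNIV) {g} = shift_group r m"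
  obtains k where "g = farey_shift (Fin r) (m * k)" "k = 1 \<or> k = - 1"
proof -
  obtain k where k: "g = farey_shift (Fin r) (m * k)" using generate_farey_shift g(1) unfolding shift_group_def by blast
  have "farey_shift (Fin r) m \<in> generate (BijGroup UNIV) {g}" unfolding g(2) shift_group_def by (rule generate.incl) simp
  then obtain j where j: "farey_shift (Fin r) m = farey_shift (Fin r) (m * k * j)" using generate_farey_shift k by blast
  have p: "0 < p" using quotient_of_denom_pos[OF r] .
  let ?t = "p * N - q * d"
  have t: "?t \<noteq> 0" using x(2) by auto
  have "qfrac (N + m * q * ?t) (d + m * p * ?t) = qfrac (N + m * k * j * q * ?t) (d + m * k * j * p * ?t)"
  proof -
    have "farey_shift (Fin r) z (Fin x) = qfrac (N + z * q * ?t) (d + z * p * ?t)" for z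
    proof -
      have "(1 + z * p * q) * N - z * q\<^sup>2 * d = N + z * q * ?t" "z * p\<^sup>2 * N + (1 - z * p * q) * d = d + z * p * ?t"
        by (simp_all add: algebra_simps power2_eq_square)
      then show ?thesis unfolding farey_shift_def by (simp add: r x(1) Let_def)
    qed
    then show ?thesis using j by metis
  qed
  moreover have co: "coprime (N + z * q * ?t) (d + z * p * ?t)" for z
  proof (rule coprimeI)
    fix u assume u: "u dvd N + z * q * ?t" "u dvd d + z * p * ?t"
    have "p * (N + z * q * ?t) - q * (d + z * p * ?t) = ?t" by (simp add: algebra_simps)
    moreover have "u dvd p * (N + z * q * ?t) - q * (d + z * p * ?t)" using u by (intro dvd_diff dvd_mult)
    ultimately have "u dvd ?t" by simp
    then have "u dvd \<bar>?t\<bar>" by simp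
    then show "is_unit u" unfolding x(2) .
  qed
  ultimately obtain e :: int where e: "e = 1 \<or> e = - 1" "N + m * q * ?t = e * (N + m * k * j * q * ?t)"
     "d + m * p * ?t = e * (d + m * k * j * p * ?t)"
    using qnum_qden_qfrac[OF co[of m]] qnum_qden_qfrac[OF co[of "m * k * j"]] by fastforce
  \<comment> \<open>The determinant with \<open>q / p\<close> is unchanged by the shifts, which
    decides the sign left open by the fractions.\<close>
  have "?t = e * ?t" 
  proof -
    have "p * (N + m * q * ?t) - q * (d + m * p * ?t) = e * (p * (N + m * k * j * q * ?t) - q * (d + m * k * j * p * ?t))"
      unfolding e(2,3) by (simp add: algebra_simps)
    then show ?thesis by (simp add: algebra_simps)
  qed
  then have "e = 1" using t by simp
  then have "m * p * ?t * (k * j - 1) = 0" using e(3) by (simp add: algebra_simps)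
  then have "k * j = 1" using m p t by simp
  then have "k = 1 \<or> k = - 1" using zmult_eq_1_iff by auto
  then show ?thesis using that k by blast
qed

lemma rat_less_quotient:
  assumes "quotient_of x = (N, d)" "quotient_of y = (N', d')"
  shows "x \<le> y \<longleftrightarrow> N * d' \<le> N' * d"
proof -
  have d: "0 < d" "0 < d'" using quotient_of_denom_pos assms by blast+
  have e: "x = of_int N / of_int d" "y = of_int N' / of_int d'" using quotient_of_div assms by blast+
  have "x \<le> y \<longleftrightarrow> of_int N * of_int d' \<le> (of_int N' * of_int d :: rat)"
    unfolding e using d by (simp add: divide_le_eq le_divide_eq mult.commute)
  then show ?thesis by (simp only: of_int_mult[symmetric] of_int_le_iff)
qed

text \<open>The Farey neighbours have determinant 1 or -1 with \<open>r\<close> according to their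
  side. A shift by \<open>2 n\<close> edges changes the denominator by \<open>2 n p\<close>; as it
  ends on the other side, the representative changes sign and the denominators add up.\<close>

lemma fundamental_pairD:
  assumes r: "quotient_of r = (q, p)" and f: "fundamental_pair r n r1 r2" and n: "n > 1"
    and a: "quotient_of (min r1 r2) = (Nm, pm)" and b: "quotient_of (max r1 r2) = (Np, pp)"
  shows "pm * q - p * Nm = 1" "pp * q - p * Np = - 1" "pm + pp = 2 * int n * p"
proof -
  obtain N1 d1 where 1: "quotient_of r1 = (N1, d1)" by (cases "quotient_of r1")
  obtain N2 d2 where 2: "quotient_of r2 = (N2, d2)" by (cases "quotient_of r2")
  have e1: "\<bar>q * d1 - N1 * p\<bar> = 1" and e2: "\<bar>q * d2 - N2 * p\<bar> = 1"
    using f r 1 2 unfolding fundamental_pair_def farey_edge_def by auto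
  obtain g where g: "g \<in> shift_group r (2 * int n)" "generate (BijGroup UNIV) {g} = shift_group r (2 * int n)" "Fin r2 = g (Fin r1)"
    using f unfolding fundamental_pair_def by blast
  have side: "min r1 r2 < r" "r < max r1 r2" using f unfolding fundamental_pair_def by auto
  have t1: "\<bar>p * N1 - q * d1\<bar> = 1" using e1 by (simp add: abs_minus_commute mult.commute)
  have "0 < 2 * int n" using n by simp
  then obtain k where k: "g = farey_shift (Fin r) (2 * int n * k)" "k = 1 \<or> k = - 1"
    using shift_generator[OF r 1 t1 _ g(1,2)] by metis
  obtain z :: int where z: "z = 1 \<or> z = - 1" "N2 = z * (N1 + 2 * int n * k * q * (p * N1 - q * d1))"
     "d2 = z * (d1 + 2 * int n * k * p * (p * N1 - q * d1))"
    by (rule farey_shift_eq[OF r 1 2 g(3)[unfolded k(1)]]) (simp add: that)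
  have d: "0 < d1" "0 < d2" "0 < p" using quotient_of_denom_pos 1 2 r by blast+
  have s: "p * N2 - q * d2 = z * (p * N1 - q * d1)" unfolding z(2,3) by (simp add: algebra_simps)
  have np: "0 < 2 * int n * p" using n d(3) by simp
  have lt: "x < y \<longleftrightarrow> N * d' < N' * d" if "quotient_of x = (N, d)" "quotient_of y = (N', d')" for x y N d N' d'
    using rat_less_quotient[OF that(2,1)] by (simp add: not_le[symmetric])
  have "(pm * q - p * Nm = 1 \<and> pp * q - p * Np = - 1) \<and> pm + pp = 2 * int n * p"
  proof (cases "r1 < r2")
    case True
    then have m: "Nm = N1" "pm = d1" "Np = N2" "pp = d2" using a b 1 2 by auto
    have "N1 * p < q * d1" "q * d2 < N2 * p" using side True lt[OF 1 r] lt[OF r 2] by auto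
    then have t: "p * N1 - q * d1 = - 1" "p * N2 - q * d2 = 1" using e1 e2 by (simp_all add: mult.commute)
    then have z1: "z = - 1" using s by simp
    have sum: "d1 + d2 = 2 * int n * p * k" using z(3) unfolding t(1) z1 by (simp add: algebra_simps)
    \<comment> \<open>Positivity of the denominators singles out the direction of the shift.\<close>
    have "k \<noteq> - 1"
    proof
      assume "k = - 1"
      then have "d1 + d2 = - (2 * int n * p)" using sum by simp
      then show False using d np by linarith
    qed
    then have "k = 1" using k(2) by simp
    then show ?thesis using sum t unfolding m by (simp add: algebra_simps)
  next
    case False
    then have m: "Nm = N2" "pm = d2" "Np = N1" "pp = d1" using a b 1 2 by (auto simp: min_def max_def split: if_splits)
    have "q * d1 < N1 * p" "N2 * p < q * d2" using side False lt[OF r 1] lt[OF 2 r] by (auto simp: min_def max_def split: if_splits)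
    then have t: "p * N1 - q * d1 = 1" "p * N2 - q * d2 = - 1" using e1 e2 by (simp_all add: mult.commute)
    then have z1: "z = - 1" using s by simp
    have sum: "d1 + d2 = - (2 * int n * p * k)" using z(3) unfolding t(1) z1 by (simp add: algebra_simps)
    have "k \<noteq> 1"
    proof
      assume "k = 1"
      then have "d1 + d2 = - (2 * int n * p)" using sum by simp
      then show False using d np by linarith
    qed
    then have "k = - 1" using k(2) by simp
    then show ?thesis using sum t unfolding m by (simp add: algebra_simps)
  qed
  then show "pm * q - p * Nm = 1" "pp * q - p * Np = - 1" "pm + pp = 2 * int n * p" by auto
qed

theorem theorem2p4:
  fixes r r1 r2 ri :: rat and n :: nat and I :: "real set"
  assumes "r \<notin> \<int>" and "n > 1"
    and "fundamental_pair r n r1 r2"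
    and "ri = r1 \<or> ri = r2"
    and "I = Ibar r r1 r2 - {of_rat ri}"
  shows "(\<forall>s s' :: rat. of_rat s \<in> I \<and> of_rat s' \<in> I \<and> s \<noteq> s' \<longrightarrow> \<not> same_loop_class r n s s')
       \<and> \<not> (\<exists>s :: rat. of_rat s \<in> I \<and> loop_peripheral r n s)
       \<and> \<not> (\<exists>s :: rat. of_rat s \<in> I \<and> loop_torsion r n s)"
proof -
  obtain q p where r: "quotient_of r = (q, p)" by (cases "quotient_of r")
  obtain Nm pm where m: "quotient_of (min r1 r2) = (Nm, pm)" by (cases "quotient_of (min r1 r2)")
  obtain Np pp where P: "quotient_of (max r1 r2) = (Np, pp)" by (cases "quotient_of (max r1 r2)")
  note pair = fundamental_pairD[OF r assms(3,2) m P]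
  have pos: "0 < p" "0 < pm" "0 < pp" using quotient_of_denom_pos r m P by blast+
  have "p \<noteq> 1"
  proof
    assume "p = 1"
    then have "r = of_int q" using quotient_of_div[OF r] by simp
    then show False using assms(1) by simp
  qed
  then have p2: "2 \<le> p" using pos(1) by simp
  interpret h: heckoid q p n by unfold_locales (use p2 quotient_of_coprime[OF r] assms(2) in auto)
  interpret f: farey_pair q p n pm pp
  proof unfold_locales
    have "pm * q - 1 = p * Nm" using pair(1) by simp
    then show "p dvd pm * q - 1" by simp
  qed (use pos pair(3) in simp_all)
  have floor: "\<lfloor>r\<rfloor> = q div p" using quotient_of_div[OF r] floor_divide_of_int_eq by metis
  have ends: "min r1 r2 < r" "r < max r1 r2" using assms(3) unfolding fundamental_pair_def by auto
  have I: "of_rat s \<in> I \<longleftrightarrow> (of_int \<lfloor>r\<rfloor> \<le> s \<and> s \<le> min r1 r2 \<or> max r1 r2 \<le> s \<and> s \<le> of_int (\<lfloor>r\<rfloor> + 1)) \<and> s \<noteq> ri" for s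
  proof -
    have "(of_int \<lfloor>r\<rfloor> :: real) \<le> of_rat s \<longleftrightarrow> of_int \<lfloor>r\<rfloor> \<le> s" "of_rat s \<le> (of_int (\<lfloor>r\<rfloor> + 1) :: real) \<longleftrightarrow> s \<le> of_int (\<lfloor>r\<rfloor> + 1)"
      using of_rat_less_eq[of "of_int \<lfloor>r\<rfloor>" s, where ?'a = real] of_rat_less_eq[of s "of_int (\<lfloor>r\<rfloor> + 1)", where ?'a = real]
      by (simp_all only: of_rat_of_int_eq)
    then show ?thesis
      unfolding assms(5) Ibar_def by (simp only: Diff_iff Un_iff atLeastAtMost_iff singleton_iff of_rat_less_eq of_rat_eq_iff)
  qed
  \<comment> \<open>Cross-multiplication with the determinants of the end points turns the position
    of \<open>s\<close> relative to them into the inequalities of \<open>slope\<close>.\<close>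
  have left: "s \<le> min r1 r2 \<longleftrightarrow> d \<le> pm * h.dt N d" and right: "max r1 r2 \<le> s \<longleftrightarrow> d \<le> pp * (- h.dt N d)"
    if s: "quotient_of s = (N, d)" for s N d
  proof -
    have "pm * h.dt N d - d = p * (Nm * d - N * pm)" "pp * (- h.dt N d) - d = p * (N * pp - Np * d)"
      using pair(1,2) unfolding h.dt_def by algebra+
    moreover have "0 \<le> p * z \<longleftrightarrow> 0 \<le> z" for z using pos(1) by (simp add: zero_le_mult_iff)
    ultimately have "0 \<le> pm * h.dt N d - d \<longleftrightarrow> 0 \<le> Nm * d - N * pm" "0 \<le> pp * (- h.dt N d) - d \<longleftrightarrow> 0 \<le> N * pp - Np * d"
      by simp_all
    then show "s \<le> min r1 r2 \<longleftrightarrow> d \<le> pm * h.dt N d" "max r1 r2 \<le> s \<longleftrightarrow> d \<le> pp * (- h.dt N d)"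
      unfolding rat_less_quotient[OF s m] rat_less_quotient[OF P s] by linarith+
  qed
  have slope: "f.slope N d" if s: "quotient_of s = (N, d)" "of_rat s \<in> I" for s N d
  proof -
    have d: "0 < d" using quotient_of_denom_pos[OF s(1)] .
    have le: "of_int \<lfloor>r\<rfloor> \<le> s" "s \<le> of_int (\<lfloor>r\<rfloor> + 1)"
      using s(2) ends floor_correct[of r] unfolding I by linarith+
    have qi: "quotient_of (of_int z) = (z, 1)" for z by simp
    have "h.in_range N d" unfolding h.in_range_def using d le
      unfolding floor rat_less_quotient[OF qi s(1)] rat_less_quotient[OF s(1) qi] by simp
    moreover consider "s \<le> min r1 r2" | "max r1 r2 \<le> s" using s(2) unfolding I by blast
    then have "h.dt N d \<noteq> 0 \<and> (0 < h.dt N d \<longrightarrow> d \<le> pm * h.dt N d) \<and> (h.dt N d < 0 \<longrightarrow> d \<le> pp * (- h.dt N d))"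
    proof cases
      case 1
      then have le: "d \<le> pm * h.dt N d" using left[OF s(1)] by simp
      then have "0 < pm * h.dt N d" using d by simp
      then have "0 < h.dt N d" using zero_less_mult_pos[OF _ pos(2)] by blast
      then show ?thesis using le by simp
    next
      case 2
      then have le: "d \<le> pp * (- h.dt N d)" using right[OF s(1)] by simp
      then have "0 < pp * (- h.dt N d)" using d by simp
      then have "0 < - h.dt N d" using zero_less_mult_pos[OF _ pos(3)] by blast
      then show ?thesis using le by simp
    qed
    ultimately show ?thesis unfolding f.slope_def by blast
  qed
  have distinct: "\<not> same_loop_class r n s s'" if s: "of_rat s \<in> I" "of_rat s' \<in> I" "s \<noteq> s'" for s s'
  proof
    assume same: "same_loop_class r n s s'"
    obtain N d where a: "quotient_of s = (N, d)" by (cases "quotient_of s")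
    obtain N' d' where b: "quotient_of s' = (N', d')" by (cases "quotient_of s'")
    have ne: "N' * d \<noteq> N * d'"
      using s(3) rat_less_quotient[OF a b] rat_less_quotient[OF b a] by auto
    \<comment> \<open>Equality in both bounds makes the slopes the two end points next to
      \<open>r\<close>, and one of these is the removed point \<open>ri\<close>.\<close>
    have extreme: "x = ri \<or> y = ri" if "quotient_of x = (N, d)" "quotient_of y = (N', d')"
        "d = pm * h.dt N d" "d' = pp * (- h.dt N' d')" for x y N d N' d'
    proof -
      have "x = min r1 r2"
      proof (rule antisym)
        show "x \<le> min r1 r2" using left[OF that(1)] that(3) by simp
        have "p * (Nm * d - N * pm) = 0" using pair(1) that(3) unfolding h.dt_def by algebra
        then show "min r1 r2 \<le> x" unfolding rat_less_quotient[OF m that(1)] using pos by simp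
      qed
      moreover have "y = max r1 r2"
      proof (rule antisym)
        show "max r1 r2 \<le> y" using right[OF that(2)] that(4) by simp
        have "p * (N' * pp - Np * d') = 0" using pair(2) that(4) unfolding h.dt_def by algebra
        then show "y \<le> max r1 r2" unfolding rat_less_quotient[OF that(2) P] using pos by simp
      qed
      ultimately show ?thesis using assms(4) by (auto simp: min_def max_def)
    qed
    have "s \<noteq> ri" "s' \<noteq> ri" using s(1,2) unfolding I by auto
    then have ex: "\<not> (d = pm * h.dt N d \<and> d' = pp * (- h.dt N' d'))" "\<not> (d' = pm * h.dt N' d' \<and> d = pp * (- h.dt N d))"
      using extreme[OF a b] extreme[OF b a] by blast+
    obtain V E where E: "h.action V E" "h.cycles E N d 1 \<noteq> h.cycles E N' d' 1"
      using f.separate[OF slope[OF a s(1)] slope[OF b s(2)] ne ex] by blast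
    interpret a: heckoid_action V E r n by (rule h.heckoid_action[OF E(1) r])
    have "a.fixed (concat (replicate 1 (uword s))) \<longleftrightarrow> h.cycles E N d 1"
      by (rule h.fixed_power_iff_cycles[OF E(1) r a f.slopeD(1)[OF slope[OF a s(1)]] zero_less_one])
    moreover have "a.fixed (concat (replicate 1 (uword s'))) \<longleftrightarrow> h.cycles E N' d' 1"
      by (rule h.fixed_power_iff_cycles[OF E(1) r b f.slopeD(1)[OF slope[OF b s(2)]] zero_less_one])
    ultimately show False using a.fixed_same_loop_class[OF same] E(2) by simp
  qed
  have peripheral: "\<not> loop_peripheral r n s" if s: "of_rat s \<in> I" for s
  proof
    assume "loop_peripheral r n s"
    then obtain x and k :: int where c: "conjugate_in (heckoid_group r n) (loop_elt r n s)
        (heckoid_elt r n [(x, True)] [^]\<^bsub>heckoid_group r n\<^esub> k)" unfolding loop_peripheral_def by blast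
    obtain N d where a: "quotient_of s = (N, d)" by (cases "quotient_of s")
    \<comment> \<open>For \<open>k = 0\<close> the power of the meridian is trivial; a cycle of
      length 1 then serves as the starting graph.\<close>
    define j where "j = (if k = 0 then 1 else nat \<bar>k\<bar>)"
    have j: "0 < j" unfolding j_def by simp
    obtain V E W where E: "h.action V E" "W 0 \<in> V" "\<forall>i::nat. (W i, x = Gen_b, True, W (Suc i)) \<in> E" "W j = W 0"
        "\<forall>M>0. \<not> h.cycles E N d M"
      using f.meridian_cycle[OF slope[OF a s] j, where e = "x = Gen_b" and b = True] by blast
    interpret a: heckoid_action V E r n by (rule h.heckoid_action[OF E(1) r])
    have "k = 0 \<or> W (nat \<bar>k\<bar>) = W 0" using E(4) unfolding j_def by (auto split: if_splits)
    from a.fixed_loop_peripheral_power[OF E(2,3) this c] have "a.fixed (concat (replicate 1 (uword s)))" by simp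
    then have "h.cycles E N d 1"
      using h.fixed_power_iff_cycles[OF E(1) r a f.slopeD(1)[OF slope[OF a s]] zero_less_one] by simp
    then show False using E(5) zero_less_one by blast
  qed
  have torsion: "\<not> loop_torsion r n s" if s: "of_rat s \<in> I" for s
  proof
    assume t: "loop_torsion r n s"
    obtain N d where a: "quotient_of s = (N, d)" by (cases "quotient_of s")
    \<comment> \<open>The meridian cycle serves here only to produce a non-empty action in which no
      positive power of the loop fixes a vertex.\<close>
    obtain V E W where E: "h.action V E" "W (0::nat) \<in> V" "\<forall>M>0. \<not> h.cycles E N d M"
      using f.meridian_cycle[OF slope[OF a s] zero_less_one, where e = True and b = True] by blast
    interpret a: heckoid_action V E r n by (rule h.heckoid_action[OF E(1) r])
    obtain k where k: "0 < k" "a.fixed (concat (replicate k (uword s)))" using a.fixed_loop_torsion[OF t] E(2) by blast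
    then show False
      using h.fixed_power_iff_cycles[OF E(1) r a f.slopeD(1)[OF slope[OF a s]] k(1)] E(3) by blast
  qed
  show ?thesis using distinct peripheral torsion by blast
qed

end
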